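(* The seven Petersen family graphs are the only MMNA graphs on 16 or fewer edges. That is, a graph $G$ with at most $16$ edges is minor minimal not apex if and only if $G$ is (isomorphic to) one of the seven graphs of the Petersen family.
   Context: All graphs are finite and simple. A graph $H$ is a minor of $G$ if $H$ is obtained by contracting (zero or more) edges in a subgraph of $G$. A graph is apex ($1$-apex) if the deletion of at most one vertex results in a planar graph. A graph is NA if it is not apex, and MMNA (minor minimal not apex) if it is NA but no proper minor of it is NA. A $\nabla\mathrm{Y}$ move on a graph consists of deleting the three edges of a $3$-cycle $abc$ and adding a new degree three vertex adjacent to $a$, $b$ and $c$. The reverse operation, deleting a degree three vertex and making its three neighbors pairwise adjacent, is a $\mathrm{Y}\nabla$ move. The Petersen family is the set of (seven, up to isomorphism) graphs obtained from the Petersen graph by a sequence of zero or more $\nabla\mathrm{Y}$ or $\mathrm{Y}\nabla$ moves; it includes $K_6$, $K_{3,3,1}$ and $K_{4,4}$ minus an edge, and each member has $15$ edges. *)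

theory Defs
  imports "HOL-Analysis.Analysis"
begin

record 'a ugraph =
  verts :: "'a set"
  edges :: "'a set set"

definition simple_graph :: "'a ugraph \<Rightarrow> bool" where
  "simple_graph G \<longleftrightarrow>
     finite (verts G) \<and> (\<forall>e\<in>edges G. e \<subseteq> verts G \<and> card e = 2)"

definition graph_iso :: "'a ugraph \<Rightarrow> 'b ugraph \<Rightarrow> bool" where
  "graph_iso G H \<longleftrightarrow>
     (\<exists>f. bij_betw f (verts G) (verts H) \<and> (\<lambda>e. f ` e) ` edges G = edges H)"

definition subgraph :: "'a ugraph \<Rightarrow> 'a ugraph \<Rightarrow> bool" where
  "subgraph H G \<longleftrightarrow>
     simple_graph H \<and> verts H \<subseteq> verts G \<and> edges H \<subseteq> edges G"

definition del_vertex :: "'a ugraph \<Rightarrow> 'a \<Rightarrow> 'a ugraph" where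
  "del_vertex G v = \<lparr>verts = verts G - {v}, edges = {e \<in> edges G. v \<notin> e}\<rparr>"

text \<open>Contraction of the edge \<open>{u, v}\<close>: the merged vertex keeps the name \<open>u\<close>. The contracted
  edge disappears, and parallel edges are identified because the edges form a set.\<close>

definition contract_edge :: "'a ugraph \<Rightarrow> 'a \<Rightarrow> 'a \<Rightarrow> 'a ugraph" where
  "contract_edge G u v =
     (let f = (\<lambda>x. if x = v then u else x)
      in \<lparr>verts = f ` verts G, edges = (\<lambda>e. f ` e) ` (edges G - {{u, v}})\<rparr>)"

inductive contracts_to :: "'a ugraph \<Rightarrow> 'a ugraph \<Rightarrow> bool" for G where
  contracts_refl: "contracts_to G G"
| contracts_step: "contracts_to G H \<Longrightarrow> {u, v} \<in> edges H \<Longrightarrow> u \<noteq> v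
                     \<Longrightarrow> contracts_to G (contract_edge H u v)"

definition is_minor :: "'a ugraph \<Rightarrow> 'a ugraph \<Rightarrow> bool" where
  "is_minor H G \<longleftrightarrow> (\<exists>K. subgraph K G \<and> contracts_to K H)"

text \<open>Minors are taken as labelled graphs on vertices of \<open>G\<close>. Every proper deletion or
  contraction strictly decreases the number of vertices or edges, so a minor is proper exactly
  when it differs from \<open>G\<close>.\<close>

definition proper_minor :: "'a ugraph \<Rightarrow> 'a ugraph \<Rightarrow> bool" where
  "proper_minor H G \<longleftrightarrow> is_minor H G \<and> H \<noteq> G"

text \<open>A plane drawing: vertices are distinct points, edges are arcs joining the points of their
  end vertices and passing through no other vertex, and two different edges meet only in common
  end vertices.\<close>

definition plane_embedding ::
    "'a ugraph \<Rightarrow> ('a \<Rightarrow> real ^ 2) \<Rightarrow> ('a set \<Rightarrow> real \<Rightarrow> real ^ 2) \<Rightarrow> bool" where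
  "plane_embedding G p \<gamma> \<longleftrightarrow>
     inj_on p (verts G) \<and>
     (\<forall>e\<in>edges G. arc (\<gamma> e) \<and>
        {pathstart (\<gamma> e), pathfinish (\<gamma> e)} = p ` e \<and>
        path_image (\<gamma> e) \<inter> p ` verts G = p ` e) \<and>
     (\<forall>e\<in>edges G. \<forall>e'\<in>edges G. e \<noteq> e' \<longrightarrow>
        path_image (\<gamma> e) \<inter> path_image (\<gamma> e') = p ` (e \<inter> e'))"

definition planar :: "'a ugraph \<Rightarrow> bool" where
  "planar G \<longleftrightarrow> (\<exists>p \<gamma>. plane_embedding G p \<gamma>)"

definition apex :: "'a ugraph \<Rightarrow> bool" where
  "apex G \<longleftrightarrow> planar G \<or> (\<exists>v\<in>verts G. planar (del_vertex G v))"

definition MMNA :: "'a ugraph \<Rightarrow> bool" where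
  "MMNA G \<longleftrightarrow> \<not> apex G \<and> (\<forall>H. proper_minor H G \<longrightarrow> apex H)"

definition nabla_Y :: "'a ugraph \<Rightarrow> 'a ugraph \<Rightarrow> bool" where
  "nabla_Y G H \<longleftrightarrow>
     (\<exists>a b c v. distinct [a, b, c] \<and>
        {a, b} \<in> edges G \<and> {b, c} \<in> edges G \<and> {a, c} \<in> edges G \<and> v \<notin> verts G \<and>
        H = \<lparr>verts = insert v (verts G),
             edges = (edges G - {{a, b}, {b, c}, {a, c}}) \<union> {{v, a}, {v, b}, {v, c}}\<rparr>)"

definition Y_nabla :: "'a ugraph \<Rightarrow> 'a ugraph \<Rightarrow> bool" where
  "Y_nabla G H \<longleftrightarrow>
     (\<exists>v a b c. v \<in> verts G \<and> distinct [a, b, c] \<and> {u. {v, u} \<in> edges G} = {a, b, c} \<and>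
        H = \<lparr>verts = verts G - {v},
             edges = {e \<in> edges G. v \<notin> e} \<union> {{a, b}, {b, c}, {a, c}}\<rparr>)"

text \<open>Outer 5-cycle on \<open>0, \<dots>, 4\<close>, spokes \<open>i, i + 5\<close>, inner pentagram on \<open>5, \<dots>, 9\<close>.\<close>

definition petersen_graph :: "nat ugraph" where
  "petersen_graph =
     \<lparr>verts = {0..<10},
      edges = (\<Union>i\<in>{0..<5}. {{i, (i + 1) mod 5}, {i, i + 5}, {i + 5, (i + 2) mod 5 + 5}})\<rparr>"

text \<open>The family as labelled graphs on natural numbers (so that a fresh vertex is always
  available); its members are meant up to \<open>graph_iso\<close>.\<close>

inductive_set petersen_family :: "nat ugraph set" where
  petersen: "petersen_graph \<in> petersen_family"
| nabla_Y: "G \<in> petersen_family \<Longrightarrow> nabla_Y G H \<Longrightarrow> H \<in> petersen_family"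
| Y_nabla: "G \<in> petersen_family \<Longrightarrow> Y_nabla G H \<Longrightarrow> H \<in> petersen_family"

end

theory Submission
  imports Defs
begin

text \<open>A graph that is not apex has no straight-line drawing, even after deletion of any one vertex.
  Straight-line drawability survives the addition of vertices of degree at most two, so a smallest
  graph with at most 16 edges that is not apex and has no Petersen family minor has minimum degree
  three and at most ten vertices. Deleting a vertex of maximum degree leaves a nonplanar graph with
  at most 12 edges, which contains a subdivision of \<open>K33\<close> or \<open>K5\<close>. The remaining edges are found by
  branching: if the edges known so far become planar after deletion of some vertex \<open>w\<close>, then some
  edge of the graph avoids \<open>w\<close> and lies outside any fixed straight-line drawn triangulation of the
  other vertices. The resulting case analysis, up to isomorphism, is recorded in certificates; it
  ends in graphs with a Petersen family minor or with too large a degree sum. Nonplanar graphs with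
  at most 12 edges are shown to contain a Kuratowski subdivision in the same way.

  Conversely, deleting a vertex from a member of the Petersen family leaves a subdivision of \<open>K33\<close> or
  \<open>K5\<close>, which is nonplanar since no face of a theta curve touches the interior of all three of its
  arcs. Its proper minors have at most 14 edges, hence are apex by the first part.\<close>

section \<open>Theta curves in the plane\<close>

definition arc_between :: "'a::topological_space set \<Rightarrow> 'a \<Rightarrow> 'a \<Rightarrow> bool" where
  "arc_between S a b \<longleftrightarrow> (\<exists>g. arc g \<and> pathstart g = a \<and> pathfinish g = b \<and> path_image g = S)"

lemma arc_betweenE:
  assumes "arc_between S a b"
  obtains g where "arc g" "pathstart g = a" "pathfinish g = b" "path_image g = S"
  using assms unfolding arc_between_def by blast

lemma arc_between_sym: "arc_between S a b \<Longrightarrow> arc_between S b a"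
  unfolding arc_between_def
  by (metis arc_reversepath path_image_reversepath pathfinish_reversepath pathstart_reversepath)

lemma arc_between_ends:
  assumes "arc_between S a b"
  shows "a \<in> S" "b \<in> S" "a \<noteq> b"
  using assms unfolding arc_between_def
  by (metis arc_distinct_ends pathfinish_in_path_image pathstart_in_path_image)+

lemma compact_arc_between: "arc_between S a b \<Longrightarrow> compact S"
  unfolding arc_between_def using compact_arc_image by blast

lemma connected_arc_between: "arc_between S a b \<Longrightarrow> connected S"
  unfolding arc_between_def using connected_arc_image by blast

lemma connected_arc_between_endless: "arc_between S a b \<Longrightarrow> connected (S - {a, b})"
  unfolding arc_between_def by (metis arc_imp_simple_path connected_simple_path_endless)

lemma nonempty_arc_between_endless: "arc_between S a b \<Longrightarrow> S - {a, b} \<noteq> {}"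
  unfolding arc_between_def by (metis arc_imp_simple_path nonempty_simple_path_endless)

lemma connected_arc_between_minus_start:
  assumes "arc_between S a b"
  shows "connected (S - {a})"
proof -
  obtain g where g: "arc g" "pathstart g = a" "path_image g = S"
    using assms by (rule arc_betweenE)
  then have "inj_on g {0..1}" and continuous: "continuous_on {0..1} g"
    and "S = g ` {0..1}" "a = g 0"
    by (auto simp: arc_def path_def path_image_def pathstart_def)
  moreover have "{0..1::real} - {0} = {0<..1}" by auto
  ultimately have "S - {a} = g ` {0<..1}"
    using inj_on_image_set_diff[of g "{0..1}" "{0..1}" "{0}"] by auto
  moreover have "connected (g ` {0<..1})"
    by (rule connected_continuous_image[OF continuous_on_subset[OF continuous]]) auto
  ultimately show ?thesis by simp
qed

lemma arc_between_connected_avoiding: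
  assumes "arc_between E a b" "E \<inter> S \<subseteq> {b}" "x \<in> E - S" "y \<in> E - S"
  shows "connected_component (- S) x y"
proof -
  have "connected (E - S)"
  proof (cases "b \<in> S")
    case True
    then have "E - S = E - {b}" using assms(2) by blast
    then show ?thesis
      using connected_arc_between_minus_start[OF arc_between_sym[OF assms(1)]] by simp
  next
    case False
    then have "E - S = E" using assms(2) by blast
    then show ?thesis using connected_arc_between[OF assms(1)] by simp
  qed
  then show ?thesis using assms(3,4) unfolding connected_component_def by blast
qed

lemma arc_between_join:
  assumes "arc_between S a b" "arc_between T b c" "S \<inter> T = {b}"
  shows "arc_between (S \<union> T) a c"
proof -
  obtain g where g: "arc g" "pathstart g = a" "pathfinish g = b" "path_image g = S"
    using assms(1) by (rule arc_betweenE)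
  obtain h where h: "arc h" "pathstart h = b" "pathfinish h = c" "path_image h = T"
    using assms(2) by (rule arc_betweenE)
  have "arc (g +++ h)" using g h assms(3) by (intro arc_join) auto
  then show ?thesis
    unfolding arc_between_def using g h by (metis path_image_join pathfinish_join pathstart_join)
qed

lemma arc_between_linear_image:
  fixes h :: "'a::euclidean_space \<Rightarrow> 'b::euclidean_space"
  assumes "arc_between S a b" "linear h" "inj h"
  shows "arc_between (h ` S) (h a) (h b)"
proof -
  obtain g where g: "arc g" "pathstart g = a" "pathfinish g = b" "path_image g = S"
    using assms(1) by (rule arc_betweenE)
  show ?thesis
    unfolding arc_between_def using g assms(2,3)
    by (intro exI[of _ "h \<circ> g"])
      (auto simp: arc_linear_image_eq path_image_compose pathstart_compose pathfinish_compose)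
qed

lemma Jordan_curve_two_arcs:
  fixes A B :: "complex set"
  assumes A: "arc_between A p q" and B: "arc_between B p q" and AB: "A \<inter> B = {p, q}"
  obtains I J where "components (- (A \<union> B)) = {I, J}" "I \<noteq> J"
    "frontier I = A \<union> B" "frontier J = A \<union> B"
proof -
  obtain g where g: "arc g" "pathstart g = p" "pathfinish g = q" "path_image g = A"
    using A by (rule arc_betweenE)
  obtain h where h: "arc h" "pathstart h = q" "pathfinish h = p" "path_image h = B"
    using arc_between_sym[OF B] by (rule arc_betweenE)
  have "simple_path (g +++ h)" by (rule simple_path_join_loop) (use g h AB in auto)
  moreover have "pathfinish (g +++ h) = pathstart (g +++ h)" using g h by simp
  moreover have "path_image (g +++ h) = A \<union> B" using g h by (simp add: path_image_join)
  ultimately obtain I J where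
    I: "I \<noteq> {}" "open I" "connected I" and J: "J \<noteq> {}" "open J" "connected J"
    and IJ: "I \<inter> J = {}" "I \<union> J = - (A \<union> B)" and "frontier I = A \<union> B" "frontier J = A \<union> B"
    using Jordan_curve by metis
  have component: "K \<in> components (K \<union> L)"
    if "K \<noteq> {}" "open K" "connected K" "open L" "K \<inter> L = {}" for K L :: "complex set"
    unfolding in_components_maximal
  proof (intro conjI allI impI)
    fix D assume D: "D \<noteq> {} \<and> K \<subseteq> D \<and> D \<subseteq> K \<union> L \<and> connected D"
    then have "L \<inter> D = {}" using connectedD[of D K L] that by blast
    then show "D = K" using D by blast
  qed (use that in auto)
  have "I \<in> components (- (A \<union> B))" "J \<in> components (- (A \<union> B))"
    using component[of I J] component[of J I] I J IJ by (simp_all add: Un_commute Int_commute)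
  moreover have "K \<in> {I, J}" if K: "K \<in> components (- (A \<union> B))" for K
  proof -
    obtain z where "z \<in> K" "z \<in> I \<union> J"
      using in_components_nonempty[OF K] in_components_subset[OF K] IJ(2) by blast
    then show ?thesis using components_nonoverlap[OF K] calculation by blast
  qed
  ultimately have "components (- (A \<union> B)) = {I, J}" by blast
  moreover have "I \<noteq> J" using I(1) IJ(1) by blast
  ultimately show thesis using that \<open>frontier I = A \<union> B\<close> \<open>frontier J = A \<union> B\<close> by blast
qed

lemma two_arcs_three_points:
  fixes A B :: "complex set"
  assumes "arc_between A p q" "arc_between B p q" "A \<inter> B = {p, q}"
    and "x \<notin> A \<union> B" "y \<notin> A \<union> B" "z \<notin> A \<union> B"
  shows "connected_component (- (A \<union> B)) x y \<or> connected_component (- (A \<union> B)) x z \<or>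
    connected_component (- (A \<union> B)) y z"
proof -
  obtain I J where IJ: "components (- (A \<union> B)) = {I, J}"
    using Jordan_curve_two_arcs[OF assms(1-3)] by metis
  have same: "connected_component (- (A \<union> B)) w w'" if "w \<in> K" "w' \<in> K" "K \<in> {I, J}" for w w' K
    unfolding connected_component_def
    using that in_components_connected in_components_subset unfolding IJ[symmetric] by blast
  have "\<Union> (components (- (A \<union> B))) = - (A \<union> B)" by (rule Union_components)
  then have "x \<in> I \<union> J" "y \<in> I \<union> J" "z \<in> I \<union> J" using assms(4-6) unfolding IJ by auto
  then show ?thesis using same by blast
qed

definition theta_curve ::
    "'a::topological_space set \<Rightarrow> 'a set \<Rightarrow> 'a set \<Rightarrow> 'a \<Rightarrow> 'a \<Rightarrow> bool" where
  "theta_curve A B C p q \<longleftrightarrow> arc_between A p q \<and> arc_between B p q \<and> arc_between C p q \<and>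
     A \<inter> B = {p, q} \<and> A \<inter> C = {p, q} \<and> B \<inter> C = {p, q}"

lemma theta_curve_face:
  fixes A B C :: "complex set"
  assumes "theta_curve A B C p q"
  obtains D where "D \<in> components (- (A \<union> B))" "frontier D = A \<union> B" "D \<inter> C = {}"
proof -
  have arcs: "arc_between A p q" "arc_between B p q" "arc_between C p q"
    and meet: "A \<inter> B = {p, q}" "A \<inter> C = {p, q}" "B \<inter> C = {p, q}"
    using assms by (auto simp: theta_curve_def)
  obtain I J where IJ: "components (- (A \<union> B)) = {I, J}" "I \<noteq> J"
    and frontier: "frontier I = A \<union> B" "frontier J = A \<union> B"
    using Jordan_curve_two_arcs[OF arcs(1,2) meet(1)] by metis
  have "C - {p, q} \<subseteq> - (A \<union> B)" using meet by blast
  moreover have "- (A \<union> B) \<noteq> {}" using IJ(1) components_empty by fastforce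
  ultimately obtain K where K: "K \<in> components (- (A \<union> B))" "C - {p, q} \<subseteq> K"
    using exists_component_superset connected_arc_between_endless[OF arcs(3)] by metis
  have "I \<noteq> K \<or> J \<noteq> K" using IJ(2) by blast
  then obtain D where D: "D \<in> components (- (A \<union> B))" "frontier D = A \<union> B" "D \<noteq> K"
    using IJ(1) frontier by blast
  have "D \<inter> K = {}" using components_nonoverlap[OF D(1) K(1)] D(3) by blast
  moreover have "D \<inter> (A \<union> B) = {}" using in_components_subset[OF D(1)] by blast
  ultimately have "D \<inter> C = {}" using K(2) arc_between_ends[OF arcs(1)] by blast
  with D show thesis using that by blast
qed

lemma connected_component_closure_point:
  assumes "connected D" "D \<inter> S = {}" "z \<in> D" "w \<in> closure D" "w \<notin> S"
  shows "connected_component (- S) z w"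
proof -
  have "connected (insert w D)"
    by (rule connected_intermediate_closure[OF assms(1)]) (use assms(4) closure_subset in auto)
  then show ?thesis
    unfolding connected_component_def using assms by (intro exI[of _ "insert w D"]) auto
qed

text \<open>A point of the face bounded by \<open>A \<union> B\<close> reaches the interior of \<open>A\<close> without crossing \<open>B \<union> C\<close>
  and the interior of \<open>B\<close> without crossing \<open>A \<union> C\<close>. If it reached \<open>x\<close> in both ways, it would reach
  \<open>x\<close> without crossing the theta curve by Janiszewski's theorem, so \<open>x\<close> would lie in that face.\<close>

lemma theta_curve_separates:
  fixes A B C :: "complex set"
  assumes theta: "theta_curve A B C p q" and x: "x \<notin> A \<union> B \<union> C"
    and a: "a \<in> A - {p, q}" and b: "b \<in> B - {p, q}" and c: "c \<in> C - {p, q}"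
  shows "\<not> connected_component (- (A \<union> B)) c x \<or> \<not> connected_component (- (A \<union> C)) b x \<or>
    \<not> connected_component (- (B \<union> C)) a x"
proof (rule ccontr)
  assume "\<not> ?thesis"
  then have cx: "connected_component (- (A \<union> B)) c x" and bx: "connected_component (- (A \<union> C)) b x"
    and ax: "connected_component (- (B \<union> C)) a x" by auto
  have arcs: "arc_between A p q" "arc_between B p q" "arc_between C p q"
    and meet: "A \<inter> B = {p, q}" "A \<inter> C = {p, q}" "B \<inter> C = {p, q}"
    using theta by (auto simp: theta_curve_def)
  obtain D where D: "D \<in> components (- (A \<union> B))" "frontier D = A \<union> B" "D \<inter> C = {}"
    using theta_curve_face[OF theta] by metis
  obtain z where z: "z \<in> D" using in_components_nonempty[OF D(1)] by blast
  have D_theta: "D \<inter> (A \<union> B \<union> C) = {}" using in_components_subset[OF D(1)] D(3) by blast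
  have reach: "connected_component (- S) z w" if "w \<in> A \<union> B" "w \<notin> S" "S \<subseteq> A \<union> B \<union> C" for w S
    by (rule connected_component_closure_point[OF in_components_connected[OF D(1)] _ z])
      (use that D(2) D_theta in \<open>auto simp: frontier_def\<close>)
  have "connected_component (- (A \<union> C)) z b" using b meet by (intro reach) auto
  then have zx_AC: "connected_component (- (A \<union> C)) z x" using bx connected_component_trans by blast
  have "connected_component (- (B \<union> C)) z a" using a meet by (intro reach) auto
  then have zx_BC: "connected_component (- (B \<union> C)) z x" using ax connected_component_trans by blast
  have "(A \<union> C) \<inter> (B \<union> C) = C" using meet arc_between_ends[OF arcs(3)] by auto
  moreover have "compact (A \<union> C)" "closed (B \<union> C)"
    using arcs[THEN compact_arc_between] by (auto intro: compact_imp_closed)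
  ultimately have "connected_component (- ((A \<union> C) \<union> (B \<union> C))) z x"
    using Janiszewski[OF _ _ _ zx_AC zx_BC] connected_arc_between[OF arcs(3)] by simp
  then have "connected_component (- (A \<union> B)) z x" by (rule connected_component_of_subset) auto
  then have "connected_component (- (A \<union> B)) z c"
    using cx connected_component_sym connected_component_trans by blast
  then have "c \<in> D" using D(1) z unfolding components_iff by (auto intro: connected_component_trans)
  then show False using D(3) c by blast
qed

section \<open>Graph embeddings and drawings with arcs\<close>

lemma simple_graph_edgeE:
  assumes "simple_graph G" "e \<in> edges G"
  obtains a b where "e = {a, b}" "a \<noteq> b" "a \<in> verts G" "b \<in> verts G"
  using assms unfolding simple_graph_def card_2_iff by (metis insert_subset)

lemma simple_graph_edge_ends:
  assumes "simple_graph G" "{a, b} \<in> edges G"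
  shows "a \<in> verts G" "b \<in> verts G" "a \<noteq> b"
  using assms unfolding simple_graph_def by (auto simp: card_insert_if split: if_splits)

lemma finite_verts: "simple_graph G \<Longrightarrow> finite (verts G)"
  by (simp add: simple_graph_def)

lemma finite_edges: "simple_graph G \<Longrightarrow> finite (edges G)"
  unfolding simple_graph_def by (meson PowI finite_Pow_iff finite_subset subsetI)

definition graph_embedding :: "('a \<Rightarrow> 'b) \<Rightarrow> 'a ugraph \<Rightarrow> 'b ugraph \<Rightarrow> bool" where
  "graph_embedding f H G \<longleftrightarrow> inj_on f (verts H) \<and> f ` verts H \<subseteq> verts G \<and>
     (\<forall>e\<in>edges H. e \<subseteq> verts H \<and> f ` e \<in> edges G)"

lemma graph_embedding_comp:
  assumes "graph_embedding f H G" "graph_embedding g G K"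
  shows "graph_embedding (g \<circ> f) H K"
  using assms comp_inj_on[of f "verts H" g] inj_on_subset[of g "verts G" "f ` verts H"]
  unfolding graph_embedding_def image_comp[symmetric] by fast

lemma graph_embedding_subset:
  assumes "graph_embedding f H G" "verts G \<subseteq> verts K" "edges G \<subseteq> edges K"
  shows "graph_embedding f H K"
  using assms unfolding graph_embedding_def by blast

lemma graph_embedding_edge: "graph_embedding f H G \<Longrightarrow> {a, b} \<in> edges H \<Longrightarrow> {f a, f b} \<in> edges G"
  by (force simp: graph_embedding_def)

definition curve_drawing :: "'a ugraph \<Rightarrow> ('a \<Rightarrow> complex) \<Rightarrow> ('a set \<Rightarrow> complex set) \<Rightarrow> bool" where
  "curve_drawing G p \<Gamma> \<longleftrightarrow> inj_on p (verts G) \<and> (\<forall>e\<in>edges G. e \<subseteq> verts G) \<and>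
     (\<forall>u v. {u, v} \<in> edges G \<longrightarrow> arc_between (\<Gamma> {u, v}) (p u) (p v)) \<and>
     (\<forall>e\<in>edges G. \<Gamma> e \<inter> p ` verts G = p ` e) \<and>
     (\<forall>e\<in>edges G. \<forall>e'\<in>edges G. e \<noteq> e' \<longrightarrow> \<Gamma> e \<inter> \<Gamma> e' = p ` (e \<inter> e'))"

definition curve_planar :: "'a ugraph \<Rightarrow> bool" where
  "curve_planar G \<longleftrightarrow> (\<exists>p \<Gamma>. curve_drawing G p \<Gamma>)"

lemma curve_drawing_inj: "curve_drawing G p \<Gamma> \<Longrightarrow> inj_on p (verts G)"
  and curve_drawing_edge_subset: "curve_drawing G p \<Gamma> \<Longrightarrow> e \<in> edges G \<Longrightarrow> e \<subseteq> verts G"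
  and curve_drawing_arc:
    "curve_drawing G p \<Gamma> \<Longrightarrow> {u, v} \<in> edges G \<Longrightarrow> arc_between (\<Gamma> {u, v}) (p u) (p v)"
  and curve_drawing_meet: "curve_drawing G p \<Gamma> \<Longrightarrow> e \<in> edges G \<Longrightarrow> e' \<in> edges G \<Longrightarrow> e \<noteq> e' \<Longrightarrow>
    \<Gamma> e \<inter> \<Gamma> e' = p ` (e \<inter> e')"
  by (simp_all add: curve_drawing_def)

lemma curve_drawing_edge_ends:
  assumes "curve_drawing G p \<Gamma>" "{u, v} \<in> edges G"
  shows "u \<in> verts G" "v \<in> verts G" "u \<noteq> v"
  using curve_drawing_edge_subset[OF assms] arc_between_ends(3)[OF curve_drawing_arc[OF assms]]
  by auto

lemma curve_drawing_vertex_mem_iff: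
  assumes "curve_drawing G p \<Gamma>" "e \<in> edges G" "v \<in> verts G"
  shows "p v \<in> \<Gamma> e \<longleftrightarrow> v \<in> e"
proof -
  have "inj_on p (verts G)" "e \<subseteq> verts G" "\<Gamma> e \<inter> p ` verts G = p ` e"
    using assms unfolding curve_drawing_def by auto
  then show ?thesis using assms(3) by (metis Int_iff image_eqI inj_on_image_mem_iff)
qed

lemma plane_embedding_arc_between:
  assumes "plane_embedding G p \<gamma>" "{u, v} \<in> edges G"
  shows "arc_between (path_image (\<gamma> {u, v})) (p u) (p v)"
proof -
  have "arc (\<gamma> {u, v})" "{pathstart (\<gamma> {u, v}), pathfinish (\<gamma> {u, v})} = p ` {u, v}"
    using assms unfolding plane_embedding_def by blast+
  then have "arc_between (path_image (\<gamma> {u, v})) (p u) (p v) \<or>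
      arc_between (path_image (\<gamma> {u, v})) (p v) (p u)"
    unfolding arc_between_def by (auto simp: doubleton_eq_iff)
  then show ?thesis using arc_between_sym by blast
qed

lemma planar_imp_curve_planar:
  assumes "planar G" "simple_graph G"
  shows "curve_planar G"
proof -
  obtain p \<gamma> where embedding: "plane_embedding G p \<gamma>" using assms(1) unfolding planar_def by blast
  define h :: "real ^ 2 \<Rightarrow> complex" where "h x = Complex (x $ 1) (x $ 2)" for x
  have h: "linear h" "inj h"
    by (auto intro!: linearI injI simp: h_def complex_eq_iff vec_eq_iff forall_2)
  have image_Int_h: "h ` X \<inter> (h \<circ> p) ` Y = (h \<circ> p) ` Z" if "X \<inter> p ` Y = p ` Z" for X Y Z
    using that by (metis image_Int[OF h(2)] image_comp)
  have "curve_drawing G (h \<circ> p) (\<lambda>e. h ` path_image (\<gamma> e))"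
    unfolding curve_drawing_def
  proof (intro conjI ballI allI impI)
    show "inj_on (h \<circ> p) (verts G)"
      using embedding inj_on_subset[OF h(2) subset_UNIV]
      by (intro comp_inj_on) (auto simp: plane_embedding_def)
    show "e \<subseteq> verts G" if "e \<in> edges G" for e
      using assms(2) that unfolding simple_graph_def by blast
    show "arc_between (h ` path_image (\<gamma> {u, v})) ((h \<circ> p) u) ((h \<circ> p) v)"
      if "{u, v} \<in> edges G" for u v
      using arc_between_linear_image[OF plane_embedding_arc_between[OF embedding that] h] by simp
    show "h ` path_image (\<gamma> e) \<inter> (h \<circ> p) ` verts G = (h \<circ> p) ` e" if "e \<in> edges G" for e
      by (rule image_Int_h) (use embedding that in \<open>simp add: plane_embedding_def\<close>)
    show "h ` path_image (\<gamma> e) \<inter> h ` path_image (\<gamma> e') = (h \<circ> p) ` (e \<inter> e')"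
      if "e \<in> edges G" "e' \<in> edges G" "e \<noteq> e'" for e e'
    proof -
      have "path_image (\<gamma> e) \<inter> path_image (\<gamma> e') = p ` (e \<inter> e')"
        using embedding that unfolding plane_embedding_def by blast
      then show ?thesis by (metis image_Int[OF h(2)] image_comp)
    qed
  qed
  then show ?thesis unfolding curve_planar_def by blast
qed

lemma curve_drawing_pullback:
  assumes drawing: "curve_drawing G p \<Gamma>" and embedding: "graph_embedding f H G"
  shows "curve_drawing H (p \<circ> f) (\<lambda>e. \<Gamma> (f ` e))"
  unfolding curve_drawing_def
proof (intro conjI ballI allI impI)
  have inj: "inj_on f (verts H)" and verts: "f ` verts H \<subseteq> verts G"
    and edge: "\<And>e. e \<in> edges H \<Longrightarrow> f ` e \<in> edges G" and sub: "\<And>e. e \<in> edges H \<Longrightarrow> e \<subseteq> verts H"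
    using embedding unfolding graph_embedding_def by auto
  show "inj_on (p \<circ> f) (verts H)"
    using inj inj_on_subset[OF curve_drawing_inj[OF drawing] verts] by (rule comp_inj_on)
  show "e \<subseteq> verts H" if "e \<in> edges H" for e using sub that .
  show "arc_between (\<Gamma> (f ` {u, v})) ((p \<circ> f) u) ((p \<circ> f) v)" if "{u, v} \<in> edges H" for u v
    using curve_drawing_arc[OF drawing] edge[OF that] by simp
  show "\<Gamma> (f ` e) \<inter> (p \<circ> f) ` verts H = (p \<circ> f) ` e" if e: "e \<in> edges H" for e
  proof -
    have "p (f v) \<in> \<Gamma> (f ` e) \<longleftrightarrow> v \<in> e" if "v \<in> verts H" for v
      using curve_drawing_vertex_mem_iff[OF drawing edge[OF e], of "f v"] that verts inj sub[OF e]
      by (auto simp: inj_on_image_mem_iff)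
    then show ?thesis using sub[OF e] by auto
  qed
  show "\<Gamma> (f ` e) \<inter> \<Gamma> (f ` e') = (p \<circ> f) ` (e \<inter> e')"
    if e: "e \<in> edges H" "e' \<in> edges H" "e \<noteq> e'" for e e'
  proof -
    have "f ` e \<noteq> f ` e'" using e(3) inj_on_image_eq_iff[OF inj sub[OF e(1)] sub[OF e(2)]] by simp
    then have "\<Gamma> (f ` e) \<inter> \<Gamma> (f ` e') = p ` (f ` e \<inter> f ` e')"
      using curve_drawing_meet[OF drawing edge[OF e(1)] edge[OF e(2)]] by simp
    then show ?thesis
      using inj_on_image_Int[OF inj sub[OF e(1)] sub[OF e(2)]] by (metis image_comp)
  qed
qed

lemma curve_planar_embedding: "curve_planar G \<Longrightarrow> graph_embedding f H G \<Longrightarrow> curve_planar H"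
  unfolding curve_planar_def using curve_drawing_pullback by blast

lemma curve_drawing_two_edge_path:
  assumes drawing: "curve_drawing G p \<Gamma>" and edges: "{a, x} \<in> edges G" "{x, b} \<in> edges G"
    and "a \<noteq> b"
  shows "arc_between (\<Gamma> {a, x} \<union> \<Gamma> {x, b}) (p a) (p b)"
proof (rule arc_between_join)
  show "arc_between (\<Gamma> {a, x}) (p a) (p x)" "arc_between (\<Gamma> {x, b}) (p x) (p b)"
    using edges by (auto intro: curve_drawing_arc[OF drawing])
  have "a \<noteq> x" "b \<noteq> x" using curve_drawing_edge_ends(3)[OF drawing] edges by blast+
  then show "\<Gamma> {a, x} \<inter> \<Gamma> {x, b} = {p x}"
    using curve_drawing_meet[OF drawing edges] \<open>a \<noteq> b\<close> by (auto simp: doubleton_eq_iff)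
qed

definition suppress :: "'a ugraph \<Rightarrow> 'a \<Rightarrow> 'a \<Rightarrow> 'a \<Rightarrow> 'a ugraph" where
  "suppress G x a b = \<lparr>verts = verts G - {x}, edges = insert {a, b} {e \<in> edges G. x \<notin> e}\<rparr>"

lemma curve_drawing_two_edge_path_vertex_mem_iff:
  assumes drawing: "curve_drawing G p \<Gamma>" and edges: "{a, x} \<in> edges G" "{x, b} \<in> edges G"
    and v: "v \<in> verts G" "v \<noteq> x"
  shows "p v \<in> \<Gamma> {a, x} \<union> \<Gamma> {x, b} \<longleftrightarrow> v \<in> {a, b}"
  using curve_drawing_vertex_mem_iff[OF drawing edges(1) v(1)]
    curve_drawing_vertex_mem_iff[OF drawing edges(2) v(1)] v(2) by auto

lemma curve_drawing_two_edge_path_meet: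
  assumes drawing: "curve_drawing G p \<Gamma>" and edges: "{a, x} \<in> edges G" "{x, b} \<in> edges G"
    and e: "e \<in> edges G" "x \<notin> e"
  shows "(\<Gamma> {a, x} \<union> \<Gamma> {x, b}) \<inter> \<Gamma> e = p ` ({a, b} \<inter> e)"
  using curve_drawing_meet[OF drawing edges(1) e(1)] curve_drawing_meet[OF drawing edges(2) e(1)]
    e(2)
  by auto

lemma curve_drawing_suppress:
  assumes drawing: "curve_drawing G p \<Gamma>"
    and edges: "{a, x} \<in> edges G" "{x, b} \<in> edges G" and "a \<noteq> b"
  shows "curve_drawing (suppress G x a b) p (\<Gamma>({a, b} := \<Gamma> {a, x} \<union> \<Gamma> {x, b}))"
    (is "curve_drawing ?H p ?\<Gamma>")
  unfolding curve_drawing_def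
proof (intro conjI ballI allI impI)
  have ends: "a \<in> verts G" "b \<in> verts G" "a \<noteq> x" "b \<noteq> x"
    using curve_drawing_edge_ends[OF drawing] edges by blast+
  have old: "e \<in> edges G" "x \<notin> e" if "e \<in> edges ?H" "e \<noteq> {a, b}" for e
    using that by (auto simp: suppress_def)
  show "inj_on p (verts ?H)"
    using curve_drawing_inj[OF drawing] by (rule inj_on_subset) (auto simp: suppress_def)
  show subset: "e \<subseteq> verts ?H" if "e \<in> edges ?H" for e
    using that ends curve_drawing_edge_subset[OF drawing] by (auto simp: suppress_def)
  have path: "arc_between (\<Gamma> {a, x} \<union> \<Gamma> {x, b}) (p a) (p b)"
    by (rule curve_drawing_two_edge_path[OF drawing edges \<open>a \<noteq> b\<close>])
  show "arc_between (?\<Gamma> {u, v}) (p u) (p v)" if "{u, v} \<in> edges ?H" for u v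
    using old[OF that] curve_drawing_arc[OF drawing, of u v] path arc_between_sym[OF path]
    by (cases "{u, v} = {a, b}") (auto simp: doubleton_eq_iff)
  show "?\<Gamma> e \<inter> p ` verts ?H = p ` e" if e: "e \<in> edges ?H" for e
  proof -
    have "p v \<in> ?\<Gamma> e \<longleftrightarrow> v \<in> e" if "v \<in> verts ?H" for v
    proof -
      have v: "v \<in> verts G" "v \<noteq> x" using that by (auto simp: suppress_def)
      then show ?thesis
        using curve_drawing_two_edge_path_vertex_mem_iff[OF drawing edges v]
          curve_drawing_vertex_mem_iff[OF drawing old(1)[OF e] v(1)]
        by (cases "e = {a, b}") auto
    qed
    then show ?thesis using subset[OF e] by blast
  qed
  note path_meet = curve_drawing_two_edge_path_meet[OF drawing edges]
  show "?\<Gamma> e \<inter> ?\<Gamma> e' = p ` (e \<inter> e')" if e: "e \<in> edges ?H" "e' \<in> edges ?H" "e \<noteq> e'" for e e'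
  proof -
    consider "e = {a, b}" "e' \<noteq> {a, b}" | "e \<noteq> {a, b}" "e' = {a, b}" | "e \<noteq> {a, b}" "e' \<noteq> {a, b}"
      using e(3) by blast
    then show ?thesis
      using path_meet[OF old[OF e(2)]] path_meet[OF old[OF e(1)]]
        curve_drawing_meet[OF drawing old(1)[OF e(1)] old(1)[OF e(2)] e(3)]
      by cases (auto simp: Int_commute)
  qed
qed

lemma curve_planar_suppress:
  assumes "curve_planar G" "{a, x} \<in> edges G" "{x, b} \<in> edges G" "a \<noteq> b"
  shows "curve_planar (suppress G x a b)"
  using assms curve_drawing_suppress unfolding curve_planar_def by metis

section \<open>Nonplanarity of the Kuratowski graphs\<close>

locale two_hub_drawing =
  fixes G :: "'a ugraph" and p :: "'a \<Rightarrow> complex" and \<Gamma> :: "'a set \<Rightarrow> complex set" and u v :: 'a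
    and K :: "'a set"
  assumes drawing: "curve_drawing G p \<Gamma>"
    and hubs: "u \<noteq> v" "u \<notin> K" "v \<notin> K"
    and hub_edges: "\<And>a. a \<in> K \<Longrightarrow> {u, a} \<in> edges G" "\<And>a. a \<in> K \<Longrightarrow> {a, v} \<in> edges G"
begin

definition hub_path :: "'a \<Rightarrow> complex set" where
  "hub_path a = \<Gamma> {u, a} \<union> \<Gamma> {a, v}"

lemma K_subset: "a \<in> K \<Longrightarrow> a \<in> verts G"
  using curve_drawing_edge_ends(2)[OF drawing hub_edges(1)] .

lemma hub_path_arc: "a \<in> K \<Longrightarrow> arc_between (hub_path a) (p u) (p v)"
  unfolding hub_path_def
  by (rule curve_drawing_two_edge_path[OF drawing hub_edges hubs(1)])

lemma hub_path_Int_edge: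
  assumes "a \<in> K" "e \<in> edges G" "e \<noteq> {u, a}" "e \<noteq> {a, v}"
  shows "hub_path a \<inter> \<Gamma> e = p ` ({u, a, v} \<inter> e)"
  using curve_drawing_meet[OF drawing hub_edges(1)[OF assms(1)] assms(2)]
    curve_drawing_meet[OF drawing hub_edges(2)[OF assms(1)] assms(2)] assms(3,4)
  unfolding hub_path_def by blast

lemma hub_path_Int_hub_path:
  assumes "a \<in> K" "b \<in> K" "a \<noteq> b"
  shows "hub_path a \<inter> hub_path b = {p u, p v}"
proof -
  have "a \<noteq> u" "a \<noteq> v" "b \<noteq> u" "b \<noteq> v" using assms hubs by auto
  then have "hub_path a \<inter> \<Gamma> {u, b} = {p u}" "hub_path a \<inter> \<Gamma> {b, v} = {p v}"
    using hub_path_Int_edge[OF assms(1) hub_edges(1)[OF assms(2)]]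
      hub_path_Int_edge[OF assms(1) hub_edges(2)[OF assms(2)]] assms(3) hubs(1)
    by (auto simp: doubleton_eq_iff)
  then show ?thesis unfolding hub_path_def[of b] by auto
qed

lemma hub_paths_theta:
  assumes "a \<in> K" "b \<in> K" "c \<in> K" "distinct [a, b, c]"
  shows "theta_curve (hub_path a) (hub_path b) (hub_path c) (p u) (p v)"
  using assms by (auto simp: theta_curve_def hub_path_arc hub_path_Int_hub_path)

lemma vertex_mem_hub_path_iff:
  assumes "a \<in> K" "w \<in> verts G"
  shows "p w \<in> hub_path a \<longleftrightarrow> w \<in> {u, a, v}"
  using curve_drawing_vertex_mem_iff[OF drawing hub_edges(1)[OF assms(1)] assms(2)]
    curve_drawing_vertex_mem_iff[OF drawing hub_edges(2)[OF assms(1)] assms(2)]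
  unfolding hub_path_def by auto

lemma vertex_mem_hub_path:
  assumes "a \<in> K"
  shows "p a \<in> hub_path a - {p u, p v}"
proof -
  have "u \<in> verts G" "v \<in> verts G"
    using curve_drawing_edge_ends[OF drawing] hub_edges assms by blast+
  then have "p a \<noteq> p u" "p a \<noteq> p v"
    using inj_onD[OF curve_drawing_inj[OF drawing]] K_subset[OF assms] assms hubs by blast+
  then show ?thesis using vertex_mem_hub_path_iff[OF assms K_subset[OF assms]] by simp
qed

lemma hub_paths_separate:
  assumes "a \<in> K" "b \<in> K" "c \<in> K" "distinct [a, b, c]" "x \<notin> hub_path a \<union> hub_path b \<union> hub_path c"
  shows "\<not> connected_component (- (hub_path a \<union> hub_path b)) (p c) x \<or>
    \<not> connected_component (- (hub_path a \<union> hub_path c)) (p b) x \<or>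
    \<not> connected_component (- (hub_path b \<union> hub_path c)) (p a) x"
  by (rule theta_curve_separates[OF hub_paths_theta[OF assms(1-4)] assms(5)])
    (use assms vertex_mem_hub_path in auto)

lemma common_neighbour_of_three:
  assumes abc: "a \<in> K" "b \<in> K" "c \<in> K" "distinct [a, b, c]"
    and w: "w \<notin> {u, v}" "w \<notin> K" "\<And>d. d \<in> {a, b, c} \<Longrightarrow> {d, w} \<in> edges G"
  shows False
proof -
  have "w \<in> verts G" using curve_drawing_edge_ends(2)[OF drawing w(3)] by blast
  then have off: "p w \<notin> hub_path d" if "d \<in> {a, b, c}" for d
    using vertex_mem_hub_path_iff[of d w] that abc w by auto
  have avoid: "\<Gamma> {d, w} \<inter> hub_path d' = {}" if "d \<in> {a, b, c}" "d' \<in> {a, b, c}" "d \<noteq> d'" for d d'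
  proof -
    have "d \<in> K" "d' \<in> K" using that abc by auto
    moreover have "{d, w} \<noteq> {u, d'}" "{d, w} \<noteq> {d', v}"
      using that(3) w calculation hubs by (auto simp: doubleton_eq_iff)
    ultimately show ?thesis
      using hub_path_Int_edge[OF _ w(3)[OF that(1)], of d'] that(3) w(1,2) hubs by auto
  qed
  have "connected_component (- (hub_path d \<union> hub_path d')) (p d'') (p w)"
    if "{d, d', d''} = {a, b, c}" "d'' \<noteq> d" "d'' \<noteq> d'" for d d' d''
  proof -
    have d: "d'' \<in> {a, b, c}" "d \<in> {a, b, c}" "d' \<in> {a, b, c}" using that(1) by auto
    have arc: "arc_between (\<Gamma> {d'', w}) (p d'') (p w)"
      by (rule curve_drawing_arc[OF drawing w(3)[OF d(1)]])
    then show ?thesis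
      using avoid[OF d(1,2)] avoid[OF d(1,3)] that(2,3) arc_between_ends[OF arc]
      by (intro arc_between_connected_avoiding[OF arc]) auto
  qed
  then show False
    using hub_paths_separate[OF abc, of "p w"] off abc(4) by auto
qed

lemma chord_separated:
  assumes ab: "a \<in> K" "b \<in> K" "a \<noteq> b" "{a, b} \<in> edges G"
    and theta: "theta_curve (hub_path a) (hub_path b) S (p u) (p v)" and "S \<inter> \<Gamma> {a, b} = {}"
    and s: "s \<in> S - {p u, p v}" and y: "y \<in> \<Gamma> {a, b} - {p a, p b}"
  shows "y \<notin> hub_path a \<union> hub_path b" "\<not> connected_component (- (hub_path a \<union> hub_path b)) s y"
proof -
  have arc: "arc_between (\<Gamma> {a, b}) (p a) (p b)" by (rule curve_drawing_arc[OF drawing ab(4)])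
  have "a \<notin> {u, v}" "b \<notin> {u, v}" using ab hubs by auto
  then have meet: "hub_path a \<inter> \<Gamma> {a, b} = {p a}" "hub_path b \<inter> \<Gamma> {a, b} = {p b}"
    using hub_path_Int_edge[OF ab(1,4)] hub_path_Int_edge[OF ab(2,4)] ab(3)
    by (auto simp: doubleton_eq_iff)
  then show off: "y \<notin> hub_path a \<union> hub_path b" using y by blast
  have "y \<notin> S" using y assms(6) by blast
  have "p b \<notin> hub_path a" "p a \<notin> hub_path b"
    using meet arc_between_ends[OF arc] by (metis IntI singletonD)+
  have "connected_component (- (hub_path a \<union> S)) (p b) y"
    using meet(1) assms(6) y off \<open>y \<notin> S\<close> \<open>p b \<notin> hub_path a\<close> arc_between_ends[OF arc]
    by (intro arc_between_connected_avoiding[OF arc_between_sym[OF arc]]) auto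
  moreover have "connected_component (- (hub_path b \<union> S)) (p a) y"
    using meet(2) assms(6) y off \<open>y \<notin> S\<close> \<open>p a \<notin> hub_path b\<close> arc_between_ends[OF arc]
    by (intro arc_between_connected_avoiding[OF arc]) auto
  ultimately show "\<not> connected_component (- (hub_path a \<union> hub_path b)) s y"
    using theta_curve_separates[OF theta, of y "p a" "p b" s] off \<open>y \<notin> S\<close> s vertex_mem_hub_path ab
    by auto
qed

lemma hub_edge_same_side:
  assumes abc: "a \<in> K" "b \<in> K" "c \<in> K" "distinct [a, b, c]"
    and "{a, b} \<in> edges G" "{u, v} \<in> edges G"
    and x: "x \<in> \<Gamma> {u, v} - {p u, p v}"
  shows "connected_component (- (hub_path a \<union> hub_path b)) (p c) x"
proof -
  have meet: "hub_path d \<inter> \<Gamma> {u, v} = {p u, p v}" if "d \<in> K" for d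
    using hub_path_Int_edge[OF that assms(6)] that hubs by (auto simp: doubleton_eq_iff)
  have thetas: "theta_curve (hub_path a) (hub_path b) (\<Gamma> {u, v}) (p u) (p v)"
    "theta_curve (hub_path a) (hub_path b) (hub_path c) (p u) (p v)"
    using abc meet hub_paths_theta curve_drawing_arc[OF drawing assms(6)]
    by (auto simp: theta_curve_def hub_path_arc hub_path_Int_hub_path)
  have outside: "{u, v} \<inter> {a, b} = {}" "{u, c, v} \<inter> {a, b} = {}" using abc hubs by auto
  then have "\<Gamma> {u, v} \<inter> \<Gamma> {a, b} = {}"
    using curve_drawing_meet[OF drawing assms(6,5)] by auto
  moreover have "{a, b} \<noteq> {u, c}" "{a, b} \<noteq> {c, v}" using outside(2) by blast+
  then have "hub_path c \<inter> \<Gamma> {a, b} = {}"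
    using hub_path_Int_edge[OF abc(3) assms(5)] outside(2) by simp
  moreover obtain y where "y \<in> \<Gamma> {a, b} - {p a, p b}"
    using nonempty_arc_between_endless[OF curve_drawing_arc[OF drawing assms(5)]] by blast
  ultimately have y: "y \<notin> hub_path a \<union> hub_path b"
    "\<not> connected_component (- (hub_path a \<union> hub_path b)) x y"
    "\<not> connected_component (- (hub_path a \<union> hub_path b)) (p c) y"
    using chord_separated[OF abc(1,2) _ assms(5)] thetas x vertex_mem_hub_path[OF abc(3)] abc(4)
    by auto
  have "x \<notin> hub_path a \<union> hub_path b" using meet[OF abc(1)] meet[OF abc(2)] x by blast
  moreover have "p c \<notin> hub_path a \<union> hub_path b"
    using vertex_mem_hub_path_iff[of _ c] K_subset abc hubs by auto
  ultimately show ?thesis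
    using two_arcs_three_points[OF hub_path_arc[OF abc(1)] hub_path_arc[OF abc(2)]
        hub_path_Int_hub_path[OF abc(1,2)], of "p c" x y] y abc(4) by auto
qed

end

lemma K33_not_curve_planar:
  assumes "distinct [a, b, c, u, v, w]"
    and edges: "\<And>x y. x \<in> {a, b, c} \<Longrightarrow> y \<in> {u, v, w} \<Longrightarrow> {x, y} \<in> edges G"
  shows "\<not> curve_planar G"
proof
  assume "curve_planar G"
  then obtain p \<Gamma> where "curve_drawing G p \<Gamma>" unfolding curve_planar_def by blast
  then interpret two_hub_drawing G p \<Gamma> u v "{a, b, c}"
    by unfold_locales (use assms(1) edges in \<open>auto simp: insert_commute\<close>)
  show False by (rule common_neighbour_of_three[of a b c w]) (use assms in auto)
qed

lemma K5_not_curve_planar: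
  assumes "distinct [a, b, c, u, v]"
    and edges: "\<And>x y. x \<in> {a, b, c, u, v} \<Longrightarrow> y \<in> {a, b, c, u, v} \<Longrightarrow> x \<noteq> y \<Longrightarrow> {x, y} \<in> edges G"
  shows "\<not> curve_planar G"
proof
  assume "curve_planar G"
  then obtain p \<Gamma> where drawing: "curve_drawing G p \<Gamma>" unfolding curve_planar_def by blast
  then interpret two_hub_drawing G p \<Gamma> u v "{a, b, c}"
    by unfold_locales (use assms(1) edges in auto)
  have uv: "{u, v} \<in> edges G" using assms by auto
  obtain x where x: "x \<in> \<Gamma> {u, v} - {p u, p v}"
    using nonempty_arc_between_endless[OF curve_drawing_arc[OF drawing uv]] by blast
  then have "x \<notin> hub_path d" if "d \<in> {a, b, c}" for d
    using hub_path_Int_edge[OF that uv] that hubs by (auto simp: doubleton_eq_iff)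
  then show False
    using hub_paths_separate[of a b c x] hub_edge_same_side[of _ _ _ x] assms uv x by auto
qed

section \<open>Straight-line drawings\<close>

definition line_drawing :: "'a ugraph \<Rightarrow> ('a \<Rightarrow> real ^ 2) \<Rightarrow> bool" where
  "line_drawing G p \<longleftrightarrow> inj_on p (verts G) \<and>
     (\<forall>e\<in>edges G. \<forall>c\<in>verts G - e. p c \<notin> convex hull (p ` e)) \<and>
     (\<forall>e\<in>edges G. \<forall>e'\<in>edges G. e \<noteq> e' \<longrightarrow> convex hull (p ` e) \<inter> convex hull (p ` e') \<subseteq> p ` (e \<inter> e'))"

definition line_planar :: "'a ugraph \<Rightarrow> bool" where
  "line_planar G \<longleftrightarrow> (\<exists>p. line_drawing G p)"

lemma line_drawing_inj: "line_drawing G p \<Longrightarrow> inj_on p (verts G)"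
  and line_drawing_vertex:
    "line_drawing G p \<Longrightarrow> e \<in> edges G \<Longrightarrow> c \<in> verts G \<Longrightarrow> c \<notin> e \<Longrightarrow> p c \<notin> convex hull (p ` e)"
  and line_drawing_meet: "line_drawing G p \<Longrightarrow> e \<in> edges G \<Longrightarrow> e' \<in> edges G \<Longrightarrow> e \<noteq> e' \<Longrightarrow>
    convex hull (p ` e) \<inter> convex hull (p ` e') \<subseteq> p ` (e \<inter> e')"
  by (auto simp: line_drawing_def)

lemma line_planar_subset:
  "line_planar G \<Longrightarrow> verts H \<subseteq> verts G \<Longrightarrow> edges H \<subseteq> edges G \<Longrightarrow> line_planar H"
  unfolding line_planar_def line_drawing_def by (meson Diff_mono inj_on_subset order_refl subsetD)

lemma line_planar_singleton:
  assumes "simple_graph G" "verts G \<subseteq> {x}"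
  shows "line_planar G"
proof -
  have "edges G = {}" using assms by (metis ex_in_conv simple_graph_edgeE singletonD subsetD)
  then have "line_drawing G (\<lambda>_. 0)"
    using assms(2) inj_on_subset[of "\<lambda>_. 0" "{x}"] by (simp add: line_drawing_def)
  then show ?thesis unfolding line_planar_def by blast
qed

lemma line_drawing_pullback:
  assumes drawing: "line_drawing G p" and embedding: "graph_embedding f H G"
  shows "line_drawing H (p \<circ> f)"
  unfolding line_drawing_def
proof (intro conjI ballI impI)
  have inj: "inj_on f (verts H)" and verts: "f ` verts H \<subseteq> verts G"
    and edge: "\<And>e. e \<in> edges H \<Longrightarrow> f ` e \<in> edges G" and sub: "\<And>e. e \<in> edges H \<Longrightarrow> e \<subseteq> verts H"
    using embedding unfolding graph_embedding_def by auto
  show "inj_on (p \<circ> f) (verts H)"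
    using inj inj_on_subset[OF line_drawing_inj[OF drawing] verts] by (rule comp_inj_on)
  show "(p \<circ> f) c \<notin> convex hull ((p \<circ> f) ` e)" if "e \<in> edges H" "c \<in> verts H - e" for e c
    using line_drawing_vertex[OF drawing edge[OF that(1)], of "f c"] that(2) verts
      inj_on_image_mem_iff[OF inj _ sub[OF that(1)], of c] by (auto simp: image_comp)
  show "convex hull ((p \<circ> f) ` e) \<inter> convex hull ((p \<circ> f) ` e') \<subseteq> (p \<circ> f) ` (e \<inter> e')"
    if e: "e \<in> edges H" "e' \<in> edges H" "e \<noteq> e'" for e e'
  proof -
    have "f ` e \<noteq> f ` e'" using e(3) inj_on_image_eq_iff[OF inj sub[OF e(1)] sub[OF e(2)]] by simp
    moreover have "f ` (e \<inter> e') = f ` e \<inter> f ` e'"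
      by (rule inj_on_image_Int[OF inj sub[OF e(1)] sub[OF e(2)]])
    ultimately show ?thesis
      using line_drawing_meet[OF drawing edge[OF e(1)] edge[OF e(2)]]
      unfolding image_comp[symmetric] by simp
  qed
qed

lemma line_planar_imp_planar:
  assumes "line_planar G" "simple_graph G"
  shows "planar G"
proof -
  obtain p where p: "line_drawing G p" using assms(1) unfolding line_planar_def by blast
  have "\<exists>g. arc g \<and> {pathstart g, pathfinish g} = p ` e \<and> path_image g = convex hull (p ` e)"
    if e: "e \<in> edges G" for e
  proof -
    obtain a b where ab: "e = {a, b}" "a \<noteq> b" "a \<in> verts G" "b \<in> verts G"
      using simple_graph_edgeE[OF assms(2) e] by metis
    then have "p a \<noteq> p b" using line_drawing_inj[OF p] by (auto dest: inj_onD)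
    then show ?thesis
      by (intro exI[of _ "linepath (p a) (p b)"]) (auto simp: ab segment_convex_hull)
  qed
  then obtain \<gamma> where \<gamma>: "\<And>e. e \<in> edges G \<Longrightarrow>
    arc (\<gamma> e) \<and> {pathstart (\<gamma> e), pathfinish (\<gamma> e)} = p ` e \<and>
      path_image (\<gamma> e) = convex hull (p ` e)" by metis
  have subset_hull: "p ` e \<subseteq> convex hull (p ` e)" for e by (rule hull_subset)
  have "plane_embedding G p \<gamma>"
    unfolding plane_embedding_def
  proof (intro conjI ballI impI)
    show "inj_on p (verts G)" using line_drawing_inj[OF p] .
    fix e assume e: "e \<in> edges G"
    show "arc (\<gamma> e)" "{pathstart (\<gamma> e), pathfinish (\<gamma> e)} = p ` e" using \<gamma>[OF e] by auto
    have "e \<subseteq> verts G" using assms(2) e unfolding simple_graph_def by blast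
    then show "path_image (\<gamma> e) \<inter> p ` verts G = p ` e"
      using \<gamma>[OF e] subset_hull[of e] line_drawing_vertex[OF p e] by blast
    show "path_image (\<gamma> e) \<inter> path_image (\<gamma> e') = p ` (e \<inter> e')" if "e' \<in> edges G" "e \<noteq> e'" for e'
      using \<gamma>[OF e] \<gamma>[OF that(1)] line_drawing_meet[OF p e that] subset_hull[of e]
        subset_hull[of e'] by auto
  qed
  then show ?thesis unfolding planar_def by blast
qed

definition det2 :: "real ^ 2 \<Rightarrow> real ^ 2 \<Rightarrow> real" where
  "det2 u v = u $ 1 * v $ 2 - u $ 2 * v $ 1"

lemma segments_meet_at_start:
  assumes "det2 (x - a) (y - a) \<noteq> 0"
  shows "closed_segment a x \<inter> closed_segment a y = {a}"
proof -
  have "z = a" if z: "z \<in> closed_segment a x" "z \<in> closed_segment a y" for z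
  proof -
    obtain s where s: "z - a = s *\<^sub>R (x - a)"
      using z(1) by (auto simp: in_segment algebra_simps)
    obtain t where t: "z - a = t *\<^sub>R (y - a)"
      using z(2) by (auto simp: in_segment algebra_simps)
    have "s * det2 (x - a) (y - a) = det2 (s *\<^sub>R (x - a)) (y - a)"
      by (simp add: det2_def algebra_simps)
    also have "\<dots> = det2 (t *\<^sub>R (y - a)) (y - a)" using s t by simp
    also have "\<dots> = 0" by (simp add: det2_def algebra_simps)
    finally show ?thesis using assms s by simp
  qed
  then show ?thesis by auto
qed

lemma not_in_segment_to_midpoint:
  fixes a b :: "'a::euclidean_space"
  assumes "a \<noteq> b"
  shows "b \<notin> closed_segment a (midpoint a b)"
proof
  assume "b \<in> closed_segment a (midpoint a b)"
  then have "dist a b \<le> dist a (midpoint a b)" using dist_in_closed_segment by (metis dist_commute)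
  then show False using assms by (simp add: dist_midpoint)
qed

lemma generic_direction:
  assumes "finite W" "0 \<notin> W"
  obtains n where "n \<noteq> 0" "\<And>w. w \<in> W \<Longrightarrow> det2 n w \<noteq> 0"
proof -
  obtain k where k: "k \<notin> (\<lambda>w. w $ 2 / w $ 1) ` W"
    using ex_new_if_finite[OF infinite_UNIV_char_0] assms(1) by blast
  define n :: "real ^ 2" where "n = vector [1, k]"
  have n: "n $ 1 = 1" "n $ 2 = k" by (simp_all add: n_def)
  show thesis
  proof (rule that)
    show "n \<noteq> 0" using n(1) by auto
    show "det2 n w \<noteq> 0" if w: "w \<in> W" for w
    proof
      assume "det2 n w = 0"
      then have "w $ 2 = k * w $ 1" by (simp add: det2_def n)
      moreover have "w \<noteq> 0" using w assms(2) by blast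
      ultimately have "k = w $ 2 / w $ 1" by (auto simp: vec_eq_iff forall_2)
      then show False using k w by blast
    qed
  qed
qed

lemma eventually_affine_nonzero:
  fixes \<alpha> \<beta> :: real
  assumes "\<beta> \<noteq> 0"
  shows "eventually (\<lambda>\<delta>. \<alpha> + \<delta> * \<beta> \<noteq> 0) (at_right 0)"
  by (rule eventually_mono[OF eventually_neq_at_within[of "- \<alpha> / \<beta>"]])
    (use assms in \<open>auto simp: field_simps add_eq_0_iff\<close>)

lemma eventually_segment_disjoint:
  fixes a m n :: "'a::euclidean_space"
  assumes "compact K" "K \<inter> closed_segment a m = {}"
  shows "eventually (\<lambda>\<delta>. K \<inter> closed_segment a (m + \<delta> *\<^sub>R n) = {}) (at_right 0)"
proof -
  obtain d where d: "d > 0" "\<And>x y. x \<in> K \<Longrightarrow> y \<in> closed_segment a m \<Longrightarrow> d \<le> dist x y"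
    using separate_compact_closed[OF assms(1) closed_segment assms(2)] by blast
  have "K \<inter> closed_segment a (m + \<delta> *\<^sub>R n) = {}" if \<delta>: "\<delta> > 0" "\<delta> < d / (norm n + 1)" for \<delta>
  proof (rule ccontr)
    assume "K \<inter> closed_segment a (m + \<delta> *\<^sub>R n) \<noteq> {}"
    then obtain u where u: "0 \<le> u" "u \<le> 1" "(1 - u) *\<^sub>R a + u *\<^sub>R (m + \<delta> *\<^sub>R n) \<in> K" (is "?y \<in> K")
      by (auto simp: in_segment)
    let ?z = "(1 - u) *\<^sub>R a + u *\<^sub>R m"
    have "?z \<in> closed_segment a m" using u by (auto simp: in_segment)
    then have "d \<le> dist ?y ?z" using d(2) u(3) by blast
    also have "dist ?y ?z = norm ((u * \<delta>) *\<^sub>R n)" by (simp add: dist_norm algebra_simps)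
    also have "\<dots> = u * \<delta> * norm n" using u \<delta> by simp
    also have "\<dots> \<le> \<delta> * norm n" using u \<delta> by (simp add: mult_left_le_one_le mult_right_mono)
    also have "\<dots> < \<delta> * (norm n + 1)" using \<delta> by simp
    also have "\<dots> < d" using \<delta> by (simp add: pos_less_divide_eq add_nonneg_pos)
    finally show False .
  qed
  moreover have "d / (norm n + 1) > 0" using d by (simp add: add_nonneg_pos)
  ultimately show ?thesis unfolding eventually_at_right_field by blast
qed

definition sees :: "'a ugraph \<Rightarrow> ('a \<Rightarrow> real ^ 2) \<Rightarrow> 'a \<Rightarrow> real ^ 2 \<Rightarrow> bool" where
  "sees G p a q \<longleftrightarrow> q \<noteq> p a \<and>
     (\<forall>e\<in>edges G. convex hull (p ` e) \<inter> closed_segment (p a) q \<subseteq> p ` (e \<inter> {a})) \<and>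
     (\<forall>c\<in>verts G - {a}. p c \<notin> closed_segment (p a) q)"

lemma eventually_segment_meets_at_start:
  assumes "det2 n (y - a) \<noteq> 0"
  shows "eventually (\<lambda>\<delta>. closed_segment a y \<inter> closed_segment a (m + \<delta> *\<^sub>R n) = {a}) (at_right 0)"
proof (rule eventually_mono[OF eventually_affine_nonzero[OF assms]])
  fix \<delta> assume "det2 (m - a) (y - a) + \<delta> * det2 n (y - a) \<noteq> 0"
  then have "det2 (y - a) (m + \<delta> *\<^sub>R n - a) \<noteq> 0" by (simp add: det2_def algebra_simps)
  then show "closed_segment a y \<inter> closed_segment a (m + \<delta> *\<^sub>R n) = {a}"
    by (rule segments_meet_at_start)
qed

lemma eventually_sees:
  assumes G: "simple_graph G"
    and n: "n \<noteq> 0" "\<And>b. b \<in> verts G - {a} \<Longrightarrow> det2 n (p b - p a) \<noteq> 0"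
    and clear: "\<And>e. e \<in> edges G \<Longrightarrow> a \<notin> e \<Longrightarrow> convex hull (p ` e) \<inter> closed_segment (p a) m = {}"
      "\<And>c. c \<in> verts G - {a} \<Longrightarrow> p c \<notin> closed_segment (p a) m"
  shows "eventually (\<lambda>\<delta>. sees G p a (m + \<delta> *\<^sub>R n)) (at_right 0)"
  unfolding sees_def
proof (intro eventually_conj eventually_ball_finite ballI)
  let ?q = "\<lambda>\<delta>. m + \<delta> *\<^sub>R n"
  show "finite (edges G)" "finite (verts G - {a})"
    using finite_edges[OF G] finite_verts[OF G] by auto
  obtain k where "n $ k \<noteq> 0" using n(1) by (auto simp: vec_eq_iff)
  then show "eventually (\<lambda>\<delta>. ?q \<delta> \<noteq> p a) (at_right 0)"
    by (rule eventually_mono[OF eventually_affine_nonzero[of _ "(m - p a) $ k"]])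
      (auto simp: algebra_simps dest!: arg_cong[where f = "\<lambda>v. v $ k"])
  show "eventually (\<lambda>\<delta>. p c \<notin> closed_segment (p a) (?q \<delta>)) (at_right 0)"
    if "c \<in> verts G - {a}" for c
    using eventually_segment_disjoint[of "{p c}" "p a" m n] clear(2)[OF that] by simp
  show "eventually (\<lambda>\<delta>. convex hull (p ` e) \<inter> closed_segment (p a) (?q \<delta>)
      \<subseteq> p ` (e \<inter> {a})) (at_right 0)"
    if e: "e \<in> edges G" for e
  proof -
    obtain c d where cd: "e = {c, d}" "c \<noteq> d" "c \<in> verts G" "d \<in> verts G"
      using simple_graph_edgeE[OF G e] by metis
    show ?thesis
    proof (cases "a \<in> e")
      case True
      then obtain b where b: "e = {a, b}" "b \<in> verts G - {a}" using cd by auto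
      show ?thesis
        by (rule eventually_mono[OF eventually_segment_meets_at_start[OF n(2)[OF b(2)]]])
          (auto simp: b(1) segment_convex_hull)
    next
      case False
      have "compact (convex hull (p ` e))"
        using cd(1) by (simp add: compact_convex_hull finite_imp_compact)
      from eventually_segment_disjoint[OF this clear(1)[OF e False]] show ?thesis
        by (rule eventually_mono) blast
    qed
  qed
qed

lemma sees_avoids:
  assumes "sees G p a q"
  shows "c \<in> verts G \<Longrightarrow> q \<noteq> p c" "e \<in> edges G \<Longrightarrow> q \<notin> convex hull (p ` e)"
proof -
  have q: "q \<in> closed_segment (p a) q" by simp
  show "q \<noteq> p c" if "c \<in> verts G" using assms that q unfolding sees_def by (cases "c = a") auto
  show "q \<notin> convex hull (p ` e)" if "e \<in> edges G" using assms that q unfolding sees_def by blast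
qed

locale added_vertex =
  fixes G :: "'a ugraph" and p x S q
  assumes simple: "simple_graph G" and drawing: "line_drawing G p" and new: "x \<notin> verts G"
    and neighbours: "S \<subseteq> verts G" "S \<noteq> {}" and sees: "\<And>a. a \<in> S \<Longrightarrow> sees G p a q"
    and spokes_meet: "\<And>a b. a \<in> S \<Longrightarrow> b \<in> S \<Longrightarrow> a \<noteq> b \<Longrightarrow>
      closed_segment (p a) q \<inter> closed_segment (p b) q \<subseteq> {q}"
begin

abbreviation extended :: "'a \<Rightarrow> real ^ 2" where
  "extended \<equiv> p(x := q)"

lemma old_edge:
  assumes "e \<in> edges G"
  shows "x \<notin> e" "extended ` e = p ` e"
proof -
  show "x \<notin> e" using simple assms new unfolding simple_graph_def by blast
  then show "extended ` e = p ` e" by auto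
qed

lemma spoke:
  assumes "a \<in> S"
  shows "a \<noteq> x" "convex hull (extended ` {x, a}) = closed_segment (p a) q"
proof -
  show "a \<noteq> x" using assms neighbours(1) new by auto
  then show "convex hull (extended ` {x, a}) = closed_segment (p a) q"
    by (simp add: segment_convex_hull insert_commute)
qed

lemma old_edge_meets_spoke:
  assumes "e \<in> edges G" "a \<in> S"
  shows "convex hull (extended ` e) \<inter> convex hull (extended ` {x, a}) \<subseteq> extended ` (e \<inter> {x, a})"
proof -
  have "extended ` (e \<inter> {x, a}) = p ` (e \<inter> {a})"
    using old_edge(1)[OF assms(1)] spoke(1)[OF assms(2)] by (intro image_cong) auto
  moreover have "convex hull (p ` e) \<inter> closed_segment (p a) q \<subseteq> p ` (e \<inter> {a})"
    using sees[OF assms(2)] assms(1) by (simp add: sees_def)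
  ultimately show ?thesis using spoke(2)[OF assms(2)] old_edge(2)[OF assms(1)] by simp
qed

lemma edges_meet:
  assumes "e \<in> edges G \<union> (\<lambda>a. {x, a}) ` S" "e' \<in> edges G \<union> (\<lambda>a. {x, a}) ` S" "e \<noteq> e'"
  shows "convex hull (extended ` e) \<inter> convex hull (extended ` e') \<subseteq> extended ` (e \<inter> e')"
proof -
  consider (old) "e \<in> edges G" "e' \<in> edges G"
    | (old_new) a where "e \<in> edges G" "a \<in> S" "e' = {x, a}"
    | (new_old) a where "e' \<in> edges G" "a \<in> S" "e = {x, a}"
    | (new) a b where "a \<in> S" "b \<in> S" "e = {x, a}" "e' = {x, b}"
    using assms(1,2) by auto
  then show ?thesis
  proof cases
    case old
    then have "extended ` (e \<inter> e') = p ` (e \<inter> e')" using old_edge(1) by (intro image_cong) auto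
    then show ?thesis using line_drawing_meet[OF drawing old assms(3)] old_edge(2) old by simp
  next
    case (new a b)
    then have "convex hull (extended ` e) \<inter> convex hull (extended ` e') \<subseteq> {q}"
      using spokes_meet[OF new(1,2)] spoke(2) assms(3) by auto
    moreover have "q \<in> extended ` (e \<inter> e')" using new by auto
    ultimately show ?thesis by blast
  qed (use old_edge_meets_spoke in \<open>auto simp: Int_commute\<close>)
qed

lemma line_drawing_extended:
  "line_drawing \<lparr>verts = insert x (verts G), edges = edges G \<union> (\<lambda>a. {x, a}) ` S\<rparr> extended"
  unfolding line_drawing_def ugraph.simps
proof (intro conjI ballI impI)
  obtain a where "a \<in> S" using neighbours(2) by blast
  note avoids = sees_avoids[OF sees[OF this]]
  show "inj_on extended (insert x (verts G))"
    using line_drawing_inj[OF drawing] avoids(1) new by (auto simp: inj_on_def)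
  show "extended c \<notin> convex hull (extended ` e)"
    if e: "e \<in> edges G \<union> (\<lambda>a. {x, a}) ` S" and c: "c \<in> insert x (verts G) - e" for e c
  proof -
    consider (old) "e \<in> edges G" | (new) b where "b \<in> S" "e = {x, b}" using e by blast
    then show ?thesis
    proof cases
      case old
      then show ?thesis using avoids(2) line_drawing_vertex[OF drawing old, of c] old_edge c by auto
    next
      case (new b)
      then have "c \<in> verts G - {b}" "c \<noteq> x" using c by auto
      then show ?thesis using sees[OF new(1)] spoke(2)[OF new(1)] new(2) by (simp add: sees_def)
    qed
  qed
qed (use edges_meet in blast)

end

lemma segment_to_midpoint_clear:
  assumes p: "line_drawing G p" and ab: "a \<in> verts G" "b \<in> verts G" "a = b \<or> {a, b} \<in> edges G"
  defines "s \<equiv> closed_segment (p a) (midpoint (p a) (p b))"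
  shows "e \<in> edges G \<Longrightarrow> a \<notin> e \<Longrightarrow> convex hull (p ` e) \<inter> s = {}" "c \<in> verts G - {a} \<Longrightarrow> p c \<notin> s"
proof -
  have "s \<subseteq> closed_segment (p a) (p b)" unfolding s_def by (simp add: subset_closed_segment)
  then have s_edge: "s \<subseteq> convex hull (p ` {a, b})" by (simp add: segment_convex_hull)
  show "convex hull (p ` e) \<inter> s = {}" if e: "e \<in> edges G" "a \<notin> e" for e
  proof (cases "a = b")
    case True
    then show ?thesis using line_drawing_vertex[OF p e(1) ab(1) e(2)] by (simp add: s_def)
  next
    case False
    then have "{a, b} \<in> edges G" "e \<noteq> {a, b}" using ab(3) e(2) by auto
    then have "convex hull (p ` e) \<inter> s \<subseteq> {p b}"
      using line_drawing_meet[OF p e(1), of "{a, b}"] e(2) s_edge by auto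
    moreover have "p a \<noteq> p b" using inj_onD[OF line_drawing_inj[OF p]] ab(1,2) False by blast
    then have "p b \<notin> s" unfolding s_def by (rule not_in_segment_to_midpoint)
    ultimately show ?thesis by blast
  qed
  show "p c \<notin> s" if c: "c \<in> verts G - {a}" for c
  proof (cases "c = b")
    case True
    then have "p a \<noteq> p b" using inj_onD[OF line_drawing_inj[OF p]] ab(1,2) c by blast
    then show ?thesis using not_in_segment_to_midpoint True by (simp add: s_def)
  next
    case False
    have "p c \<notin> convex hull (p ` {a, b})"
    proof (cases "a = b")
      case True
      then show ?thesis using inj_onD[OF line_drawing_inj[OF p], of c a] ab(1) c by auto
    next
      case False
      then show ?thesis using line_drawing_vertex[OF p, of "{a, b}" c] ab(3) c \<open>c \<noteq> b\<close> by auto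
    qed
    then show ?thesis using s_edge by blast
  qed
qed

lemma line_drawing_generic_direction:
  assumes G: "simple_graph G" and p: "line_drawing G p"
  obtains n where "n \<noteq> 0" "\<And>c d. c \<in> verts G \<Longrightarrow> d \<in> verts G \<Longrightarrow> c \<noteq> d \<Longrightarrow> det2 n (p d - p c) \<noteq> 0"
proof -
  obtain n where n: "n \<noteq> 0"
    "\<And>w. w \<in> (\<lambda>(c, d). p d - p c) ` (verts G \<times> verts G) - {0} \<Longrightarrow> det2 n w \<noteq> 0"
    using generic_direction[of "(\<lambda>(c, d). p d - p c) ` (verts G \<times> verts G) - {0}"]
      finite_verts[OF G] by auto
  have "det2 n (p d - p c) \<noteq> 0" if "c \<in> verts G" "d \<in> verts G" "c \<noteq> d" for c d
  proof -
    have "p d - p c \<noteq> 0" using inj_onD[OF line_drawing_inj[OF p]] that by force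
    then show ?thesis using n(2) that(1,2) by blast
  qed
  then show thesis using that n(1) by blast
qed

lemma eventually_sees_near_midpoint:
  assumes G: "simple_graph G" and p: "line_drawing G p"
    and ab: "a \<in> verts G" "b \<in> verts G" "a = b \<or> {a, b} \<in> edges G"
    and n: "n \<noteq> 0" "\<And>c. c \<in> verts G - {a} \<Longrightarrow> det2 n (p c - p a) \<noteq> 0"
  shows "eventually (\<lambda>\<delta>. sees G p a (midpoint (p a) (p b) + \<delta> *\<^sub>R n)) (at_right 0)"
  by (rule eventually_sees[OF G n(1)]) (use n(2) segment_to_midpoint_clear[OF p ab] in auto)

text \<open>The new vertex is drawn close to the midpoint of the edge \<open>ab\<close> (or close to \<open>a\<close> if \<open>a = b\<close>),
  in a direction that is not parallel to any line through two vertices.\<close>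

lemma line_planar_add_vertex:
  assumes G: "simple_graph G" and lp: "line_planar G" and x: "x \<notin> verts G"
    and ab: "a \<in> verts G" "b \<in> verts G" "a = b \<or> {a, b} \<in> edges G"
  shows "line_planar \<lparr>verts = insert x (verts G), edges = edges G \<union> {{x, a}, {x, b}}\<rparr>"
proof -
  obtain p where p: "line_drawing G p" using lp unfolding line_planar_def by blast
  obtain n where n: "n \<noteq> 0"
    "\<And>c d. c \<in> verts G \<Longrightarrow> d \<in> verts G \<Longrightarrow> c \<noteq> d \<Longrightarrow> det2 n (p d - p c) \<noteq> 0"
    using line_drawing_generic_direction[OF G p] by metis
  define q where "q \<delta> = midpoint (p a) (p b) + \<delta> *\<^sub>R n" for \<delta>
  have "eventually (\<lambda>\<delta>. sees G p a (q \<delta>)) (at_right 0)"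
    unfolding q_def using ab n by (intro eventually_sees_near_midpoint[OF G p]) auto
  moreover have "eventually (\<lambda>\<delta>. sees G p b (q \<delta>)) (at_right 0)"
    unfolding q_def midpoint_sym[of "p a"]
    using ab n by (intro eventually_sees_near_midpoint[OF G p]) (auto simp: insert_commute)
  ultimately have "eventually (\<lambda>\<delta>. sees G p a (q \<delta>) \<and> sees G p b (q \<delta>) \<and> 0 < \<delta>) (at_right 0)"
    using eventually_at_right_less[of 0] by (intro eventually_conj)
  from eventually_happens'[OF trivial_limit_at_right_real this]
  obtain \<delta> where \<delta>: "sees G p a (q \<delta>)" "sees G p b (q \<delta>)" "0 < \<delta>" by blast
  have "closed_segment (q \<delta>) (p a) \<inter> closed_segment (q \<delta>) (p b) = {q \<delta>}" if "a \<noteq> b"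
  proof (rule segments_meet_at_start)
    have "det2 (p a - q \<delta>) (p b - q \<delta>) = - \<delta> * det2 n (p b - p a)"
      by (simp add: q_def det2_def midpoint_def field_simps)
    then show "det2 (p a - q \<delta>) (p b - q \<delta>) \<noteq> 0" using n(2) ab(1,2) \<delta>(3) that by simp
  qed
  then interpret added_vertex G p x "{a, b}" "q \<delta>"
    by unfold_locales (use G p x ab \<delta> in \<open>auto simp: closed_segment_commute\<close>)
  have "\<lparr>verts = insert x (verts G), edges = edges G \<union> (\<lambda>c. {x, c}) ` {a, b}\<rparr>
    = \<lparr>verts = insert x (verts G), edges = edges G \<union> {{x, a}, {x, b}}\<rparr>" by simp
  then show ?thesis using line_drawing_extended unfolding line_planar_def by metis
qed

section \<open>Vertices of small degree\<close>

definition nbrs :: "'a ugraph \<Rightarrow> 'a \<Rightarrow> 'a set" where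
  "nbrs G x = {y. {x, y} \<in> edges G}"

lemma nbrs_subset: "simple_graph G \<Longrightarrow> nbrs G x \<subseteq> verts G - {x}"
  unfolding nbrs_def using simple_graph_edge_ends(2,3)[of G x] by auto

lemma finite_nbrs: "simple_graph G \<Longrightarrow> finite (nbrs G x)"
  using nbrs_subset finite_verts by (metis finite_Diff finite_subset)

lemma simple_graph_del_vertex: "simple_graph G \<Longrightarrow> simple_graph (del_vertex G v)"
  unfolding simple_graph_def del_vertex_def by auto

lemma simple_graph_suppress:
  assumes "simple_graph G" "nbrs G x = {a, b}" "a \<noteq> b"
  shows "simple_graph (suppress G x a b)"
  using assms nbrs_subset[OF assms(1), of x] unfolding simple_graph_def suppress_def by auto

lemma simple_graph_edge_cases:
  assumes "simple_graph G" "e \<in> edges G"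
  obtains "x \<notin> e" | y where "y \<in> nbrs G x" "e = {x, y}"
proof (cases "x \<in> e")
  case True
  obtain a b where "e = {a, b}" using simple_graph_edgeE[OF assms] by metis
  then have "e = {x, if x = a then b else a}" using True by auto
  then show ?thesis using assms(2) that(2)[of "if x = a then b else a"] by (simp add: nbrs_def)
qed (use that in blast)

lemma card_nbrs:
  assumes "simple_graph G"
  shows "card (nbrs G x) = card {e \<in> edges G. x \<in> e}"
proof -
  have "e \<in> (\<lambda>y. {x, y}) ` nbrs G x" if e: "e \<in> edges G" "x \<in> e" for e
    by (cases rule: simple_graph_edge_cases[OF assms e(1), of x]) (use e in auto)
  then have "(\<lambda>y. {x, y}) ` nbrs G x = {e \<in> edges G. x \<in> e}" by (auto simp: nbrs_def)
  moreover have "inj_on (\<lambda>y. {x, y}) (nbrs G x)" by (auto simp: inj_on_def doubleton_eq_iff)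
  ultimately show ?thesis by (metis card_image)
qed

lemma sum_card_nbrs:
  assumes "simple_graph G"
  shows "(\<Sum>x\<in>verts G. card (nbrs G x)) = 2 * card (edges G)"
proof -
  have "{x \<in> verts G. x \<in> e} = e" "card e = 2" if "e \<in> edges G" for e
    using assms that unfolding simple_graph_def by auto
  then have "(\<Sum>x\<in>verts G. card {e \<in> edges G. x \<in> e}) = (\<Sum>e\<in>edges G. 2)"
    using finite_verts[OF assms] finite_edges[OF assms] by (intro sum_multicount_gen) auto
  then show ?thesis by (simp add: card_nbrs[OF assms])
qed

lemma card_edges_del_vertex:
  assumes "simple_graph G"
  shows "card (edges (del_vertex G x)) + card (nbrs G x) = card (edges G)"
proof -
  have "card (edges G) = card ({e \<in> edges G. x \<notin> e} \<union> {e \<in> edges G. x \<in> e})"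
    by (rule arg_cong[of _ _ card]) auto
  also have "\<dots> = card {e \<in> edges G. x \<notin> e} + card {e \<in> edges G. x \<in> e}"
    using finite_edges[OF assms] by (intro card_Un_disjoint) auto
  finally show ?thesis by (simp add: card_nbrs[OF assms] del_vertex_def)
qed

lemma card_edges_suppress:
  assumes "simple_graph G" "nbrs G x = {a, b}" "a \<noteq> b"
  shows "card (edges (suppress G x a b)) < card (edges G)"
proof -
  have "card (edges (suppress G x a b)) \<le> Suc (card (edges (del_vertex G x)))"
    using finite_edges[OF simple_graph_del_vertex[OF assms(1)], of x]
    by (simp add: suppress_def del_vertex_def card_insert_if)
  then show ?thesis using card_edges_del_vertex[OF assms(1), of x] assms(2,3) by simp
qed

definition max_degree_vertex :: "'a ugraph \<Rightarrow> 'a \<Rightarrow> bool" where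
  "max_degree_vertex G v \<longleftrightarrow>
    v \<in> verts G \<and> (\<forall>x\<in>verts G. card (nbrs G x) \<le> card (nbrs G v))"

lemma max_degree_vertexD:
  assumes "max_degree_vertex G v"
  shows "v \<in> verts G" "x \<in> verts G \<Longrightarrow> card (nbrs G x) \<le> card (nbrs G v)"
  using assms unfolding max_degree_vertex_def by auto

lemma exists_max_degree_vertex:
  assumes "simple_graph G" "verts G \<noteq> {}"
  obtains v where "max_degree_vertex G v"
proof -
  let ?degrees = "(\<lambda>x. card (nbrs G x)) ` verts G"
  have finite: "finite ?degrees" using finite_verts[OF assms(1)] by simp
  then have "Max ?degrees \<in> ?degrees" using assms(2) by (intro Max_in) auto
  then obtain v where "v \<in> verts G" "card (nbrs G v) = Max ?degrees" by force
  then have "max_degree_vertex G v" using Max_ge[OF finite] by (auto simp: max_degree_vertex_def)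
  then show thesis by (rule that)
qed

lemma min_degree_3_card_verts:
  assumes "simple_graph G" "\<forall>x\<in>verts G. 3 \<le> card (nbrs G x)"
  shows "3 * card (verts G) \<le> 2 * card (edges G)"
  using sum_mono[of "verts G" "\<lambda>_. 3" "\<lambda>x. card (nbrs G x)"] assms(2) sum_card_nbrs[OF assms(1)]
  by simp

lemma card_nbrs_less_card_verts:
  assumes "simple_graph G" "x \<in> verts G"
  shows "card (nbrs G x) < card (verts G)"
proof -
  have "nbrs G x \<subset> verts G" using nbrs_subset[OF assms(1), of x] assms(2) by blast
  then show ?thesis by (rule psubset_card_mono[OF finite_verts[OF assms(1)]])
qed

lemma low_degree_cases:
  assumes "simple_graph G" "card (nbrs G x) < 3"
  obtains (degree_le_1) a where "nbrs G x \<subseteq> {a}"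
    | (degree_2) a b where "nbrs G x = {a, b}" "a \<noteq> b"
proof -
  consider "card (nbrs G x) = 0" | "card (nbrs G x) = 1" | "card (nbrs G x) = 2"
    using assms(2) by linarith
  then show thesis
    using that finite_nbrs[OF assms(1), of x]
    by cases (auto simp: card_1_singleton_iff card_2_iff)
qed

lemma low_degree_induct [consumes 1, case_names del_vertex suppress min_degree_3]:
  assumes "simple_graph G"
    and del_vertex: "\<And>G x a. simple_graph G \<Longrightarrow> x \<in> verts G \<Longrightarrow> nbrs G x \<subseteq> {a} \<Longrightarrow>
      P (del_vertex G x) \<Longrightarrow> P G"
    and suppress: "\<And>G x a b. simple_graph G \<Longrightarrow> x \<in> verts G \<Longrightarrow> nbrs G x = {a, b} \<Longrightarrow> a \<noteq> b \<Longrightarrow>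
      P (suppress G x a b) \<Longrightarrow> P G"
    and min_degree: "\<And>G. simple_graph G \<Longrightarrow> (\<forall>x\<in>verts G. 3 \<le> card (nbrs G x)) \<Longrightarrow> P G"
  shows "P G"
  using assms(1)
proof (induction "card (verts G)" arbitrary: G rule: less_induct)
  case less
  show ?case
  proof (cases "\<exists>x\<in>verts G. card (nbrs G x) < 3")
    case True
    then obtain x where x: "x \<in> verts G" "card (nbrs G x) < 3" by blast
    have "card (verts G - {x}) < card (verts G)"
      using finite_verts[OF less.prems] x(1) by (rule card_Diff1_less)
    then have smaller: "P H" if "verts H = verts G - {x}" "simple_graph H" for H
      using less.hyps that by simp
    show ?thesis
      using less.prems x(2)
    proof (cases rule: low_degree_cases)
      case (degree_le_1 a)
      then show ?thesis
        using del_vertex[OF less.prems x(1)] smaller simple_graph_del_vertex[OF less.prems]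
        by (simp add: del_vertex_def)
    next
      case (degree_2 a b)
      then show ?thesis
        using suppress[OF less.prems x(1) degree_2] smaller
          simple_graph_suppress[OF less.prems degree_2]
        by (simp add: suppress_def)
    qed
  next
    case False
    then show ?thesis using min_degree[OF less.prems] by (simp add: not_less)
  qed
qed

lemma line_planar_if_line_planar_del_vertex:
  assumes G: "simple_graph G" and x: "x \<in> verts G" and degree: "nbrs G x \<subseteq> {a}"
    and lp: "line_planar (del_vertex G x)"
  shows "line_planar G"
proof (cases "verts G \<subseteq> {x}")
  case True
  then show ?thesis by (rule line_planar_singleton[OF G])
next
  case False
  then obtain c where c: "c \<in> verts G - {x}" "nbrs G x \<subseteq> {c}"
    using degree nbrs_subset[OF G, of x] by (cases "nbrs G x = {}") blast+
  let ?H = "\<lparr>verts = insert x (verts (del_vertex G x)),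
    edges = edges (del_vertex G x) \<union> {{x, c}, {x, c}}\<rparr>"
  have "line_planar ?H"
    by (rule line_planar_add_vertex[OF simple_graph_del_vertex[OF G] lp])
      (use c in \<open>auto simp: del_vertex_def\<close>)
  moreover have "e \<in> edges ?H" if e: "e \<in> edges G" for e
    by (cases rule: simple_graph_edge_cases[OF G e, of x])
      (use e c(2) in \<open>auto simp: del_vertex_def\<close>)
  ultimately show ?thesis using line_planar_subset[of ?H G] by (auto simp: del_vertex_def)
qed

lemma line_planar_if_line_planar_suppress:
  assumes G: "simple_graph G" and x: "x \<in> verts G" and ab: "nbrs G x = {a, b}" "a \<noteq> b"
    and lp: "line_planar (suppress G x a b)"
  shows "line_planar G"
proof -
  let ?H = "\<lparr>verts = insert x (verts (suppress G x a b)),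
    edges = edges (suppress G x a b) \<union> {{x, a}, {x, b}}\<rparr>"
  have "line_planar ?H"
    by (rule line_planar_add_vertex[OF simple_graph_suppress[OF G ab] lp])
      (use nbrs_subset[OF G, of x] ab in \<open>auto simp: suppress_def\<close>)
  moreover have "e \<in> edges ?H" if e: "e \<in> edges G" for e
    by (cases rule: simple_graph_edge_cases[OF G e, of x]) (use e ab in \<open>auto simp: suppress_def\<close>)
  ultimately show ?thesis using line_planar_subset[of ?H G] by (auto simp: suppress_def)
qed

definition line_apex :: "'a ugraph \<Rightarrow> bool" where
  "line_apex G \<longleftrightarrow> line_planar G \<or> (\<exists>v\<in>verts G. line_planar (del_vertex G v))"

lemma line_apex_imp_apex:
  assumes "simple_graph G" "line_apex G"
  shows "apex G"
  using assms line_planar_imp_planar simple_graph_del_vertex unfolding line_apex_def apex_def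
  by metis

lemma del_vertex_commute: "del_vertex (del_vertex G v) w = del_vertex (del_vertex G w) v"
  by (auto simp: del_vertex_def)

lemma nbrs_del_vertex: "nbrs (del_vertex G w) x = (if x = w then {} else nbrs G x - {w})"
  by (auto simp: nbrs_def del_vertex_def)

lemma line_apex_if_line_apex_del_vertex:
  assumes G: "simple_graph G" and x: "x \<in> verts G" and degree: "nbrs G x \<subseteq> {a}"
    and la: "line_apex (del_vertex G x)"
  shows "line_apex G"
  using la unfolding line_apex_def[of "del_vertex G x"]
proof (elim disjE bexE)
  assume "line_planar (del_vertex G x)"
  then show "line_apex G" using x unfolding line_apex_def by blast
next
  fix v assume v: "v \<in> verts (del_vertex G x)" "line_planar (del_vertex (del_vertex G x) v)"
  then have "v \<in> verts G" "x \<noteq> v" by (auto simp: del_vertex_def)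
  moreover have "line_planar (del_vertex G v)"
  proof (rule line_planar_if_line_planar_del_vertex[OF simple_graph_del_vertex[OF G]])
    show "x \<in> verts (del_vertex G v)" using x \<open>x \<noteq> v\<close> by (simp add: del_vertex_def)
    show "nbrs (del_vertex G v) x \<subseteq> {a}" using degree by (auto simp: nbrs_del_vertex)
    show "line_planar (del_vertex (del_vertex G v) x)" using v(2) by (simp add: del_vertex_commute)
  qed
  ultimately show "line_apex G" unfolding line_apex_def by blast
qed

lemma line_apex_if_line_apex_suppress:
  assumes G: "simple_graph G" and x: "x \<in> verts G" and ab: "nbrs G x = {a, b}" "a \<noteq> b"
    and la: "line_apex (suppress G x a b)"
  shows "line_apex G"
  using la unfolding line_apex_def[of "suppress G x a b"]
proof (elim disjE bexE)
  assume "line_planar (suppress G x a b)"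
  then show "line_apex G"
    using line_planar_if_line_planar_suppress[OF G x ab] unfolding line_apex_def by blast
next
  fix v assume v: "v \<in> verts (suppress G x a b)"
    and lp: "line_planar (del_vertex (suppress G x a b) v)"
  have vG: "v \<in> verts G" "v \<noteq> x" using v by (auto simp: suppress_def)
  then have xv: "x \<in> verts (del_vertex G v)" using x by (simp add: del_vertex_def)
  have "line_planar (del_vertex G v)"
  proof (cases "v \<in> {a, b}")
    case True
    have "del_vertex (suppress G x a b) v = del_vertex (del_vertex G v) x"
      using True by (auto simp: suppress_def del_vertex_def)
    moreover have "nbrs (del_vertex G v) x \<subseteq> {if v = a then b else a}"
      using True ab vG by (auto simp: nbrs_del_vertex)
    ultimately show ?thesis
      using line_planar_if_line_planar_del_vertex[OF simple_graph_del_vertex[OF G] xv] lp by simp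
  next
    case False
    have "del_vertex (suppress G x a b) v = suppress (del_vertex G v) x a b"
      using False by (auto simp: suppress_def del_vertex_def)
    moreover have "nbrs (del_vertex G v) x = {a, b}"
      using False ab vG by (auto simp: nbrs_del_vertex)
    ultimately show ?thesis
      using line_planar_if_line_planar_suppress[OF simple_graph_del_vertex[OF G] xv _ ab(2)] lp
      by simp
  qed
  then show "line_apex G" using vG unfolding line_apex_def by blast
qed

section \<open>Minors\<close>

definition merge_vertex :: "'a \<Rightarrow> 'a \<Rightarrow> 'a \<Rightarrow> 'a" where
  "merge_vertex u v x = (if x = v then u else x)"

lemma contract_edge_eq:
  "contract_edge G u v =
    \<lparr>verts = merge_vertex u v ` verts G, edges = (`) (merge_vertex u v) ` (edges G - {{u, v}})\<rparr>"
  by (simp add: contract_edge_def merge_vertex_def[abs_def] Let_def)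

lemma simple_graph_contract_edge:
  assumes G: "simple_graph G" and uv: "{u, v} \<in> edges G"
  shows "simple_graph (contract_edge G u v)" "card (edges (contract_edge G u v)) < card (edges G)"
proof -
  have "merge_vertex u v ` e \<subseteq> merge_vertex u v ` verts G \<and> card (merge_vertex u v ` e) = 2"
    if e: "e \<in> edges G" "e \<noteq> {u, v}" for e
  proof -
    obtain a b where ab: "e = {a, b}" "a \<noteq> b" "a \<in> verts G" "b \<in> verts G"
      using simple_graph_edgeE[OF G e(1)] by metis
    then have "merge_vertex u v a \<noteq> merge_vertex u v b" using e(2) by (auto simp: merge_vertex_def)
    then show ?thesis using ab by auto
  qed
  then show "simple_graph (contract_edge G u v)"
    using finite_verts[OF G] by (auto simp: contract_edge_eq simple_graph_def)
  have finite: "finite (edges G)" by (rule finite_edges[OF G])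
  have "card (edges (contract_edge G u v)) \<le> card (edges G - {{u, v}})"
    unfolding contract_edge_eq using finite by (simp add: card_image_le)
  also have "\<dots> < card (edges G)" using finite uv by (rule card_Diff1_less)
  finally show "card (edges (contract_edge G u v)) < card (edges G)" .
qed

lemma contracts_to_simple_graph:
  assumes "contracts_to G H" "simple_graph G"
  shows "simple_graph H \<and> (H = G \<or> card (edges H) < card (edges G))"
  using assms
proof (induction rule: contracts_to.induct)
  case (contracts_step H u v)
  then have "simple_graph H" "card (edges H) \<le> card (edges G)" by auto
  then show ?case using simple_graph_contract_edge[OF _ contracts_step.hyps(2)] by fastforce
qed auto

lemma contracts_to_trans:
  assumes "contracts_to G H" "contracts_to H K"
  shows "contracts_to G K"
  using assms(2,1) by (induction rule: contracts_to.induct) (auto intro: contracts_to.intros)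

lemma subgraph_contract_edge_avoiding:
  assumes K: "subgraph K (contract_edge G u v)" "u \<notin> verts K"
  shows "subgraph K G"
proof -
  have simple: "simple_graph K" and verts: "verts K \<subseteq> merge_vertex u v ` verts G"
    and edges: "\<And>e. e \<in> edges K \<Longrightarrow> \<exists>d\<in>edges G. e = merge_vertex u v ` d"
    using K(1) unfolding subgraph_def contract_edge_eq by fastforce+
  have "e \<in> edges G" if e: "e \<in> edges K" for e
  proof -
    obtain d where d: "d \<in> edges G" "e = merge_vertex u v ` d" using edges[OF e] by blast
    have "u \<notin> e" using simple e K(2) unfolding simple_graph_def by blast
    then have "v \<notin> d" using d(2) by (auto simp: merge_vertex_def)
    then have "e = d" using d(2) by (auto simp: merge_vertex_def)
    then show ?thesis using d(1) by simp
  qed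
  moreover have "verts K \<subseteq> verts G"
    using verts K(2) by (auto simp: merge_vertex_def split: if_splits)
  ultimately show ?thesis using simple unfolding subgraph_def by blast
qed

definition uncontract :: "'a ugraph \<Rightarrow> 'a \<Rightarrow> 'a \<Rightarrow> 'a ugraph \<Rightarrow> 'a ugraph" where
  "uncontract G u v K = \<lparr>verts = insert v (verts K),
     edges = insert {u, v} {e \<in> edges G. merge_vertex u v ` e \<in> edges K}\<rparr>"

lemma uncontract:
  assumes G: "simple_graph G" and uv: "{u, v} \<in> edges G"
    and K: "subgraph K (contract_edge G u v)" "u \<in> verts K"
  shows "subgraph (uncontract G u v K) G" "contract_edge (uncontract G u v K) u v = K"
proof -
  let ?r = "merge_vertex u v"
  have uvG: "u \<in> verts G" "v \<in> verts G" "u \<noteq> v" using simple_graph_edge_ends[OF G uv] by auto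
  have simple: "simple_graph K" and "verts K \<subseteq> ?r ` verts G"
    and edges: "\<And>e. e \<in> edges K \<Longrightarrow> \<exists>d\<in>edges G. d \<noteq> {u, v} \<and> e = ?r ` d"
    using K(1) unfolding subgraph_def contract_edge_eq by fastforce+
  then have verts: "verts K \<subseteq> verts G - {v}" using uvG by (auto simp: merge_vertex_def)
  have "e \<subseteq> insert v (verts K)" if "?r ` e \<in> edges K" for e
  proof -
    have "?r ` e \<subseteq> verts K" using simple that by (simp add: simple_graph_def)
    then have "?r x \<in> verts K" if "x \<in> e" for x using that by blast
    then show ?thesis by (metis insert_iff merge_vertex_def subsetI)
  qed
  then have "simple_graph (uncontract G u v K)"
    using G simple uvG K(2) unfolding simple_graph_def by (auto simp: uncontract_def)
  then show "subgraph (uncontract G u v K) G"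
    using verts uv uvG unfolding subgraph_def by (auto simp: uncontract_def)
  have "?r ` verts (uncontract G u v K) = verts K"
    using K(2) verts by (auto simp: uncontract_def merge_vertex_def)
  moreover have "(`) ?r ` (edges (uncontract G u v K) - {{u, v}}) = edges K"
    using edges by (fastforce simp: uncontract_def)
  ultimately show "contract_edge (uncontract G u v K) u v = K" by (simp add: contract_edge_eq)
qed

lemma subgraph_contract_edge_lift:
  assumes G: "simple_graph G" and uv: "{u, v} \<in> edges G" and K: "subgraph K (contract_edge G u v)"
  obtains L where "subgraph L G" "contracts_to L K"
proof (cases "u \<in> verts K")
  case True
  have "contracts_to (uncontract G u v K) (contract_edge (uncontract G u v K) u v)"
    using simple_graph_edge_ends(3)[OF G uv]
    by (intro contracts_step contracts_refl) (simp add: uncontract_def)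
  then show thesis using that uncontract[OF G uv K True] by metis
next
  case False
  then show thesis using that subgraph_contract_edge_avoiding[OF K] contracts_refl by blast
qed

lemma is_minor_del_vertex: "is_minor H (del_vertex G x) \<Longrightarrow> is_minor H G"
  unfolding is_minor_def subgraph_def by (auto simp: del_vertex_def)

lemma is_minor_contract_edge:
  assumes "simple_graph G" "{u, v} \<in> edges G" "is_minor H (contract_edge G u v)"
  shows "is_minor H G"
  using assms(3) subgraph_contract_edge_lift[OF assms(1,2)] contracts_to_trans
  unfolding is_minor_def by metis

lemma suppress_eq_contract_edge:
  assumes G: "simple_graph G" and ab: "nbrs G x = {a, b}" "a \<noteq> b"
  shows "suppress G x a b = contract_edge G a x"
proof -
  let ?r = "merge_vertex a x"
  have ne: "a \<noteq> x" "b \<noteq> x" "a \<in> verts G" using nbrs_subset[OF G, of x] ab(1) by auto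
  have "?r ` verts G = verts G - {x}" using ne by (auto simp: merge_vertex_def)
  moreover have "edges G - {{a, x}} = insert {x, b} {e \<in> edges G. x \<notin> e}"
  proof -
    have "e \<in> {{x, a}, {x, b}} \<or> x \<notin> e" if e: "e \<in> edges G" for e
      by (cases rule: simple_graph_edge_cases[OF G e, of x]) (use ab(1) in auto)
    moreover have "{x, b} \<in> edges G" using ab(1) by (auto simp: nbrs_def)
    ultimately show ?thesis using ab(2) ne by (auto simp: doubleton_eq_iff)
  qed
  moreover have "?r ` {x, b} = {a, b}" using ne by (auto simp: merge_vertex_def)
  moreover have "?r ` e = e" if "x \<notin> e" for e using that by (auto simp: merge_vertex_def)
  then have "(`) ?r ` {e \<in> edges G. x \<notin> e} = {e \<in> edges G. x \<notin> e}" by auto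
  ultimately show ?thesis by (simp add: suppress_def contract_edge_eq)
qed

lemma is_minor_suppress:
  assumes "simple_graph G" "nbrs G x = {a, b}" "a \<noteq> b" "is_minor H (suppress G x a b)"
  shows "is_minor H G"
proof (rule is_minor_contract_edge[OF assms(1)])
  show "{a, x} \<in> edges G" using assms(2) by (auto simp: nbrs_def insert_commute)
  show "is_minor H (contract_edge G a x)"
    using assms(4) by (simp add: suppress_eq_contract_edge[OF assms(1-3)])
qed

lemma is_minor_simple_graph:
  assumes "simple_graph G" "is_minor H G"
  shows "simple_graph H" "card (edges H) \<le> card (edges G)"
proof -
  obtain K where K: "subgraph K G" "contracts_to K H" using assms(2) unfolding is_minor_def by blast
  then have H: "simple_graph H \<and> (H = K \<or> card (edges H) < card (edges K))"
    using contracts_to_simple_graph unfolding subgraph_def by blast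
  then show "simple_graph H" by blast
  have "card (edges K) \<le> card (edges G)"
    using K(1) finite_edges[OF assms(1)] by (auto simp: subgraph_def intro: card_mono)
  then show "card (edges H) \<le> card (edges G)" using H by auto
qed

lemma proper_minor_card_edges:
  assumes G: "simple_graph G" and covered: "verts G \<subseteq> \<Union> (edges G)" and H: "proper_minor H G"
  shows "card (edges H) < card (edges G)"
proof -
  obtain K where K: "subgraph K G" "contracts_to K H" and ne: "H \<noteq> G"
    using H unfolding proper_minor_def is_minor_def by blast
  then have simple: "simple_graph K" and KG: "verts K \<subseteq> verts G" "edges K \<subseteq> edges G"
    by (auto simp: subgraph_def)
  have le: "card (edges K) \<le> card (edges G)" using card_mono[OF finite_edges[OF G] KG(2)] .
  consider (fewer_edges) "card (edges H) < card (edges K)" | (subgraph) "H = K"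
    using contracts_to_simple_graph[OF K(2) simple] by blast
  then show ?thesis
  proof cases
    case subgraph
    have "edges K \<noteq> edges G"
    proof
      assume "edges K = edges G"
      moreover have "\<Union> (edges K) \<subseteq> verts K" using simple by (auto simp: simple_graph_def)
      ultimately have "K = G" using covered KG(1) by simp
      then show False using ne subgraph by simp
    qed
    then show ?thesis using subgraph psubset_card_mono[OF finite_edges[OF G]] KG(2) by blast
  qed (use le in simp)
qed

section \<open>Patterns\<close>

type_synonym pattern = "(nat \<times> nat) list"

definition pat_edges :: "('a \<times> 'a) list \<Rightarrow> 'a set set" where
  "pat_edges P = (\<lambda>(i, j). {i, j}) ` set P"

definition pat_graph :: "nat \<Rightarrow> pattern \<Rightarrow> nat ugraph" where
  "pat_graph n P = \<lparr>verts = {..<n}, edges = pat_edges P\<rparr>"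

definition in_range :: "nat \<Rightarrow> pattern \<Rightarrow> bool" where
  "in_range n P \<longleftrightarrow> list_all (\<lambda>(i, j). i < n \<and> j < n) P"

lemma pat_graph_sel [simp]: "verts (pat_graph n P) = {..<n}" "edges (pat_graph n P) = pat_edges P"
  by (simp_all add: pat_graph_def)

lemma pat_edges_simps [simp]:
  "pat_edges [] = {}" "pat_edges ((i, j) # P) = insert {i, j} (pat_edges P)"
  "pat_edges (P @ Q) = pat_edges P \<union> pat_edges Q"
  by (simp_all add: pat_edges_def image_Un)

lemma pat_edgesI: "(i, j) \<in> set P \<or> (j, i) \<in> set P \<Longrightarrow> {i, j} \<in> pat_edges P"
  by (force simp: pat_edges_def insert_commute)

lemma in_range_edge:
  assumes "in_range n P" "e \<in> pat_edges P"
  obtains i j where "e = {i, j}" "i < n" "j < n"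
  using assms by (auto simp: in_range_def pat_edges_def list_all_iff)

fun pairs :: "'a list \<Rightarrow> ('a \<times> 'a) list" where
  "pairs [] = []"
| "pairs (x # xs) = map (Pair x) xs @ pairs xs"

lemma mem_pairs_upt: "(i, j) \<in> set (pairs [m..<n]) \<longleftrightarrow> m \<le> i \<and> i < j \<and> j < n"
proof (induction "n - m" arbitrary: m)
  case (Suc k)
  then show ?case by (subst upt_conv_Cons) (auto simp: image_iff Suc_le_eq)
qed auto

lemma pat_edges_pairs:
  "distinct xs \<Longrightarrow> pat_edges (pairs xs) = {e. e \<subseteq> set xs \<and> card e = 2}"
proof (induction xs)
  case (Cons x xs)
  have "pat_edges (map (Pair x) xs) = {e. e \<subseteq> set (x # xs) \<and> card e = 2 \<and> x \<in> e}"
    using Cons.prems by (auto simp: pat_edges_def card_2_iff image_iff)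
  then show ?case using Cons by auto
qed (auto simp: card_2_iff)

definition simple_pat :: "nat \<Rightarrow> pattern \<Rightarrow> bool" where
  "simple_pat n P \<longleftrightarrow> distinct P \<and> list_all (\<lambda>(i, j). i < j \<and> j < n) P"

lemma simple_patD: "simple_pat n P \<Longrightarrow> (i, j) \<in> set P \<Longrightarrow> i < j \<and> j < n"
  by (auto simp: simple_pat_def list_all_iff)

lemma simple_pat_in_range: "simple_pat n P \<Longrightarrow> in_range n P"
  by (auto simp: in_range_def list_all_iff dest: simple_patD)

lemma simple_graph_pat_graph: "simple_pat n P \<Longrightarrow> simple_graph (pat_graph n P)"
  by (auto simp: simple_graph_def pat_edges_def dest: simple_patD)

lemma simple_pat_edge_iff:
  assumes "simple_pat n P" "(i, j) \<in> set P" "(k, l) \<in> set P"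
  shows "{k, l} = {i, j} \<longleftrightarrow> (k, l) = (i, j)"
  using simple_patD[OF assms(1,2)] simple_patD[OF assms(1,3)] by (auto simp: doubleton_eq_iff)

lemma card_pat_edges:
  assumes "simple_pat n P"
  shows "card (pat_edges P) = length P"
proof -
  have "inj_on (\<lambda>(i, j). {i, j}) (set P)"
    using simple_pat_edge_iff[OF assms] by (fastforce intro!: inj_onI)
  then show ?thesis using assms by (simp add: pat_edges_def card_image distinct_card simple_pat_def)
qed

definition spanning :: "nat \<Rightarrow> pattern \<Rightarrow> bool" where
  "spanning n P \<longleftrightarrow> list_all (\<lambda>i. list_ex (\<lambda>(a, b). a = i \<or> b = i) P) [0..<n]"

lemma spanningD: "spanning n P \<Longrightarrow> i < n \<Longrightarrow> \<exists>e\<in>pat_edges P. i \<in> e"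
  by (fastforce simp: spanning_def list_all_iff list_ex_iff pat_edges_def)

lemma graph_embedding_pat_graph:
  assumes "in_range n P"
  shows "graph_embedding f (pat_graph n P) G \<longleftrightarrow>
    inj_on f {..<n} \<and> f ` {..<n} \<subseteq> verts G \<and> (\<forall>e\<in>pat_edges P. f ` e \<in> edges G)"
proof -
  have "e \<subseteq> {..<n}" if "e \<in> pat_edges P" for e using in_range_edge[OF assms that] by auto
  then show ?thesis by (auto simp: graph_embedding_def)
qed

type_synonym matrix = "bool list list"

definition add_arc :: "nat \<Rightarrow> nat \<Rightarrow> matrix \<Rightarrow> matrix" where
  "add_arc i j M = M[i := (M ! i)[j := True]]"

definition add_edge :: "nat \<Rightarrow> nat \<Rightarrow> matrix \<Rightarrow> matrix" where
  "add_edge i j M = add_arc i j (add_arc j i M)"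

fun adj_mat :: "nat \<Rightarrow> pattern \<Rightarrow> matrix" where
  "adj_mat n [] = replicate n (replicate n False)"
| "adj_mat n ((i, j) # P) = add_edge i j (adj_mat n P)"

definition square :: "nat \<Rightarrow> matrix \<Rightarrow> bool" where
  "square n M \<longleftrightarrow> length M = n \<and> (\<forall>i<n. length (M ! i) = n)"

lemma square_add_arc: "square n M \<Longrightarrow> square n (add_arc i j M)"
  by (cases "i < length M") (auto simp: square_def add_arc_def nth_list_update list_update_beyond)

lemma add_arc_iff:
  assumes "square n M" "i < n" "j < n"
  shows "add_arc a b M ! i ! j \<longleftrightarrow> M ! i ! j \<or> (i, j) = (a, b)"
  using assms
  by (cases "a < n"; cases "b < n")
    (auto simp: add_arc_def square_def nth_list_update list_update_beyond)

lemma square_adj_mat: "square n (adj_mat n P)"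
  by (induction n P rule: adj_mat.induct)
    (auto simp: add_edge_def square_add_arc, simp add: square_def)

lemma adj_mat_iff:
  assumes "i < n" "j < n"
  shows "adj_mat n P ! i ! j \<longleftrightarrow> {i, j} \<in> pat_edges P"
proof (induction P)
  case (Cons e P)
  obtain a b where e: "e = (a, b)" by fastforce
  have "adj_mat n (e # P) ! i ! j \<longleftrightarrow> adj_mat n P ! i ! j \<or> (i, j) = (b, a) \<or> (i, j) = (a, b)"
    using assms by (simp add: e add_edge_def add_arc_iff[of n] square_add_arc square_adj_mat)
  then show ?case using Cons.IH by (auto simp: e doubleton_eq_iff)
qed (use assms in simp)

definition inj_list :: "nat \<Rightarrow> nat \<Rightarrow> nat list \<Rightarrow> bool" where
  "inj_list m n h \<longleftrightarrow> length h = m \<and> distinct h \<and> list_all (\<lambda>x. x < n) h"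

lemma inj_listD:
  assumes "inj_list m n h"
  shows "inj_on ((!) h) {..<m}" "(!) h ` {..<m} = set h" "set h \<subseteq> {..<n}"
  using assms nth_image[of m h]
  by (auto simp: inj_list_def list_all_iff inj_on_def nth_eq_iff_index_eq lessThan_atLeast0)

lemma inj_list_bij_betw:
  assumes "inj_list n n \<pi>"
  shows "bij_betw ((!) \<pi>) {..<n} {..<n}"
proof -
  have "card (set \<pi>) = card {..<n}" using assms by (simp add: inj_list_def distinct_card)
  then have "set \<pi> = {..<n}" using inj_listD(3)[OF assms] by (intro card_subset_eq) auto
  then show ?thesis using inj_listD[OF assms] by (simp add: bij_betw_def)
qed

definition embeds :: "nat \<Rightarrow> matrix \<Rightarrow> nat list \<Rightarrow> nat \<Rightarrow> pattern \<Rightarrow> bool" where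
  "embeds n M h m P \<longleftrightarrow> inj_list m n h \<and> list_all (\<lambda>(i, j). M ! (h ! i) ! (h ! j)) P"

lemma embeds_sound:
  assumes "embeds n (adj_mat n Q) h m P" "in_range m P"
  shows "graph_embedding ((!) h) (pat_graph m P) (pat_graph n Q)"
  unfolding graph_embedding_pat_graph[OF assms(2)] pat_graph_sel
proof (intro conjI ballI)
  have h: "inj_list m n h" using assms(1) by (simp add: embeds_def)
  note h = inj_listD[OF h]
  show "inj_on ((!) h) {..<m}" "(!) h ` {..<m} \<subseteq> {..<n}" using h by auto
  fix e assume "e \<in> pat_edges P"
  then obtain i j where ij: "e = {i, j}" "(i, j) \<in> set P" by (auto simp: pat_edges_def)
  then have "i < m" "j < m" using assms(2) by (auto simp: in_range_def list_all_iff)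
  then have "h ! i < n" "h ! j < n" using h(2,3) by auto
  then show "(!) h ` e \<in> pat_edges Q"
    using assms(1) ij adj_mat_iff by (force simp: embeds_def list_all_iff)
qed

fun nth_ok :: "'a list \<Rightarrow> nat \<Rightarrow> ('a \<Rightarrow> bool) \<Rightarrow> bool" where
  "nth_ok [] k f \<longleftrightarrow> False"
| "nth_ok (x # xs) 0 f \<longleftrightarrow> f x"
| "nth_ok (x # xs) (Suc k) f \<longleftrightarrow> nth_ok xs k f"

lemma nth_ok_iff: "nth_ok xs k f \<longleftrightarrow> k < length xs \<and> f (xs ! k)"
  by (induction xs k f rule: nth_ok.induct) auto

lemma nth_okD: "nth_ok xs k f \<Longrightarrow> \<exists>x\<in>set xs. f x"
  using nth_mem by (fastforce simp: nth_ok_iff)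

section \<open>Certified case analysis\<close>

definition degree :: "bool list \<Rightarrow> nat" where
  "degree r = length (filter (\<lambda>b. b) r)"

text \<open>A lower bound for the degree sum, given that vertex 0 has maximum degree and that all degrees
  are at least three.\<close>

definition degree_bound :: "matrix \<Rightarrow> nat" where
  "degree_bound M = foldr (\<lambda>r. max (degree r)) M 3 + sum_list (map (\<lambda>r. max 3 (degree r)) (tl M))"

text \<open>Permutations are given without the final segment on which they are the identity.\<close>

definition contains :: "nat \<Rightarrow> matrix \<Rightarrow> nat list \<Rightarrow> pattern \<Rightarrow> bool" where
  "contains n M \<pi> Q \<longleftrightarrow> (let \<sigma> = \<pi> @ [length \<pi>..<n] in \<sigma> ! 0 = 0 \<and> embeds n M \<sigma> n Q)"

fun closes :: "nat \<Rightarrow> nat \<Rightarrow> pattern list \<Rightarrow> matrix \<Rightarrow> pattern \<Rightarrow> (nat \<times> nat list) list \<Rightarrow> bool" where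
  "closes n d Qs M [] subs \<longleftrightarrow> True"
| "closes n d Qs M ((i, j) # ps) subs \<longleftrightarrow>
     (let M' = add_edge i j M in
      if d < degree_bound M' then closes n d Qs M ps subs
      else case subs of [] \<Rightarrow> False
        | (k, \<pi>) # subs' \<Rightarrow> nth_ok Qs k (contains n M' \<pi>) \<and> closes n d Qs M ps subs')"

definition nonneighbours :: "nat \<Rightarrow> bool list \<Rightarrow> pattern" where
  "nonneighbours x r = map (Pair x) (filter (\<lambda>j. j \<noteq> x \<and> \<not> r ! j) [0..<length r])"

text \<open>A node \<open>(P, br, subs)\<close> treats the graphs that contain the pattern \<open>P\<close>. The branching \<open>br\<close>
  yields pairs one of which is a further edge: for \<open>At x\<close> because \<open>x\<close> has degree at least three, for
  \<open>Cover c \<tau>\<close> because the \<open>c\<close>-th cover, relabelled by \<open>\<tau>\<close>, lists the nonedges of a planar graph (or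
  of an apex graph, respectively). Adding such a pair to \<open>P\<close> either makes the degree sum too large
  or yields a pattern that contains an earlier one: the next entry \<open>(k, \<pi>)\<close> of \<open>subs\<close> stands for the
  pattern \<open>k\<close> steps back, relabelled by \<open>\<pi>\<close>.\<close>

datatype branch = At nat | Cover nat "nat list"

type_synonym proof_node = "pattern \<times> branch \<times> (nat \<times> nat list) list"

fun node_ok :: "nat \<Rightarrow> nat \<Rightarrow> pattern list \<Rightarrow> pattern list \<Rightarrow> proof_node \<Rightarrow> bool" where
  "node_ok n d covs Qs (P, At x, subs) \<longleftrightarrow> in_range n P \<and> x < n \<and> degree (adj_mat n P ! x) < 3 \<and>
     closes n d Qs (adj_mat n P) (nonneighbours x (adj_mat n P ! x)) subs"
| "node_ok n d covs Qs (P, Cover c \<tau>, subs) \<longleftrightarrow> in_range n P \<and> inj_list n n \<tau> \<and>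
     nth_ok covs c (\<lambda>C. closes n d Qs (adj_mat n P) (map (\<lambda>(p, q). (\<tau> ! p, \<tau> ! q)) C) subs)"

definition root_ok :: "nat \<Rightarrow> nat \<Rightarrow> pattern list \<Rightarrow> pattern \<times> nat \<times> nat list \<Rightarrow> bool" where
  "root_ok n d Qs =
    (\<lambda>(B, k, \<pi>). d < degree_bound (adj_mat n B) \<or> nth_ok Qs k (contains n (adj_mat n B) \<pi>))"

fun run :: "nat \<Rightarrow> nat \<Rightarrow> pattern list \<Rightarrow> pattern list \<Rightarrow> proof_node list \<Rightarrow>
  (pattern \<times> nat \<times> nat list) list \<Rightarrow> bool" where
  "run n d covs Qs [] roots \<longleftrightarrow> list_all (root_ok n d Qs) roots"
| "run n d covs Qs (nd # nds) roots \<longleftrightarrow> node_ok n d covs Qs nd \<and> run n d covs (fst nd # Qs) nds roots"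

lemma degree_eq_card: "degree r = card {j. j < length r \<and> r ! j}"
  by (simp add: degree_def length_filter_conv_card)

lemma foldr_max_le: "(\<And>x. x \<in> set xs \<Longrightarrow> f x \<le> b) \<Longrightarrow> c \<le> b \<Longrightarrow>
  foldr (\<lambda>x. max (f x)) xs c \<le> (b::'a::linorder)"
  by (induction xs) auto

locale sparse_graph =
  fixes G :: "'a ugraph" and n d :: nat and v :: 'a and covs :: "pattern list"
  assumes simple: "simple_graph G" and card_verts: "card (verts G) = n"
    and max_degree: "max_degree_vertex G v"
    and min_degree: "\<forall>x\<in>verts G. 3 \<le> card (nbrs G x)"
    and degree_sum: "2 * card (edges G) \<le> d"
    and covers: "\<And>C f. C \<in> set covs \<Longrightarrow> bij_betw f {..<n} (verts G) \<Longrightarrow>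
      \<exists>(i, j)\<in>set C. {f i, f j} \<in> edges G"
begin

definition labelling :: "(nat \<Rightarrow> 'a) \<Rightarrow> bool" where
  "labelling f \<longleftrightarrow> bij_betw f {..<n} (verts G) \<and> f 0 = v"

definition holds :: "(nat \<Rightarrow> 'a) \<Rightarrow> pattern \<Rightarrow> bool" where
  "holds f P \<longleftrightarrow> (\<forall>e\<in>pat_edges P. f ` e \<in> edges G)"

definition forces :: "pattern \<Rightarrow> bool \<Rightarrow> bool" where
  "forces P goal \<longleftrightarrow> in_range n P \<and> (\<forall>f. labelling f \<longrightarrow> holds f P \<longrightarrow> goal)"

lemma n_pos: "n > 0"
  using card_verts max_degree_vertexD(1)[OF max_degree] finite_verts[OF simple]
  by (auto simp: card_gt_0_iff)

lemma labelling_verts: "labelling f \<Longrightarrow> i < n \<Longrightarrow> f i \<in> verts G"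
  by (auto simp: labelling_def bij_betw_def)

lemma labelling_embedding: "labelling f \<Longrightarrow> holds f P \<Longrightarrow> in_range n P \<Longrightarrow>
  graph_embedding f (pat_graph n P) G"
  by (auto simp: graph_embedding_pat_graph labelling_def holds_def bij_betw_def)

lemma holds_Cons: "holds f ((i, j) # P) \<longleftrightarrow> {f i, f j} \<in> edges G \<and> holds f P"
  by (simp add: holds_def)

lemma card_nbrs_labelling:
  assumes "labelling f" "i < n"
  shows "card (nbrs G (f i)) = card {j. j < n \<and> {f i, f j} \<in> edges G}"
proof -
  have inj: "inj_on f {..<n}" and image: "f ` {..<n} = verts G"
    using assms unfolding labelling_def bij_betw_def by auto
  have "nbrs G (f i) \<subseteq> f ` {..<n}" using nbrs_subset[OF simple] image by blast
  then have "nbrs G (f i) = f ` {j. j < n \<and> {f i, f j} \<in> edges G}" by (auto simp: nbrs_def)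
  moreover have "inj_on f {j. j < n \<and> {f i, f j} \<in> edges G}" using inj by (rule inj_on_subset) auto
  ultimately show ?thesis by (simp add: card_image)
qed

lemma degree_le:
  assumes "labelling f" "holds f P" "i < n"
  shows "degree (adj_mat n P ! i) \<le> card (nbrs G (f i))"
proof -
  have "{j. j < n \<and> adj_mat n P ! i ! j} \<subseteq> {j. j < n \<and> {f i, f j} \<in> edges G}"
    using assms by (fastforce simp: adj_mat_iff holds_def)
  then show ?thesis
    using card_nbrs_labelling[OF assms(1,3)] square_adj_mat[of n P] assms(3)
    by (simp add: degree_eq_card square_def card_mono)
qed

lemma degree_bound_le:
  assumes f: "labelling f" "holds f P"
  shows "degree_bound (adj_mat n P) \<le> d"
proof -
  define D where "D i = card (nbrs G (f i))" for i
  let ?M = "adj_mat n P"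
  have bij: "bij_betw f {..<n} (verts G)" and f0: "f 0 = v"
    using f(1) unfolding labelling_def by auto
  have row: "degree (?M ! i) \<le> D i" "3 \<le> D i" "D i \<le> D 0" if "i < n" for i
    using degree_le[OF f that] min_degree max_degree_vertexD(2)[OF max_degree]
      labelling_verts[OF f(1) that] f0
    by (simp_all add: D_def)
  have length: "length ?M = n" using square_adj_mat by (simp add: square_def)
  have "degree r \<le> D 0" if "r \<in> set ?M" for r
    using row(1,3) that length order_trans by (metis in_set_conv_nth)
  then have "foldr (\<lambda>r. max (degree r)) ?M 3 \<le> D 0"
    using row(2)[OF n_pos] by (intro foldr_max_le)
  moreover have "sum_list (map (\<lambda>r. max 3 (degree r)) (tl ?M)) =
    (\<Sum>i<n - 1. max 3 (degree (?M ! Suc i)))"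
    by (simp add: sum_list_sum_nth length nth_tl atLeast0LessThan)
  moreover have "\<dots> \<le> (\<Sum>i<n - 1. D (Suc i))"
    by (intro sum_mono) (use row(1,2) in auto)
  ultimately have "degree_bound ?M \<le> D 0 + (\<Sum>i<n - 1. D (Suc i))"
    unfolding degree_bound_def by linarith
  also have "\<dots> = (\<Sum>i<n. D i)"
    using n_pos sum.lessThan_Suc_shift[of D "n - 1"] by simp
  also have "\<dots> = (\<Sum>x\<in>verts G. card (nbrs G x))" unfolding D_def
    by (rule sum.reindex_bij_betw[OF bij])
  also have "\<dots> \<le> d" using degree_sum by (simp add: sum_card_nbrs[OF simple])
  finally show ?thesis .
qed

lemma contains_forces:
  assumes "contains n (adj_mat n P) \<pi> Q" "forces Q goal" "labelling f" "holds f P"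
  shows goal
proof -
  define \<sigma> where "\<sigma> = \<pi> @ [length \<pi>..<n]"
  have \<sigma>: "inj_list n n \<sigma>" "\<sigma> ! 0 = 0" "embeds n (adj_mat n P) \<sigma> n Q"
    using assms(1) by (auto simp: contains_def embeds_def \<sigma>_def Let_def)
  have "in_range n Q" using assms(2) by (simp add: forces_def)
  then have "graph_embedding ((!) \<sigma>) (pat_graph n Q) (pat_graph n P)"
    by (rule embeds_sound[OF \<sigma>(3)])
  then have "holds (\<lambda>i. f (\<sigma> ! i)) Q"
    using assms(4) by (fastforce simp: graph_embedding_def holds_def image_image)
  moreover have "labelling (\<lambda>i. f (\<sigma> ! i))"
    using assms(3) bij_betw_trans[OF inj_list_bij_betw[OF \<sigma>(1)], of f "verts G"] \<sigma>(2)
    by (simp add: labelling_def comp_def)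
  ultimately show ?thesis using assms(2) unfolding forces_def by blast
qed

lemma closes_sound:
  assumes f: "labelling f" "holds f P" and Qs: "\<And>Q. Q \<in> set Qs \<Longrightarrow> forces Q goal"
  shows "closes n d Qs (adj_mat n P) ps subs \<Longrightarrow> (i, j) \<in> set ps \<Longrightarrow> {f i, f j} \<in> edges G \<Longrightarrow> goal"
proof (induction ps arbitrary: subs)
  case (Cons e ps)
  obtain a b where e: "e = (a, b)" by fastforce
  let ?M = "adj_mat n ((a, b) # P)"
  show ?case
  proof (cases "d < degree_bound ?M")
    case True
    then have "\<not> holds f ((a, b) # P)" using degree_bound_le[OF f(1)] by fastforce
    then have "(i, j) \<in> set ps" using Cons.prems(2,3) f(2) e by (auto simp: holds_Cons)
    moreover have "closes n d Qs (adj_mat n P) ps subs" using Cons.prems(1) True e by simp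
    ultimately show ?thesis using Cons.IH Cons.prems(3) by blast
  next
    case False
    then obtain k \<pi> subs' where
      subs: "nth_ok Qs k (contains n ?M \<pi>)" "closes n d Qs (adj_mat n P) ps subs'"
      using Cons.prems(1) e by (auto simp: Let_def split: list.splits)
    show ?thesis
    proof (cases "(i, j) = (a, b)")
      case True
      then have "holds f ((a, b) # P)" using Cons.prems(3) f(2) by (simp add: holds_Cons)
      then show ?thesis using nth_okD[OF subs(1)] contains_forces Qs f(1) by blast
    next
      case False
      then show ?thesis using Cons.IH[OF subs(2)] Cons.prems(2,3) e by auto
    qed
  qed
qed auto

lemma exists_nonneighbour_edge:
  assumes f: "labelling f" "holds f P" and x: "x < n" "degree (adj_mat n P ! x) < 3"
  obtains y where "(x, y) \<in> set (nonneighbours x (adj_mat n P ! x))" "{f x, f y} \<in> edges G"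
proof -
  let ?known = "{j. j < n \<and> adj_mat n P ! x ! j}" and ?nbrs = "{j. j < n \<and> {f x, f j} \<in> edges G}"
  have length: "length (adj_mat n P ! x) = n" using square_adj_mat x(1) by (simp add: square_def)
  then have "card ?known < card ?nbrs"
    using x(2) bspec[OF min_degree labelling_verts[OF f(1) x(1)]] card_nbrs_labelling[OF f(1) x(1)]
    by (simp add: degree_eq_card)
  then have "\<not> ?nbrs \<subseteq> ?known" using card_mono[of ?known ?nbrs] by fastforce
  then obtain y where y: "y < n" "{f x, f y} \<in> edges G" "\<not> adj_mat n P ! x ! y" by blast
  then have "y \<noteq> x" using simple_graph_edge_ends(3)[OF simple] by blast
  then show thesis using that y length by (auto simp: nonneighbours_def)
qed

lemma node_ok_sound:
  assumes ok: "node_ok n d covs Qs nd" and Qs: "\<And>Q. Q \<in> set Qs \<Longrightarrow> forces Q goal"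
  shows "forces (fst nd) goal"
proof -
  obtain P br subs where nd: "nd = (P, br, subs)" by (cases nd) auto
  have goal if f: "labelling f" "holds f P" for f
  proof (cases br)
    case (At x)
    then have x: "x < n" "degree (adj_mat n P ! x) < 3"
      and closes: "closes n d Qs (adj_mat n P) (nonneighbours x (adj_mat n P ! x)) subs"
      using ok nd by auto
    show goal using exists_nonneighbour_edge[OF f x] closes_sound[OF f Qs closes] by metis
  next
    case (Cover c \<tau>)
    then have \<tau>: "inj_list n n \<tau>"
      and "\<exists>C\<in>set covs. closes n d Qs (adj_mat n P) (map (\<lambda>(p, q). (\<tau> ! p, \<tau> ! q)) C) subs"
      using ok nd nth_okD by auto
    then obtain C where C: "C \<in> set covs"
      and closes: "closes n d Qs (adj_mat n P) (map (\<lambda>(p, q). (\<tau> ! p, \<tau> ! q)) C) subs" by blast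
    have "bij_betw (f \<circ> (!) \<tau>) {..<n} (verts G)"
      using f(1) bij_betw_trans[OF inj_list_bij_betw[OF \<tau>]] unfolding labelling_def by blast
    from covers[OF C this] obtain p q where pq: "(p, q) \<in> set C" "{f (\<tau> ! p), f (\<tau> ! q)} \<in> edges G"
      by auto
    then have "(\<tau> ! p, \<tau> ! q) \<in> set (map (\<lambda>(p, q). (\<tau> ! p, \<tau> ! q)) C)" by force
    then show goal using closes_sound[OF f Qs closes] pq(2) by blast
  qed
  moreover have "in_range n P" using ok nd by (cases br) auto
  ultimately show ?thesis using nd unfolding forces_def by auto
qed

lemma run_sound:
  assumes "run n d covs Qs nds roots" "\<And>Q. Q \<in> set Qs \<Longrightarrow> forces Q goal"
    and root: "(B, r) \<in> set roots" and f: "labelling f" "holds f B"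
  shows goal
  using assms(1,2)
proof (induction nds arbitrary: Qs)
  case Nil
  obtain k \<pi> where "r = (k, \<pi>)" by fastforce
  then have "d < degree_bound (adj_mat n B) \<or> nth_ok Qs k (contains n (adj_mat n B) \<pi>)"
    using Nil(1) root by (auto simp: list_all_iff root_ok_def)
  then have "nth_ok Qs k (contains n (adj_mat n B) \<pi>)" using degree_bound_le[OF f] by linarith
  then obtain Q where "Q \<in> set Qs" "contains n (adj_mat n B) \<pi> Q" using nth_okD by blast
  then show ?case using contains_forces f Nil(2) by blast
next
  case (Cons nd nds)
  then have "node_ok n d covs Qs nd" "run n d covs (fst nd # Qs) nds roots" by auto
  then show ?case using Cons.IH[of "fst nd # Qs"] node_ok_sound[of Qs nd] Cons.prems(2) by auto
qed

end

section \<open>Drawings with integer coordinates\<close>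

type_synonym point = "int \<times> int"

definition orient :: "point \<Rightarrow> point \<Rightarrow> point \<Rightarrow> int" where
  "orient = (\<lambda>(x1, y1) (x2, y2) (x3, y3). (x2 - x1) * (y3 - y1) - (y2 - y1) * (x3 - x1))"

definition same_side :: "point \<Rightarrow> point \<Rightarrow> point \<Rightarrow> point \<Rightarrow> bool" where
  "same_side a b c d \<longleftrightarrow> 0 < orient a b c * orient a b d"

definition segments_ok :: "point list \<Rightarrow> nat \<times> nat \<Rightarrow> nat \<times> nat \<Rightarrow> bool" where
  "segments_ok pts = (\<lambda>(a, b) (c, d).
     if a = c then orient (pts ! a) (pts ! b) (pts ! d) \<noteq> 0
     else if a = d then orient (pts ! a) (pts ! b) (pts ! c) \<noteq> 0
     else if b = c then orient (pts ! b) (pts ! a) (pts ! d) \<noteq> 0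
     else if b = d then orient (pts ! b) (pts ! a) (pts ! c) \<noteq> 0
     else same_side (pts ! a) (pts ! b) (pts ! c) (pts ! d) \<or>
       same_side (pts ! c) (pts ! d) (pts ! a) (pts ! b))"

definition pat_complement :: "nat \<Rightarrow> pattern \<Rightarrow> pattern" where
  "pat_complement m C = filter (\<lambda>e. \<not> List.member C e) (pairs [0..<m])"

definition drawing_ok :: "nat \<Rightarrow> point list \<times> pattern \<Rightarrow> bool" where
  "drawing_ok m = (\<lambda>(pts, C). length pts = m \<and> distinct pts \<and>
     sorted_wrt (segments_ok pts) (pat_complement m C) \<and> spanning m (pat_complement m C))"

definition to_plane :: "point \<Rightarrow> real ^ 2" where
  "to_plane = (\<lambda>(x, y). vector [of_int x, of_int y])"

lemma inj_to_plane: "inj to_plane"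
  by (rule injI) (auto simp: to_plane_def vec_eq_iff forall_2)

lemma det2_to_plane:
  "det2 (to_plane b - to_plane a) (to_plane c - to_plane a) = of_int (orient a b c)"
  by (auto simp: det2_def to_plane_def orient_def split: prod.splits)

lemma convex_comb_nonzero:
  fixes x y t :: real
  assumes "0 < x * y" "0 \<le> t" "t \<le> 1"
  shows "(1 - t) * x + t * y \<noteq> 0"
proof
  assume "(1 - t) * x + t * y = 0"
  then have "0 = x * ((1 - t) * x + t * y)" by simp
  also have "\<dots> = (1 - t) * x\<^sup>2 + t * (x * y)" by (simp add: algebra_simps power2_eq_square)
  also have "\<dots> > 0"
  proof (cases "t = 0")
    case True
    then show ?thesis using assms(1) by auto
  next
    case False
    then show ?thesis using assms by (intro add_nonneg_pos) auto
  qed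
  finally show False by simp
qed

lemma same_side_disjoint:
  assumes "same_side a b c d"
  shows "closed_segment (to_plane a) (to_plane b) \<inter> closed_segment (to_plane c) (to_plane d) = {}"
proof (rule ccontr)
  assume "\<not> ?thesis"
  then obtain s t where t: "0 \<le> t" "t \<le> 1"
    and eq: "(1 - s) *\<^sub>R to_plane a + s *\<^sub>R to_plane b = (1 - t) *\<^sub>R to_plane c + t *\<^sub>R to_plane d"
    by (auto simp: in_segment)
  define side where "side y = det2 (to_plane b - to_plane a) (y - to_plane a)" for y
  have "side ((1 - s) *\<^sub>R to_plane a + s *\<^sub>R to_plane b) = 0"
    by (simp add: side_def det2_def algebra_simps)
  moreover have "side ((1 - t) *\<^sub>R to_plane c + t *\<^sub>R to_plane d) =
      (1 - t) * side (to_plane c) + t * side (to_plane d)"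
    by (simp add: side_def det2_def algebra_simps)
  moreover have "0 < side (to_plane c) * side (to_plane d)"
    using assms by (simp add: side_def det2_to_plane same_side_def flip: of_int_mult)
  ultimately show False using convex_comb_nonzero[OF _ t] eq by metis
qed

lemma segments_ok_meet:
  assumes ok: "segments_ok pts (a, b) (c, d)" and "(a, b) \<noteq> (c, d)" "a < b" "c < d"
  defines "p \<equiv> \<lambda>i. to_plane (pts ! i)"
  shows "convex hull (p ` {a, b}) \<inter> convex hull (p ` {c, d}) \<subseteq> p ` ({a, b} \<inter> {c, d})"
proof -
  have hull: "convex hull (p ` {i, j}) = closed_segment (p i) (p j)" for i j
    by (simp add: segment_convex_hull)
  have common: "closed_segment (p i) (p j) \<inter> closed_segment (p i) (p k) \<subseteq> {p i}"
    if "orient (pts ! i) (pts ! j) (pts ! k) \<noteq> 0" for i j k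
    using segments_meet_at_start[of "p j" "p i" "p k"] that by (simp add: p_def det2_to_plane)
  consider (start) "a = c" | (start_end) "a = d" | (end_start) "b = c" | (end_end) "b = d" "a \<noteq> c"
    | (disjoint) "a \<noteq> c" "a \<noteq> d" "b \<noteq> c" "b \<noteq> d" by blast
  then show ?thesis
  proof cases
    case start
    then show ?thesis using ok common[of a b d] unfolding hull by (auto simp: segments_ok_def)
  next
    case start_end
    then show ?thesis
      using ok common[of a b c] assms(3,4) unfolding hull closed_segment_commute[of "p c"]
      by (auto simp: segments_ok_def)
  next
    case end_start
    then show ?thesis
      using ok common[of b a d] assms(3,4) unfolding hull closed_segment_commute[of "p a"]
      by (auto simp: segments_ok_def)
  next
    case end_end
    then show ?thesis
      using ok common[of b a c] assms(3,4)
      unfolding hull closed_segment_commute[of "p a"] closed_segment_commute[of "p c"]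
      by (auto simp: segments_ok_def)
  next
    case disjoint
    then have "same_side (pts ! a) (pts ! b) (pts ! c) (pts ! d) \<or>
      same_side (pts ! c) (pts ! d) (pts ! a) (pts ! b)"
      using ok by (simp add: segments_ok_def)
    then have "closed_segment (p a) (p b) \<inter> closed_segment (p c) (p d) = {}"
      using same_side_disjoint unfolding p_def by (metis Int_commute)
    then show ?thesis unfolding hull by simp
  qed
qed

lemma mem_pat_complement: "(i, j) \<in> set (pat_complement m C) \<longleftrightarrow> i < j \<and> j < m \<and> (i, j) \<notin> set C"
  by (simp add: pat_complement_def mem_pairs_upt)

lemma sorted_wrt_either:
  "sorted_wrt R xs \<Longrightarrow> x \<in> set xs \<Longrightarrow> y \<in> set xs \<Longrightarrow> x \<noteq> y \<Longrightarrow> R x y \<or> R y x"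
  by (induction xs) auto

lemma drawing_ok_meet:
  assumes ok: "drawing_ok m (pts, C)"
    and e: "e \<in> pat_edges (pat_complement m C)" "e' \<in> pat_edges (pat_complement m C)" "e \<noteq> e'"
  defines "p \<equiv> \<lambda>i. to_plane (pts ! i)"
  shows "convex hull (p ` e) \<inter> convex hull (p ` e') \<subseteq> p ` (e \<inter> e')"
proof -
  obtain a b where ab: "e = {a, b}" "(a, b) \<in> set (pat_complement m C)"
    using e(1) by (auto simp: pat_edges_def)
  obtain c d where cd: "e' = {c, d}" "(c, d) \<in> set (pat_complement m C)"
    using e(2) by (auto simp: pat_edges_def)
  have ne: "(a, b) \<noteq> (c, d)" using e(3) ab(1) cd(1) by auto
  have "sorted_wrt (segments_ok pts) (pat_complement m C)" using ok by (simp add: drawing_ok_def)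
  then have "segments_ok pts (a, b) (c, d) \<or> segments_ok pts (c, d) (a, b)"
    using ab(2) cd(2) ne by (rule sorted_wrt_either)
  moreover have "a < b" "c < d" using ab(2) cd(2) by (auto simp: mem_pat_complement)
  ultimately show ?thesis
    using segments_ok_meet[of pts a b c d] segments_ok_meet[of pts c d a b] ne
    unfolding ab(1) cd(1) p_def by (auto simp: Int_commute)
qed

lemma line_drawing_pat_complement:
  assumes ok: "drawing_ok m (pts, C)"
  shows "line_drawing (pat_graph m (pat_complement m C)) (\<lambda>i. to_plane (pts ! i))"
    (is "line_drawing ?T ?p")
proof -
  have inj: "inj_on ?p {..<m}"
  proof (rule inj_onI)
    fix i j assume ij: "i \<in> {..<m}" "j \<in> {..<m}" "?p i = ?p j"
    then have "pts ! i = pts ! j" using injD[OF inj_to_plane] by blast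
    then show "i = j" using ok ij(1,2) by (auto simp: drawing_ok_def nth_eq_iff_index_eq)
  qed
  note meet = drawing_ok_meet[OF ok]
  have "?p c \<notin> convex hull (?p ` e)"
    if e: "e \<in> pat_edges (pat_complement m C)" and c: "c < m" "c \<notin> e" for e c
  proof
    assume on: "?p c \<in> convex hull (?p ` e)"
    have "spanning m (pat_complement m C)" using ok by (simp add: drawing_ok_def)
    then obtain e' where e': "e' \<in> pat_edges (pat_complement m C)" "c \<in> e'"
      using spanningD c(1) by blast
    have "?p c \<in> convex hull (?p ` e')" using e'(2) by (intro hull_inc) auto
    then have "?p c \<in> ?p ` (e \<inter> e')" using meet[OF e e'(1)] on c(2) e'(2) by blast
    then obtain z where z: "z \<in> e" "z \<in> e'" "?p c = ?p z" by auto
    have "z < m" using z(2) e'(1) by (auto simp: pat_edges_def mem_pat_complement)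
    then have "c = z" using inj_onD[OF inj z(3)] c(1) by simp
    then show False using z(1) c(2) by simp
  qed
  then show ?thesis using inj meet unfolding line_drawing_def by auto
qed

lemma drawing_ok_cover:
  assumes ok: "drawing_ok m (pts, C)" and H: "simple_graph H" and f: "bij_betw f {..<m} (verts H)"
    and np: "\<not> line_planar H"
  shows "\<exists>(i, j)\<in>set C. {f i, f j} \<in> edges H"
proof (rule ccontr)
  assume "\<not> ?thesis"
  then have uncovered: "{f i, f j} \<notin> edges H" if "(i, j) \<in> set C" for i j using that by auto
  define g where "g = inv_into {..<m} f"
  have g: "bij_betw g (verts H) {..<m}" unfolding g_def by (rule bij_betw_inv_into[OF f])
  have fg: "f (g y) = y" if "y \<in> verts H" for y
    using that f unfolding g_def by (simp add: bij_betw_inv_into_right)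
  have "g ` e \<in> pat_edges (pat_complement m C)" if e: "e \<in> edges H" for e
  proof -
    obtain a b where ab: "e = {a, b}" "a \<noteq> b" "a \<in> verts H" "b \<in> verts H"
      using simple_graph_edgeE[OF H e] by metis
    have "g a < m" "g b < m" "g a \<noteq> g b" using g ab by (auto simp: bij_betw_def dest: inj_onD)
    moreover have "(g a, g b) \<notin> set C" "(g b, g a) \<notin> set C"
      using uncovered[of "g a" "g b"] uncovered[of "g b" "g a"] fg ab e
      by (auto simp: insert_commute)
    ultimately have "(g a, g b) \<in> set (pat_complement m C) \<or> (g b, g a) \<in> set (pat_complement m C)"
      by (auto simp: mem_pat_complement)
    then show ?thesis using pat_edgesI by (simp add: ab(1))
  qed
  then have "graph_embedding g H (pat_graph m (pat_complement m C))"
    using g H by (auto simp: graph_embedding_def bij_betw_def simple_graph_def)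
  then show False
    using np line_drawing_pullback[OF line_drawing_pat_complement[OF ok]] unfolding line_planar_def
    by blast
qed

section \<open>Isomorphisms and triangle-star exchanges\<close>

definition graph_isom :: "('a \<Rightarrow> 'b) \<Rightarrow> 'a ugraph \<Rightarrow> 'b ugraph \<Rightarrow> bool" where
  "graph_isom f G H \<longleftrightarrow> bij_betw f (verts G) (verts H) \<and> (\<lambda>e. f ` e) ` edges G = edges H"

lemma graph_iso_iff: "graph_iso G H \<longleftrightarrow> (\<exists>f. graph_isom f G H)"
  by (simp add: graph_iso_def graph_isom_def)

lemma graph_isom_embedding: "simple_graph G \<Longrightarrow> graph_isom f G H \<Longrightarrow> graph_embedding f G H"
  by (auto simp: graph_isom_def graph_embedding_def bij_betw_def simple_graph_def)

lemma simple_graph_isom: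
  assumes "simple_graph G" "graph_isom f G H"
  shows "simple_graph H"
proof -
  have inj: "inj_on f (verts G)" and H: "verts H = f ` verts G" "edges H = (`) f ` edges G"
    using assms(2) by (auto simp: graph_isom_def bij_betw_def)
  have "f ` e \<subseteq> f ` verts G \<and> card (f ` e) = 2" if "e \<in> edges G" for e
    using assms(1) that card_image[OF inj_on_subset[OF inj], of e] by (auto simp: simple_graph_def)
  then show ?thesis using finite_verts[OF assms(1)] by (auto simp: simple_graph_def H)
qed

lemma graph_isom_comp:
  assumes "graph_isom f G H" "graph_isom g H K"
  shows "graph_isom (g \<circ> f) G K"
proof -
  have "(\<lambda>e. (g \<circ> f) ` e) ` edges G = (\<lambda>e. g ` e) ` (\<lambda>e. f ` e) ` edges G"
    by (simp add: image_image image_comp)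
  then show ?thesis using assms by (auto simp: graph_isom_def intro: bij_betw_trans)
qed

lemma graph_isom_inv:
  assumes "simple_graph G" "graph_isom f G H"
  shows "graph_isom (inv_into (verts G) f) H G"
proof -
  have bij: "bij_betw f (verts G) (verts H)" and edges: "edges H = (`) f ` edges G"
    using assms(2) by (auto simp: graph_isom_def)
  have "inv_into (verts G) f ` f ` e = e" if "e \<in> edges G" for e
    using assms(1) that bij
    by (intro inv_into_image_cancel) (auto simp: simple_graph_def bij_betw_def)
  then show ?thesis using bij_betw_inv_into[OF bij] by (simp add: graph_isom_def edges image_image)
qed

lemma graph_iso_trans: "graph_iso G H \<Longrightarrow> graph_iso H K \<Longrightarrow> graph_iso G K"
  unfolding graph_iso_iff using graph_isom_comp by blast

lemma graph_iso_sym: "simple_graph G \<Longrightarrow> graph_iso G H \<Longrightarrow> graph_iso H G"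
  unfolding graph_iso_iff using graph_isom_inv by blast

lemma graph_isom_nbrs:
  assumes G: "simple_graph G" and isom: "graph_isom f G H" and x: "x \<in> verts G"
  shows "nbrs H (f x) = f ` nbrs G x"
proof -
  have inj: "inj_on f (verts G)" and edges: "edges H = (`) f ` edges G"
    using isom by (auto simp: graph_isom_def bij_betw_def)
  have "y \<in> f ` nbrs G x" if "{f x, y} \<in> edges H" for y
  proof -
    obtain e where e: "e \<in> edges G" "f ` e = {f x, y}" using \<open>{f x, y} \<in> edges H\<close> edges by auto
    have "e \<subseteq> verts G" using G e(1) by (auto simp: simple_graph_def)
    then have "x \<in> e" using e(2) x inj_on_image_mem_iff[OF inj, of x e] by auto
    then obtain z where z: "z \<in> nbrs G x" "e = {x, z}"
      using simple_graph_edge_cases[OF G e(1), of x] by metis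
    then have "f z = y \<or> f z = f x" "y \<in> {f x, f z}" using e(2) by auto
    moreover have "f z \<noteq> f x" using z(1) nbrs_subset[OF G, of x] inj x by (auto dest: inj_onD)
    ultimately show ?thesis using z(1) by blast
  qed
  moreover have "{f x, f y} \<in> edges H" if "{x, y} \<in> edges G" for y
    using imageI[OF that, of "(`) f"] edges by simp
  ultimately show ?thesis by (auto simp: nbrs_def)
qed

lemma graph_embedding_card_edges:
  assumes "graph_embedding f H G" "finite (edges G)"
  shows "card (edges H) \<le> card (edges G)"
proof -
  have "inj_on ((`) f) (edges H)"
    by (rule inj_on_subset[OF inj_on_image_Pow]) (use assms(1) in \<open>auto simp: graph_embedding_def\<close>)
  moreover have "(`) f ` edges H \<subseteq> edges G" using assms(1) by (auto simp: graph_embedding_def)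
  ultimately show ?thesis using assms(2) by (rule card_inj_on_le)
qed

lemma graph_isom_if_graph_embedding:
  assumes f: "graph_embedding f G H" and H: "finite (verts H)" "finite (edges H)"
    and verts: "card (verts H) = card (verts G)" and edges: "card (edges H) \<le> card (edges G)"
  shows "graph_isom f G H"
proof -
  have inj: "inj_on f (verts G)" "inj_on ((`) f) (edges G)"
    using f inj_on_subset[OF inj_on_image_Pow, of f "verts G" "edges G"]
    by (auto simp: graph_embedding_def)
  have "f ` verts G = verts H"
    by (rule card_subset_eq[OF H(1)])
      (use f inj(1) verts in \<open>auto simp: graph_embedding_def card_image\<close>)
  moreover have "(`) f ` edges G = edges H"
    by (rule card_seteq[OF H(2)])
      (use f inj(2) edges in \<open>auto simp: graph_embedding_def card_image\<close>)
  ultimately show ?thesis using inj(1) by (simp add: graph_isom_def bij_betw_def)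
qed

definition triangle_to_star :: "'a ugraph \<Rightarrow> 'a set \<Rightarrow> 'a \<Rightarrow> 'a ugraph" where
  "triangle_to_star G T v =
     \<lparr>verts = insert v (verts G), edges = {e \<in> edges G. \<not> e \<subseteq> T} \<union> (\<lambda>u. {v, u}) ` T\<rparr>"

definition star_to_triangle :: "'a ugraph \<Rightarrow> 'a \<Rightarrow> 'a ugraph" where
  "star_to_triangle G v =
     \<lparr>verts = verts G - {v}, edges = {e \<in> edges G. v \<notin> e} \<union> {e. e \<subseteq> nbrs G v \<and> card e = 2}\<rparr>"

lemma pairs_of_triple:
  assumes "distinct [a, b, c]"
  shows "{e. e \<subseteq> {a, b, c} \<and> card e = 2} = {{a, b}, {b, c}, {a, c}}"
  using pat_edges_pairs[OF assms] by (simp add: insert_commute)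

lemma nabla_Y_iff:
  assumes "simple_graph G"
  shows "nabla_Y G H \<longleftrightarrow> (\<exists>T v. card T = 3 \<and> {e. e \<subseteq> T \<and> card e = 2} \<subseteq> edges G \<and> v \<notin> verts G \<and>
    H = triangle_to_star G T v)"
proof -
  have eq: "triangle_to_star G {a, b, c} v = \<lparr>verts = insert v (verts G),
      edges = (edges G - {{a, b}, {b, c}, {a, c}}) \<union> {{v, a}, {v, b}, {v, c}}\<rparr>"
    if "distinct [a, b, c]" for a b c v
  proof -
    have "{e \<in> edges G. \<not> Q e} = edges G - {e. Q e \<and> card e = 2}" for Q
      using assms by (auto simp: simple_graph_def)
    then show ?thesis by (simp add: triangle_to_star_def pairs_of_triple[OF that])
  qed
  have "nabla_Y G H \<longleftrightarrow> (\<exists>a b c v. distinct [a, b, c] \<and> {e. e \<subseteq> {a, b, c} \<and> card e = 2} \<subseteq> edges G \<and>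
      v \<notin> verts G \<and> H = triangle_to_star G {a, b, c} v)"
    unfolding nabla_Y_def
    by (intro ex_cong1, rule conj_cong, rule refl) (simp add: pairs_of_triple eq)
  also have "\<dots> \<longleftrightarrow> (\<exists>T v. card T = 3 \<and> {e. e \<subseteq> T \<and> card e = 2} \<subseteq> edges G \<and> v \<notin> verts G \<and>
      H = triangle_to_star G T v)"
    by (auto simp: card_3_iff)
  finally show ?thesis .
qed

lemma Y_nabla_iff: "Y_nabla G H \<longleftrightarrow> (\<exists>v\<in>verts G. card (nbrs G v) = 3 \<and> H = star_to_triangle G v)"
proof -
  have eq: "star_to_triangle G v =
      \<lparr>verts = verts G - {v}, edges = {e \<in> edges G. v \<notin> e} \<union> {{a, b}, {b, c}, {a, c}}\<rparr>"
    if "distinct [a, b, c]" "nbrs G v = {a, b, c}" for v a b c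
    by (simp add: star_to_triangle_def that(2) pairs_of_triple[OF that(1)])
  have "Y_nabla G H \<longleftrightarrow> (\<exists>v a b c. v \<in> verts G \<and> distinct [a, b, c] \<and> nbrs G v = {a, b, c} \<and>
      H = star_to_triangle G v)"
    unfolding Y_nabla_def nbrs_def[symmetric] by (intro ex_cong1 conj_cong refl) (simp add: eq)
  also have "\<dots> \<longleftrightarrow> (\<exists>v\<in>verts G. card (nbrs G v) = 3 \<and> H = star_to_triangle G v)"
    by (auto simp: card_3_iff)
  finally show ?thesis .
qed

lemma graph_isom_triangle_to_star:
  assumes G: "simple_graph G" and isom: "graph_isom f G H"
    and T: "T \<subseteq> verts G" and v: "v \<notin> verts G" and w: "w \<notin> verts H"
  shows "graph_isom (f(v := w)) (triangle_to_star G T v) (triangle_to_star H (f ` T) w)"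
proof -
  let ?g = "f(v := w)"
  have inj: "inj_on f (verts G)" and H: "verts H = f ` verts G" "edges H = (`) f ` edges G"
    using isom by (auto simp: graph_isom_def bij_betw_def)
  have image: "?g ` X = f ` X" if "X \<subseteq> verts G" for X using that v by auto
  have edge: "e \<subseteq> verts G" if "e \<in> edges G" for e using G that by (auto simp: simple_graph_def)
  have "bij_betw ?g (verts (triangle_to_star G T v)) (verts (triangle_to_star H (f ` T) w))"
    using inj v w image[of "verts G"] by (auto simp: triangle_to_star_def bij_betw_def H inj_on_def)
  moreover have "(`) ?g ` {e \<in> edges G. \<not> e \<subseteq> T} = (`) f ` {e \<in> edges G. \<not> e \<subseteq> T}"
    by (rule image_cong) (use image edge in auto)
  moreover have "(`) f ` {e \<in> edges G. \<not> e \<subseteq> T} = {e \<in> edges H. \<not> e \<subseteq> f ` T}"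
  proof -
    have "{e \<in> edges G. \<not> e \<subseteq> T} = {e \<in> edges G. \<not> f ` e \<subseteq> f ` T}"
      using inj_on_image_subset_iff[OF inj edge T] by blast
    then show ?thesis unfolding H(2) by blast
  qed
  moreover have "(`) ?g ` (\<lambda>u. {v, u}) ` T = (\<lambda>u. {w, u}) ` f ` T"
    unfolding image_image by (rule image_cong) (use T v in auto)
  ultimately show ?thesis by (simp add: graph_isom_def triangle_to_star_def image_Un)
qed

lemma graph_isom_star_to_triangle:
  assumes G: "simple_graph G" and isom: "graph_isom f G H" and v: "v \<in> verts G"
  shows "graph_isom f (star_to_triangle G v) (star_to_triangle H (f v))"
proof -
  have inj: "inj_on f (verts G)" and H: "verts H = f ` verts G" "edges H = (`) f ` edges G"
    using isom by (auto simp: graph_isom_def bij_betw_def)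
  have edge: "e \<subseteq> verts G" if "e \<in> edges G" for e using G that by (auto simp: simple_graph_def)
  have "bij_betw f (verts G - {v}) (verts H - {f v})"
    using inj v by (auto simp: bij_betw_def H inj_on_def)
  moreover have "(`) f ` {e \<in> edges G. v \<notin> e} = {e \<in> edges H. f v \<notin> e}"
    using inj_on_image_mem_iff[OF inj v edge] by (auto simp: H)
  moreover have "(`) f ` {e. e \<subseteq> nbrs G v \<and> card e = 2} = {e. e \<subseteq> nbrs H (f v) \<and> card e = 2}"
  proof -
    have "inj_on f (nbrs G v)" using inj_on_subset[OF inj] nbrs_subset[OF G, of v] by blast
    then have "card (f ` e) = card e" if "e \<subseteq> nbrs G v" for e
      using that by (intro card_image) (rule inj_on_subset)
    then show ?thesis unfolding graph_isom_nbrs[OF G isom v]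
      by (auto simp: subset_image_iff image_iff)
  qed
  ultimately show ?thesis by (simp add: graph_isom_def star_to_triangle_def image_Un)
qed

lemma triple_subset_verts:
  assumes "simple_graph G" "card T = 3" "{e. e \<subseteq> T \<and> card e = 2} \<subseteq> edges G"
  shows "T \<subseteq> verts G"
proof -
  obtain a b c where abc: "T = {a, b, c}" "distinct [a, b, c]"
    using assms(2) by (auto simp: card_3_iff)
  then have "{a, b} \<in> edges G" "{b, c} \<in> edges G" using assms(3) pairs_of_triple[OF abc(2)] by auto
  then show ?thesis using simple_graph_edge_ends[OF assms(1)] abc(1) by blast
qed

lemma nabla_Y_graph_iso:
  fixes H :: "'b ugraph"
  assumes G: "simple_graph G" and iso: "graph_iso G H" and move: "nabla_Y G G'"
    and "infinite (UNIV :: 'b set)"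
  obtains H' where "nabla_Y H H'" "graph_iso G' H'"
proof -
  obtain f where f: "graph_isom f G H" using iso by (auto simp: graph_iso_iff)
  have H: "simple_graph H" by (rule simple_graph_isom[OF G f])
  have inj: "inj_on f (verts G)" and edges: "edges H = (`) f ` edges G"
    using f by (auto simp: graph_isom_def bij_betw_def)
  obtain T v where T: "card T = 3" "{e. e \<subseteq> T \<and> card e = 2} \<subseteq> edges G" and v: "v \<notin> verts G"
    and G': "G' = triangle_to_star G T v"
    using move by (auto simp: nabla_Y_iff[OF G])
  have TV: "T \<subseteq> verts G" by (rule triple_subset_verts[OF G T])
  obtain a b c where abc: "T = {a, b, c}" "distinct [a, b, c]" using T(1) by (auto simp: card_3_iff)
  have "finite (verts H)" by (rule finite_verts[OF H])
  then obtain w where w: "w \<notin> verts H" using ex_new_if_finite assms(4) by blast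
  have fabc: "distinct [f a, f b, f c]" using inj TV abc by (auto dest: inj_onD)
  have "{{a, b}, {b, c}, {a, c}} \<subseteq> edges G" using T(2) pairs_of_triple[OF abc(2)] abc(1) by simp
  then have "(`) f ` {{a, b}, {b, c}, {a, c}} \<subseteq> edges H" unfolding edges by (rule image_mono)
  then have "{e. e \<subseteq> f ` T \<and> card e = 2} \<subseteq> edges H"
    using pairs_of_triple[OF fabc] abc(1) by simp
  moreover have "card (f ` T) = 3" using fabc abc(1) by simp
  ultimately have "nabla_Y H (triangle_to_star H (f ` T) w)" using w nabla_Y_iff[OF H] by blast
  moreover have "graph_iso G' (triangle_to_star H (f ` T) w)"
    using graph_isom_triangle_to_star[OF G f TV v w] by (auto simp: graph_iso_iff G')
  ultimately show thesis by (rule that)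
qed

lemma Y_nabla_graph_iso:
  assumes G: "simple_graph G" and iso: "graph_iso G H" and move: "Y_nabla G G'"
  obtains H' where "Y_nabla H H'" "graph_iso G' H'"
proof -
  obtain f where f: "graph_isom f G H" using iso by (auto simp: graph_iso_iff)
  obtain v where v: "v \<in> verts G" "card (nbrs G v) = 3" and G': "G' = star_to_triangle G v"
    using move by (auto simp: Y_nabla_iff)
  have inj: "inj_on f (verts G)" and "f v \<in> verts H"
    using f v(1) by (auto simp: graph_isom_def bij_betw_def)
  moreover have "card (nbrs H (f v)) = 3"
    unfolding graph_isom_nbrs[OF G f v(1)] v(2)[symmetric]
    using inj_on_subset[OF inj] nbrs_subset[OF G, of v] by (intro card_image) blast
  ultimately have "Y_nabla H (star_to_triangle H (f v))" by (auto simp: Y_nabla_iff)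
  moreover have "graph_iso G' (star_to_triangle H (f v))"
    using graph_isom_star_to_triangle[OF G f v(1)] by (auto simp: graph_iso_iff G')
  ultimately show thesis by (rule that)
qed

lemma simple_graph_nabla_Y:
  assumes G: "simple_graph G" and "nabla_Y G H"
  shows "simple_graph H"
proof -
  obtain T v where T: "card T = 3" "{e. e \<subseteq> T \<and> card e = 2} \<subseteq> edges G" and v: "v \<notin> verts G"
    and H: "H = triangle_to_star G T v"
    using assms(2) by (auto simp: nabla_Y_iff[OF G])
  have "T \<subseteq> verts G" by (rule triple_subset_verts[OF G T])
  moreover have "finite T" using T(1) by (simp add: card_ge_0_finite)
  ultimately show ?thesis
    using G v by (auto simp: H simple_graph_def triangle_to_star_def card_insert_if)
qed

lemma simple_graph_Y_nabla:
  assumes "simple_graph G" "Y_nabla G H"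
  shows "simple_graph H"
  using assms nbrs_subset[OF assms(1)]
  by (fastforce simp: Y_nabla_iff simple_graph_def star_to_triangle_def)

section \<open>Kuratowski subdivisions with few edges\<close>

definition subdivide :: "'a ugraph \<Rightarrow> 'a \<Rightarrow> 'a \<Rightarrow> 'a \<Rightarrow> 'a ugraph" where
  "subdivide G a b x =
    \<lparr>verts = insert x (verts G), edges = (edges G - {{a, b}}) \<union> {{a, x}, {x, b}}\<rparr>"

lemma suppress_subdivide:
  assumes "simple_graph G" "{a, b} \<in> edges G" "x \<notin> verts G"
  shows "suppress (subdivide G a b x) x a b = G"
proof -
  have "x \<notin> e" if "e \<in> edges G" for e using assms(1,3) that by (auto simp: simple_graph_def)
  then have "{e \<in> edges (subdivide G a b x). x \<notin> e} = edges G - {{a, b}}"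
    by (auto simp: subdivide_def)
  then have "insert {a, b} {e \<in> edges (subdivide G a b x). x \<notin> e} = edges G" using assms(2) by blast
  moreover have "verts (subdivide G a b x) - {x} = verts G"
    using assms(3) by (simp add: subdivide_def)
  ultimately show ?thesis by (simp add: suppress_def)
qed

lemma curve_planar_if_curve_planar_subdivide:
  assumes "simple_graph G" "{a, b} \<in> edges G" "x \<notin> verts G" "curve_planar (subdivide G a b x)"
  shows "curve_planar G"
proof -
  have "curve_planar (suppress (subdivide G a b x) x a b)"
    using assms(4) by (rule curve_planar_suppress)
      (use simple_graph_edge_ends(3)[OF assms(1,2)] in \<open>auto simp: subdivide_def\<close>)
  then show ?thesis by (simp add: suppress_subdivide[OF assms(1-3)])
qed

lemma graph_embedding_subdivide:
  assumes inj: "inj_on f (verts B)" and verts: "f ` verts B \<subseteq> verts G - {x}" and x: "x \<in> verts G"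
    and y: "y \<notin> verts B" and ij: "i \<in> verts B" "j \<in> verts B"
    and new: "{f i, x} \<in> edges G" "{x, f j} \<in> edges G"
    and old: "\<And>e. e \<in> edges B - {{i, j}} \<Longrightarrow> e \<subseteq> verts B \<and> f ` e \<in> edges G"
  shows "graph_embedding (f(y := x)) (subdivide B i j y) G"
  unfolding graph_embedding_def subdivide_def ugraph.simps
proof (intro conjI ballI)
  let ?g = "f(y := x)"
  have image: "?g ` X = f ` X" if "X \<subseteq> verts B" for X using that y by auto
  show "inj_on ?g (insert y (verts B))" using inj verts y by (auto simp: inj_on_def)
  show "?g ` insert y (verts B) \<subseteq> verts G" using image[of "verts B"] verts x by auto
  have "?g ` {i, y} = {f i, x}" "?g ` {y, j} = {x, f j}" using ij y by auto
  then have spokes: "?g ` {i, y} \<in> edges G" "?g ` {y, j} \<in> edges G" using new by auto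
  fix e assume "e \<in> edges B - {{i, j}} \<union> {{i, y}, {y, j}}"
  then consider "e \<in> edges B - {{i, j}}" | "e = {i, y}" | "e = {y, j}" by blast
  then show "e \<subseteq> insert y (verts B)" "?g ` e \<in> edges G"
    by (cases; use old image spokes ij in auto)+
qed

lemma graph_embedding_suppress:
  assumes G: "simple_graph G" and x: "x \<in> verts G" and ab: "nbrs G x = {a, b}"
    and f: "graph_embedding f B (suppress G x a b)" and y: "y \<notin> verts B"
  obtains "graph_embedding f B G"
    | i j where "{i, j} \<in> edges B" "graph_embedding (f(y := x)) (subdivide B i j y) G"
proof (cases "\<forall>e\<in>edges B. f ` e \<in> edges G")
  case True
  then have "graph_embedding f B G" using f by (auto simp: graph_embedding_def suppress_def)
  then show thesis by (rule that(1))
next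
  case False
  then obtain d where d: "d \<in> edges B" "f ` d \<notin> edges G" by blast
  have inj: "inj_on f (verts B)" and verts: "f ` verts B \<subseteq> verts G - {x}"
    and sub: "\<And>e. e \<in> edges B \<Longrightarrow> e \<subseteq> verts B"
    and edge: "\<And>e. e \<in> edges B \<Longrightarrow> f ` e = {a, b} \<or> f ` e \<in> edges G"
    using f unfolding graph_embedding_def suppress_def ugraph.simps by blast+
  have fd: "f ` d = {a, b}" using edge[OF d(1)] d(2) by blast
  then obtain i j where ij: "i \<in> d" "j \<in> d" "f i = a" "f j = b" by (metis imageE insertI1 insertI2)
  then have "f ` {i, j} = f ` d" by (simp add: fd)
  then have d_eq: "d = {i, j}"
    using inj_on_image_eq_iff[OF inj, of "{i, j}" d] sub[OF d(1)] ij(1,2) by auto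
  have "f ` e \<in> edges G" if e: "e \<in> edges B - {{i, j}}" for e
  proof -
    have "f ` e \<noteq> f ` d" using inj_on_image_eq_iff[OF inj sub sub[OF d(1)]] e d_eq by blast
    then show ?thesis using edge[of e] fd e by simp
  qed
  then have "graph_embedding (f(y := x)) (subdivide B i j y) G"
    using sub d d_eq ij(3,4) ab
    by (intro graph_embedding_subdivide[OF inj verts x y]) (auto simp: nbrs_def insert_commute)
  then show thesis using that(2) d(1) d_eq by blast
qed

definition subdivide_pat :: "pattern \<Rightarrow> nat \<times> nat \<Rightarrow> nat \<Rightarrow> pattern" where
  "subdivide_pat P = (\<lambda>(i, j) x. map (\<lambda>d. if d = (i, j) then (i, x) else d) P @ [(j, x)])"

lemma pat_graph_subdivide_pat:
  assumes "simple_pat n P" "(i, j) \<in> set P"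
  shows "pat_graph (Suc n) (subdivide_pat P (i, j) n) = subdivide (pat_graph n P) i j n"
proof -
  have "set (map (\<lambda>d. if d = (i, j) then (i, n) else d) P) = insert (i, n) (set P - {(i, j)})"
    using assms(2) by auto
  moreover have "(\<lambda>(k, l). {k, l}) ` (set P - {(i, j)}) = pat_edges P - {{i, j}}"
    using simple_pat_edge_iff[OF assms] by (auto simp: pat_edges_def)
  ultimately have "pat_edges (subdivide_pat P (i, j) n) =
    (pat_edges P - {{i, j}}) \<union> {{i, n}, {n, j}}"
    by (simp add: subdivide_pat_def pat_edges_def image_Un insert_commute)
  then show ?thesis by (simp add: pat_graph_def subdivide_def lessThan_Suc)
qed

lemma simple_pat_subdivide_pat:
  assumes "simple_pat n P" "(i, j) \<in> set P"
  shows "simple_pat (Suc n) (subdivide_pat P (i, j) n)"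
proof -
  have ij: "i < n" "j < n" using simple_patD[OF assms] by auto
  have old: "k < l" "l < n" if "(k, l) \<in> set P" for k l using simple_patD[OF assms(1) that] by auto
  then have "inj_on (\<lambda>d. if d = (i, j) then (i, n) else d) (set P)"
    by (intro inj_onI) (auto split: if_splits)
  moreover have "distinct P" using assms(1) by (simp add: simple_pat_def)
  ultimately show ?thesis
    using ij old
    by (auto simp: simple_pat_def subdivide_pat_def distinct_map list_all_iff less_Suc_eq
      split: if_splits)
qed

definition K33 :: pattern where
  "K33 = List.product [0, 1, 2] [3, 4, 5]"

definition K5 :: pattern where
  "K5 = pairs [0..<5]"

definition add_subdivision :: "(nat \<times> pattern) list \<Rightarrow> nat \<times> nat \<Rightarrow> (nat \<times> pattern) list" where
  "add_subdivision Bs = (\<lambda>(p, k). case Bs ! p of (m, B) \<Rightarrow>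
     if p < length Bs \<and> k < length B then Bs @ [(Suc m, subdivide_pat B (B ! k) m)] else Bs)"

text \<open>All subdivisions of \<open>K33\<close> and \<open>K5\<close> with at most 12 edges, up to isomorphism.\<close>

definition kuratowski_pats :: "(nat \<times> pattern) list" where
  "kuratowski_pats = foldl add_subdivision [(6, K33), (5, K5)]
     [(0,0),(2,0),(3,0),(3,1),(3,4),(2,1),(7,2),(7,3),(7,5),(2,4),(11,8),(1,0),(13,0),(13,1),
      (13,7)]"

definition nonplanar_pat :: "nat \<times> pattern \<Rightarrow> bool" where
  "nonplanar_pat = (\<lambda>(m, B). simple_pat m B \<and> \<not> curve_planar (pat_graph m B))"

lemma nonplanar_pat_K33: "nonplanar_pat (6, K33)"
proof -
  have "{x, y} \<in> edges (pat_graph 6 K33)" if "x \<in> {0, 1, 2}" "y \<in> {3, 4, 5}" for x y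
  proof -
    have "(x, y) \<in> set K33" using that by (auto simp: K33_def)
    then show ?thesis by (simp add: pat_edgesI)
  qed
  then have "\<not> curve_planar (pat_graph 6 K33)" by (intro K33_not_curve_planar[of 0 1 2 3 4 5]) auto
  moreover have "simple_pat 6 K33" by code_simp
  ultimately show ?thesis by (simp add: nonplanar_pat_def)
qed

lemma nonplanar_pat_K5: "nonplanar_pat (5, K5)"
proof -
  have "{x, y} \<in> edges (pat_graph 5 K5)" if "x < 5" "y < 5" "x \<noteq> y" for x y
  proof -
    have "(x, y) \<in> set K5 \<or> (y, x) \<in> set K5" unfolding K5_def mem_pairs_upt using that by linarith
    then show ?thesis by (simp add: pat_edgesI)
  qed
  then have "\<not> curve_planar (pat_graph 5 K5)" by (intro K5_not_curve_planar[of 0 1 2 3 4]) auto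
  moreover have "simple_pat 5 K5" by code_simp
  ultimately show ?thesis by (simp add: nonplanar_pat_def)
qed

lemma nonplanar_pat_subdivide_pat:
  assumes "nonplanar_pat (m, B)" "e \<in> set B"
  shows "nonplanar_pat (Suc m, subdivide_pat B e m)"
proof -
  obtain i j where e: "e = (i, j)" by fastforce
  have B: "simple_pat m B" "\<not> curve_planar (pat_graph m B)"
    using assms(1) by (auto simp: nonplanar_pat_def)
  have "{i, j} \<in> pat_edges B" using assms(2) e by (intro pat_edgesI) auto
  then have "curve_planar (subdivide (pat_graph m B) i j m) \<Longrightarrow> curve_planar (pat_graph m B)"
    using curve_planar_if_curve_planar_subdivide[OF simple_graph_pat_graph[OF B(1)], of i j m]
    by simp
  then show ?thesis
    using simple_pat_subdivide_pat[OF B(1)] pat_graph_subdivide_pat[OF B(1)] assms(2) B(2)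
    by (auto simp: nonplanar_pat_def e)
qed

lemma nonplanar_pat_foldl_add_subdivision:
  assumes "\<forall>B\<in>set Bs. nonplanar_pat B"
  shows "\<forall>B\<in>set (foldl add_subdivision Bs steps). nonplanar_pat B"
  using assms
proof (induction steps arbitrary: Bs)
  case (Cons step steps)
  obtain p k where step: "step = (p, k)" by fastforce
  obtain m B where B: "Bs ! p = (m, B)" by fastforce
  have "nonplanar_pat (Suc m, subdivide_pat B (B ! k) m)" if "p < length Bs" "k < length B"
  proof (rule nonplanar_pat_subdivide_pat)
    show "nonplanar_pat (m, B)" using Cons.prems that(1) B nth_mem by metis
    show "B ! k \<in> set B" using that(2) by (rule nth_mem)
  qed
  then have "\<forall>B\<in>set (add_subdivision Bs step). nonplanar_pat B"
    using Cons.prems by (simp add: add_subdivision_def step B)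
  then show ?case using Cons.IH by simp
qed simp

lemma kuratowski_patsD:
  assumes "(m, B) \<in> set kuratowski_pats"
  shows "simple_pat m B" "\<not> curve_planar (pat_graph m B)"
proof -
  have "\<forall>B\<in>set kuratowski_pats. nonplanar_pat B"
    unfolding kuratowski_pats_def
    by (rule nonplanar_pat_foldl_add_subdivision) (simp add: nonplanar_pat_K33 nonplanar_pat_K5)
  then have "nonplanar_pat (m, B)" using assms by blast
  then show "simple_pat m B" "\<not> curve_planar (pat_graph m B)" by (simp_all add: nonplanar_pat_def)
qed

definition contains_kuratowski :: "'a ugraph \<Rightarrow> bool" where
  "contains_kuratowski G \<longleftrightarrow> (\<exists>(m, B)\<in>set kuratowski_pats. \<exists>f. graph_embedding f (pat_graph m B) G)"

lemma contains_kuratowski_embedding: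
  "contains_kuratowski H \<Longrightarrow> graph_embedding f H G \<Longrightarrow> contains_kuratowski G"
  unfolding contains_kuratowski_def using graph_embedding_comp by fastforce

lemma contains_kuratowski_del_vertex: "contains_kuratowski (del_vertex G x) \<Longrightarrow> contains_kuratowski G"
  unfolding contains_kuratowski_def
  using graph_embedding_subset[of _ _ "del_vertex G x" G] by (fastforce simp: del_vertex_def)

lemma contains_kuratowski_not_planar:
  assumes "simple_graph G" "contains_kuratowski G"
  shows "\<not> planar G"
proof
  assume "planar G"
  then have "curve_planar G" using planar_imp_curve_planar assms(1) by blast
  then show False
    using assms(2) kuratowski_patsD(2) curve_planar_embedding unfolding contains_kuratowski_def
    by blast
qed

lemma kuratowski_embedding_if_embeds:
  assumes "nth_ok kuratowski_pats b (\<lambda>(m, B). embeds n (adj_mat n Q) h m B)"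
  obtains m B where "(m, B) \<in> set kuratowski_pats"
    "graph_embedding ((!) h) (pat_graph m B) (pat_graph n Q)" "(!) h ` {..<m} = set h"
proof -
  obtain m B where B: "(m, B) \<in> set kuratowski_pats" "embeds n (adj_mat n Q) h m B"
    using nth_okD[OF assms] by auto
  have "in_range m B" by (rule simple_pat_in_range[OF kuratowski_patsD(1)[OF B(1)]])
  then have "graph_embedding ((!) h) (pat_graph m B) (pat_graph n Q)"
    by (rule embeds_sound[OF B(2)])
  moreover have "(!) h ` {..<m} = set h" using B(2) inj_listD(2)[of m n h] by (simp add: embeds_def)
  ultimately show thesis using that B(1) by blast
qed

definition subdivision_certificate :: "(nat \<times> nat list) list list" where
  "subdivision_certificate = [[(2,[0,1,2,3,4,5,6]), (2,[0,1,2,4,3,5,6]), (2,[0,1,2,5,3,4,6]),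
   (2,[1,0,2,3,4,5,6]), (2,[1,0,2,4,3,5,6]), (2,[1,0,2,5,3,4,6]), (2,[2,0,1,3,4,5,6]),
   (2,[2,0,1,4,3,5,6]), (2,[2,0,1,5,3,4,6])],
   [(13,[0,1,2,3,4,5]), (13,[0,2,1,3,4,5]), (13,[0,3,1,2,4,5]), (13,[0,4,1,2,3,5]),
    (13,[1,2,0,3,4,5]), (13,[1,3,0,2,4,5]), (13,[1,4,0,2,3,5]), (13,[2,3,0,1,4,5]),
    (13,[2,4,0,1,3,5]), (13,[3,4,0,1,2,5])],
   [(3,[0,1,2,3,4,5,6,7]), (7,[0,1,2,3,4,5,6,7]), (7,[0,1,2,3,5,4,6,7]), (7,[3,4,5,0,1,2,6,7]),
    (11,[0,1,2,3,4,5,6,7]), (11,[0,1,2,3,5,4,6,7]), (7,[3,4,5,0,2,1,6,7]), (11,[0,2,1,3,4,5,6,7]),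
    (11,[0,2,1,3,5,4,6,7]), (3,[0,1,2,3,4,5,7,6])],
   [(4,[0,1,2,3,4,5,6,7,8]), (5,[0,1,2,3,4,5,6,7,8]), (5,[0,1,2,3,5,4,6,7,8]),
    (5,[3,4,5,0,1,2,7,6,8]), (6,[0,1,2,3,4,5,6,7,8]), (6,[0,1,2,3,5,4,6,7,8]),
    (5,[3,4,5,0,2,1,7,6,8]), (6,[0,2,1,3,4,5,6,7,8]), (6,[0,2,1,3,5,4,6,7,8]),
    (4,[0,1,2,3,4,5,8,6,7]), (4,[0,1,2,3,4,5,6,8,7])],
   [],
   [],
   [],
   [(5,[0,1,2,3,4,5,6,8,7]), (5,[0,1,2,4,3,5,7,8,6]), (8,[0,1,2,3,4,5,6,7,8]),
    (9,[0,1,2,3,4,5,6,7,8]), (9,[0,1,2,4,3,5,7,6,8]), (10,[0,1,2,3,4,5,6,7,8]),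
    (9,[0,2,1,3,4,5,6,7,8]), (9,[0,2,1,4,3,5,7,6,8]), (10,[0,2,1,3,4,5,6,7,8]),
    (5,[0,1,2,3,4,5,8,6,7]), (5,[0,1,2,4,3,5,8,7,6])],
   [],
   [],
   [],
   [(6,[0,1,2,3,4,5,6,8,7]), (9,[0,1,2,4,3,5,8,6,7]), (10,[0,1,2,3,5,4,6,8,7]),
    (9,[1,0,2,3,4,5,8,7,6]), (6,[1,0,2,4,3,5,7,8,6]), (10,[1,0,2,4,5,3,7,8,6]),
    (10,[3,4,5,0,2,1,6,8,7]), (10,[4,3,5,1,2,0,7,8,6]), (12,[0,1,2,3,4,5,6,7,8]),
    (6,[0,1,2,3,4,5,8,6,7]), (6,[1,0,2,4,3,5,8,7,6])],
   [],
   [(14,[0,1,2,3,4,5,6]), (15,[0,1,2,3,4,5,6]), (15,[0,1,3,2,4,5,6]), (15,[0,1,4,2,3,5,6]),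
    (15,[1,0,2,3,4,5,6]), (15,[1,0,3,2,4,5,6]), (15,[1,0,4,2,3,5,6]), (16,[0,1,2,3,4,5,6]),
    (16,[0,1,2,4,3,5,6]), (16,[0,1,3,4,2,5,6]), (14,[0,1,2,3,4,6,5])],
   [],
   [],
   []]"

definition subdivision_ok :: "nat \<times> pattern \<Rightarrow> (nat \<times> nat list) list \<Rightarrow> bool" where
  "subdivision_ok = (\<lambda>(m, B) cs. 12 \<le> length B \<or>
     list_all2 (\<lambda>e (b, h). let M = adj_mat (Suc m) (subdivide_pat B e m) in
       nth_ok kuratowski_pats b (\<lambda>(m', B'). embeds (Suc m) M h m' B')) B cs)"

lemma kuratowski_pats_subdivision_ok:
  "list_all2 subdivision_ok kuratowski_pats subdivision_certificate"
  by code_simp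

lemma subdivide_commute: "subdivide G a b x = subdivide G b a x"
  by (auto simp: subdivide_def insert_commute)

lemma contains_kuratowski_subdivide:
  assumes B: "(m, B) \<in> set kuratowski_pats" "length B < 12" and ij: "{i, j} \<in> pat_edges B"
  shows "contains_kuratowski (subdivide (pat_graph m B) i j m)"
proof -
  have oriented: "contains_kuratowski (subdivide (pat_graph m B) i j m)"
    if mem: "(i, j) \<in> set B" for i j
  proof -
    obtain k where k: "k < length B" "B ! k = (i, j)" using mem by (metis in_set_conv_nth)
    obtain cs where "subdivision_ok (m, B) cs"
      using kuratowski_pats_subdivision_ok B(1) by (metis in_set_conv_nth list_all2_conv_all_nth)
    then have certified: "list_all2 (\<lambda>e (b, h). nth_ok kuratowski_pats b
        (\<lambda>(m', B'). embeds (Suc m) (adj_mat (Suc m) (subdivide_pat B e m)) h m' B')) B cs"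
      using B(2) by (simp add: subdivision_ok_def)
    obtain b h where "cs ! k = (b, h)" by fastforce
    then have "nth_ok kuratowski_pats b
        (\<lambda>(m', B'). embeds (Suc m) (adj_mat (Suc m) (subdivide_pat B (i, j) m)) h m' B')"
      using list_all2_nthD[OF certified k(1)] k(2) by simp
    then have "contains_kuratowski (pat_graph (Suc m) (subdivide_pat B (i, j) m))"
      by (rule kuratowski_embedding_if_embeds) (auto simp: contains_kuratowski_def)
    then show ?thesis by (simp add: pat_graph_subdivide_pat[OF kuratowski_patsD(1)[OF B(1)] mem])
  qed
  have "(i, j) \<in> set B \<or> (j, i) \<in> set B" using ij by (auto simp: pat_edges_def doubleton_eq_iff)
  then show ?thesis using oriented subdivide_commute by metis
qed

lemma contains_kuratowski_suppress:
  assumes G: "simple_graph G" and x: "x \<in> verts G" and ab: "nbrs G x = {a, b}" "a \<noteq> b"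
    and few: "card (edges G) \<le> 12" and K: "contains_kuratowski (suppress G x a b)"
  shows "contains_kuratowski G"
proof -
  let ?H = "suppress G x a b"
  obtain m B f where B: "(m, B) \<in> set kuratowski_pats" and f: "graph_embedding f (pat_graph m B) ?H"
    using K unfolding contains_kuratowski_def by blast
  have "length B = card (pat_edges B)" using card_pat_edges[OF kuratowski_patsD(1)[OF B]] ..
  also have "\<dots> \<le> card (edges ?H)"
    using graph_embedding_card_edges[OF f finite_edges[OF simple_graph_suppress[OF G ab]]] by simp
  also have "\<dots> < card (edges G)" by (rule card_edges_suppress[OF G ab])
  finally have short: "length B < 12" using few by simp
  show ?thesis
  proof (rule graph_embedding_suppress[OF G x ab(1) f, of m])
    show "contains_kuratowski G" if "graph_embedding f (pat_graph m B) G"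
      using that B unfolding contains_kuratowski_def by blast
    show "contains_kuratowski G"
      if "{i, j} \<in> edges (pat_graph m B)"
        "graph_embedding (f(m := x)) (subdivide (pat_graph m B) i j m) G" for i j
      using contains_kuratowski_embedding[OF contains_kuratowski_subdivide[OF B short] that(2)]
        that(1) by simp
  qed simp
qed

section \<open>The Petersen family\<close>

text \<open>In this order: the Petersen graph, \<open>P9\<close>, \<open>P8\<close>, \<open>K331\<close>, \<open>P7\<close>, \<open>K6\<close>, and \<open>K44\<close> minus an edge.\<close>

definition petersen_pats :: "(nat \<times> pattern) list" where
  "petersen_pats = [
   (10, [(0,1),(1,2),(2,3),(3,4),(0,4),(0,5),(1,6),(2,7),(3,8),(4,9),(5,7),(6,8),(7,9),(5,8),(6,9)]),
   (9, [(0,1),(1,2),(2,3),(0,5),(1,6),(2,7),(3,8),(4,6),(5,7),(6,8),(4,7),(5,8),(0,3),(3,4),(0,4)]),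
   (8, [(1,2),(0,4),(1,6),(2,7),(3,5),(4,6),(5,7),(3,6),(4,7),(0,2),(2,3),(0,3),(0,1),(1,5),(0,5)]),
   (7, [(1,2),(1,5),(2,6),(3,4),(4,6),(3,5),(0,2),(2,3),(0,3),(0,1),(1,4),(0,4),(0,5),(5,6),(0,6)]),
   (7, [(1,2),(0,4),(2,6),(3,5),(5,6),(4,6),(0,2),(2,3),(0,3),(0,1),(1,5),(0,5),(1,3),(3,4),(1,4)]),
   (6, [(1,2),(0,4),(3,5),(0,2),(2,3),(0,3),(0,1),(1,5),(0,5),(1,3),(3,4),(1,4),(2,4),(4,5),(2,5)]),
   (8, [(1,2),(0,4),(2,6),(3,5),(5,6),(4,6),(0,2),(2,3),(1,5),(0,5),(3,4),(1,4),(0,7),(1,7),(3,7)])]"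

definition petersen_rep :: "nat \<Rightarrow> nat ugraph" where
  "petersen_rep r = (case petersen_pats ! r of (k, R) \<Rightarrow> pat_graph k R)"

definition petersen_type :: "'a ugraph \<Rightarrow> bool" where
  "petersen_type G \<longleftrightarrow> (\<exists>r<length petersen_pats. graph_iso (petersen_rep r) G)"

lemma petersen_pats_ok:
  "list_all (\<lambda>(k, R). simple_pat k R \<and> spanning k R \<and> length R = 15) petersen_pats"
  by code_simp

lemma petersen_patsD:
  assumes "r < length petersen_pats" "petersen_pats ! r = (k, R)"
  shows "simple_pat k R" "spanning k R" "length R = 15" "petersen_rep r = pat_graph k R"
  using petersen_pats_ok nth_mem[OF assms(1)] assms(2) by (auto simp: list_all_iff petersen_rep_def)

lemma petersen_rep:
  assumes "r < length petersen_pats"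
  shows "simple_graph (petersen_rep r)" "card (edges (petersen_rep r)) = 15"
    "verts (petersen_rep r) \<subseteq> \<Union> (edges (petersen_rep r))"
proof -
  obtain k R where "petersen_pats ! r = (k, R)" by fastforce
  note R = petersen_patsD[OF assms this]
  show "simple_graph (petersen_rep r)" "card (edges (petersen_rep r)) = 15"
    using R simple_graph_pat_graph card_pat_edges by auto
  show "verts (petersen_rep r) \<subseteq> \<Union> (edges (petersen_rep r))" using R(4) spanningD[OF R(2)] by auto
qed

lemma petersen_type_edges:
  assumes "petersen_type G"
  shows "card (edges G) = 15" "verts G \<subseteq> \<Union> (edges G)"
proof -
  obtain r f where r: "r < length petersen_pats" and f: "graph_isom f (petersen_rep r) G"
    using assms by (auto simp: petersen_type_def graph_iso_iff)
  note rep = petersen_rep[OF r]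
  have G: "edges G = (`) f ` edges (petersen_rep r)" "verts G = f ` verts (petersen_rep r)"
    using f by (auto simp: graph_isom_def bij_betw_def)
  have "card (edges (petersen_rep r)) \<le> card (edges G)"
    using graph_embedding_card_edges[OF graph_isom_embedding[OF rep(1) f]]
      finite_edges[OF simple_graph_isom[OF rep(1) f]] .
  moreover have "card (edges G) \<le> card (edges (petersen_rep r))"
    unfolding G(1) by (rule card_image_le[OF finite_edges[OF rep(1)]])
  ultimately show "card (edges G) = 15" using rep(2) by simp
  show "verts G \<subseteq> \<Union> (edges G)" using rep(3) unfolding G by blast
qed

definition deletion_certificate :: "(nat \<times> nat list) list list" where
  "deletion_certificate = [[(12,[2,9,8,6,3,7,1,4,5]), (12,[3,5,9,7,4,8,2,0,6]),
   (12,[0,8,9,6,4,5,1,3,7]), (12,[0,7,6,9,1,5,4,2,8]), (12,[1,8,7,5,2,6,0,3,9]),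
   (12,[1,9,3,4,2,6,0,7,8]), (12,[0,7,3,2,4,5,1,9,8]), (12,[0,3,6,8,1,4,5,2,9]),
   (12,[0,9,2,7,1,4,5,6,3]), (12,[0,8,2,3,1,5,4,6,7])],
   [(11,[2,8,4,6,7,3,1,5]), (11,[3,4,5,7,8,0,2,6]), (11,[0,4,8,6,5,3,1,7]), (11,[1,5,4,7,6,0,2,8]),
    (11,[1,5,3,8,2,0,6,7]), (11,[2,6,0,4,3,1,7,8]), (11,[0,3,7,2,5,4,1,8]), (11,[0,3,6,8,1,4,5,2]),
    (11,[0,4,2,7,1,3,5,6])],
   [(2,[6,2,5,7,1,3,4]), (2,[3,0,7,4,2,5,6]), (2,[4,1,3,5,0,6,7]), (2,[1,0,7,4,2,5,6]),
    (16,[1,3,2,5,0,6,7]), (2,[2,0,6,4,1,3,7]), (2,[0,2,5,7,1,3,4]), (2,[0,1,3,6,2,5,4])],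
   [(0,[1,3,6,2,4,5]), (0,[0,3,6,2,4,5]), (0,[0,4,5,1,3,6]), (0,[0,1,6,2,4,5]), (0,[0,2,5,1,3,6]),
    (0,[0,2,4,1,3,6]), (0,[0,1,3,2,4,5])],
   [(0,[1,3,6,2,4,5]), (0,[0,3,6,2,4,5]), (13,[4,5,0,1,3,6]), (0,[0,1,6,2,4,5]), (13,[2,5,0,1,3,6]),
    (13,[2,4,0,1,3,6]), (0,[0,1,3,2,4,5])],
   [(1,[1,2,3,4,5]), (1,[0,2,3,4,5]), (1,[0,1,3,4,5]), (1,[0,1,2,4,5]), (1,[0,1,2,3,5]),
    (1,[0,1,2,3,4])],
   [(0,[1,3,6,2,4,5]), (0,[0,3,6,2,4,5]), (0,[0,1,3,4,5,7]), (0,[0,1,6,2,4,5]), (0,[0,1,3,2,5,7]),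
    (0,[0,1,3,2,4,7]), (0,[0,1,3,2,4,5]), (0,[0,1,3,2,4,5])]]"

definition deletion_ok ::
    "(nat \<times> pattern) list \<Rightarrow> nat \<times> pattern \<Rightarrow> (nat \<times> nat list) list \<Rightarrow> bool" where
  "deletion_ok Bs = (\<lambda>(k, R) cs. let M = adj_mat k R in
     list_all2 (\<lambda>i (b, h). \<not> List.member h i \<and> nth_ok Bs b (\<lambda>(m, B). embeds k M h m B)) [0..<k] cs)"

lemma petersen_pats_deletion_ok:
  "list_all2 (deletion_ok kuratowski_pats) petersen_pats deletion_certificate"
  by code_simp

lemma graph_embedding_del_vertex:
  assumes "graph_embedding f H G" "v \<notin> f ` verts H"
  shows "graph_embedding f H (del_vertex G v)"
  using assms unfolding graph_embedding_def del_vertex_def by fastforce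

lemma petersen_rep_del_vertex:
  assumes r: "r < length petersen_pats" and i: "i \<in> verts (petersen_rep r)"
  shows "contains_kuratowski (del_vertex (petersen_rep r) i)"
proof -
  obtain k R where kR: "petersen_pats ! r = (k, R)" by fastforce
  note R = petersen_patsD[OF r kR]
  have i: "i < k" using i R(4) by simp
  have "deletion_ok kuratowski_pats (k, R) (deletion_certificate ! r)"
    using list_all2_nthD[OF petersen_pats_deletion_ok r] kR by simp
  then have certified: "list_all2 (\<lambda>i (b, h). \<not> List.member h i \<and>
      nth_ok kuratowski_pats b (\<lambda>(m, B). embeds k (adj_mat k R) h m B)) [0..<k]
        (deletion_certificate ! r)"
    by (simp add: deletion_ok_def Let_def)
  obtain b h where "deletion_certificate ! r ! i = (b, h)" by fastforce
  then have h: "i \<notin> set h" "nth_ok kuratowski_pats b (\<lambda>(m, B). embeds k (adj_mat k R) h m B)"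
    using list_all2_nthD[OF certified, of i] i by auto
  obtain m B where B: "(m, B) \<in> set kuratowski_pats"
    and embedding: "graph_embedding ((!) h) (pat_graph m B) (pat_graph k R)"
      "(!) h ` {..<m} = set h"
    using kuratowski_embedding_if_embeds[OF h(2)] by metis
  have "graph_embedding ((!) h) (pat_graph m B) (del_vertex (pat_graph k R) i)"
    using embedding h(1) by (intro graph_embedding_del_vertex) auto
  then show ?thesis using B R(4) unfolding contains_kuratowski_def by auto
qed

lemma petersen_type_not_apex:
  assumes "petersen_type G"
  shows "\<not> apex G"
proof -
  obtain r f where r: "r < length petersen_pats" and f: "graph_isom f (petersen_rep r) G"
    using assms by (auto simp: petersen_type_def graph_iso_iff)
  note rep = petersen_rep[OF r]
  have G: "simple_graph G" by (rule simple_graph_isom[OF rep(1) f])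
  have bij: "bij_betw f (verts (petersen_rep r)) (verts G)" using f by (simp add: graph_isom_def)
  have "contains_kuratowski (del_vertex G v)" if "v \<in> verts G" for v
  proof -
    obtain i where i: "i \<in> verts (petersen_rep r)" "v = f i"
      using \<open>v \<in> verts G\<close> bij by (auto simp: bij_betw_def)
    let ?D = "del_vertex (petersen_rep r) i"
    have "graph_embedding f ?D G"
      using graph_isom_embedding[OF rep(1) f] unfolding graph_embedding_def del_vertex_def
      by (auto intro: inj_on_subset)
    moreover have "v \<notin> f ` verts ?D"
      using bij i by (auto simp: del_vertex_def bij_betw_def dest: inj_onD)
    ultimately have "graph_embedding f ?D (del_vertex G v)" by (rule graph_embedding_del_vertex)
    with petersen_rep_del_vertex[OF r i(1)] show ?thesis by (rule contains_kuratowski_embedding)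
  qed
  then have nonplanar: "\<not> planar G \<and> \<not> planar (del_vertex G v)" if "v \<in> verts G" for v
    using that contains_kuratowski_not_planar[OF G] contains_kuratowski_del_vertex
      contains_kuratowski_not_planar[OF simple_graph_del_vertex[OF G]] by metis
  have "edges G \<noteq> {}" using petersen_type_edges(1)[OF assms] by auto
  then have "verts G \<noteq> {}" using simple_graph_edgeE[OF G] by (metis all_not_in_conv)
  then show ?thesis using nonplanar unfolding apex_def by blast
qed

definition star_pat :: "nat \<Rightarrow> pattern \<Rightarrow> nat list \<Rightarrow> pattern" where
  "star_pat k R T = filter (\<lambda>(i, j). \<not> (List.member T i \<and> List.member T j)) R @ map (Pair k) T"

lemma pat_graph_star_pat:
  "pat_graph (Suc k) (star_pat k R T) = triangle_to_star (pat_graph k R) (set T) k"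
proof -
  have "pat_edges (filter (\<lambda>(i, j). \<not> (List.member T i \<and> List.member T j)) R) =
      {e \<in> pat_edges R. \<not> e \<subseteq> set T}"
    by (auto simp: pat_edges_def)
  moreover have "pat_edges (map (Pair k) T) = (\<lambda>u. {k, u}) ` set T"
    by (simp add: pat_edges_def image_image)
  ultimately show ?thesis
    by (simp add: pat_graph_def star_pat_def triangle_to_star_def lessThan_Suc)
qed

definition triangle_pat :: "pattern \<Rightarrow> nat \<Rightarrow> nat list \<Rightarrow> pattern" where
  "triangle_pat R x T = filter (\<lambda>(i, j). i \<noteq> x \<and> j \<noteq> x) R @ pairs T"

lemma pat_edges_triangle_pat:
  assumes "distinct T" "set T = nbrs (pat_graph k R) x"
  shows "pat_edges (triangle_pat R x T) = edges (star_to_triangle (pat_graph k R) x)"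
proof -
  have "pat_edges (filter (\<lambda>(i, j). i \<noteq> x \<and> j \<noteq> x) R) = {e \<in> pat_edges R. x \<notin> e}"
    by (auto simp: pat_edges_def)
  then show ?thesis using assms by (simp add: triangle_pat_def star_to_triangle_def pat_edges_pairs)
qed

lemma graph_isom_if_embeds:
  assumes P: "simple_pat m P" and embeds: "embeds n (adj_mat n Q) h m P"
    and few: "length Q \<le> length P"
  shows "graph_isom ((!) h) (pat_graph m P) \<lparr>verts = set h, edges = pat_edges Q\<rparr>"
proof (rule graph_isom_if_graph_embedding)
  have h: "inj_list m n h" using embeds by (simp add: embeds_def)
  have "graph_embedding ((!) h) (pat_graph m P) (pat_graph n Q)"
    by (rule embeds_sound[OF embeds simple_pat_in_range[OF P]])
  then show "graph_embedding ((!) h) (pat_graph m P) \<lparr>verts = set h, edges = pat_edges Q\<rparr>"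
    using inj_listD(2)[OF h] by (simp add: graph_embedding_def)
  show "finite (edges \<lparr>verts = set h, edges = pat_edges Q\<rparr>)" by (simp add: pat_edges_def)
  show "card (verts \<lparr>verts = set h, edges = pat_edges Q\<rparr>) = card (verts (pat_graph m P))"
    using h by (simp add: inj_list_def distinct_card)
  have "card (pat_edges Q) \<le> length Q"
    unfolding pat_edges_def using card_image_le[of "set Q"] card_length[of Q] order_trans by blast
  then show "card (edges \<lparr>verts = set h, edges = pat_edges Q\<rparr>) \<le> card (edges (pat_graph m P))"
    using few card_pat_edges[OF P] by simp
qed simp

definition triangles :: "nat \<Rightarrow> pattern \<Rightarrow> nat list list" where
  "triangles k R = (let M = adj_mat k R in
     concat (map (\<lambda>(i, j). map (\<lambda>l. [i, j, l]) (filter (\<lambda>l. M ! i ! l \<and> M ! j ! l) [Suc j..<k]))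
       (filter (\<lambda>(i, j). M ! i ! j) (pairs [0..<k]))))"

lemma mem_triangles_iff:
  "T \<in> set (triangles k R) \<longleftrightarrow> sorted_wrt (<) T \<and> length T = 3 \<and> set T \<subseteq> {..<k} \<and>
     {e. e \<subseteq> set T \<and> card e = 2} \<subseteq> pat_edges R"
proof (cases "length T = 3")
  case True
  then obtain i j l where T: "T = [i, j, l]" by (auto simp: length_Suc_conv numeral_3_eq_3)
  show ?thesis
  proof (cases "i < j \<and> j < l \<and> l < k")
    case True
    then have "{e. e \<subseteq> set T \<and> card e = 2} = {{i, j}, {j, l}, {i, l}}"
      using pairs_of_triple[of i j l] T by simp
    moreover have "T \<in> set (triangles k R) \<longleftrightarrow>
      adj_mat k R ! i ! j \<and> adj_mat k R ! i ! l \<and> adj_mat k R ! j ! l"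
      using True by (auto simp: triangles_def Let_def mem_pairs_upt T Suc_le_eq image_iff)
    ultimately show ?thesis using True by (auto simp: adj_mat_iff T)
  qed (auto simp: triangles_def Let_def mem_pairs_upt T)
qed (auto simp: triangles_def Let_def)

definition nabla_certificate :: "(nat \<times> nat list) list list" where
  "nabla_certificate = [[],
   [(0,[0,1,2,3,9,5,6,7,8,4])],
   [(1,[0,4,6,3,5,8,7,1,2]), (1,[0,4,7,2,3,8,6,5,1]), (1,[0,4,6,1,5,8,7,3,2]),
    (1,[0,4,6,1,2,8,7,3,5])],
   [(2,[0,3,4,6,7,5,2,1]), (2,[0,2,3,5,7,6,1,4]), (2,[0,2,3,4,7,6,1,5]), (2,[0,1,4,6,7,5,2,3]),
    (2,[0,1,4,3,7,5,2,6]), (2,[0,1,2,6,7,5,4,3]), (2,[0,1,2,6,7,4,5,3]), (2,[0,1,2,3,7,5,4,6]),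
    (2,[0,1,2,3,7,4,5,6])],
   [(2,[3,0,4,1,2,5,7,6]), (6,[0,1,2,3,4,5,6,7]), (2,[3,0,2,1,4,5,7,6]), (2,[3,0,2,1,5,4,7,6]),
    (2,[1,0,4,3,2,5,7,6]), (2,[1,0,2,3,4,5,7,6]), (2,[1,0,2,3,5,4,7,6]), (2,[0,1,4,3,2,5,7,6]),
    (2,[0,1,2,3,4,5,7,6]), (2,[0,1,2,3,5,4,7,6])],
   [(4,[3,4,0,5,1,2,6]), (4,[2,4,0,5,1,3,6]), (4,[2,3,0,5,1,4,6]), (4,[2,3,0,4,1,5,6]),
    (4,[1,4,0,5,2,3,6]), (4,[1,3,0,5,2,4,6]), (4,[1,3,0,4,2,5,6]), (4,[1,2,0,5,3,4,6]),
    (4,[1,2,0,4,3,5,6]), (4,[1,2,0,3,4,5,6]), (4,[0,4,1,5,2,3,6]), (4,[0,3,1,5,2,4,6]),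
    (4,[0,3,1,4,2,5,6]), (4,[0,2,1,5,3,4,6]), (4,[0,2,1,4,3,5,6]), (4,[0,2,1,3,4,5,6]),
    (4,[0,1,2,5,3,4,6]), (4,[0,1,2,4,3,5,6]), (4,[0,1,2,3,4,5,6]), (4,[0,1,3,2,4,5,6])],
   []]"

definition nabla_ok :: "nat \<times> pattern \<Rightarrow> nat list \<Rightarrow> nat \<times> nat list \<Rightarrow> bool" where
  "nabla_ok = (\<lambda>(k, R) T (r, h). let N = star_pat k R T; M = adj_mat (Suc k) N in
     nth_ok petersen_pats r (\<lambda>(m, P). m = Suc k \<and> length N \<le> length P \<and> embeds (Suc k) M h m P))"

lemma petersen_pats_nabla_ok:
  "list_all2 (\<lambda>(k, R). list_all2 (nabla_ok (k, R)) (triangles k R))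
    petersen_pats nabla_certificate"
  by code_simp

lemma nabla_ok_sound:
  assumes "nabla_ok (k, R) T (r, h)"
  shows "r < length petersen_pats"
    "graph_iso (petersen_rep r) (triangle_to_star (pat_graph k R) (set T) k)"
proof -
  obtain m P where P: "petersen_pats ! r = (m, P)" by fastforce
  then have r: "r < length petersen_pats" and m: "m = Suc k"
    and N: "length (star_pat k R T) \<le> length P" "embeds m (adj_mat m (star_pat k R T)) h m P"
    using assms by (auto simp: nabla_ok_def nth_ok_iff Let_def)
  show "r < length petersen_pats" by (rule r)
  have "inj_list m m h" using N(2) by (simp add: embeds_def)
  then have "set h = {..<m}" using inj_list_bij_betw inj_listD(2) by (metis bij_betw_def)
  then have "\<lparr>verts = set h, edges = pat_edges (star_pat k R T)\<rparr> =
    triangle_to_star (pat_graph k R) (set T) k"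
    unfolding pat_graph_star_pat[symmetric] by (simp add: m pat_graph_def)
  then show "graph_iso (petersen_rep r) (triangle_to_star (pat_graph k R) (set T) k)"
    using graph_isom_if_embeds[OF petersen_patsD(1)[OF r P] N(2,1)] petersen_patsD(4)[OF r P]
    unfolding graph_iso_iff by auto
qed

definition cubic_vertices :: "nat \<Rightarrow> pattern \<Rightarrow> (nat \<times> nat list) list" where
  "cubic_vertices k R = (let M = adj_mat k R in
     filter (\<lambda>(x, T). length T = 3) (map (\<lambda>x. (x, filter (\<lambda>y. M ! x ! y) [0..<k])) [0..<k]))"

lemma mem_cubic_vertices_iff:
  assumes "simple_pat k R"
  shows "(x, T) \<in> set (cubic_vertices k R) \<longleftrightarrow>
    x < k \<and> T = sorted_list_of_set (nbrs (pat_graph k R) x) \<and>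
    card (nbrs (pat_graph k R) x) = 3"
proof -
  have "filter (\<lambda>y. adj_mat k R ! x ! y) [0..<k] = sorted_list_of_set (nbrs (pat_graph k R) x)"
    if "x < k"
  proof -
    have "nbrs (pat_graph k R) x \<subseteq> {..<k}"
      using nbrs_subset[OF simple_graph_pat_graph[OF assms], of x] by auto
    then have "set (filter (\<lambda>y. adj_mat k R ! x ! y) [0..<k]) = nbrs (pat_graph k R) x"
      using adj_mat_iff[OF that] by (auto simp: nbrs_def)
    then show ?thesis
      by (metis distinct_filter distinct_upt sorted_list_of_set.idem_if_sorted_distinct
        sorted_wrt_filter sorted_upt)
  qed
  then show ?thesis
    using finite_nbrs[OF simple_graph_pat_graph[OF assms], of x]
    by (auto simp: cubic_vertices_def Let_def image_iff)
qed

definition Y_certificate :: "(nat \<times> nat list) list list" where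
  "Y_certificate = [[(1,[1,2,3,4,5,6,7,8,9]), (1,[0,4,3,2,6,5,9,8,7]), (1,[1,0,4,3,7,6,5,9,8]),
   (1,[2,1,0,4,8,7,6,5,9]), (1,[0,1,2,3,9,5,6,7,8]), (1,[0,1,2,7,8,4,6,3,9]),
   (1,[1,0,5,8,9,2,4,7,3]), (1,[2,1,0,5,9,3,6,4,8]), (1,[3,2,7,5,6,4,1,9,0]),
   (1,[4,0,1,6,7,3,5,2,8])],
   [(2,[0,2,3,4,5,6,7,8]), (2,[3,0,1,7,8,4,5,6]), (2,[0,3,4,7,1,8,2,6]), (2,[4,0,1,8,7,3,5,2]),
    (2,[4,0,3,2,6,5,1,8]), (2,[3,0,4,6,2,5,1,7])],
   [(3,[0,1,2,3,5,6,7]), (4,[0,1,2,3,4,5,7]), (4,[0,2,1,5,3,4,6])],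
   [],
   [(5,[0,1,2,3,4,5])],
   [],
   [(4,[2,4,0,5,1,3,7]), (4,[0,1,2,3,4,5,6])]]"

definition Y_ok :: "nat \<times> pattern \<Rightarrow> nat \<times> nat list \<Rightarrow> nat \<times> nat list \<Rightarrow> bool" where
  "Y_ok = (\<lambda>(k, R) (x, T) (r, h). let N = triangle_pat R x T; M = adj_mat k N in
     \<not> List.member h x \<and>
     nth_ok petersen_pats r (\<lambda>(m, P). Suc m = k \<and> length N \<le> length P \<and> embeds k M h m P))"

lemma petersen_pats_Y_ok:
  "list_all2 (\<lambda>(k, R). list_all2 (Y_ok (k, R)) (cubic_vertices k R)) petersen_pats Y_certificate"
  by code_simp

lemma Y_ok_sound:
  assumes xT: "(x, T) \<in> set (cubic_vertices k R)" and R: "simple_pat k R"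
    and ok: "Y_ok (k, R) (x, T) (r, h)"
  shows "r < length petersen_pats" "graph_iso (petersen_rep r) (star_to_triangle (pat_graph k R) x)"
proof -
  obtain m P where P: "petersen_pats ! r = (m, P)" by fastforce
  then have r: "r < length petersen_pats" and m: "Suc m = k" and x: "x \<notin> set h"
    and N: "length (triangle_pat R x T) \<le> length P"
      "embeds k (adj_mat k (triangle_pat R x T)) h m P"
    using ok by (auto simp: Y_ok_def nth_ok_iff Let_def)
  show "r < length petersen_pats" by (rule r)
  have h: "inj_list m k h" using N(2) by (simp add: embeds_def)
  have "x < k" and T: "distinct T" "set T = nbrs (pat_graph k R) x"
    using xT mem_cubic_vertices_iff[OF R] finite_nbrs[OF simple_graph_pat_graph[OF R]] by auto
  have "set h = {..<k} - {x}"
  proof (rule card_subset_eq)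
    show "set h \<subseteq> {..<k} - {x}" using inj_listD(3)[OF h] x by auto
    show "card (set h) = card ({..<k} - {x})"
      using h m \<open>x < k\<close> by (auto simp: inj_list_def distinct_card)
  qed simp
  then have "\<lparr>verts = set h, edges = pat_edges (triangle_pat R x T)\<rparr> =
    star_to_triangle (pat_graph k R) x"
    unfolding pat_edges_triangle_pat[OF T] by (simp add: star_to_triangle_def)
  then show "graph_iso (petersen_rep r) (star_to_triangle (pat_graph k R) x)"
    using graph_isom_if_embeds[OF petersen_patsD(1)[OF r P] N(2,1)] petersen_patsD(4)[OF r P]
    unfolding graph_iso_iff by auto
qed

lemma petersen_type_graph_iso: "petersen_type G \<Longrightarrow> graph_iso G H \<Longrightarrow> petersen_type H"
  unfolding petersen_type_def using graph_iso_trans by blast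

lemma petersen_rep_nabla_Y:
  assumes r: "r < length petersen_pats" and H: "nabla_Y (petersen_rep r) H"
  shows "petersen_type H"
proof -
  obtain k R where kR: "petersen_pats ! r = (k, R)" by fastforce
  note R = petersen_patsD[OF r kR]
  have simple: "simple_graph (pat_graph k R)" by (rule simple_graph_pat_graph[OF R(1)])
  obtain S v where S: "card S = 3" "{e. e \<subseteq> S \<and> card e = 2} \<subseteq> pat_edges R" and v: "\<not> v < k"
    and H_eq: "H = triangle_to_star (pat_graph k R) S v"
    using H by (auto simp: nabla_Y_iff[OF simple] R(4))
  have SV: "S \<subseteq> {..<k}" using triple_subset_verts[OF simple S(1)] S(2) by simp
  then have "finite S" using finite_subset by blast
  define T where "T = sorted_list_of_set S"
  have T: "set T = S" using \<open>finite S\<close> by (simp add: T_def)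
  then have "T \<in> set (triangles k R)" using S SV by (simp add: mem_triangles_iff T_def)
  then obtain i where i: "i < length (triangles k R)" "triangles k R ! i = T"
    by (metis in_set_conv_nth)
  obtain s h where sh: "nabla_certificate ! r ! i = (s, h)" by fastforce
  have "list_all2 (nabla_ok (k, R)) (triangles k R) (nabla_certificate ! r)"
    using list_all2_nthD[OF petersen_pats_nabla_ok r] kR by simp
  then have "nabla_ok (k, R) T (s, h)" using list_all2_nthD[OF _ i(1)] i(2) sh by metis
  note s = nabla_ok_sound[OF this]
  have "graph_isom id (pat_graph k R) (pat_graph k R)" by (simp add: graph_isom_def)
  from graph_isom_triangle_to_star[OF simple this, of S k v] SV v
  have "graph_iso (triangle_to_star (pat_graph k R) (set T) k) H"
    by (auto simp: graph_iso_iff H_eq T)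
  then show ?thesis using s graph_iso_trans unfolding petersen_type_def by blast
qed

lemma petersen_rep_Y_nabla:
  assumes r: "r < length petersen_pats" and H: "Y_nabla (petersen_rep r) H"
  shows "petersen_type H"
proof -
  obtain k R where kR: "petersen_pats ! r = (k, R)" by fastforce
  note R = petersen_patsD[OF r kR]
  obtain x where x: "x < k" "card (nbrs (pat_graph k R) x) = 3"
    and H_eq: "H = star_to_triangle (pat_graph k R) x"
    using H by (auto simp: Y_nabla_iff R(4))
  then obtain T where "(x, T) \<in> set (cubic_vertices k R)"
    by (simp add: mem_cubic_vertices_iff[OF R(1)])
  then obtain i where i: "i < length (cubic_vertices k R)" "cubic_vertices k R ! i = (x, T)"
    by (metis in_set_conv_nth)
  obtain s h where sh: "Y_certificate ! r ! i = (s, h)" by fastforce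
  have "list_all2 (Y_ok (k, R)) (cubic_vertices k R) (Y_certificate ! r)"
    using list_all2_nthD[OF petersen_pats_Y_ok r] kR by simp
  then have "Y_ok (k, R) (x, T) (s, h)" using list_all2_nthD[OF _ i(1)] i(2) sh by metis
  then show ?thesis
    using Y_ok_sound \<open>(x, T) \<in> set (cubic_vertices k R)\<close> R(1) unfolding petersen_type_def H_eq
    by blast
qed

lemma petersen_rep_0: "petersen_rep 0 = petersen_graph"
proof -
  have "pat_edges (snd (petersen_pats ! 0)) = edges petersen_graph"
  proof -
    have "{0..<5::nat} = {0, 1, 2, 3, 4}" by auto
    then show ?thesis
      by (simp add: petersen_graph_def petersen_pats_def insert_commute numeral_2_eq_2)
  qed
  then show ?thesis
    by (simp add: petersen_rep_def petersen_pats_def pat_graph_def petersen_graph_def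
      atLeast0LessThan)
qed

lemma graph_iso_refl: "graph_iso G G"
  unfolding graph_iso_iff by (intro exI[of _ id]) (simp add: graph_isom_def)

lemma petersen_family_petersen_type: "P \<in> petersen_family \<Longrightarrow> simple_graph P \<and> petersen_type P"
proof (induction rule: petersen_family.induct)
  case petersen
  have "0 < length petersen_pats" by (simp add: petersen_pats_def)
  then show ?case
    using petersen_rep(1)[of 0] graph_iso_refl unfolding petersen_type_def petersen_rep_0
    by (metis petersen_rep_0)
next
  case (nabla_Y G H)
  then obtain r where r: "r < length petersen_pats" "graph_iso (petersen_rep r) G"
    by (auto simp: petersen_type_def)
  then have iso: "graph_iso G (petersen_rep r)" using graph_iso_sym petersen_rep(1) by blast
  obtain H' where H': "nabla_Y (petersen_rep r) H'" "graph_iso H H'"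
    using nabla_Y_graph_iso[OF _ iso nabla_Y.hyps(2)] nabla_Y.IH infinite_UNIV_nat by blast
  have H: "simple_graph H" using simple_graph_nabla_Y nabla_Y by blast
  then show ?case
    using petersen_type_graph_iso[OF petersen_rep_nabla_Y[OF r(1) H'(1)]] graph_iso_sym[OF H H'(2)]
    by blast
next
  case (Y_nabla G H)
  then obtain r where r: "r < length petersen_pats" "graph_iso (petersen_rep r) G"
    by (auto simp: petersen_type_def)
  then have iso: "graph_iso G (petersen_rep r)" using graph_iso_sym petersen_rep(1) by blast
  obtain H' where H': "Y_nabla (petersen_rep r) H'" "graph_iso H H'"
    using Y_nabla_graph_iso[OF _ iso Y_nabla.hyps(2)] Y_nabla.IH by blast
  have H: "simple_graph H" using simple_graph_Y_nabla Y_nabla by blast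
  then show ?case
    using petersen_type_graph_iso[OF petersen_rep_Y_nabla[OF r(1) H'(1)]] graph_iso_sym[OF H H'(2)]
    by blast
qed

definition realized :: "nat \<Rightarrow> bool" where
  "realized r \<longleftrightarrow> r < length petersen_pats \<and> (\<exists>P\<in>petersen_family. graph_iso (petersen_rep r) P)"

lemma realized_Y_certificate:
  assumes "realized r" "(s, h) \<in> set (Y_certificate ! r)"
  shows "realized s"
proof -
  obtain k R where kR: "petersen_pats ! r = (k, R)" by fastforce
  obtain P where r: "r < length petersen_pats"
    and P: "P \<in> petersen_family" "graph_iso (petersen_rep r) P"
    using assms(1) by (auto simp: realized_def)
  note R = petersen_patsD[OF r kR]
  obtain i where i: "i < length (Y_certificate ! r)" "Y_certificate ! r ! i = (s, h)"
    using assms(2) by (metis in_set_conv_nth)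
  have certified: "list_all2 (Y_ok (k, R)) (cubic_vertices k R) (Y_certificate ! r)"
    using list_all2_nthD[OF petersen_pats_Y_ok r] kR by simp
  obtain x T where xT: "cubic_vertices k R ! i = (x, T)" by fastforce
  have len: "i < length (cubic_vertices k R)" using i(1) list_all2_lengthD[OF certified] by simp
  then have mem: "(x, T) \<in> set (cubic_vertices k R)" using xT nth_mem by metis
  have "Y_ok (k, R) (x, T) (s, h)" using list_all2_nthD[OF certified len] i(2) xT by simp
  note s = Y_ok_sound[OF mem R(1) this]
  have "Y_nabla (petersen_rep r) (star_to_triangle (pat_graph k R) x)"
    using mem by (auto simp: Y_nabla_iff R(4) mem_cubic_vertices_iff[OF R(1)])
  then obtain P' where "Y_nabla P P'" "graph_iso (star_to_triangle (pat_graph k R) x) P'"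
    using Y_nabla_graph_iso[OF petersen_rep(1)[OF r] P(2)] by metis
  then show ?thesis
    unfolding realized_def using s P(1) petersen_family.Y_nabla graph_iso_trans by blast
qed

lemma realized_nabla_certificate:
  assumes "realized r" "(s, h) \<in> set (nabla_certificate ! r)"
  shows "realized s"
proof -
  obtain k R where kR: "petersen_pats ! r = (k, R)" by fastforce
  obtain P where r: "r < length petersen_pats"
    and P: "P \<in> petersen_family" "graph_iso (petersen_rep r) P"
    using assms(1) by (auto simp: realized_def)
  note R = petersen_patsD[OF r kR]
  obtain i where i: "i < length (nabla_certificate ! r)" "nabla_certificate ! r ! i = (s, h)"
    using assms(2) by (metis in_set_conv_nth)
  have certified: "list_all2 (nabla_ok (k, R)) (triangles k R) (nabla_certificate ! r)"
    using list_all2_nthD[OF petersen_pats_nabla_ok r] kR by simp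
  define T where "T = triangles k R ! i"
  have len: "i < length (triangles k R)" using i(1) list_all2_lengthD[OF certified] by simp
  then have "T \<in> set (triangles k R)" by (simp add: T_def)
  then have "card (set T) = 3 \<and> {e. e \<subseteq> set T \<and> card e = 2} \<subseteq> pat_edges R"
    by (simp add: mem_triangles_iff strict_sorted_iff distinct_card)
  then have "nabla_Y (petersen_rep r) (triangle_to_star (pat_graph k R) (set T) k)"
    unfolding R(4) nabla_Y_iff[OF simple_graph_pat_graph[OF R(1)]]
    by (intro exI[of _ "set T"] exI[of _ k]) simp
  then obtain P' where "nabla_Y P P'" "graph_iso (triangle_to_star (pat_graph k R) (set T) k) P'"
    using nabla_Y_graph_iso[OF petersen_rep(1)[OF r] P(2) _ infinite_UNIV_nat] by metis
  moreover have "nabla_ok (k, R) T (s, h)"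
    using list_all2_nthD[OF certified len] i(2) by (simp add: T_def)
  ultimately show ?thesis
    unfolding realized_def
    using nabla_ok_sound P(1) petersen_family.nabla_Y graph_iso_trans by blast
qed

lemma realized_petersen_rep:
  assumes "r < length petersen_pats"
  shows "realized r"
proof -
  have Y: "(1, [1,2,3,4,5,6,7,8,9]) \<in> set (Y_certificate ! 0)"
    "(2, [0,2,3,4,5,6,7,8]) \<in> set (Y_certificate ! 1)"
    "(3, [0,1,2,3,5,6,7]) \<in> set (Y_certificate ! 2)"
    "(4, [0,1,2,3,4,5,7]) \<in> set (Y_certificate ! 2)"
    "(5, [0,1,2,3,4,5]) \<in> set (Y_certificate ! 4)"
    by (simp_all add: Y_certificate_def)
  have nabla: "(6, [0,1,2,3,4,5,6,7]) \<in> set (nabla_certificate ! 4)"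
    by (simp add: nabla_certificate_def)
  have "realized 0"
    using petersen_family.petersen graph_iso_refl
    by (auto simp: realized_def petersen_rep_0 petersen_pats_def)
  moreover from this have "realized 1" by (rule realized_Y_certificate[OF _ Y(1)])
  moreover from this have two: "realized 2" by (rule realized_Y_certificate[OF _ Y(2)])
  moreover from two have "realized 3" by (rule realized_Y_certificate[OF _ Y(3)])
  moreover from two have four: "realized 4" by (rule realized_Y_certificate[OF _ Y(4)])
  moreover from four have "realized 5" by (rule realized_Y_certificate[OF _ Y(5)])
  moreover from four have "realized 6" by (rule realized_nabla_certificate[OF _ nabla])
  moreover have "r \<in> {0, 1, 2, 3, 4, 5, 6}" using assms by (auto simp: petersen_pats_def)
  ultimately show ?thesis by blast
qed

lemma petersen_type_iff_petersen_family:
  assumes "simple_graph G"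
  shows "petersen_type G \<longleftrightarrow> (\<exists>P\<in>petersen_family. graph_iso G P)"
proof
  assume "petersen_type G"
  then obtain r where r: "r < length petersen_pats" "graph_iso (petersen_rep r) G"
    by (auto simp: petersen_type_def)
  obtain P where "P \<in> petersen_family" "graph_iso (petersen_rep r) P"
    using realized_petersen_rep[OF r(1)] by (auto simp: realized_def)
  moreover have "graph_iso G (petersen_rep r)"
    using graph_iso_sym[OF petersen_rep(1)[OF r(1)] r(2)] .
  ultimately show "\<exists>P\<in>petersen_family. graph_iso G P" using graph_iso_trans by blast
next
  assume "\<exists>P\<in>petersen_family. graph_iso G P"
  then obtain P where "P \<in> petersen_family" "graph_iso G P" by blast
  then show "petersen_type G"
    using petersen_family_petersen_type petersen_type_graph_iso graph_iso_sym[OF assms] by blast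
qed

section \<open>Soundness of the certificates\<close>

lemma extend_bij_betw:
  assumes "finite A" "finite B" "card A = card B" "S \<subseteq> A" "inj_on f S" "f ` S \<subseteq> B"
  obtains g where "bij_betw g A B" "\<And>x. x \<in> S \<Longrightarrow> g x = f x"
proof -
  have "card (A - S) = card (B - f ` S)"
    using assms by (simp add: card_Diff_subset card_image finite_subset)
  then obtain h where h: "bij_betw h (A - S) (B - f ` S)"
    using finite_same_card_bij assms(1,2) by (metis finite_Diff)
  define g where "g x = (if x \<in> S then f x else h x)" for x
  have "bij_betw g S (f ` S)" using assms(5) by (auto simp: g_def bij_betw_def inj_on_def)
  moreover have "bij_betw g (A - S) (B - f ` S)"
    using h bij_betw_cong[of "A - S" g h] by (simp add: g_def)
  ultimately have "bij_betw g (S \<union> (A - S)) (f ` S \<union> (B - f ` S))" by (rule bij_betw_combine) auto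
  moreover have "S \<union> (A - S) = A" "f ` S \<union> (B - f ` S) = B" using assms by auto
  ultimately show thesis using that[of g] by (simp add: g_def)
qed

lemma (in sparse_graph) extend_labelling:
  assumes "inj_on f {..<m}" "f ` {..<m} \<subseteq> verts G" "0 < m" "f 0 = v"
  obtains g where "labelling g" "\<And>i. i < m \<Longrightarrow> g i = f i"
proof -
  have "card (f ` {..<m}) \<le> card (verts G)"
    using finite_verts[OF simple] assms(2) by (rule card_mono)
  then have "m \<le> n" using assms(1) card_verts by (simp add: card_image)
  then obtain g where g: "bij_betw g {..<n} (verts G)" "\<And>i. i \<in> {..<m} \<Longrightarrow> g i = f i"
    using extend_bij_betw[of "{..<n}" "verts G" "{..<m}" f] finite_verts[OF simple] card_verts assms
    by auto
  then have "labelling g" using assms(3,4) by (simp add: labelling_def)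
  then show thesis using that g(2) by simp
qed

definition kuratowski_terminal_ok ::
    "(nat \<times> pattern) list \<Rightarrow> nat \<Rightarrow> pattern \<times> nat \<times> nat list \<Rightarrow> bool" where
  "kuratowski_terminal_ok Bs n = (\<lambda>(Q, b, h). in_range n Q \<and>
     (let M = adj_mat n Q in nth_ok Bs b (\<lambda>(m, B). embeds n M h m B)))"

definition kuratowski_certificate ::
    "nat \<Rightarrow> (point list \<times> pattern) list \<Rightarrow> (pattern \<times> nat \<times> nat list) list \<Rightarrow> proof_node list \<Rightarrow>
      bool" where
  "kuratowski_certificate n draws terms nodes \<longleftrightarrow> list_all (drawing_ok n) draws \<and>
     list_all (kuratowski_terminal_ok kuratowski_pats n) terms \<and>
     run n 24 (map snd draws) (map fst terms) nodes [([], 0, [])]"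

lemma contains_kuratowski_if_certificate:
  assumes H: "simple_graph H" "verts H \<noteq> {}" and np: "\<not> line_planar H"
    and few: "card (edges H) \<le> 12"
    and min: "\<forall>x\<in>verts H. 3 \<le> card (nbrs H x)"
    and n: "card (verts H) = n" and cert: "kuratowski_certificate n draws terms nodes"
  shows "contains_kuratowski H"
proof -
  have draws: "list_all (drawing_ok n) draws"
    and terms: "list_all (kuratowski_terminal_ok kuratowski_pats n) terms"
    and run: "run n 24 (map snd draws) (map fst terms) nodes [([], 0, [])]"
    using cert unfolding kuratowski_certificate_def by auto
  obtain v where v: "max_degree_vertex H v" using exists_max_degree_vertex[OF H] .
  interpret sparse_graph H n 24 v "map snd draws"
  proof
    fix C f assume "C \<in> set (map snd draws)" and f: "bij_betw f {..<n} (verts H)"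
    then obtain pts where "(pts, C) \<in> set draws" by auto
    then have "drawing_ok n (pts, C)" using draws by (auto simp: list_all_iff)
    then show "\<exists>(i, j)\<in>set C. {f i, f j} \<in> edges H" by (rule drawing_ok_cover[OF _ H(1) f np])
  qed (use H(1) v min few n in auto)
  have "forces Q (contains_kuratowski H)" if "Q \<in> set (map fst terms)" for Q
  proof -
    obtain b h where "(Q, b, h) \<in> set terms" using \<open>Q \<in> set (map fst terms)\<close> by auto
    then have range: "in_range n Q"
      and "nth_ok kuratowski_pats b (\<lambda>(m, B). embeds n (adj_mat n Q) h m B)"
      using terms by (auto simp: list_all_iff kuratowski_terminal_ok_def Let_def)
    from this(2) have "contains_kuratowski (pat_graph n Q)"
      by (rule kuratowski_embedding_if_embeds) (auto simp: contains_kuratowski_def)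
    then show ?thesis
      using contains_kuratowski_embedding labelling_embedding range unfolding forces_def by blast
  qed
  moreover obtain g where "labelling g"
    by (rule extend_labelling[of "\<lambda>_. v" 1])
      (use max_degree_vertexD(1)[OF v] in \<open>auto simp: lessThan_Suc\<close>)
  ultimately show ?thesis
    using run_sound[OF run, of "contains_kuratowski H" "[]" "(0, [])" g] by (simp add: holds_def)
qed

definition contract_pat :: "nat \<Rightarrow> nat \<Rightarrow> pattern \<Rightarrow> pattern" where
  "contract_pat u v Q = map (\<lambda>(i, j). (merge_vertex u v i, merge_vertex u v j))
     (filter (\<lambda>(i, j). \<not> (i = u \<and> j = v \<or> i = v \<and> j = u)) Q)"

fun petersen_terminal_ok ::
    "(nat \<times> pattern) list \<Rightarrow> nat \<Rightarrow> pattern \<times> (nat \<times> nat) option \<times> nat \<times> nat list \<Rightarrow> bool" where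
  "petersen_terminal_ok Rs n (Q, None, r, h) \<longleftrightarrow> in_range n Q \<and>
     (let M = adj_mat n Q in nth_ok Rs r (\<lambda>(m, R). embeds n M h m R))"
| "petersen_terminal_ok Rs n (Q, Some (u, v), r, h) \<longleftrightarrow> in_range n Q \<and> u \<noteq> v \<and> List.member Q (u, v) \<and>
     \<not> List.member h v \<and>
     (let M = adj_mat n (contract_pat u v Q) in nth_ok Rs r (\<lambda>(m, R). embeds n M h m R))"

lemma contract_edge_pat_graph:
  assumes "u < n" "u \<noteq> v"
  shows "contract_edge (pat_graph n Q) u v =
    \<lparr>verts = {..<n} - {v}, edges = pat_edges (contract_pat u v Q)\<rparr>"
proof -
  have "filter (\<lambda>(i, j). \<not> (i = u \<and> j = v \<or> i = v \<and> j = u)) Q = filter (\<lambda>(i, j). {i, j} \<noteq> {u, v}) Q"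
    by (intro filter_cong) (auto simp: doubleton_eq_iff)
  then have "pat_edges (contract_pat u v Q) =
    (`) (merge_vertex u v) ` pat_edges (filter (\<lambda>(i, j). {i, j} \<noteq> {u, v}) Q)"
    by (simp add: contract_pat_def pat_edges_def image_image split_beta)
  moreover have "pat_edges (filter (\<lambda>(i, j). {i, j} \<noteq> {u, v}) Q) = pat_edges Q - {{u, v}}"
    by (auto simp: pat_edges_def)
  moreover have "merge_vertex u v ` {..<n} = {..<n} - {v}"
    using assms by (auto simp: merge_vertex_def)
  ultimately show ?thesis by (simp add: contract_edge_eq)
qed

lemma graph_embedding_contract_edge:
  assumes f: "graph_embedding f B G" and uv: "{u, v} \<in> edges B"
  shows "graph_embedding f (contract_edge B u v) (contract_edge G (f u) (f v))"
proof -
  let ?r = "merge_vertex u v" and ?s = "merge_vertex (f u) (f v)"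
  have inj: "inj_on f (verts B)" and verts: "f ` verts B \<subseteq> verts G"
    and sub: "\<And>e. e \<in> edges B \<Longrightarrow> e \<subseteq> verts B" and edges: "\<And>e. e \<in> edges B \<Longrightarrow> f ` e \<in> edges G"
    using f unfolding graph_embedding_def by auto
  have uvB: "u \<in> verts B" "v \<in> verts B" using sub[OF uv] by auto
  then have commute: "f (?r x) = ?s (f x)" if "x \<in> verts B" for x
    using that inj_on_eq_iff[OF inj that uvB(2)] by (simp add: merge_vertex_def)
  have image: "f ` ?r ` X = ?s ` f ` X" if "X \<subseteq> verts B" for X
    unfolding image_image by (rule image_cong) (use commute that in auto)
  have "?r ` verts B \<subseteq> verts B" using uvB by (auto simp: merge_vertex_def)
  then have "inj_on f (?r ` verts B)" by (rule inj_on_subset[OF inj])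
  moreover have "f ` ?r ` verts B \<subseteq> ?s ` verts G"
    unfolding image[OF subset_refl] using verts by (rule image_mono)
  moreover have "f ` ?r ` e \<in> (`) ?s ` (edges G - {{f u, f v}})"
    if e: "e \<in> edges B - {{u, v}}" for e
  proof -
    have "f ` e \<noteq> f ` {u, v}" using e inj_on_image_eq_iff[OF inj sub sub[OF uv]] by blast
    then show ?thesis using e edges image[OF sub] by (auto intro!: image_eqI[of _ _ "f ` e"])
  qed
  moreover have "?r ` e \<subseteq> ?r ` verts B" if "e \<in> edges B - {{u, v}}" for e
    using sub that by (intro image_mono) auto
  ultimately show ?thesis unfolding graph_embedding_def contract_edge_eq by auto
qed

definition petersen_minor :: "'a ugraph \<Rightarrow> bool" where
  "petersen_minor G \<longleftrightarrow> (\<exists>H. is_minor H G \<and> petersen_type H)"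

lemma petersen_minor_if_embedding:
  assumes G: "simple_graph G" and r: "r < length petersen_pats"
    and f: "graph_embedding f (petersen_rep r) G"
  shows "petersen_minor G"
proof -
  define K where "K = \<lparr>verts = f ` verts (petersen_rep r), edges = (`) f ` edges (petersen_rep r)\<rparr>"
  have isom: "graph_isom f (petersen_rep r) K"
    using f by (simp add: graph_isom_def K_def bij_betw_def graph_embedding_def)
  then have "subgraph K G"
    using simple_graph_isom[OF petersen_rep(1)[OF r]] f
    by (auto simp: subgraph_def K_def graph_embedding_def)
  then have "is_minor K G" using contracts_refl unfolding is_minor_def by blast
  then show ?thesis
    using isom r unfolding petersen_minor_def petersen_type_def graph_iso_iff by blast
qed

lemma petersen_minor_if_contracted_embedding:
  assumes G: "simple_graph G" and r: "r < length petersen_pats"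
    and f: "graph_embedding f B G" and uv: "{u, v} \<in> edges B"
    and g: "graph_embedding g (petersen_rep r) (contract_edge B u v)"
  shows "petersen_minor G"
proof -
  have edge: "{f u, f v} \<in> edges G" by (rule graph_embedding_edge[OF f uv])
  have "graph_embedding (f \<circ> g) (petersen_rep r) (contract_edge G (f u) (f v))"
    by (rule graph_embedding_comp[OF g graph_embedding_contract_edge[OF f uv]])
  then have "petersen_minor (contract_edge G (f u) (f v))"
    by (rule petersen_minor_if_embedding[OF simple_graph_contract_edge(1)[OF G edge] r])
  then show ?thesis using is_minor_contract_edge[OF G edge] unfolding petersen_minor_def by blast
qed

lemma petersen_minor_if_terminal:
  assumes G: "simple_graph G" and ok: "petersen_terminal_ok petersen_pats n (Q, c, r, h)"
    and f: "graph_embedding f (pat_graph n Q) G"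
  shows "petersen_minor G"
proof -
  obtain m R where mR: "petersen_pats ! r = (m, R)" by fastforce
  have r: "r < length petersen_pats" using ok by (cases c) (auto simp: nth_ok_iff Let_def)
  note R = petersen_patsD[OF r mR]
  have embed: "graph_embedding ((!) h) (pat_graph m R) (pat_graph n P)" "(!) h ` {..<m} = set h"
    if "embeds n (adj_mat n P) h m R" for P
    using embeds_sound[OF that simple_pat_in_range[OF R(1)]] that inj_listD(2)[of m n h]
    by (simp_all add: embeds_def)
  show ?thesis
  proof (cases c)
    case None
    then have "graph_embedding ((!) h) (petersen_rep r) (pat_graph n Q)"
      using ok embed(1) mR R(4) by (auto simp: nth_ok_iff Let_def)
    then show ?thesis
      using petersen_minor_if_embedding[OF G r] graph_embedding_comp[OF _ f] by blast
  next
    case (Some uv)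
    then obtain u v where c: "c = Some (u, v)" by (cases uv) auto
    have uv: "u \<noteq> v" "(u, v) \<in> set Q" "in_range n Q" and h: "v \<notin> set h"
      and embeds: "embeds n (adj_mat n (contract_pat u v Q)) h m R"
      using ok mR by (auto simp: c nth_ok_iff Let_def)
    have "u < n" using uv(2,3) by (auto simp: in_range_def list_all_iff)
    have "graph_embedding ((!) h) (petersen_rep r) (contract_edge (pat_graph n Q) u v)"
      using embed[OF embeds] h R(4) unfolding contract_edge_pat_graph[OF \<open>u < n\<close> uv(1)]
      by (auto simp: graph_embedding_def)
    moreover have "{u, v} \<in> edges (pat_graph n Q)" using uv(2) by (auto intro: pat_edgesI)
    ultimately show ?thesis using petersen_minor_if_contracted_embedding[OF G r f] by blast
  qed
qed

definition shift_pat :: "pattern \<Rightarrow> pattern" where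
  "shift_pat P = map (\<lambda>(i, j). (Suc i, Suc j)) P"

lemma (in sparse_graph) labelling_shift_pat:
  assumes B: "in_range m B" and f: "graph_embedding f (pat_graph m B) (del_vertex G v)"
  obtains g where "labelling g" "holds g (shift_pat B)" "m < n"
proof -
  have inj: "inj_on f {..<m}" and verts: "f ` {..<m} \<subseteq> verts G - {v}"
    and edges: "\<And>e. e \<in> pat_edges B \<Longrightarrow> f ` e \<in> edges G"
    using f by (auto simp: graph_embedding_def del_vertex_def)
  have "card (f ` {..<m}) \<le> card (verts G - {v})"
    using verts finite_verts[OF simple] by (intro card_mono) auto
  then have "m < n"
    using inj max_degree_vertexD(1)[OF max_degree] finite_verts[OF simple] n_pos card_verts
    by (simp add: card_image)
  have Suc_m: "{..<Suc m} = insert 0 (Suc ` {..<m})" by (auto simp: image_iff less_Suc_eq_0_disj)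
  have "inj_on (case_nat v f) {..<Suc m}"
    unfolding Suc_m using inj verts by (auto simp: inj_on_def image_subset_iff)
  moreover have "case_nat v f ` {..<Suc m} \<subseteq> verts G"
    unfolding Suc_m
    using verts max_degree_vertexD(1)[OF max_degree] by (auto simp: image_subset_iff)
  ultimately obtain g where g: "labelling g" "\<And>i. i < Suc m \<Longrightarrow> g i = case_nat v f i"
    using extend_labelling[of "case_nat v f" "Suc m"] by auto
  have "holds g (shift_pat B)"
    unfolding holds_def
  proof
    fix e assume "e \<in> pat_edges (shift_pat B)"
    then obtain i j where ij: "(i, j) \<in> set B" "e = {Suc i, Suc j}"
      by (auto simp: pat_edges_def shift_pat_def)
    then have "i < m" "j < m" using B by (auto simp: in_range_def list_all_iff)
    then show "g ` e \<in> edges G" using edges[OF pat_edgesI, of i j] ij g(2) by simp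
  qed
  then show thesis using that g(1) \<open>m < n\<close> by blast
qed

lemma (in sparse_graph) labelling_kuratowski:
  assumes "contains_kuratowski (del_vertex G v)"
  obtains m B g where "(m, B) \<in> set kuratowski_pats" "m < n" "labelling g" "holds g (shift_pat B)"
proof -
  obtain m B f where B: "(m, B) \<in> set kuratowski_pats"
    and f: "graph_embedding f (pat_graph m B) (del_vertex G v)"
    using assms unfolding contains_kuratowski_def by blast
  obtain g where "m < n" "labelling g" "holds g (shift_pat B)"
    using labelling_shift_pat[OF simple_pat_in_range[OF kuratowski_patsD(1)[OF B]] f] by metis
  with B show thesis by (rule that)
qed

definition apex_certificate :: "nat \<Rightarrow> (point list \<times> pattern) list \<Rightarrow>
    (pattern \<times> (nat \<times> nat) option \<times> nat \<times> nat list) list \<Rightarrow> proof_node list \<Rightarrow> (nat \<times> nat list) list \<Rightarrow>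
      bool" where
  "apex_certificate n draws terms nodes roots \<longleftrightarrow>
     list_all (drawing_ok (n - 1)) draws \<and> list_all (petersen_terminal_ok petersen_pats n) terms \<and>
     (let Bs = filter (\<lambda>(m, B). m < n) kuratowski_pats in length Bs = length roots \<and>
       run n 32 (map snd draws) (map fst terms) nodes
         (map2 (\<lambda>(m, B) c. (shift_pat B, c)) Bs roots))"

lemma not_line_apex_cover:
  assumes G: "simple_graph G" and na: "\<not> line_apex G" and ok: "drawing_ok (n - 1) (pts, C)"
    and f: "bij_betw f {..<n} (verts G)" and "0 < n"
  shows "\<exists>(i, j)\<in>set C. {f i, f j} \<in> edges G"
proof -
  let ?w = "f (n - 1)"
  have n: "{..<n} = insert (n - 1) {..<n - 1}" using \<open>0 < n\<close> by auto
  then have w: "?w \<in> verts G" using f by (auto simp: bij_betw_def)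
  have "bij_betw f ({..<n} - {n - 1}) (verts G - {?w})"
    using f w \<open>0 < n\<close> by (intro bij_betw_DiffI) (auto simp: bij_betw_def)
  moreover have "{..<n} - {n - 1} = {..<n - 1}" using n by auto
  ultimately have "bij_betw f {..<n - 1} (verts (del_vertex G ?w))" by (simp add: del_vertex_def)
  moreover have "\<not> line_planar (del_vertex G ?w)" using na w unfolding line_apex_def by blast
  ultimately have "\<exists>(i, j)\<in>set C. {f i, f j} \<in> edges (del_vertex G ?w)"
    by (rule drawing_ok_cover[OF ok simple_graph_del_vertex[OF G]])
  then show ?thesis by (auto simp: del_vertex_def)
qed

lemma petersen_minor_if_certificate:
  assumes G: "simple_graph G" and na: "\<not> line_apex G" and few: "card (edges G) \<le> 16"
    and min: "\<forall>x\<in>verts G. 3 \<le> card (nbrs G x)"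
    and v: "max_degree_vertex G v"
    and K: "contains_kuratowski (del_vertex G v)"
    and n: "card (verts G) = n" and cert: "apex_certificate n draws terms nodes roots"
  shows "petersen_minor G"
proof -
  have "0 < n"
    using max_degree_vertexD(1)[OF v] finite_verts[OF G] by (auto simp: n[symmetric] card_gt_0_iff)
  define Bs where "Bs = filter (\<lambda>(m, B). m < n) kuratowski_pats"
  let ?roots = "map2 (\<lambda>(m, B) c. (shift_pat B, c)) Bs roots"
  have draws: "list_all (drawing_ok (n - 1)) draws"
    and terms: "list_all (petersen_terminal_ok petersen_pats n) terms"
    and length: "length Bs = length roots"
      and run: "run n 32 (map snd draws) (map fst terms) nodes ?roots"
    using cert unfolding apex_certificate_def Bs_def Let_def by auto
  interpret sparse_graph G n 32 v "map snd draws"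
  proof
    fix C f assume "C \<in> set (map snd draws)" and f: "bij_betw f {..<n} (verts G)"
    then obtain pts where "(pts, C) \<in> set draws" by auto
    then have "drawing_ok (n - 1) (pts, C)" using draws by (auto simp: list_all_iff)
    then show "\<exists>(i, j)\<in>set C. {f i, f j} \<in> edges G"
      by (rule not_line_apex_cover[OF G na _ f \<open>0 < n\<close>])
  qed (use G v min few n in auto)
  have forces: "forces Q (petersen_minor G)" if "Q \<in> set (map fst terms)" for Q
  proof -
    obtain c r h where "(Q, c, r, h) \<in> set terms" using \<open>Q \<in> set (map fst terms)\<close> by auto
    then have ok: "petersen_terminal_ok petersen_pats n (Q, c, r, h)"
      using terms by (auto simp: list_all_iff)
    then have "in_range n Q" by (cases c) auto
    then show ?thesis
      using petersen_minor_if_terminal[OF G ok] labelling_embedding unfolding forces_def by blast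
  qed
  obtain m B g where B: "(m, B) \<in> set kuratowski_pats" "m < n"
    and g: "labelling g" "holds g (shift_pat B)"
    using labelling_kuratowski[OF K] by metis
  have "(m, B) \<in> set Bs" using B by (simp add: Bs_def)
  then obtain k where k: "k < length Bs" "Bs ! k = (m, B)" by (metis in_set_conv_nth)
  then have "?roots ! k = (shift_pat B, roots ! k)" "k < length ?roots" using length by simp_all
  then have "(shift_pat B, roots ! k) \<in> set ?roots" by (metis nth_mem)
  then show ?thesis using run_sound[OF run _ _ g] forces by blast
qed

section \<open>The certificates\<close>

fun adj_from :: "nat \<Rightarrow> nat list list \<Rightarrow> pattern" where
  "adj_from i [] = []"
| "adj_from i (js # rs) = map (Pair i) js @ adj_from (Suc i) rs"

definition adj :: "nat list list \<Rightarrow> pattern" where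
  "adj = adj_from 0"

lemma kuratowski_certificate_4: "kuratowski_certificate 4
    [([(1,0),(3,0),(0,2),(1,1)], adj [])]
    []
    [(adj [], Cover 0 [0,1,3,2], [])]"
  by code_simp

lemma kuratowski_certificate_5: "kuratowski_certificate 5
    [([(0,0),(1,1),(2,1),(3,0),(1,3)], adj [[2]])]
    [(adj [[1,2,3,4],[2,3,4],[3,4],[4]], 1, [0,1,2,3,4])]
    [(adj [[1,2,3,4],[2,3],[3,4],[4]], Cover 0 [4,2,1,3,0], [(0,[])]),
     (adj [[1,2,3,4],[3],[3,4],[4]], Cover 0 [1,4,2,0,3], [(0,[])]),
     (adj [[1,2,3,4],[],[3,4],[4]], Cover 0 [1,0,3,2,4], [(0,[])]),
     (adj [[1,3,4],[],[3,4],[4]], Cover 0 [0,4,2,1,3], [(0,[])]),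
     (adj [[1,3,4],[],[3],[4]], Cover 0 [2,1,4,3,0], [(0,[])]),
     (adj [[1,3,4],[],[3]], Cover 0 [4,0,3,2,1], [(0,[])]),
     (adj [[1,3],[],[3]], Cover 0 [0,1,4,2,3], [(0,[])]),
     (adj [[1],[],[3]], Cover 0 [0,1,3,4,2], [(0,[])]),
     (adj [[],[],[3]], Cover 0 [1,3,0,4,2], [(0,[])]),
     (adj [], Cover 0 [2,4,3,0,1], [(0,[])])]"
  by code_simp

lemma kuratowski_certificate_6: "kuratowski_certificate 6
    [([(0,0),(5,2),(2,3),(1,3),(1,1),(0,4)], adj [[2,3],[3]]),
     ([(0,0),(4,1),(2,2),(1,4),(1,2),(2,1)], adj [[2],[4],[],[5]])]
    [(adj [[1,2,3,5],[2,3,4],[3,4],[4],[5]], 13, [0,4,1,2,3,5]),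
     (adj [[1,2,3,4],[2,3,4],[3,4],[5],[5]], 13, [3,4,0,1,2,5]),
     (adj [[3,4,5],[3,4,5],[3,4,5]], 0, [0,1,2,3,4,5]),
     (adj [[1,2,3,4],[2,3,4],[3,4],[4]], 1, [0,1,2,3,4])]
    [(adj [[1,2,3,4],[2,3,4,5],[3,4,5]], At 5, [(2,[])]),
     (adj [[1,2,3,4],[2,3,4,5],[3,4],[5]], Cover 0 [5,3,2,4,1,0], []),
     (adj [[1,2,3,4],[2,3,4,5],[3,4]], Cover 0 [3,2,4,5,1,0], [(0,[]),(1,[])]),
     (adj [[1,2,3,4],[2,3,4],[3,4],[5]], Cover 0 [4,2,3,5,0,1], [(4,[]),(0,[0,2,1])]),
     (adj [[1,2,3,4],[2,3,4],[3,4]], Cover 0 [3,1,4,5,2,0], [(7,[]),(0,[]),(1,[])]),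
     (adj [[1,2,3],[2,3,4],[3,4],[4,5]], Cover 0 [4,2,0,5,1,3], []),
     (adj [[1,2,3],[2,3,4],[3,4],[4],[5]], Cover 0 [5,4,1,0,2,3], [(6,[])]),
     (adj [[1,2,3],[2,3,4],[3,4],[4]], Cover 0 [4,3,0,5,2,1], [(2,[]),(0,[]),(1,[])]),
     (adj [[1,2,3,5],[2,3,4],[3,4],[],[5]], Cover 0 [4,5,0,3,2,1], [(3,[]),(0,[]),(10,[0,3,4,1,2])]),
     (adj [[1,2,3],[2,3,4],[3,4],[],[5]], Cover 0 [4,5,3,0,2,1], [(1,[]),(4,[]),(0,[])]),
     (adj [[1,2,3],[2,3,4],[3,4]], At 4, [(5,[]),(2,[]),(0,[])]),
     (adj [[1,2,3],[2,3,4],[3,5]], Cover 0 [3,1,4,5,0,2], [(0,[0,1,3,2]),(0,[0,2,3,1,5,4]),(0,[0,1,2,3,5,4])]),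
     (adj [[1,2,3],[2,3,4],[3]], Cover 0 [2,3,5,4,0,1], [(0,[]),(1,[]),(1,[0,1,3,2])]),
     (adj [[1,2,3],[2,4,5],[3,5],[4,5]], Cover 1 [0,4,5,1,2,3], [(0,[0,1,2,5,4,3]),(15,[0,4,5,3,1,2])]),
     (adj [[1,2,3],[2,4,5],[3,5],[4]], Cover 0 [3,0,1,5,2,4], [(1,[]),(0,[]),(1,[0,1,2,5,4,3])]),
     (adj [[1,2,3],[2,4],[3,5],[4],[5]], At 5, [(17,[0,2,4,3,1]),(0,[]),(0,[0,3,2,1])]),
     (adj [[1,2,3],[2,4],[3,5],[4]], Cover 0 [5,3,4,1,2,0], [(0,[]),(1,[]),(3,[])]),
     (adj [[1,2,3],[2,4],[3],[4,5]], Cover 1 [4,5,0,3,2,1], [(0,[0,2,3,4,1]),(0,[]),(4,[])]),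
     (adj [[1,2,3],[2,4],[3],[4]], Cover 0 [3,2,1,5,0,4], [(5,[]),(0,[]),(1,[])]),
     (adj [[1,2,3],[2,4],[3],[5]], Cover 0 [1,4,5,3,2,0], [(0,[0,1,2,3,5,4]),(6,[]),(0,[])]),
     (adj [[1,2,3],[2,4],[3]], At 3, [(7,[]),(1,[]),(0,[])]),
     (adj [[1,2,3],[2,4,5],[4],[4,5]], Cover 0 [5,3,0,2,1,4], [(0,[0,1,5,3,4,2]),(23,[0,4,5,3,1,2]),(0,[])]),
     (adj [[1,2,3],[2,4,5],[4],[5]], At 3, [(1,[0,2,1]),(1,[]),(0,[])]),
     (adj [[1,2,3],[2,4,5],[4]], Cover 0 [5,4,3,0,2,1], [(0,[]),(2,[0,2,1,5,4,3]),(2,[0,1,2,4,5,3])]),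
     (adj [[1,2,3],[2,4],[4]], Cover 0 [1,2,5,3,0,4], [(0,[]),(3,[0,2,1]),(3,[])]),
     (adj [[1,2,3],[2,4],[5]], Cover 0 [0,2,5,4,1,3], [(4,[0,1,2,5,4,3]),(4,[0,2,1,4,5,3]),(0,[])]),
     (adj [[1,2,3],[2,4]], At 2, [(5,[]),(1,[]),(0,[])]),
     (adj [[1,2,3],[4,5],[4,5],[4]], At 3, [(0,[0,1,3,2]),(0,[0,2,3,1]),(29,[0,4,5,3,1,2])]),
     (adj [[1,2,3],[4,5],[4,5]], Cover 0 [4,1,0,3,5,2], [(1,[0,4,2,3,1]),(0,[]),(1,[0,1,3,2])]),
     (adj [[1,2,3],[4,5],[4]], At 2, [(2,[]),(2,[0,2,3,1]),(0,[])]),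
     (adj [[1,2,3],[4,5]], Cover 1 [2,0,4,1,5,3], [(0,[]),(3,[0,1,5,3,4,2]),(3,[0,1,3,2])]),
     (adj [[1,2,3],[4]], At 1, [(4,[]),(4,[0,1,3,2]),(0,[])]),
     (adj [[1,2,3]], Cover 0 [1,3,5,4,2,0], [(0,[0,1,2,3,5,4]),(0,[]),(0,[0,3,2,1])]),
     (adj [[1,2]], At 0, [(0,[]),(0,[0,1,2,4,3]),(0,[0,1,2,5,4,3])]),
     (adj [[1]], At 0, [(0,[]),(0,[0,1,3,2]),(0,[0,1,4,3,2]),(0,[0,1,5,3,4,2])]),
     (adj [], At 0, [(0,[]),(0,[0,2,1]),(0,[0,3,2,1]),(0,[0,4,2,3,1]),(0,[0,5,2,3,4,1])])]"
  by code_simp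

lemma kuratowski_certificate_7: "kuratowski_certificate 7
    [([(1,2),(1,1),(7,1),(3,4),(1,5),(2,2),(0,7)], adj [[2,3,4],[3,4],[4]]),
     ([(3,4),(1,0),(6,0),(5,1),(5,2),(4,7),(4,1)], adj [[2,3,4],[3,4],[],[5]]),
     ([(1,1),(0,0),(5,0),(2,2),(0,5),(1,2),(2,1)], adj [[2,3,4],[3],[5],[],[6]])]
    [(adj [[1,3,6],[2,4],[3,6],[4],[6]], 0, [0,2,4,1,3,6]),
     (adj [[1,3,5],[2,4],[3,6],[4],[6],[6]], 2, [0,2,4,6,1,3,5]),
     (adj [[1,3,6],[2,5],[3,6],[4],[5],[6]], 2, [3,1,6,5,0,2,4])]
    [(adj [[1,2,3],[2,3,5],[3,6]], Cover 1 [3,2,6,4,5,1,0], []),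
     (adj [[1,2,3],[2,3,5],[3],[5]], Cover 1 [2,3,5,4,6,1,0], []),
     (adj [[1,2,3],[2,3,5],[3]], Cover 1 [6,4,2,3,1,5,0], [(1,[]),(1,[0,1,3,2]),(1,[0,1,3,2,6,5,4]),(0,[])]),
     (adj [[1,2,3,4,5],[2,4,5],[3],[4]], Cover 1 [4,3,2,6,5,1,0], []),
     (adj [[1,2,3,4,6],[2,4,5],[3],[4]], Cover 1 [5,6,0,3,4,1,2], []),
     (adj [[1,2,3,4],[2,4,5],[3,6],[4]], Cover 1 [5,6,4,3,0,1,2], []),
     (adj [[1,2,3,4],[2,4,5],[3],[4]], Cover 2 [6,4,0,2,1,5,3], [(1,[]),(0,[]),(2,[])]),
     (adj [[1,2,3],[2,4,5],[3,4],[4]], Cover 1 [6,5,1,4,2,0,3], []),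
     (adj [[1,2,3,5],[2,4,5],[3,6],[4],[5]], At 6, []),
     (adj [[1,2,3,5],[2,4,5],[3],[4],[5]], Cover 2 [2,1,4,6,5,0,3], [(0,[])]),
     (adj [[1,2,3],[2,4,5],[3],[4],[5,6]], Cover 0 [3,2,1,5,6,0,4], []),
     (adj [[1,2,3],[2,4,5],[3,6],[4],[5],[6]], At 6, [(13,[])]),
     (adj [[1,2,3],[2,4,5],[3],[4],[5],[6]], Cover 2 [2,1,5,6,4,3,0], [(0,[]),(5,[])]),
     (adj [[1,2,3],[2,4,5],[3],[4],[5]], Cover 2 [6,0,4,5,1,2,3], [(2,[]),(0,[]),(3,[])]),
     (adj [[1,2,3,5],[2,4,5],[3,6],[4],[6]], At 6, [(15,[])]),
     (adj [[1,2,3,5],[2,4,5],[3],[4],[6]], Cover 2 [2,3,6,5,4,1,0], [(0,[]),(12,[0,1,2,5,3,4]),(8,[0,1,2,3,5,4])]),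
     (adj [[1,2,3,6],[2,4,5],[3],[4],[6],[6]], Cover 0 [3,2,1,5,6,0,4], [(17,[0,1,4,6,5,2,3]),(18,[0,1,4,3,2])]),
     (adj [[1,2,3,6],[2,4,5],[3],[4],[6]], At 6, [(17,[]),(3,[0,3,2,1,4,6,5]),(0,[])]),
     (adj [[1,2,3],[2,4,5],[3,6],[4],[6]], Cover 0 [0,3,4,6,5,1,2], [(18,[]),(2,[])]),
     (adj [[1,2,3],[2,4,5],[3],[4],[6]], Cover 2 [6,5,1,0,2,3,4], [(1,[]),(0,[]),(3,[])]),
     (adj [[1,2,3],[2,4,5],[3],[4]], At 4, [(13,[]),(12,[]),(6,[]),(0,[])]),
     (adj [[1,2,3,5,6],[2,5,6],[3],[4],[6]], At 4, [(23,[0,5,1,2,3,4])]),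
     (adj [[1,2,3,5,6],[2,5,6],[3],[4]], Cover 0 [6,1,2,3,4,0,5], [(0,[])]),
     (adj [[1,2,3,6],[2,5,6],[3],[4]], Cover 2 [3,0,6,5,1,2,4], [(2,[0,1,2,3,6,5,4]),(2,[0,3,2,1,5,4]),(0,[]),(20,[0,1,2,6,4,5,3])]),
     (adj [[1,2,3],[2,5,6],[3,5],[4],[5]], Cover 2 [3,4,5,1,6,0,2], []),
     (adj [[1,2,3],[2,5,6],[3],[4],[5]], Cover 2 [3,0,1,6,5,4,2], [(4,[0,1,2,3,6,5,4]),(4,[0,3,2,1,5,4]),(1,[]),(0,[])]),
     (adj [[1,2,3],[2,5,6],[3],[4]], Cover 1 [6,1,0,4,3,5,2], [(2,[]),(0,[0,1,2,3,4,6,5]),(5,[0,1,2,3,6,5,4]),(0,[])]),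
     (adj [[1,2,3,6],[2,5],[3],[4],[5,6]], Cover 2 [1,5,4,3,6,0,2], [(6,[]),(24,[]),(0,[]),(6,[0,3,2,1,5,4]),(0,[0,4,3,2,1]),(29,[0,3,2,1,5,4])]),
     (adj [[1,2,3],[2,5],[3],[4],[5,6]], Cover 0 [6,4,3,0,1,5,2], [(1,[0,3,2,1,5,4]),(0,[]),(1,[]),(1,[0,4,3,2,1]),(7,[]),(25,[])]),
     (adj [[1,2,3],[2,5],[3],[4],[5]], Cover 0 [6,3,4,5,1,2,0], [(0,[]),(0,[0,3,2,1,5,4]),(2,[]),(8,[0,3,2,1,5,4]),(26,[]),(8,[])]),
     (adj [[1,2,3],[2,5],[3],[4]], Cover 0 [1,5,6,4,3,0,2], [(3,[]),(9,[]),(27,[]),(0,[]),(9,[0,3,2,1,5,4]),(3,[0,3,2,1,5,4])]),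
     (adj [[1,2,3],[2,5],[3,4],[5],[5,6]], Cover 1 [3,0,1,6,4,2,5], [(0,[0,1,2,3,6,5,4]),(32,[0,1,2,3,5,6,4]),(31,[0,1,2,3,5,6,4])]),
     (adj [[1,2,3],[2,5],[3,4],[5],[5]], Cover 2 [6,5,3,2,4,1,0], [(1,[0,1,2,3,6,5,4]),(0,[]),(32,[0,1,2,3,5,6,4])]),
     (adj [[1,2,3],[2,5],[3,4],[5],[6],[6]], At 6, [(35,[0,1,5,6,4,2,3]),(2,[0,1,2,3,5,6,4]),(2,[0,1,2,3,6,5,4])]),
     (adj [[1,2,3],[2,5],[3,4],[5],[],[6]], Cover 1 [5,6,0,4,2,3,1], [(3,[0,2,1,5,3,4]),(1,[]),(0,[]),(3,[])]),
     (adj [[1,2,3],[2,5],[3,4],[5]], At 5, [(4,[0,2,1,5,3,4]),(2,[]),(0,[])]),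
     (adj [[1,2,3],[2,5],[3],[5]], Cover 0 [4,6,3,2,1,0,5], [(5,[]),(0,[]),(5,[0,3,2,1]),(0,[0,1,2,3,6,5,4]),(5,[0,1,2,3,5,6,4]),(33,[])]),
     (adj [[1,2,3],[2,5],[3]], At 3, [(34,[]),(6,[]),(0,[]),(6,[0,1,2,3,6,5,4])]),
     (adj [[1,2,3,6],[2,5],[4,5],[4,5],[6]], Cover 1 [1,5,3,6,4,2,0], [(40,[0,2,4,3,5,1]),(40,[0,3,4,2,1])]),
     (adj [[1,2,3],[2,5],[4,5],[4,5],[6]], Cover 1 [1,2,4,6,3,0,5], [(41,[0,2,5,1,6,4,3]),(0,[])]),
     (adj [[1,2,3],[2,5],[4,5],[4,5]], Cover 2 [4,5,1,0,6,3,2], [(40,[0,1,4,3,5,6,2]),(2,[0,1,2,4,3]),(0,[]),(2,[0,1,5,3,4,2])]),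
     (adj [[1,2,3],[2,5,6],[4],[4,5,6],[5]], Cover 1 [6,0,2,4,5,1,3], []),
     (adj [[1,2,3],[2,5,6],[4],[4,5],[5]], Cover 2 [3,5,1,2,6,4,0], [(0,[]),(4,[0,2,1,6,3,4,5])]),
     (adj [[1,2,3],[2,5],[4],[4,5],[5,6],[6]], At 6, [(45,[0,3,4,2,1])]),
     (adj [[1,2,3],[2,5],[4],[4,5],[5],[6]], Cover 2 [2,1,5,3,6,0,4], [(1,[0,2,1,3,5,4]),(0,[])]),
     (adj [[1,2,3],[2,5],[4],[4,5],[5]], Cover 1 [1,2,4,6,3,5,0], [(4,[0,2,1,3,5,4]),(2,[]),(7,[0,3,1,2]),(2,[0,2,1,3,5,4]),(7,[]),(0,[])]),
     (adj [[1,2,3],[2,5],[4],[4,5],[6],[6]], Cover 2 [5,1,2,4,0,3,6], [(5,[]),(0,[]),(8,[0,1,5,3,4,2]),(5,[0,2,1,3,5,4]),(8,[]),(48,[0,3,4,2,1])]),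
     (adj [[1,2,3],[2,5],[4],[4,5],[],[6]], At 4, [(9,[0,1,2,4,3]),(6,[0,2,1,3,5,4]),(1,[]),(0,[])]),
     (adj [[1,2,3],[2,5],[4],[4,5]], At 5, [(10,[0,1,5,3,4,2]),(7,[]),(2,[]),(0,[])]),
     (adj [[1,2,3],[2,5],[4,5],[4,6],[],[6]], Cover 1 [1,2,4,3,6,5,0], [(51,[0,1,4,3,6,5,2]),(0,[0,1,2,3,4,6,5])]),
     (adj [[1,2,3],[2,5],[4],[4,6],[5],[6]], Cover 2 [5,4,3,0,2,1,6], [(1,[]),(12,[0,2,1,5,3,4]),(0,[]),(12,[0,1,2,4,3]),(12,[0,2,1,3,5,4]),(51,[0,2,4,3,6,1,5])]),
     (adj [[1,2,3],[2,5],[4],[4,6],[],[6]], At 5, [(13,[0,2,1,5,3,4]),(1,[]),(2,[]),(0,[])]),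
     (adj [[1,2,3],[2,5],[4],[4,6]], Cover 1 [5,1,0,3,6,2,4], [(14,[0,2,1,5,3,4]),(3,[]),(0,[]),(14,[0,2,1,3,5,4]),(3,[0,1,2,3,4,6,5]),(14,[])]),
     (adj [[1,2,3],[2,5],[4],[4]], At 3, [(15,[0,2,1,3,5,4]),(15,[]),(4,[]),(0,[])]),
     (adj [[1,2,3],[2,5],[4],[6]], At 3, [(16,[0,2,1,3,5,4]),(16,[]),(0,[]),(0,[0,2,1,3,5,4])]),
     (adj [[1,2,3],[2,5],[4]], At 3, [(17,[0,2,1,3,5,4]),(17,[]),(1,[]),(1,[0,2,1,3,5,4]),(0,[])]),
     (adj [[1,2,3,4],[2,5],[5],[],[5],[6]], Cover 2 [3,4,5,1,2,0,6], [(18,[0,2,1]),(18,[]),(18,[0,2,1,4,3]),(0,[0,1,2,3,6,5,4])]),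
     (adj [[1,2,3,4],[2,5],[5],[],[],[6]], Cover 1 [4,3,5,2,1,6,0], [(0,[]),(19,[0,1,2,4,3]),(19,[0,2,1,4,3]),(19,[]),(19,[0,2,1]),(1,[0,1,2,3,6,5,4])]),
     (adj [[1,2,3,4],[2,5],[5]], Cover 1 [2,1,4,6,3,5,0], [(20,[0,1,2,4,3]),(2,[0,1,2,3,6,5,4]),(20,[]),(2,[0,1,2,3,5,6,4]),(20,[0,2,1]),(0,[])]),
     (adj [[1,2,3],[2,5],[5]], Cover 1 [6,4,2,1,0,3,5], [(3,[0,1,2,3,6,5,4]),(3,[0,1,2,3,5,6,4]),(0,[0,1,2,3,6,5,4]),(3,[0,2,1]),(0,[]),(21,[0,2,1])]),
     (adj [[1,2,3],[2,5]], At 2, [(22,[]),(4,[]),(0,[]),(4,[0,1,2,3,6,5,4])]),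
     (adj [[1,2,3],[4,5,6],[4,5],[4,6],[5]], Cover 0 [3,6,1,5,2,4,0], []),
     (adj [[1,2,3],[4,5],[4,5],[4,6],[5]], Cover 0 [1,5,2,6,3,0,4], [(0,[]),(64,[0,1,4,3,6,5,2])]),
     (adj [[1,2,3],[4,5],[4,5],[4,6]], At 5, [(2,[0,1,5,3,2,4]),(63,[0,1,4,3,5,6,2]),(0,[]),(65,[0,1,4,3,6,5,2])]),
     (adj [[1,2,3],[4,5],[4,5],[4]], At 3, [(3,[0,1,3,2]),(3,[0,2,3,1]),(64,[0,1,4,3,5,6,2]),(0,[])]),
     (adj [[1,2,3],[4,5],[4,5],[6]], At 3, [(4,[0,1,3,2]),(4,[0,2,3,1]),(0,[]),(0,[0,1,2,3,5,4])]),
     (adj [[1,2,3],[4,5],[4,5]], At 3, [(5,[0,1,3,2]),(5,[0,2,3,1]),(1,[]),(1,[0,1,2,3,5,4]),(0,[])]),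
     (adj [[1,2,3],[4,5],[5,6],[5]], At 3, [(6,[0,1,3,2]),(6,[0,2,3,1]),(0,[0,1,3,2]),(0,[0,2,3,1,5,6,4])]),
     (adj [[1,2,3],[4,5],[5,6]], Cover 2 [1,4,6,2,3,0,5], [(1,[0,1,2,3,5,6,4]),(7,[]),(7,[0,1,3,2]),(1,[]),(7,[0,2,6,3,4,5,1]),(0,[])]),
     (adj [[1,2,3],[4,5],[5]], At 2, [(8,[]),(8,[0,2,3,1]),(2,[]),(0,[])]),
     (adj [[1,2,3],[4,5]], Cover 1 [5,4,2,3,0,1,6], [(0,[]),(0,[0,1,3,2]),(9,[0,1,5,3,2,4]),(0,[0,1,3,2,5,4]),(9,[0,1,4,3,2]),(9,[0,1,3,2])]),
     (adj [[1,2,3],[5]], At 1, [(10,[]),(10,[0,1,3,2]),(0,[]),(0,[0,1,2,3,5,6,4])]),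
     (adj [[1,2,3]], Cover 1 [2,3,4,5,6,1,0], [(0,[0,2,1,3,5,4]),(0,[0,2,1]),(0,[0,2,1,3,4,6,5]),(0,[0,3,2,1]),(0,[0,3,2,1,4,6,5]),(0,[])]),
     (adj [[1,2]], At 0, [(0,[]),(0,[0,1,2,4,3]),(0,[0,1,2,5,4,3]),(0,[0,1,2,6,4,5,3])]),
     (adj [[1]], At 0, [(0,[]),(0,[0,1,3,2]),(0,[0,1,4,3,2]),(0,[0,1,5,3,4,2]),(0,[0,1,6,3,4,5,2])]),
     (adj [], At 0, [(0,[]),(0,[0,2,1]),(0,[0,3,2,1]),(0,[0,4,2,3,1]),(0,[0,5,2,3,4,1]),(0,[0,6,2,3,4,5,1])])]"
  by code_simp

lemma kuratowski_certificate_8: "kuratowski_certificate 8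
    [([(2,4),(1,4),(0,0),(7,1),(4,2),(5,3),(0,9),(3,2)], adj [[2,3,4,5],[3,4,5],[4,5],[],[6]]),
     ([(2,3),(1,0),(10,0),(6,2),(4,4),(4,5),(2,10),(3,3)], adj [[2,3,4,5],[3,4,5],[4],[6],[6]]),
     ([(1,1),(0,0),(6,0),(3,2),(2,3),(2,5),(1,2),(3,1)], adj [[2,3,4,5],[3,4],[4,6],[6],[],[7]]),
     ([(2,3),(2,2),(0,0),(7,0),(4,3),(5,3),(3,7),(3,2)], adj [[3,4,5],[3,4,5,6],[4,5],[],[],[7]])]
    [(adj [[1,4,5],[2,3],[4,5],[6,7],[6],[7]], 7, [3,0,2,4,5,1,6,7]),
     (adj [[1,4,5],[2,3],[4,7],[5,6],[6],[7]], 11, [2,3,0,5,4,1,7,6]),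
     (adj [[1,4,5],[2,3],[4,6],[4,6],[],[7],[7]], 3, [0,2,3,6,1,4,7,5]),
     (adj [[1,4,5],[2,3],[4,6],[4,7],[],[6],[7]], 7, [6,1,4,0,3,2,5,7]),
     (adj [[1,4,5],[2,3],[4,6],[4,6],[],[6]], 2, [0,2,3,6,1,4,5]),
     (adj [[1,4,5],[2,3],[4,5],[4,6],[],[7],[7]], 3, [3,0,2,5,1,4,7,6]),
     (adj [[1,4,5],[2,3],[4,5],[4,6],[],[6]], 2, [3,0,2,5,1,4,6]),
     (adj [[1,4,5],[2,3],[4,5],[4,5]], 0, [0,2,3,1,4,5]),
     (adj [[1,2,4],[3],[5],[6,7],[6,7],[6,7]], 7, [0,6,7,3,5,4,1,2])]
    [(adj [[1,2,3],[2,3],[4],[7]], Cover 3 [5,6,7,2,1,0,3,4], []),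
     (adj [[1,2,3],[2,3],[4]], Cover 3 [6,7,4,2,1,0,3,5], [(0,[])]),
     (adj [[1,2,3],[2,3]], Cover 3 [2,0,1,7,4,5,6,3], [(0,[0,1,2,3,7,5,6,4]),(0,[]),(0,[0,1,2,3,5,4]),(0,[0,1,3,2,5,4])]),
     (adj [[1,2,4],[2,3],[3],[5]], Cover 1 [0,1,3,7,6,5,2,4], []),
     (adj [[1,2,4],[2,3],[3]], Cover 3 [7,5,4,0,2,1,3,6], [(0,[])]),
     (adj [[1,2,4],[2,3],[5],[6,7],[7],[6,7]], At 6, [(13,[])]),
     (adj [[1,2,4],[2,3],[5],[6],[7],[6,7]], Cover 0 [7,6,3,1,2,0,4,5], [(0,[])]),
     (adj [[1,2,4],[2,3],[5],[],[7],[6,7]], Cover 0 [0,1,3,7,5,6,4,2], [(0,[])]),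
     (adj [[1,2,4],[2,3],[5],[],[7],[6]], Cover 0 [7,6,5,2,1,0,4,3], [(0,[])]),
     (adj [[1,2,4],[2,3],[5],[],[],[6]], Cover 1 [2,0,4,6,7,3,1,5], [(0,[])]),
     (adj [[1,2,4],[2,3],[5]], Cover 3 [1,2,5,4,7,6,3,0], [(0,[0,1,2,3,4,5,7,6]),(0,[])]),
     (adj [[1,2,4],[2,3]], At 2, [(6,[]),(8,[0,2,1,4,3]),(0,[]),(0,[0,1,2,3,4,6,5]),(0,[0,1,2,3,4,7,6,5])]),
     (adj [[1,2],[2,3]], At 0, [(9,[]),(0,[]),(0,[0,1,2,3,5,4]),(0,[0,1,2,3,6,5,4]),(0,[0,1,2,3,7,5,6,4])]),
     (adj [[1,4,5],[2,3],[4,5],[4,6],[],[7]], At 7, [(18,[])]),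
     (adj [[1,4,5],[2,3],[4,5],[4,6]], At 5, [(20,[]),(0,[])]),
     (adj [[1,4,5],[2,3],[4,5],[4]], At 3, [(22,[]),(0,[]),(0,[0,1,2,3,4,5,7,6])]),
     (adj [[1,4,5],[2,3],[4,6],[4],[],[6],[7]], At 3, [(0,[0,1,3,2]),(19,[])]),
     (adj [[1,4,5],[2,3],[4,6],[4],[],[6]], At 6, [(21,[]),(0,[])]),
     (adj [[1,4,5],[2,3],[4,6],[4,6],[],[],[7]], At 5, [(20,[])]),
     (adj [[1,4,5],[2,3],[4,6],[4],[],[],[7]], At 6, [(0,[]),(1,[])]),
     (adj [[1,4,5],[2,3],[4,6],[4]], Cover 3 [6,2,4,0,7,5,3,1], [(0,[]),(2,[])]),
     (adj [[1,4,5],[2,3],[4],[4]], Cover 1 [7,6,0,4,2,1,5,3], [(0,[0,1,2,3,4,5,7,6]),(0,[]),(5,[])]),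
     (adj [[1,4,5],[2,3],[4],[5,6],[6],[7]], Cover 0 [4,2,1,3,5,7,6,0], [(23,[])]),
     (adj [[1,4,5],[2,3],[4],[5,6],[6]], Cover 0 [3,5,0,4,7,2,1,6], [(0,[]),(1,[0,1,2,3,5,4])]),
     (adj [[1,4,5],[2,3],[4],[6,7],[6],[7]], At 5, [(24,[]),(0,[0,4,2,6,1,5,3])]),
     (adj [[1,4,5],[2,3],[4],[6,7],[6]], Cover 1 [5,0,1,3,7,6,4,2], [(0,[]),(1,[0,4,2,6,1,5,3])]),
     (adj [[1,4,5],[2,3],[4],[6],[6]], Cover 0 [5,7,4,6,3,1,0,2], [(2,[0,4,2,6,1,5,3]),(2,[]),(0,[0,4,2,6,1,5,3]),(0,[])]),
     (adj [[1,4,5],[2,3],[3,4],[7],[6]], Cover 1 [7,5,0,1,2,4,6,3], []),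
     (adj [[1,4,5],[2,3],[4],[5,7],[6]], Cover 2 [3,5,0,4,2,6,7,1], [(6,[0,1,2,3,5,4])]),
     (adj [[1,4,5],[2,3],[4],[7],[6]], At 3, [(1,[]),(0,[]),(2,[])]),
     (adj [[1,4,5],[2,3],[4],[],[6]], Cover 0 [7,6,4,0,1,3,5,2], [(0,[]),(3,[])]),
     (adj [[1,4,5],[2,3],[4]], At 4, [(9,[]),(18,[0,4,5,2,1,3]),(0,[]),(0,[0,1,2,3,4,5,7,6])]),
     (adj [[1,4,5],[2,3],[],[],[6,7]], At 5, [(0,[0,1,2,3,5,4]),(0,[0,1,3,2,5,4]),(0,[0,4,6,7,5,1,2,3]),(0,[0,4,7,6,5,1,2,3])]),
     (adj [[1,4,5],[2,3],[],[],[6]], At 4, [(1,[]),(1,[0,1,3,2]),(20,[0,4,5,6,1,2,3]),(0,[])]),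
     (adj [[1,4,5],[2,3]], Cover 0 [6,2,1,0,4,5,3,7], [(0,[]),(0,[0,1,2,3,5,4]),(2,[]),(2,[0,1,2,3,5,4]),(2,[0,1,3,2])]),
     (adj [[1,4],[2,3]], At 0, [(22,[]),(22,[0,1,3,2]),(0,[]),(0,[0,1,2,3,4,6,5]),(0,[0,1,2,3,4,7,6,5])]),
     (adj [[1],[2,3]], At 0, [(23,[]),(23,[0,1,3,2]),(0,[]),(0,[0,1,2,3,5,4]),(0,[0,1,2,3,6,5,4]),(0,[0,1,2,3,7,5,6,4])]),
     (adj [[1],[2]], At 1, [(0,[]),(0,[0,1,2,4,3]),(0,[0,1,2,5,4,3]),(0,[0,1,2,6,4,5,3]),(0,[0,1,2,7,4,5,6,3])]),
     (adj [[1]], At 1, [(0,[]),(0,[0,1,3,2]),(0,[0,1,4,3,2]),(0,[0,1,5,3,4,2]),(0,[0,1,6,3,4,5,2]),(0,[0,1,7,3,4,5,6,2])]),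
     (adj [], At 0, [(0,[]),(0,[0,2,1]),(0,[0,3,2,1]),(0,[0,4,2,3,1]),(0,[0,5,2,3,4,1]),(0,[0,6,2,3,4,5,1]),(0,[0,7,2,3,4,5,6,1])])]"
  by code_simp

lemma apex_certificate_6: "apex_certificate 6
    [([(0,0),(1,1),(2,1),(3,0),(1,3)], adj [[2]])]
    [(adj [[1,2,3,4,5],[2,3,4,5],[3,4,5],[4,5],[5]], None, 5, [0,1,2,3,4,5])]
    [(adj [[1,2,3,4],[2,3,4,5],[3,4,5],[4,5],[5]], Cover 0 [0,2,5,4,3,1], [(0,[])]),
     (adj [[1,2,4],[2,3,4,5],[3,4,5],[4,5],[5]], Cover 0 [3,2,0,5,4,1], [(0,[])]),
     (adj [[1,4],[2,3,4,5],[3,4,5],[4,5],[5]], Cover 0 [0,3,2,5,4,1], [(0,[])]),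
     (adj [[1],[2,3,4,5],[3,4,5],[4,5],[5]], Cover 0 [4,5,0,2,3,1], [(0,[])]),
     (adj [[],[2,3,4,5],[3,4,5],[4,5],[5]], Cover 0 [1,3,0,5,4,2], [(0,[])])]
    [(0,[])]"
  by code_simp

lemma apex_certificate_7: "apex_certificate 7
    [([(0,0),(5,2),(2,3),(1,3),(1,1),(0,4)], adj [[2,3],[3]]),
     ([(0,0),(4,1),(2,2),(1,4),(1,2),(2,1)], adj [[2],[4],[],[5]])]
    [(adj [[1,2,3],[4,5,6],[4,5,6],[4,5,6],[5,6],[6]], None, 4, [4,5,1,6,2,3,0]),
     (adj [[1,2,3,5],[4,5,6],[4,5,6],[4,5,6],[5],[6]], None, 3, [5,0,1,4,2,3,6]),
     (adj [[1,2,3,4,5],[4,5,6],[4,5,6],[4,5,6],[5]], None, 4, [0,4,1,5,2,3,6]),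
     (adj [[1,2,3,4,5,6],[4,5,6],[4,5,6],[4,5,6]], None, 3, [0,1,4,2,5,6,3]),
     (adj [[3,4,5,6],[3,4,5,6],[3,4,5,6],[4,5],[5]], None, 4, [3,4,0,5,1,2,6])]
    [(adj [[4,5,6],[3,4,5,6],[3,4,5,6],[4,5,6],[5]], Cover 0 [2,3,1,0,5,6,4], []),
     (adj [[4,5,6],[3,4,5,6],[3,4,5,6],[4,5],[5]], Cover 0 [3,5,0,6,2,4,1], [(5,[]),(0,[])]),
     (adj [[4,6],[3,4,5,6],[3,4,5,6],[4,5,6],[5]], Cover 0 [6,0,4,5,3,2,1], [(0,[])]),
     (adj [[4,6],[3,4,5,6],[3,4,5,6],[4,5],[5]], Cover 0 [5,3,0,6,2,4,1], [(1,[]),(0,[0,1,2,5,4,3]),(0,[])]),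
     (adj [[6],[3,4,5,6],[3,4,5,6],[4,5,6],[5,6]], Cover 0 [5,4,6,0,3,2,1], []),
     (adj [[6],[3,4,5,6],[3,4,5,6],[4,5,6],[5]], Cover 0 [0,6,5,4,3,2,1], [(1,[0,1,2,3,5,4]),(1,[]),(0,[])]),
     (adj [[6],[3,4,5,6],[3,4,5,6],[4,5],[5]], Cover 0 [6,0,3,4,5,2,1], [(0,[]),(0,[0,1,2,4,3]),(2,[])]),
     (adj [[3,5],[3,4,5,6],[3,4,5,6],[4,5,6],[5]], Cover 0 [2,6,1,0,4,5,3], []),
     (adj [[3],[3,4,5,6],[3,4,5,6],[4,5,6],[5]], Cover 0 [5,4,0,6,3,2,1], [(0,[])]),
     (adj [[],[3,4,5,6],[3,4,5,6],[4,5,6],[5,6]], Cover 0 [1,4,2,0,6,5,3], [(2,[0,5,6,3,4,2,1])]),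
     (adj [[],[3,4,5,6],[3,4,5,6],[4,5,6],[5]], Cover 0 [0,4,3,6,2,5,1], [(1,[]),(3,[]),(0,[])]),
     (adj [[],[3,4,5,6],[3,4,5,6],[4,5],[5]], At 6, [(4,[]),(0,[]),(0,[0,1,2,4,3]),(0,[0,1,2,5,4,3])]),
     (adj [[1,2,3,4],[2,3,4,5],[3,4,5],[4,5],[5]], Cover 0 [6,0,1,5,4,3,2], []),
     (adj [[1,2,4,6],[2,3,4,5],[3,4,5],[4,5],[5],[6]], Cover 0 [3,4,0,6,2,5,1], []),
     (adj [[1,2,4,6],[2,3,4,5],[3,4,5],[4,5],[5]], Cover 0 [6,0,2,5,3,4,1], [(0,[]),(1,[0,1,2,4,5,3])]),
     (adj [[1,2,4],[2,3,4,5],[3,4,5],[4,5],[5]], Cover 0 [0,4,3,6,2,5,1], [(2,[]),(0,[])]),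
     (adj [[1,2],[2,3,4,5],[3,4,5],[4,5],[5,6]], Cover 0 [0,6,4,5,3,2,1], [(0,[0,1,2,3,5,4]),(4,[0,4,5,3,1,2])]),
     (adj [[1,2],[2,3,4,5],[3,4,5],[4,5],[5]], Cover 0 [0,6,5,4,2,3,1], [(1,[0,1,2,3,5,4]),(1,[]),(0,[])]),
     (adj [[2],[2,3,4,5,6],[3,4,5],[4,5],[5]], Cover 0 [5,1,6,0,3,4,2], [(6,[0,1,5,3,4,2]),(0,[0,2,5,3,4,1]),(0,[])]),
     (adj [[2],[2,3,4,5],[3,4,5],[4,5],[5]], Cover 0 [1,5,6,0,4,3,2], [(0,[]),(1,[]),(1,[0,2,5,3,4,1])]),
     (adj [[],[2,3,4,5,6],[3,4,5],[4,5],[5]], Cover 0 [6,0,5,4,3,2,1], [(8,[0,1,5,3,4,2]),(8,[0,1,4,3,2]),(0,[0,1,4,3,2])]),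
     (adj [[],[2,3,4,5],[3,4,5],[4,5],[5]], Cover 0 [6,0,1,2,4,5,3], [(0,[]),(0,[0,2,1]),(1,[])]),
     (adj [[1,2,3,4,5],[4,5,6],[4,5,6],[4,5,6],[6],[6]], Cover 1 [6,1,0,4,3,5,2], []),
     (adj [[1,2,3,4,5],[4,5,6],[4,5,6],[4,5,6],[6]], Cover 0 [5,0,4,6,3,2,1], [(0,[]),(26,[])]),
     (adj [[1,2,3,4,5],[4,5,6],[4,5,6],[4,5,6]], Cover 0 [4,0,5,6,3,2,1], [(26,[]),(0,[]),(27,[])]),
     (adj [[1,2,4,5],[3,4,5,6],[3,4,5,6],[4,5,6]], Cover 1 [1,3,2,5,0,6,4], []),
     (adj [[1,2,4,5],[4,5,6],[3,4,5,6],[4,5,6]], Cover 0 [3,6,1,0,5,4,2], [(0,[]),(1,[]),(1,[0,4,5,6,1,2,3])]),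
     (adj [[1,2,4,5],[4,5,6],[4,5,6],[4,5,6]], Cover 0 [0,2,6,3,5,4,1], [(2,[0,4,5,6,1,2,3]),(2,[]),(0,[])]),
     (adj [[1,2,5],[4,5,6],[4,5,6],[4,5,6],[5],[6]], Cover 0 [3,1,0,2,6,5,4], [(29,[])]),
     (adj [[1,2,5],[4,5,6],[4,5,6],[4,5,6],[5]], Cover 0 [6,4,5,0,2,3,1], [(0,[]),(1,[0,1,2,3,5,6,4]),(1,[])]),
     (adj [[1,2,5],[4,5,6],[4,5,6],[4,5,6]], Cover 0 [4,6,5,0,3,2,1], [(0,[]),(2,[]),(2,[0,1,2,3,5,6,4])]),
     (adj [[1,5],[4,5,6],[4,5,6],[4,5,6]], At 0, [(0,[]),(0,[0,1,3,2]),(0,[0,4,5,6,2,1,3]),(0,[0,5,6,4,2,1,3])]),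
     (adj [[1,2],[4,5,6],[4,5,6],[4,5,6],[5,6],[6]], Cover 0 [0,2,5,3,4,6,1], [(32,[])]),
     (adj [[1],[4,5,6],[4,5,6],[4,5,6],[5,6],[6]], Cover 0 [2,5,3,0,4,6,1], [(21,[0,4,5,3,2,6,1]),(0,[]),(1,[])]),
     (adj [[1],[4,5,6],[4,5,6],[4,5,6],[5,6]], Cover 0 [0,5,4,6,2,3,1], [(2,[0,1,2,3,5,4]),(2,[0,1,2,3,4,6,5]),(0,[])]),
     (adj [[1],[4,5,6],[4,5,6],[4,5,6],[5]], Cover 0 [0,6,5,4,2,3,1], [(3,[]),(3,[0,1,2,3,5,4]),(0,[])]),
     (adj [[1],[4,5,6],[4,5,6],[4,5,6]], Cover 0 [4,0,6,5,2,3,1], [(0,[0,1,2,3,4,6,5]),(0,[]),(4,[])]),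
     (adj [[],[2,4,5,6],[4,5,6],[4,5,6],[],[6]], Cover 0 [0,3,6,1,5,4,2], [(0,[0,6,4,5,1,2,3]),(0,[]),(25,[0,2,3,1,5,6,4])]),
     (adj [[],[2,4,5,6],[4,5,6],[4,5,6]], Cover 0 [0,5,2,6,3,4,1], [(1,[0,2,1]),(1,[0,6,4,5,1,2,3]),(0,[])]),
     (adj [[],[4,5,6],[4,5,6],[4,5,6]], Cover 0 [2,0,3,1,6,5,4], [(0,[0,2,3,1]),(0,[]),(2,[])])]
    [(0,[]), (18,[]), (28,[])]"
  by code_simp

lemma apex_certificate_8: "apex_certificate 8
    [([(3,4),(1,0),(6,0),(5,1),(5,2),(4,7),(4,1)], adj [[2,3,4],[3,4],[],[5]]),
     ([(2,2),(1,3),(0,0),(6,1),(2,1),(3,3),(0,6)], adj [[2,3],[3,5],[5],[],[6]])]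
    [(adj [[4,5,7],[4,5,6,7],[4,5,6,7],[4,5,6,7]], None, 6, [1,2,4,3,5,7,0,6]),
     (adj [[4,5,6,7],[4,5,6,7],[4,5,6,7],[4,5,6]], None, 6, [0,1,4,2,5,6,3,7]),
     (adj [[2,3,7],[5,6,7],[4,5,6],[4,5,6],[5,6,7]], None, 2, [4,2,5,3,7,6,0,1]),
     (adj [[2,3,5,7],[4,5,6,7],[4,5,6],[4,5,6],[7],[],[7]], Some (0,7), 3, [0,1,4,2,5,6,3]),
     (adj [[1,2,3,7],[5,6,7],[4,5,6],[4,5,6],[5,7],[],[7]], Some (1,5), 3, [1,0,2,4,3,7,6]),
     (adj [[1,2,3,5,7],[5,6,7],[4,5,6],[4,5,6],[7],[7]], Some (1,6), 4, [0,1,2,5,3,7,4]),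
     (adj [[2,5,6,7],[2,5,6,7],[4,5,6],[4,5,6],[7]], None, 2, [2,0,5,1,4,6,7,3]),
     (adj [[2,3,5,6,7],[5,6,7],[4,5,6],[4,5,6],[7]], None, 2, [0,2,5,3,7,6,4,1]),
     (adj [[5,6,7],[3,4,5,6],[3,4,5,6],[5,7],[5,7]], None, 2, [5,1,3,2,0,4,6,7])]
    [(adj [[1,6,7],[3,4,5,7],[3,4,5,6],[4,5],[5],[],[7]], Cover 0 [5,3,0,6,7,4,2,1], []),
     (adj [[3,6,7],[3,4,5,7],[3,4,5,6],[4,5],[5],[],[7]], Cover 0 [5,4,0,7,6,2,3,1], []),
     (adj [[6,7],[3,4,5,7],[3,4,5,6],[4,5],[5],[],[7]], At 0, [(1,[]),(1,[0,2,1,3,4,5,7,6]),(0,[]),(0,[0,1,2,4,3]),(0,[0,1,2,5,4,3])]),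
     (adj [[7],[3,4,5,6,7],[3,4,5,6],[4,5],[5],[],[7]], At 0, []),
     (adj [[7],[3,4,5,7],[3,4,5,6],[4,5,6],[5],[],[7]], At 0, []),
     (adj [[7],[3,4,5,7],[3,4,5,6],[4,5],[5],[],[7]], At 6, [(2,[]),(1,[]),(0,[]),(0,[0,1,2,4,3]),(0,[0,1,2,5,4,3])]),
     (adj [[],[3,4,5,7],[3,4,5,6,7],[4,5],[5],[],[7]], Cover 0 [0,7,4,3,5,6,2,1], []),
     (adj [[],[3,4,5,7],[3,4,5,6],[4,5,7],[5],[],[7]], Cover 0 [5,4,7,0,6,3,2,1], []),
     (adj [[],[3,4,5,7],[3,4,5,6],[4,5],[5],[],[7]], At 7, [(2,[]),(1,[]),(0,[]),(0,[0,1,2,4,3]),(0,[0,1,2,5,4,3])]),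
     (adj [[2],[4,5,6,7],[3,4,5,6],[4,5,7],[5]], Cover 0 [0,7,3,4,5,6,2,1], []),
     (adj [[4],[4,5,6,7],[3,4,5,6],[4,5,7],[5]], Cover 0 [5,4,0,6,7,3,2,1], []),
     (adj [[],[4,5,6,7],[3,4,5,6,7],[4,5,7],[5]], Cover 0 [0,6,3,5,4,7,2,1], []),
     (adj [[],[4,5,6,7],[3,4,5,6],[4,5,7],[5]], Cover 0 [0,1,4,2,3,7,6,5], [(1,[]),(2,[]),(2,[0,1,3,2,4,5,7,6]),(0,[])]),
     (adj [[1],[3,4,5,6],[3,4,5,6],[5,7],[5,7]], Cover 0 [5,3,7,0,6,2,4,1], []),
     (adj [[5,7],[3,4,5,6],[3,4,5,6],[5,7],[5,7]], At 6, [(22,[])]),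
     (adj [[5],[3,4,5,6],[3,4,5,6],[5,7],[5,7]], Cover 0 [7,2,5,0,1,4,6,3], [(0,[])]),
     (adj [[6],[3,4,5,6],[3,4,5,6],[5,7],[5,7]], Cover 0 [0,6,1,4,5,3,7,2], [(2,[]),(2,[0,4,3,1,2,5,7,6]),(0,[])]),
     (adj [[],[3,4,5,6],[3,4,5,6],[5,7],[5,7]], At 0, [(3,[]),(3,[0,2,1]),(3,[0,3,4,1,2,5,7,6]),(3,[0,4,3,1,2,5,7,6]),(1,[]),(0,[]),(0,[0,3,4,1,2,5,7,6])]),
     (adj [[4,6],[3,4,5,6],[3,4,5,6],[4,5],[5]], Cover 0 [3,5,0,7,6,4,2,1], []),
     (adj [[6],[3,4,5,6],[3,4,5,6],[4,5],[5],[7]], Cover 0 [0,6,1,3,5,7,4,2], []),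
     (adj [[6],[3,4,5,6],[3,4,5,6],[4,5],[5]], Cover 0 [5,4,7,6,0,3,2,1], [(0,[]),(1,[0,1,2,3,5,4]),(1,[])]),
     (adj [[],[3,4,5,6],[3,4,5,6],[4,5,6],[5]], Cover 0 [2,5,1,0,7,3,6,4], []),
     (adj [[4],[3,4,5,6],[3,4,5,6],[4,5],[5],[],[7]], Cover 0 [1,3,2,0,7,5,6,4], []),
     (adj [[],[3,4,5,6],[3,4,5,6],[4,5],[5],[7],[7]], Cover 0 [7,0,4,3,2,6,5,1], []),
     (adj [[],[3,4,5,6],[3,4,5,6],[4,5],[5],[],[7]], Cover 0 [5,4,7,6,0,3,2,1], [(0,[]),(1,[0,1,2,3,5,4]),(1,[])]),
     (adj [[],[3,4,5,6],[3,4,5,6],[4,5],[5]], At 6, [(4,[]),(3,[]),(3,[0,1,2,4,3]),(3,[0,1,2,5,4,3]),(0,[])]),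
     (adj [[1,2,5,6,7],[3,5,6,7],[4,5,6],[4,5,6],[7]], Cover 1 [3,1,0,2,6,4,5,7], []),
     (adj [[1,2,5,6,7],[5,6,7],[4,5,6,7],[4,5,6],[7]], Cover 0 [4,3,5,1,0,2,7,6], []),
     (adj [[1,2,5,6,7],[5,6,7],[4,5,6],[4,5,6,7],[7]], Cover 1 [0,2,4,3,6,1,5,7], []),
     (adj [[1,2,5,6,7],[5,6,7],[4,5,6],[4,5,6],[7],[7]], Cover 1 [1,3,4,2,6,0,7,5], []),
     (adj [[1,2,5,6,7],[5,6,7],[4,5,6],[4,5,6],[7]], Cover 0 [3,2,0,7,1,5,6,4], [(37,[]),(1,[]),(3,[]),(2,[]),(36,[]),(0,[])]),
     (adj [[1,2,5,7],[5,6,7],[4,5,6,7],[4,5,6],[7]], Cover 1 [7,4,3,5,0,1,6,2], [(0,[])]),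
     (adj [[1,2,5,7],[5,6,7],[4,5,6],[4,5,6],[5,7]], Cover 1 [2,6,1,7,0,4,3,5], [(38,[0,4,5,6,1,2,3])]),
     (adj [[1,2,5,7],[5,6,7],[4,5,6],[4,5,6],[6,7]], Cover 1 [1,7,4,2,0,5,6,3], [(2,[])]),
     (adj [[1,2,5,7],[5,6,7],[4,5,6],[4,5,6],[7],[7]], Cover 0 [7,1,6,3,2,0,5,4], [(39,[])]),
     (adj [[1,2,5,7],[5,6,7],[4,5,6],[4,5,6],[7],[],[7]], Cover 1 [7,1,5,2,0,4,6,3], [(4,[])]),
     (adj [[1,2,5,7],[5,6,7],[4,5,6],[4,5,6],[7]], Cover 0 [6,5,0,7,4,2,3,1], [(5,[]),(0,[]),(2,[]),(1,[]),(3,[]),(4,[])]),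
     (adj [[1,2,3,7],[5,6,7],[4,5,6],[4,5,6,7],[7]], Cover 1 [2,5,1,7,0,4,6,3], [(0,[0,1,2,3,4,6,5])]),
     (adj [[1,2,7],[5,6,7],[4,5,6],[4,5,6,7],[5,7]], Cover 0 [0,1,5,3,4,2,7,6], []),
     (adj [[1,2,7],[5,6,7],[4,5,6],[4,5,6,7],[7],[7]], Cover 1 [2,4,3,1,7,0,6,5], []),
     (adj [[1,2,7],[5,6,7],[4,5,6],[4,5,6,7],[7]], Cover 0 [5,6,4,0,7,3,2,1], [(1,[]),(3,[]),(0,[]),(3,[0,1,2,3,4,6,5]),(0,[0,1,2,3,4,6,5]),(2,[])]),
     (adj [[1,2,3,7],[5,6,7],[4,5,6],[4,5,6],[5,7]], Cover 1 [4,7,1,6,5,2,0,3], [(45,[]),(47,[0,4,5,6,1,2,3])]),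
     (adj [[1,2,7],[3,5,6,7],[4,5,6],[4,5,6],[5,7]], Cover 1 [0,7,5,3,4,6,1,2], []),
     (adj [[1,2,7],[5,6,7],[4,5,6],[4,5,6],[5,7],[7]], Cover 0 [7,0,2,3,6,1,5,4], []),
     (adj [[1,2,7],[5,6,7],[4,5,6],[4,5,6],[5,7]], Cover 0 [0,7,6,3,5,1,4,2], [(7,[0,1,2,3,4,6,5]),(2,[]),(7,[]),(3,[]),(0,[]),(1,[])]),
     (adj [[1,2,7],[4,5,6,7],[4,5,6],[4,5,6],[7],[7]], Cover 0 [6,4,7,0,5,3,2,1], []),
     (adj [[1,2,7],[5,6,7],[4,5,6],[4,5,6],[7],[7]], Cover 1 [1,6,3,4,0,7,5,2], [(5,[0,7,2,3,6,5,4,1]),(0,[]),(1,[0,1,2,3,4,6,5]),(0,[0,7,2,3,5,6,4,1]),(5,[]),(9,[])]),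
     (adj [[1,2,7],[5,6,7],[4,5,6],[4,5,6],[7]], Cover 0 [5,6,0,7,4,3,2,1], [(10,[]),(0,[]),(2,[]),(0,[0,1,2,3,4,6,5]),(2,[0,1,2,3,4,6,5]),(6,[])]),
     (adj [[1,4,7],[5,6,7],[4,5,6],[4,5,6,7],[6,7]], Cover 0 [7,0,5,2,6,1,4,3], []),
     (adj [[1,4,7],[5,6,7],[4,5,6],[4,5,6,7],[7],[7]], Cover 1 [7,0,6,2,1,5,4,3], []),
     (adj [[1,4,7],[5,6,7],[4,5,6],[4,5,6,7],[7]], Cover 0 [6,5,4,0,7,3,2,1], [(1,[]),(2,[0,4,6,5,1,2,3]),(0,[0,1,2,3,4,6,5]),(2,[0,4,5,6,1,2,3]),(0,[]),(2,[0,1,3,2])]),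
     (adj [[1,4,7],[5,6,7],[4,5,6],[4,5,6],[5,7]], Cover 0 [6,2,4,0,7,5,3,1], [(3,[0,4,6,5,1,2,3]),(0,[0,4,5,6,1,2,3]),(3,[]),(0,[0,1,3,2]),(3,[0,4,5,6,1,2,3])]),
     (adj [[1,4,7],[5,6,7],[4,5,6],[4,5,6],[7]], Cover 0 [5,3,4,0,7,2,6,1], [(0,[]),(4,[0,4,5,6,1,2,3]),(1,[0,4,6,5,1,2,3]),(4,[0,1,3,2]),(1,[]),(4,[])]),
     (adj [[1,5,7],[2,5,6,7],[4,5,6],[4,5,6],[5,7]], Cover 1 [7,4,2,6,3,0,1,5], []),
     (adj [[1,5,7],[2,5,6,7],[4,5,6],[4,5,6],[7]], Cover 0 [4,3,5,0,1,2,7,6], [(0,[]),(6,[0,4,5,6,1,2,3]),(6,[0,1,3,2]),(6,[])]),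
     (adj [[1,5,7],[5,6,7],[4,5,6,7],[4,5,6,7],[7]], Cover 0 [3,4,2,0,1,6,7,5], []),
     (adj [[1,5,7],[5,6,7],[4,5,6,7],[4,5,6],[7]], Cover 0 [3,2,7,0,1,4,6,5], [(0,[]),(8,[0,1,3,2]),(1,[0,1,3,2]),(8,[]),(1,[]),(8,[0,4,5,6,1,2,3])]),
     (adj [[1,5,7],[5,6,7],[4,5,6],[4,5,6],[7]], Cover 0 [7,1,6,3,2,0,5,4], [(4,[0,5,4,6,7,2,3,1]),(0,[0,1,3,2]),(0,[]),(2,[0,1,3,2]),(2,[]),(9,[0,1,3,2])]),
     (adj [[1,7],[5,6,7],[4,5,6],[4,5,6],[7]], At 0, [(10,[]),(10,[0,1,3,2]),(5,[]),(0,[]),(0,[0,1,2,3,4,6,5])]),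
     (adj [[2,3,5,7],[5,6,7],[4,5,6],[4,5,6],[7],[6]], Cover 1 [4,2,5,1,6,7,0,3], [(66,[])]),
     (adj [[2,3,5,7],[5,6,7],[4,5,6],[4,5,6],[7],[],[7]], Cover 1 [1,5,3,4,6,7,0,2], [(63,[]),(67,[])]),
     (adj [[2,3,5,7],[5,6,7],[4,5,6],[4,5,6],[7]], Cover 0 [6,4,7,0,5,1,3,2], [(0,[]),(68,[]),(1,[]),(2,[0,4,5,6,1,2,3]),(67,[0,4,5,6,1,2,3]),(2,[])]),
     (adj [[2,3,7],[5,6,7],[4,5,6],[4,5,6],[6,7],[6]], Cover 1 [0,7,1,6,4,3,5,2], []),
     (adj [[2,3,7],[5,6,7],[4,5,6],[4,5,6],[6,7],[],[7]], Cover 1 [1,7,4,2,6,5,0,3], []),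
     (adj [[2,3,7],[5,6,7],[4,5,6],[4,5,6],[6,7]], Cover 0 [6,4,7,0,5,1,3,2], [(0,[]),(2,[0,1,2,3,4,6,5]),(1,[]),(5,[0,4,5,6,1,2,3]),(66,[]),(5,[])]),
     (adj [[2,3,7],[5,6,7],[4,5,6],[4,5,6],[7],[7],[7]], Cover 1 [6,1,5,4,2,0,3,7], []),
     (adj [[2,3,7],[5,6,7],[4,5,6],[4,5,6],[7],[7]], Cover 0 [6,5,7,0,4,1,3,2], [(0,[]),(4,[0,1,2,3,4,6,5]),(1,[]),(4,[]),(1,[0,1,2,3,4,6,5]),(7,[])]),
     (adj [[2,3,7],[5,6,7],[4,5,6],[4,5,6],[7]], Cover 0 [0,7,1,6,5,4,3,2], [(8,[]),(5,[0,1,2,3,4,6,5]),(5,[]),(0,[0,1,2,3,4,6,5]),(0,[]),(2,[])]),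
     (adj [[2,5,7],[4,5,6,7],[4,5,6],[4,5,6,7],[7]], Cover 1 [7,0,5,6,3,4,2,1], [(0,[0,4,5,6,1,2,3])]),
     (adj [[2,5,7],[5,6,7],[4,5,6],[4,5,6,7],[7],[],[7]], Cover 0 [0,4,3,6,1,5,7,2], []),
     (adj [[2,5,7],[5,6,7],[4,5,6],[4,5,6,7],[7]], Cover 0 [4,0,5,6,1,7,3,2], [(2,[0,6,5,7,4,1,3,2]),(11,[0,5,6,7,4,1,3,2]),(1,[]),(2,[0,4,5,6,1,2,3]),(11,[]),(0,[])]),
     (adj [[2,5,7],[3,5,6,7],[4,5,6],[4,5,6],[7],[6]], Cover 1 [0,7,4,3,2,5,1,6], []),
     (adj [[2,5,7],[5,6,7],[4,5,6],[4,5,6],[7],[6]], Cover 1 [0,7,4,6,1,5,3,2], [(13,[0,4,5,6,1,2,3]),(4,[0,4,5,6,1,2,3]),(1,[0,4,5,6,1,2,3]),(0,[])]),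
     (adj [[2,5,7],[5,6,7],[4,5,6],[4,5,6],[7]], Cover 0 [6,3,5,0,7,1,4,2], [(0,[]),(5,[0,4,5,6,1,2,3]),(2,[0,4,5,6,1,2,3]),(5,[]),(2,[]),(14,[])]),
     (adj [[2,7],[5,6,7],[4,5,6],[4,5,6],[7]], At 0, [(15,[]),(6,[]),(15,[0,4,5,6,1,2,3]),(0,[]),(0,[0,1,2,3,4,6,5])]),
     (adj [[7],[5,6,7],[4,5,6],[4,5,6],[7]], At 0, [(16,[]),(0,[]),(0,[0,1,3,2]),(16,[0,4,5,6,1,2,3]),(0,[0,4,5,6,1,2,3]),(0,[0,4,6,5,1,2,3])]),
     (adj [[1,2,3,6],[5,6,7],[4,5,6,7],[4,5,6],[7]], Cover 1 [4,7,6,0,3,5,2,1], [(0,[0,3,2,1,7,5,6,4]),(0,[])]),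
     (adj [[1,2,3],[5,6,7],[4,5,6,7],[4,5,6],[7]], Cover 1 [4,6,5,0,2,7,1,3], [(1,[0,4,2,1,6,5,7,3]),(1,[0,3,2,1,7,5,6,4]),(0,[]),(1,[0,5,4,6,7,2,3,1]),(1,[0,6,4,5,7,2,3,1])]),
     (adj [[1,3],[5,6,7],[4,5,6,7],[4,5,6],[7]], Cover 0 [4,7,5,0,6,2,3,1], [(2,[0,4,2,1,6,5,7,3]),(2,[0,3,2,1,7,5,6,4]),(2,[0,4,2,1,5,6,7,3]),(2,[]),(2,[0,5,4,6,7,2,3,1]),(0,[])]),
     (adj [[1],[5,6,7],[4,5,6,7],[4,5,6],[5,6,7]], At 0, []),
     (adj [[1],[5,6,7],[4,5,6,7],[4,5,6],[6,7]], Cover 0 [7,4,6,0,5,3,2,1], [(4,[0,5,4,6,7,2,3,1]),(4,[]),(4,[0,6,4,5,7,2,3,1]),(4,[0,3,2,1,7,5,6,4]),(0,[]),(4,[0,4,2,1,5,6,7,3])]),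
     (adj [[1],[5,6,7],[4,5,6,7],[4,5,6],[7]], Cover 0 [0,6,3,7,4,5,2,1], [(2,[]),(5,[]),(5,[0,3,2,1,7,5,6,4]),(5,[0,5,4,6,7,2,3,1]),(0,[]),(5,[0,6,4,5,7,2,3,1])]),
     (adj [[],[3,5,6,7],[4,5,6,7],[4,5,6],[6,7]], Cover 1 [3,6,0,7,1,5,4,2], [(6,[0,4,2,1,5,6,7,3]),(6,[0,2,1,4,3,6,7,5])]),
     (adj [[],[5,6,7],[4,5,6,7],[4,5,6],[6,7]], Cover 0 [3,5,1,0,7,4,6,2], [(0,[]),(7,[0,4,2,1,5,6,7,3]),(65,[0,2,3,6,7,4,5,1]),(1,[0,5,6,7,4,1,2,3]),(0,[0,5,6,7,4,1,2,3]),(7,[0,3,2,1,7,5,6,4])]),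
     (adj [[],[5,6,7],[4,5,6,7],[4,5,6],[7]], Cover 0 [7,4,5,0,6,1,3,2], [(0,[0,3,2,1,7,6,5,4]),(8,[]),(0,[0,3,2,1,7,5,6,4]),(8,[0,3,2,1,7,5,6,4]),(0,[]),(2,[])]),
     (adj [[],[5,6,7],[4,5,6],[4,5,6],[7]], At 7, [(9,[]),(0,[]),(0,[0,1,3,2]),(0,[0,4,5,6,1,2,3]),(0,[0,4,6,5,1,2,3])]),
     (adj [[4],[2,3,4,5],[3,4,5],[4,5],[5]], Cover 0 [0,6,3,1,5,7,4,2], []),
     (adj [[],[2,3,4,5],[3,4,5],[4,5,7],[5]], Cover 0 [5,4,0,6,7,2,3,1], []),
     (adj [[],[2,3,4,5],[3,4,5],[4,5],[5]], Cover 0 [7,0,3,4,5,6,2,1], [(0,[]),(0,[0,1,2,4,3]),(0,[0,1,2,5,4,3]),(1,[]),(1,[0,1,2,3,5,4]),(0,[0,1,2,4,3,5,7,6])]),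
     (adj [[1,2,4,5,7],[4,5,6,7],[4,5,6,7],[4,5,6]], Cover 0 [3,6,2,7,0,4,5,1], []),
     (adj [[1,2,5,7],[4,5,6,7],[4,5,6,7],[4,5,6]], Cover 0 [4,5,0,7,6,3,2,1], [(0,[])]),
     (adj [[1,2,7],[4,5,6,7],[4,5,6,7],[4,5,6],[5]], Cover 0 [7,0,4,3,5,1,6,2], []),
     (adj [[1,2,7],[4,5,6,7],[4,5,6,7],[4,5,6]], Cover 1 [4,6,5,7,2,0,3,1], [(0,[]),(6,[]),(6,[0,1,2,3,6,5,4]),(1,[0,1,2,3,4,6,5]),(1,[])]),
     (adj [[1,3,4,6,7],[4,5,6,7],[4,5,6,7],[4,5,6]], Cover 0 [5,4,0,7,6,3,2,1], []),
     (adj [[1,3,4,7],[4,5,6,7],[4,5,6,7],[4,5,6]], Cover 0 [6,5,0,7,4,3,2,1], [(0,[])]),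
     (adj [[1,3,7],[4,5,6,7],[4,5,6,7],[4,5,6],[5]], Cover 0 [7,0,3,5,4,6,2,1], []),
     (adj [[1,3,7],[4,5,6,7],[4,5,6,7],[4,5,6]], Cover 1 [5,0,7,4,1,6,2,3], [(10,[0,1,2,3,5,4]),(0,[]),(1,[]),(1,[0,1,2,3,6,5,4]),(10,[0,1,2,3,6,5,4])]),
     (adj [[1,4,5,7],[4,5,6,7],[4,5,6,7],[4,5,6]], Cover 0 [7,5,3,6,4,0,2,1], [(98,[])]),
     (adj [[1,4,7],[4,5,6,7],[4,5,6,7],[4,5,6,7]], Cover 0 [0,4,3,6,5,7,2,1], []),
     (adj [[1,4,7],[4,5,6,7],[4,5,6,7],[4,5,6]], Cover 0 [3,2,7,0,1,5,6,4], [(0,[]),(2,[]),(6,[]),(1,[])]),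
     (adj [[1,7],[4,5,6,7],[4,5,6,7],[4,5,6]], At 0, [(7,[]),(3,[]),(0,[]),(0,[0,1,2,3,5,4]),(0,[0,1,2,3,6,5,4])]),
     (adj [[3,4,5,7],[4,5,6,7],[4,5,6,7],[4,5,6]], Cover 0 [7,4,3,6,5,0,2,1], [(15,[0,1,2,3,6,5,4]),(102,[])]),
     (adj [[3,4,7],[4,5,6,7],[4,5,6,7],[4,5,6],[5]], Cover 0 [6,5,4,0,7,1,3,2], []),
     (adj [[3,4,7],[4,5,6,7],[4,5,6,7],[4,5,6]], Cover 0 [0,7,1,5,6,4,3,2], [(2,[]),(1,[]),(1,[0,1,2,3,4,6,5]),(17,[0,1,2,3,5,4]),(17,[0,1,2,3,6,5,4]),(0,[])]),
     (adj [[3,7],[4,5,6,7],[4,5,6,7],[4,5,6]], At 0, [(3,[]),(3,[0,2,1]),(0,[]),(0,[0,1,2,3,5,4]),(0,[0,1,2,3,6,5,4])]),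
     (adj [[4,5,7],[3,4,5,6,7],[4,5,6,7],[4,5,6]], Cover 0 [7,5,3,6,4,0,2,1], []),
     (adj [[4,5,7],[4,5,6,7],[4,5,6,7],[4,5,6]], Cover 0 [7,0,5,3,6,1,4,2], [(20,[0,1,2,3,5,4]),(106,[]),(20,[0,1,2,3,6,5,4]),(1,[]),(107,[]),(0,[])]),
     (adj [[4,7],[4,5,6,7],[4,5,6,7],[4,5,6]], At 0, [(6,[]),(6,[0,2,1]),(2,[]),(0,[]),(0,[0,1,2,3,4,6,5])]),
     (adj [[7],[4,5,6,7],[4,5,6,7],[4,5,6]], At 0, [(7,[]),(7,[0,2,1]),(3,[]),(0,[]),(0,[0,1,2,3,5,4]),(0,[0,1,2,3,6,5,4])]),
     (adj [[7],[4,5,6,7],[4,5,6],[4,5,6]], At 7, [(0,[]),(0,[0,1,3,2]),(23,[]),(23,[0,1,2,3,5,4]),(23,[0,1,2,3,6,5,4])]),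
     (adj [[7],[4,5,6],[4,5,6],[4,5,6]], At 7, [(0,[]),(0,[0,2,1]),(0,[0,3,2,1]),(0,[0,4,5,6,1,2,3]),(0,[0,5,4,6,1,2,3]),(0,[0,6,4,5,1,2,3])]),
     (adj [[],[4,5,6,7],[3,4,5,6,7],[4,5,6,7]], Cover 0 [6,7,5,0,4,3,2,1], [(0,[0,1,2,3,4,5,7,6]),(0,[])]),
     (adj [[],[4,5,6,7],[4,5,6,7],[4,5,6,7]], Cover 1 [5,4,0,7,3,6,2,1], [(1,[0,1,2,3,4,6,7,5]),(26,[0,1,2,3,5,4]),(26,[]),(26,[0,1,2,3,4,5,7,6]),(1,[0,1,2,3,4,5,7,6]),(0,[])]),
     (adj [[],[4,5,6,7],[4,5,6,7],[4,5,6]], At 7, [(2,[]),(0,[]),(27,[]),(27,[0,1,2,3,5,4]),(27,[0,1,2,3,6,5,4])]),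
     (adj [[],[4,5,6,7],[4,5,6],[4,5,6]], At 7, [(3,[]),(0,[]),(0,[0,1,3,2]),(28,[]),(28,[0,1,2,3,5,4]),(28,[0,1,2,3,6,5,4])]),
     (adj [[],[4,5,6],[4,5,6],[4,5,6]], At 7, [(4,[]),(0,[]),(0,[0,2,1]),(0,[0,3,2,1]),(0,[0,4,5,6,1,2,3]),(0,[0,5,4,6,1,2,3]),(0,[0,6,4,5,1,2,3])])]
    [(0,[]), (27,[]), (30,[]), (90,[]), (107,[]), (103,[]), (98,[])]"
  by code_simp

lemma apex_certificate_9: "apex_certificate 9
    [([(1,4),(0,0),(8,2),(5,3),(5,4),(2,5),(0,8),(2,3)], adj [[2,3,4,5],[3,4,5],[5],[5,6]]),
     ([(2,3),(1,0),(10,0),(6,2),(4,4),(4,5),(2,10),(3,3)], adj [[2,3,4,5],[3,4,5],[4],[6],[6]]),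
     ([(2,3),(0,1),(8,0),(4,2),(3,4),(5,3),(4,7),(2,2)], adj [[2,3,4,5],[3,4,5],[4],[6],[],[7]]),
     ([(1,1),(0,0),(6,0),(3,2),(2,3),(2,5),(1,2),(3,1)], adj [[2,3,4,5],[3,4],[4,6],[6],[],[7]]),
     ([(4,4),(4,3),(2,4),(1,3),(0,0),(2,2),(7,2),(0,7)], adj [[2,3,4,5],[4],[4,5,6],[6],[],[7]]),
     ([(2,3),(2,2),(0,0),(7,0),(4,3),(5,3),(3,7),(3,2)], adj [[3,4,5],[3,4,5,6],[4,5],[],[],[7]]),
     ([(2,4),(1,3),(0,1),(7,1),(5,3),(3,8),(4,5),(3,2)], adj [[2,3,4],[3,4,6],[4,6],[6],[],[7]]),
     ([(5,4),(4,1),(3,1),(2,2),(0,0),(7,0),(4,7),(3,2)], adj [[2,3,4],[3,4,6],[6],[5],[7],[7]])]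
    [(adj [[2,3,7,8],[5,6,7],[4,5,6],[4,5,6],[7],[8],[8]], Some (0,8), 2, [0,2,5,3,7,6,4,1]),
     (adj [[2,3,7,8],[5,6,7],[4,5,6],[4,5,6],[7,8],[8]], Some (1,7), 6, [0,4,1,5,2,3,6,8]),
     (adj [[1,3,7,8],[5,6,7],[4,6,8],[4,5,6],[7],[7,8]], Some (1,6), 2, [1,0,3,5,2,7,8,4]),
     (adj [[3,7,8],[5,6,7],[4,6,8],[4,5,6],[5,7],[8]], None, 1, [3,0,7,4,5,6,8,1,2]),
     (adj [[3,6,7,8],[5,6,7],[4,6,8],[4,5,6],[7],[8]], None, 1, [0,7,4,3,6,8,1,2,5]),
     (adj [[2,3,4,8],[6,7,8],[4,5,6],[4,5,6],[7],[7,8]], Some (0,8), 2, [0,2,4,3,1,5,6,7]),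
     (adj [[2,3,7,8],[6,7,8],[4,5,6],[4,5,6],[7,8],[8]], Some (1,6), 6, [0,1,2,4,3,8,5,7]),
     (adj [[2,3,7,8],[6,7,8],[4,5,6],[4,5,6],[5,7],[8]], Some (4,7), 2, [4,0,2,5,1,3,8,6]),
     (adj [[2,3,6,7,8],[6,7,8],[4,5,6],[4,5,6],[7],[8]], Some (4,7), 2, [0,2,4,3,8,6,5,1])]
    [(adj [[1,2,3,7,8],[5,6,8],[4,5,6],[4,5,6],[7],[],[],[8]], Cover 4 [5,1,6,4,7,8,0,3,2], []),
     (adj [[1,2,7,8],[5,6,8],[4,5,6],[4,5,6,7],[7],[],[],[8]], Cover 4 [6,3,4,7,8,5,1,0,2], []),
     (adj [[1,2,7,8],[5,6,8],[4,5,6],[4,5,6],[7],[],[7],[8]], Cover 4 [1,5,3,4,7,2,0,8,6], []),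
     (adj [[1,2,7,8],[5,6,8],[4,5,6],[4,5,6],[7],[],[8],[8]], Cover 4 [4,2,5,6,8,0,7,3,1], []),
     (adj [[1,2,7,8],[5,6,8],[4,5,6],[4,5,6],[7],[],[],[8]], Cover 4 [2,4,7,8,1,3,6,0,5], [(2,[]),(1,[]),(0,[]),(3,[])]),
     (adj [[1,2,7],[5,6,8],[4,5,6,8],[4,5,6],[7],[],[],[8]], Cover 4 [4,3,5,1,8,0,7,6,2], []),
     (adj [[1,2,7],[5,6,8],[4,5,6],[4,5,6,8],[7],[],[],[8]], Cover 4 [3,5,2,0,7,1,8,4,6], [(1,[])]),
     (adj [[1,2,5,7],[5,6,8],[4,5,6],[4,5,6],[7,8],[],[],[8]], Cover 4 [7,0,1,6,3,2,4,8,5], []),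
     (adj [[1,2,7],[5,6,8],[4,5,6],[4,5,6],[7,8],[],[],[8]], Cover 4 [5,2,6,0,7,8,4,3,1], [(0,[])]),
     (adj [[1,2,7],[5,6,8],[4,5,6],[4,5,6],[7],[8],[],[8]], Cover 3 [6,2,4,7,8,5,1,0,3], []),
     (adj [[1,2,7],[5,6,8],[4,5,6],[4,5,6],[7],[],[],[8]], At 8, [(5,[]),(4,[]),(3,[]),(1,[]),(0,[]),(0,[0,1,2,3,4,6,5])]),
     (adj [[1,4,7],[5,6,8],[4,5,6,7],[4,5,6],[7],[],[],[8]], Cover 2 [8,7,4,6,5,3,0,2,1], []),
     (adj [[1,4,7],[5,6,8],[4,5,6,8],[4,5,6],[7],[],[],[8]], Cover 3 [3,5,1,8,7,2,4,0,6], []),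
     (adj [[1,4,7],[5,6,8],[4,5,6],[4,5,6],[7,8],[],[],[8]], Cover 2 [8,7,3,5,2,6,4,0,1], []),
     (adj [[1,4,7],[5,6,8],[4,5,6],[4,5,6],[7],[],[],[8]], Cover 2 [1,8,7,3,2,4,0,5,6], [(1,[0,1,3,2]),(1,[]),(0,[]),(2,[]),(3,[0,1,3,2])]),
     (adj [[1,5,7],[5,6,8],[4,5,6],[4,5,6,7],[7],[],[],[8]], Cover 3 [4,2,6,1,0,5,7,8,3], []),
     (adj [[1,5,7],[5,6,8],[4,5,6],[4,5,6,8],[7],[],[],[8]], Cover 4 [7,0,1,6,3,2,4,8,5], []),
     (adj [[1,5,7],[5,6,8],[4,5,6],[4,5,6],[7,8],[],[],[8]], Cover 2 [7,8,5,3,6,2,1,0,4], [(6,[])]),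
     (adj [[1,5,7],[5,6,8],[4,5,6],[4,5,6],[7],[],[],[8]], Cover 3 [1,5,3,4,7,2,8,0,6], [(2,[]),(1,[]),(0,[]),(7,[])]),
     (adj [[1,7,8],[5,6,8],[4,5,6,8],[4,5,6],[7],[],[],[8]], Cover 3 [3,5,1,8,7,2,4,0,6], []),
     (adj [[1,7,8],[5,6,8],[4,5,6],[4,5,6],[5,7],[],[],[8]], Cover 2 [8,7,2,5,3,6,0,4,1], []),
     (adj [[1,7,8],[5,6,8],[4,5,6],[4,5,6],[7],[7],[],[8]], Cover 3 [6,1,8,7,4,5,3,0,2], []),
     (adj [[1,7,8],[5,6,8],[4,5,6],[4,5,6],[7],[8],[],[8]], Cover 2 [4,7,8,5,6,1,0,2,3], []),
     (adj [[1,7,8],[5,6,8],[4,5,6],[4,5,6],[7],[],[],[8]], Cover 5 [0,8,7,2,6,5,3,4,1], [(12,[]),(4,[0,1,2,3,4,6,5]),(4,[]),(3,[]),(0,[0,1,2,3,4,6,5]),(0,[]),(3,[0,1,3,2]),(1,[0,1,2,3,4,6,5]),(1,[]),(2,[])]),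
     (adj [[1,7],[5,6,8],[4,5,6],[4,5,6],[7],[],[],[8]], At 0, [(13,[]),(13,[0,1,3,2]),(9,[]),(5,[]),(5,[0,1,2,3,4,6,5]),(0,[])]),
     (adj [[1,2],[5,6,7,8],[4,5,6],[4,5,6],[7],[],[],[8]], Cover 3 [8,7,3,6,2,4,0,1,5], []),
     (adj [[1,5],[5,6,7,8],[4,5,6],[4,5,6],[7],[],[],[8]], Cover 3 [8,0,2,6,3,4,7,5,1], []),
     (adj [[1],[5,6,7,8],[4,5,6],[4,5,6],[7],[],[8],[8]], At 0, []),
     (adj [[1],[5,6,7,8],[4,5,6],[4,5,6],[7],[],[],[8]], Cover 2 [7,0,3,6,2,5,8,4,1], [(1,[0,1,2,3,4,6,5]),(2,[]),(1,[]),(0,[])]),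
     (adj [[1,3,8],[5,6,8],[4,5,6,7],[4,5,6],[7],[],[],[8]], Cover 4 [2,6,3,0,8,1,7,4,5], [(4,[])]),
     (adj [[1,3],[5,6,8],[4,5,6,7],[4,5,6],[7],[],[],[8]], Cover 6 [2,3,0,1,8,4,7,5,6], [(0,[]),(5,[])]),
     (adj [[1,4],[5,6,8],[4,5,6,7],[4,5,6,8],[7],[],[],[8]], At 0, []),
     (adj [[1,4],[5,6,8],[4,5,6,7],[4,5,6],[7],[],[],[8]], Cover 4 [1,6,3,4,7,2,8,0,5], [(0,[])]),
     (adj [[1],[5,6,8],[4,5,6,7],[4,5,6],[5,7],[],[],[8]], Cover 4 [3,5,0,8,7,2,4,1,6], []),
     (adj [[1],[5,6,8],[4,5,6,7],[4,5,6],[7],[],[7],[8]], Cover 3 [0,8,7,2,3,4,1,5,6], []),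
     (adj [[1],[5,6,8],[4,5,6,7],[4,5,6],[7],[],[],[8]], Cover 5 [7,4,3,6,0,1,5,2,8], [(0,[]),(10,[]),(1,[0,1,2,3,4,6,5]),(2,[]),(1,[]),(4,[])]),
     (adj [[1,3],[5,6,8],[4,5,6],[4,5,6],[7],[7],[8],[8]], At 0, []),
     (adj [[1,3],[5,6,8],[4,5,6],[4,5,6],[7],[7],[],[8]], Cover 3 [7,8,1,6,3,0,4,5,2], [(12,[]),(0,[])]),
     (adj [[1],[5,6,8],[4,5,6,8],[4,5,6],[7],[7],[],[8]], Cover 6 [8,0,6,3,5,1,7,2,4], [(13,[0,1,2,7,4,5,8,3,6]),(13,[])]),
     (adj [[1],[5,6,8],[4,5,6],[4,5,6],[7,8],[7],[],[8]], Cover 3 [3,1,8,7,2,0,6,5,4], [(1,[])]),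
     (adj [[1],[5,6,8],[4,5,6],[4,5,6],[7],[7],[],[8]], Cover 2 [1,8,7,3,2,4,0,5,6], [(1,[0,1,3,2]),(1,[]),(0,[]),(4,[]),(2,[])]),
     (adj [[1],[5,6,8],[4,5,6],[4,5,6],[7],[],[],[8]], At 7, [(16,[]),(12,[]),(5,[]),(5,[0,1,3,2]),(0,[]),(0,[0,1,2,3,4,6,5])]),
     (adj [[2,3,5,7,8],[5,6,8],[4,5,6],[4,5,6],[7],[],[],[8]], Cover 5 [4,7,0,5,1,6,3,8,2], []),
     (adj [[2,3,7,8],[5,6,8],[4,5,6],[4,5,6],[6,7],[],[],[8]], Cover 3 [4,7,8,1,5,0,2,6,3], []),
     (adj [[2,3,7,8],[5,6,8],[4,5,6],[4,5,6],[7],[8],[],[8]], Cover 6 [8,7,4,2,6,5,1,0,3], []),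
     (adj [[2,3,7,8],[5,6,8],[4,5,6],[4,5,6],[7],[],[],[8]], Cover 2 [8,7,2,5,3,6,0,4,1], [(0,[]),(0,[0,1,2,3,4,6,5]),(3,[0,7,2,3,6,5,4,1]),(3,[0,7,2,3,5,4,6,1]),(2,[]),(1,[])]),
     (adj [[2,3,6,8],[5,6,7,8],[4,5,6],[4,5,6],[7],[],[],[8]], Cover 3 [4,7,8,0,6,1,5,3,2], []),
     (adj [[2,3,8],[5,6,7,8],[4,5,6],[4,5,6],[7],[],[],[8]], Cover 2 [8,7,4,2,5,6,3,0,1], [(0,[])]),
     (adj [[2,3,8],[5,6,8],[4,5,6,7],[4,5,6],[7],[],[],[8]], Cover 2 [4,7,6,5,0,1,8,2,3], []),
     (adj [[2,3,8],[5,6,8],[4,5,6],[4,5,6],[7],[7],[],[8]], Cover 4 [6,0,8,7,5,4,2,1,3], []),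
     (adj [[2,3,8],[5,6,8],[4,5,6],[4,5,6],[7],[],[],[8]], At 7, [(4,[]),(2,[]),(1,[]),(1,[0,1,3,2]),(0,[]),(0,[0,1,2,3,4,6,5])]),
     (adj [[2,5,8],[5,6,8],[4,5,6,7],[4,5,6],[7],[],[],[8]], Cover 2 [4,3,5,1,8,0,2,7,6], []),
     (adj [[2,5,8],[5,6,8],[4,5,6],[4,5,6,7],[7],[],[],[8]], Cover 4 [2,0,1,8,3,7,4,6,5], []),
     (adj [[2,5,8],[5,6,8],[4,5,6],[4,5,6],[7],[],[8],[8]], Cover 3 [7,8,1,3,2,6,0,5,4], []),
     (adj [[2,5,8],[5,6,8],[4,5,6],[4,5,6],[7],[],[],[8]], Cover 2 [8,7,5,3,6,2,0,1,4], [(12,[0,2,1,3,8,5,6,7,4]),(0,[]),(1,[]),(12,[0,5,4,6,7,2,3,8,1]),(2,[]),(3,[])]),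
     (adj [[2,7,8],[5,6,8],[4,5,6],[4,5,6],[5,7],[],[],[8]], Cover 3 [7,4,2,6,1,5,8,0,3], []),
     (adj [[2,7,8],[5,6,8],[4,5,6],[4,5,6],[7],[8],[],[8]], Cover 3 [6,1,8,7,4,5,3,0,2], []),
     (adj [[2,7,8],[5,6,8],[4,5,6],[4,5,6],[7],[],[],[8]], Cover 5 [5,6,3,4,0,8,7,2,1], [(1,[]),(2,[]),(0,[]),(1,[0,1,2,3,4,6,5]),(2,[0,1,2,3,4,6,5]),(0,[0,1,2,3,4,6,5]),(15,[0,7,2,3,5,4,6,1]),(6,[]),(15,[0,2,1,3,8,5,6,7,4]),(15,[0,8,5,6,3,1,2,4,7])]),
     (adj [[2,8],[5,6,8],[4,5,6],[4,5,6],[7],[],[],[8]], At 0, [(16,[]),(7,[]),(16,[0,4,5,6,1,2,3,8,7]),(3,[]),(3,[0,1,2,3,4,6,5]),(0,[])]),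
     (adj [[2,6],[5,6,8],[4,5,6,8],[4,5,6],[7],[],[],[8]], Cover 3 [4,0,6,1,5,8,7,3,2], []),
     (adj [[2],[5,6,8],[4,5,6,8],[4,5,6],[7],[],[],[8]], Cover 2 [1,8,2,4,3,0,5,6,7], [(18,[]),(18,[0,8,5,6,3,1,2,4,7]),(0,[])]),
     (adj [[2,7],[5,6,8],[4,5,6],[4,5,6],[7,8],[],[],[8]], Cover 3 [1,5,4,7,0,2,6,8,3], [(2,[0,1,2,3,4,5,6,8,7]),(19,[]),(19,[0,7,2,3,6,5,4,1]),(2,[0,4,5,6,1,2,3,8,7]),(19,[0,4,5,6,1,2,3,8,7]),(19,[0,7,2,3,5,4,6,1])]),
     (adj [[2],[5,6,7,8],[4,5,6],[4,5,6],[7,8],[],[],[8]], Cover 2 [8,7,5,3,6,0,2,4,1], [(3,[]),(3,[0,1,2,3,4,5,6,8,7])]),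
     (adj [[2],[5,6,8],[4,5,6],[4,5,6],[7,8],[],[7],[8]], Cover 2 [0,5,4,7,6,8,1,2,3], [(21,[0,7,2,3,5,4,6,1]),(4,[])]),
     (adj [[2],[5,6,8],[4,5,6],[4,5,6],[7,8],[],[],[8]], Cover 4 [0,5,1,8,4,7,2,6,3], [(22,[]),(5,[]),(22,[0,4,5,6,1,2,3,8,7]),(2,[]),(1,[]),(0,[])]),
     (adj [[2,3],[5,6,8],[4,5,6],[4,5,6],[7],[8],[],[8]], Cover 3 [8,1,6,2,4,0,7,5,3], [(6,[]),(0,[0,7,2,3,5,4,6,1])]),
     (adj [[2],[5,6,8],[4,5,6],[4,5,6,7],[7],[8],[],[8]], Cover 2 [4,7,8,5,6,1,0,3,2], []),
     (adj [[2],[5,6,8],[4,5,6],[4,5,6],[7],[8],[],[8]], Cover 4 [0,5,8,1,4,3,2,7,6], [(8,[]),(25,[]),(25,[0,4,5,6,1,2,3,8,7]),(1,[]),(2,[]),(25,[0,2,1,3,8,5,6,7,4]),(0,[])]),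
     (adj [[2],[5,6,8],[4,5,6],[4,5,6],[7],[],[],[8]], At 8, [(9,[]),(7,[]),(26,[0,2,1,3,8,5,6,7,4]),(3,[]),(0,[]),(0,[0,1,2,3,4,6,5])]),
     (adj [[7,8],[5,6,8],[4,5,6],[4,5,6],[7],[],[],[8]], At 0, [(27,[]),(0,[]),(0,[0,1,3,2]),(27,[0,4,5,6,1,2,3,8,7]),(0,[0,4,5,6,1,2,3,8,7]),(0,[0,4,6,5,1,2,3,8,7])]),
     (adj [[7],[5,6,8],[4,5,6],[4,5,6],[7],[],[],[8]], At 0, [(28,[]),(1,[]),(1,[0,1,3,2]),(28,[0,4,5,6,1,2,3,8,7]),(1,[0,4,5,6,1,2,3,8,7]),(1,[0,4,6,5,1,2,3,8,7]),(0,[])]),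
     (adj [[],[5,6,8],[4,5,6],[4,5,6],[7],[],[],[8]], At 0, [(29,[]),(2,[]),(2,[0,1,3,2]),(29,[0,4,5,6,1,2,3,8,7]),(2,[0,4,5,6,1,2,3,8,7]),(2,[0,4,6,5,1,2,3,8,7]),(0,[]),(0,[0,4,5,6,1,2,3,8,7])]),
     (adj [[1,2,3,7,8],[6,7,8],[4,5,6],[4,5,6],[7],[8]], Cover 6 [0,7,4,6,5,2,8,3,1], []),
     (adj [[1,2,4,7,8],[6,7,8],[4,5,6],[4,5,6],[7],[8]], Cover 5 [3,6,2,0,7,8,5,4,1], []),
     (adj [[1,2,7,8],[6,7,8],[4,5,6],[4,5,6],[7,8],[8]], Cover 2 [7,0,8,3,6,5,1,4,2], []),
     (adj [[1,2,7,8],[6,7,8],[4,5,6],[4,5,6],[7],[8]], Cover 3 [1,8,3,4,2,5,0,7,6], [(0,[]),(2,[]),(1,[]),(0,[0,1,2,3,5,4,6,8,7])]),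
     (adj [[1,7,8],[2,6,7,8],[4,5,6],[4,5,6],[7],[8]], Cover 2 [8,7,4,3,6,2,1,0,5], []),
     (adj [[1,7,8],[6,7,8],[4,5,6,7],[4,5,6],[7],[8]], Cover 2 [8,1,6,3,4,2,7,0,5], []),
     (adj [[1,7,8],[6,7,8],[4,5,6],[4,5,6],[7],[7,8]], Cover 4 [7,1,8,6,3,2,4,0,5], [(2,[])]),
     (adj [[1,7,8],[6,7,8],[4,5,6],[4,5,6],[7],[8]], Cover 5 [8,7,0,6,3,2,5,1,4], [(7,[0,4,5,6,8,2,3,1,7]),(1,[0,1,3,2,5,4,6,8,7]),(1,[0,1,2,3,5,4,6,8,7]),(7,[0,5,4,6,7,2,3,1]),(1,[0,1,3,2]),(1,[]),(0,[]),(3,[0,1,3,2]),(3,[]),(2,[])]),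
     (adj [[2,3,7,8],[6,7,8],[4,5,6],[4,5,6],[7],[8]], Cover 7 [6,2,0,8,7,4,1,5,3], [(88,[]),(8,[0,4,5,6,8,2,3,1,7]),(8,[0,5,4,6,7,2,3,1]),(0,[]),(86,[]),(86,[0,1,2,3,5,4,6,8,7]),(87,[])]),
     (adj [[2,6,7,8],[6,7,8],[4,5,6],[4,5,6,7],[7],[8]], Cover 2 [4,3,6,0,8,1,5,2,7], []),
     (adj [[2,6,7,8],[6,7,8],[4,5,6],[4,5,6],[7,8],[8]], Cover 4 [7,0,8,5,3,2,6,1,4], []),
     (adj [[2,6,7,8],[6,7,8],[4,5,6],[4,5,6],[7],[8]], Cover 2 [8,7,4,3,6,2,0,1,5], [(0,[]),(1,[0,1,2,3,5,4,6,8,7]),(1,[]),(2,[])]),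
     (adj [[2,7,8],[4,6,7,8],[4,5,6],[4,5,6],[7],[8]], Cover 2 [5,0,7,1,6,4,2,8,3], [(0,[])]),
     (adj [[2,7,8],[6,7,8],[4,5,6],[4,5,6],[6,7],[8]], Cover 7 [8,5,2,7,4,6,1,0,3], []),
     (adj [[2,7,8],[6,7,8],[4,5,6],[4,5,6],[7,8],[8]], Cover 5 [1,7,8,5,2,3,6,0,4], [(5,[])]),
     (adj [[2,7,8],[6,7,8],[4,5,6],[4,5,6],[7],[8]], Cover 2 [6,1,7,0,5,4,3,8,2], [(15,[0,5,4,6,7,2,3,1]),(3,[]),(1,[0,1,2,3,5,4,6,8,7]),(1,[]),(7,[]),(2,[0,1,2,3,5,4,6,8,7]),(2,[]),(0,[0,1,2,3,5,4,6,8,7]),(6,[]),(0,[])]),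
     (adj [[4,6,7,8],[3,6,7,8],[4,5,6],[4,5,6],[7],[8]], Cover 4 [5,3,1,7,0,4,2,8,6], []),
     (adj [[4,6,7,8],[6,7,8],[4,5,6,8],[4,5,6],[7],[8]], Cover 5 [3,5,2,1,0,7,4,6,8], []),
     (adj [[4,6,7,8],[6,7,8],[4,5,6],[4,5,6,7],[7],[8]], Cover 4 [3,7,1,8,2,0,4,5,6], []),
     (adj [[4,6,7,8],[6,7,8],[4,5,6],[4,5,6],[7],[8]], Cover 3 [8,1,6,3,4,2,7,0,5], [(1,[0,1,3,2]),(1,[]),(2,[]),(0,[]),(3,[])]),
     (adj [[4,7,8],[6,7,8],[4,5,6,7],[4,5,6],[7],[8]], Cover 3 [8,1,7,4,3,2,5,0,6], []),
     (adj [[4,7,8],[6,7,8],[4,5,6,8],[4,5,6],[7],[8]], Cover 6 [5,8,1,7,4,0,3,2,6], []),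
     (adj [[4,7,8],[6,7,8],[4,5,6],[4,5,6],[7],[6,8]], Cover 3 [7,0,8,5,6,2,4,3,1], []),
     (adj [[4,7,8],[6,7,8],[4,5,6],[4,5,6],[7],[8]], Cover 5 [7,0,8,3,2,6,1,5,4], [(2,[0,1,3,2]),(2,[]),(23,[0,5,4,6,7,2,3,1]),(7,[0,1,3,2]),(7,[]),(3,[]),(15,[]),(1,[]),(23,[0,4,5,6,8,2,3,1,7]),(0,[])]),
     (adj [[6,7,8],[3,6,7,8],[4,5,6],[4,5,6],[7],[8]], Cover 4 [2,5,8,1,7,3,4,0,6], []),
     (adj [[6,7,8],[6,7,8],[4,5,6,7],[4,5,6],[7],[8]], Cover 4 [3,6,8,1,7,2,4,0,5], []),
     (adj [[6,7,8],[6,7,8],[4,5,6],[4,5,6],[7],[7,8]], Cover 3 [3,2,8,1,7,0,4,5,6], [(10,[0,1,3,2])]),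
     (adj [[6,7,8],[6,7,8],[4,5,6],[4,5,6],[7],[8]], Cover 5 [2,3,6,0,8,7,1,5,4], [(11,[]),(1,[0,1,2,3,5,4,6,8,7]),(1,[]),(11,[0,1,3,2]),(1,[0,1,3,2,5,4,6,8,7]),(1,[0,1,3,2]),(2,[]),(27,[0,4,5,6,8,2,3,1,7]),(27,[0,5,4,6,7,2,3,1]),(0,[])]),
     (adj [[7,8],[6,7,8],[4,5,6],[4,5,6],[7],[8]], At 0, [(20,[]),(12,[]),(12,[0,1,3,2]),(4,[]),(4,[0,1,2,3,5,4,6,8,7]),(0,[])]),
     (adj [[1,2,8],[6,7,8],[4,5,6,7],[4,5,6],[7],[8]], Cover 4 [7,2,0,5,3,6,4,8,1], []),
     (adj [[1,8],[6,7,8],[4,5,6,7],[4,5,6,7],[7],[8]], At 0, []),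
     (adj [[1,8],[6,7,8],[4,5,6,7],[4,5,6,8],[7],[8]], At 0, []),
     (adj [[1,8],[6,7,8],[4,5,6,7],[4,5,6],[7],[8]], Cover 4 [2,4,3,0,1,8,7,6,5], [(2,[]),(0,[]),(1,[]),(3,[]),(32,[0,4,5,6,8,2,3,1,7])]),
     (adj [[2,4,8],[6,7,8],[4,5,6,7],[4,5,6],[7],[8]], Cover 6 [0,4,7,6,5,3,8,1,2], []),
     (adj [[2,8],[6,7,8],[4,5,6,7],[4,5,6],[7],[8]], Cover 3 [4,5,8,1,6,0,3,7,2], [(0,[]),(5,[])]),
     (adj [[3,8],[6,7,8],[4,5,6,7],[4,5,6],[7],[8],[],[8]], At 0, []),
     (adj [[3,8],[6,7,8],[4,5,6,7],[4,5,6],[7],[8]], Cover 3 [8,1,7,2,3,6,0,4,5], [(0,[]),(36,[0,4,5,6,8,2,3,1,7]),(7,[]),(1,[]),(7,[0,5,6,7,4,1,2,3])]),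
     (adj [[4,5,8],[6,7,8],[4,5,6,7],[4,5,6],[7],[8]], Cover 3 [8,5,3,4,7,2,1,0,6], []),
     (adj [[4,6,8],[6,7,8],[4,5,6,7],[4,5,6],[7],[8]], Cover 3 [8,1,6,3,4,2,7,0,5], []),
     (adj [[4,8],[6,7,8],[4,5,6,7],[4,5,6],[7],[8]], At 0, [(6,[]),(4,[]),(2,[]),(1,[]),(0,[]),(10,[])]),
     (adj [[5,8],[6,7,8],[4,5,6,7],[4,5,6],[7,8],[8]], At 0, []),
     (adj [[5,8],[6,7,8],[4,5,6,7],[4,5,6],[7],[8]], Cover 7 [1,4,2,0,5,7,8,6,3], [(8,[]),(1,[]),(0,[]),(12,[]),(41,[0,5,4,6,7,2,3,1])]),
     (adj [[6,8],[6,7,8],[4,5,6,7],[4,5,6],[7],[8]], At 0, [(9,[]),(7,[]),(5,[]),(2,[]),(0,[]),(13,[])]),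
     (adj [[8],[6,7,8],[4,5,6,7],[4,5,6],[7],[8]], At 0, [(10,[]),(8,[]),(6,[]),(3,[]),(1,[]),(0,[]),(14,[])]),
     (adj [[2,4,8],[6,7,8],[4,5,6],[4,5,6],[7],[7,8]], Cover 4 [8,1,7,4,2,3,6,0,5], [(121,[])]),
     (adj [[2,8],[6,7,8],[4,5,6],[4,5,6],[7,8],[7,8]], At 0, []),
     (adj [[2,8],[6,7,8],[4,5,6],[4,5,6],[7],[7,8]], Cover 7 [7,8,0,2,6,1,4,5,3], [(17,[]),(46,[0,5,4,6,7,2,3,1]),(46,[0,6,4,5,7,2,3,1]),(0,[]),(1,[])]),
     (adj [[8],[2,6,7,8],[4,5,6],[4,5,6],[7],[7,8]], Cover 2 [7,8,0,3,2,6,1,5,4], [(18,[])]),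
     (adj [[8],[6,7,8],[4,5,6,8],[4,5,6],[7],[7,8]], Cover 3 [3,4,2,8,1,0,7,5,6], [(1,[0,1,3,2])]),
     (adj [[8],[6,7,8],[4,5,6],[4,5,6],[7],[7,8]], Cover 1 [7,8,0,3,2,6,1,5,4], [(20,[]),(5,[0,1,3,2]),(5,[]),(49,[0,5,4,6,7,2,3,1]),(0,[0,1,3,2]),(0,[]),(49,[0,6,4,5,7,2,3,1]),(2,[]),(1,[0,1,3,2]),(1,[])]),
     (adj [[2,3,6,8],[6,7,8],[4,5,6],[4,5,6],[7],[8],[],[8]], Cover 2 [5,0,6,7,4,1,2,3,8], []),
     (adj [[2,3,8],[6,7,8],[4,5,6],[4,5,6],[7],[8],[],[8]], Cover 3 [4,0,5,6,1,8,7,2,3], [(0,[]),(22,[0,7,2,3,6,5,4,1])]),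
     (adj [[2,8],[6,7,8],[4,5,6],[4,5,6],[7],[8],[],[8]], Cover 4 [3,5,2,0,7,8,1,6,4], [(0,[]),(8,[0,1,3,2]),(52,[0,7,2,3,6,5,4,1]),(23,[0,7,2,3,6,5,4,1])]),
     (adj [[8],[6,7,8],[4,5,6,8],[4,5,6],[7],[8],[],[8]], At 0, []),
     (adj [[8],[6,7,8],[4,5,6],[4,5,6],[7],[8],[],[8]], Cover 3 [2,4,0,8,1,7,3,6,5], [(1,[]),(0,[]),(10,[0,7,2,3,6,5,4,1]),(10,[]),(54,[0,6,4,5,8,2,3,7,1]),(54,[0,5,4,6,1,2,3]),(25,[0,7,2,3,6,5,4,1]),(1,[0,1,3,2]),(0,[0,1,3,2]),(54,[0,5,4,6,7,2,3,1])]),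
     (adj [[8],[6,7,8],[4,5,6],[4,5,6],[7],[8]], At 7, [(26,[]),(11,[]),(11,[0,1,3,2]),(5,[]),(55,[0,5,4,6,7,2,3,1]),(0,[])]),
     (adj [[],[6,7,8],[4,5,6,7,8],[4,5,6],[7],[8]], Cover 3 [4,3,5,8,1,0,6,2,7], [(0,[0,3,2,1,8,7,6,5,4])]),
     (adj [[2],[6,7,8],[4,5,6,8],[4,5,6,7],[7],[8]], At 0, []),
     (adj [[4,5],[6,7,8],[4,5,6,8],[4,5,6,7],[7],[8]], At 0, []),
     (adj [[4],[6,7,8],[4,5,6,8],[4,5,6,7],[7],[8]], Cover 2 [5,2,4,7,1,0,6,3,8], [(0,[])]),
     (adj [[],[6,7,8],[4,5,6,8],[4,5,6,7],[5,7],[8]], At 0, []),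
     (adj [[],[6,7,8],[4,5,6,8],[4,5,6,7],[7],[8]], Cover 3 [0,6,2,8,7,4,3,5,1], [(3,[]),(5,[]),(5,[0,1,2,3,5,4,6,8,7]),(1,[]),(61,[0,4,5,6,8,2,3,1,7]),(61,[0,5,4,6,7,2,3,1]),(0,[])]),
     (adj [[1],[6,7,8],[4,5,6,8],[4,5,6],[7],[7,8]], Cover 3 [7,1,8,2,3,6,0,4,5], [(6,[])]),
     (adj [[],[6,7,8],[4,5,6,8],[4,5,6,8],[7],[7,8]], At 0, []),
     (adj [[],[6,7,8],[4,5,6,8],[4,5,6],[7],[7,8]], Cover 2 [7,8,2,0,3,6,1,5,4], [(8,[0,1,2,3,5,4,6,8,7]),(2,[]),(64,[0,2,3,7,6,5,4,1]),(8,[]),(0,[]),(64,[0,6,4,5,7,2,3,1]),(1,[])]),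
     (adj [[],[6,7,8],[4,5,6,8],[4,5,6],[7],[8],[],[8]], Cover 2 [3,0,2,1,7,8,5,6,4], [(3,[0,7,2,3,6,5,4,1]),(3,[]),(9,[0,7,2,3,5,6,4,8,1]),(9,[0,1,2,3,5,4,6,8,7]),(9,[]),(65,[])]),
     (adj [[],[6,7,8],[4,5,6,8],[4,5,6],[7],[8]], At 7, [(10,[0,1,2,3,5,4,6,8,7]),(9,[]),(4,[]),(1,[]),(66,[0,5,4,6,7,2,3,1]),(0,[])]),
     (adj [[],[6,7,8],[4,5,6],[4,5,6],[7,8],[7,8]], Cover 3 [8,7,2,3,0,6,1,5,4], [(0,[]),(0,[0,1,3,2]),(11,[]),(67,[0,6,4,5,7,2,3,1]),(0,[0,1,3,2,4,5,6,8,7]),(11,[0,1,2,3,4,5,6,8,7]),(11,[0,6,7,8,4,5,1,3,2]),(67,[0,1,4,5,3,7,8,6,2]),(67,[0,1,4,5,2,7,8,6,3])]),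
     (adj [[],[6,7,8],[4,5,6],[4,5,6],[7,8],[8]], At 7, [(12,[0,1,2,3,5,4,6,8,7]),(1,[0,1,2,3,5,4,6,8,7]),(1,[0,1,3,2,5,4,6,8,7]),(0,[]),(68,[0,5,4,6,7,2,3,1]),(68,[0,6,4,5,8,2,3,7,1])]),
     (adj [[2,5],[6,7,8],[4,5,6],[4,5,6],[7],[8],[],[8]], Cover 2 [1,7,4,2,5,0,3,8,6], [(69,[0,5,4,6,1,2,3]),(13,[0,7,2,3,5,6,4,8,1]),(13,[0,1,2,3,5,4,6,8,7]),(13,[])]),
     (adj [[2],[6,7,8],[4,5,6],[4,5,6],[7],[8],[],[8]], Cover 5 [3,0,4,7,1,8,5,2,6], [(3,[0,1,3,2,5,4,6,8,7]),(3,[0,7,3,2,5,6,4,8,1]),(3,[0,1,3,2]),(14,[0,1,2,3,5,4,6,8,7]),(14,[0,7,2,3,5,6,4,8,1]),(14,[]),(0,[]),(70,[0,5,4,6,1,2,3]),(70,[0,6,4,5,8,2,3,7,1]),(3,[])]),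
     (adj [[],[6,7,8],[4,5,6],[4,5,6],[7],[8],[],[8]], Cover 1 [7,8,0,3,2,6,1,5,4], [(15,[0,1,2,3,5,4,6,8,7]),(4,[0,1,3,2,5,4,6,8,7]),(4,[0,1,2,3,5,4,6,8,7]),(71,[0,5,4,6,7,2,3,1]),(4,[0,1,3,2]),(4,[]),(71,[0,4,5,6,8,2,3,1,7]),(0,[]),(4,[0,7,3,2,5,6,4,8,1]),(4,[0,7,2,3,5,6,4,8,1])]),
     (adj [[],[6,7,8],[4,5,6],[4,5,6],[7],[8]], At 8, [(16,[]),(5,[]),(5,[0,1,3,2]),(3,[]),(72,[0,4,5,6,8,2,3,1,7]),(0,[])]),
     (adj [[1,2,3,7,8],[5,6,7],[4,6,8],[4,5,6],[7],[8]], Cover 3 [5,6,4,7,0,2,8,1,3], []),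
     (adj [[1,3,7,8],[5,6,7],[4,5,6,8],[4,5,6],[7],[8]], Cover 3 [8,5,6,4,7,3,0,1,2], []),
     (adj [[1,3,7,8],[5,6,7],[4,6,8],[4,5,6],[7],[8]], Cover 7 [7,2,6,3,5,1,0,4,8], [(2,[0,5,4,6,7,2,3,1]),(149,[]),(0,[]),(1,[]),(151,[]),(150,[])]),
     (adj [[1,4,7,8],[5,6,7],[4,6,7,8],[4,5,6],[7],[8]], Cover 3 [8,0,7,6,3,1,5,4,2], []),
     (adj [[1,4,7,8],[5,6,7],[4,6,8],[4,5,6],[7],[8],[],[8]], Cover 6 [0,2,6,3,5,1,7,8,4], []),
     (adj [[1,4,7,8],[5,6,7],[4,6,8],[4,5,6],[7],[8]], Cover 3 [8,2,4,7,1,3,6,0,5], [(0,[]),(5,[0,1,2,3,4,8,6,7,5]),(1,[]),(5,[0,5,4,6,7,2,3,1]),(2,[])]),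
     (adj [[1,6,7,8],[5,6,7],[4,5,6,8],[4,5,6],[7],[8]], Cover 4 [2,6,3,1,7,0,8,5,4], []),
     (adj [[1,6,7,8],[5,6,7],[4,6,8],[4,5,6],[7],[8]], Cover 3 [1,6,3,4,8,2,0,5,7], [(7,[0,1,2,3,4,8,6,7,5]),(156,[]),(4,[0,4,5,6,1,2,3]),(0,[])]),
     (adj [[1,7,8],[3,5,6,7],[4,6,8],[4,5,6],[7],[8]], Cover 1 [0,7,4,3,6,5,8,2,1], []),
     (adj [[1,7,8],[5,6,7,8],[4,6,8],[4,5,6],[7],[8]], Cover 5 [7,0,8,5,6,3,4,2,1], []),
     (adj [[1,7,8],[5,6,7],[4,6,8],[4,5,6],[7,8],[8]], Cover 4 [3,6,1,0,8,2,4,7,5], [(7,[])]),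
     (adj [[1,7,8],[5,6,7],[4,6,8],[4,5,6],[7],[8]], Cover 1 [3,6,1,0,8,7,4,5,2], [(2,[]),(8,[]),(11,[0,1,2,3,4,8,6,7,5]),(11,[0,2,1,3,7,5,6,4]),(3,[]),(11,[0,4,5,6,1,8,3,7,2]),(11,[0,5,4,6,7,2,3,1]),(1,[]),(5,[]),(0,[])]),
     (adj [[3,7,8],[5,6,7],[3,4,6,8],[4,5,6],[7],[8]], Cover 4 [6,1,4,7,8,0,5,2,3], []),
     (adj [[3,7,8],[5,6,7],[4,6,8],[4,5,6],[7,8],[8]], Cover 3 [4,2,6,5,0,1,7,3,8], [(1,[0,2,1,3,5,4,6,8,7]),(162,[])]),
     (adj [[3,7,8],[5,6,7],[4,6,8],[4,5,6],[7],[8]], Cover 7 [6,3,0,7,8,5,2,4,1], [(163,[]),(14,[0,5,4,6,7,2,3,1]),(14,[0,4,5,6,1,8,3,7,2]),(14,[0,2,1,3,7,5,6,4]),(14,[0,1,2,3,4,8,6,7,5]),(1,[]),(2,[0,2,1,3,5,4,6,8,7]),(0,[0,2,1,3,5,4,6,8,7]),(0,[]),(162,[])]),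
     (adj [[7,8],[5,6,7],[4,6,8],[4,5,6],[7],[8]], At 0, [(3,[]),(3,[0,2,1,3,5,4,6,8,7]),(0,[]),(3,[0,4,5,6,1,2,3]),(3,[0,5,4,6,2,1,3,8,7]),(0,[0,4,5,6,1,2,3])]),
     (adj [[2,8],[5,6,7],[4,6,7,8],[4,5,6],[7],[8]], Cover 7 [5,8,2,6,7,4,1,0,3], [(0,[]),(0,[0,3,2,1,7,5,6,4])]),
     (adj [[8],[5,6,7],[4,6,7,8],[4,5,6],[7,8],[8]], Cover 5 [2,7,4,3,0,5,8,6,1], [(1,[])]),
     (adj [[8],[5,6,7],[4,6,7,8],[4,5,6],[7],[6,8]], Cover 7 [6,5,0,4,7,1,2,8,3], []),
     (adj [[8],[5,6,7],[4,6,7,8],[4,5,6],[7],[8]], Cover 2 [4,7,1,6,8,0,5,2,3], [(19,[0,2,1]),(19,[0,5,6,7,4,2,1,3]),(1,[]),(3,[0,3,2,1,7,5,6,4]),(19,[0,5,4,6,7,2,3,1]),(1,[0,3,2,1,7,5,6,4]),(3,[]),(19,[0,3,2,1,7,8,6,4,5]),(0,[]),(2,[])]),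
     (adj [[1,3,4,8],[5,6,7],[4,6,8],[4,5,6],[7],[8],[],[8]], Cover 7 [0,5,6,2,7,1,4,3,8], []),
     (adj [[1,3,8],[5,6,7],[4,6,8],[4,5,6],[7],[8],[],[8]], Cover 4 [6,2,4,7,5,8,0,1,3], [(0,[]),(5,[])]),
     (adj [[1,8],[5,6,7],[4,6,8],[4,5,6],[7],[8],[],[8]], Cover 3 [3,2,0,1,7,8,4,6,5], [(0,[]),(22,[0,2,1,3,7,5,6,4]),(2,[]),(6,[]),(0,[0,8,3,1,6,7,5,2,4])]),
     (adj [[8],[5,6,7],[4,6,8],[4,5,6],[7],[8],[],[8]], Cover 3 [7,1,5,0,2,3,4,8,6], [(3,[0,4,5,6,1,2,3]),(7,[]),(3,[]),(23,[0,2,1,3,7,5,6,4]),(0,[]),(23,[0,3,2,7,1,8,4,6,5]),(23,[0,7,2,3,6,5,4,1]),(23,[0,6,4,8,5,7,2,3,1]),(0,[0,4,5,6,1,2,3]),(23,[0,1,2,3,4,8,6,7,5])]),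
     (adj [[8],[5,6,7],[4,6,8],[4,5,6],[7],[8]], At 7, [(8,[]),(4,[]),(24,[0,2,1,3,7,5,6,4]),(4,[0,4,5,6,1,2,3]),(24,[0,5,4,6,7,2,3,1]),(0,[])]),
     (adj [[],[5,6,7,8],[4,6,8],[4,5,6],[7],[7,8]], Cover 1 [0,5,8,2,4,6,1,7,3], [(0,[]),(0,[0,1,4,5,3,8,7,6,2]),(0,[0,5,2,1,6,7,8,3,4]),(0,[0,4,1,5,8,3,7,2,6]),(25,[0,6,4,5,7,8,3,1,2])]),
     (adj [[],[5,6,7,8],[4,6,8],[4,5,6],[7],[8]], At 7, [(1,[0,2,1,3,5,4,6,8,7]),(26,[0,3,2,1,7,8,6,4,5]),(26,[0,2,1,3,7,5,6,4]),(0,[]),(26,[0,1,4,6,3,2,7,5]),(0,[0,1,3,2,4,8,6,7,5])]),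
     (adj [[],[5,6,7],[4,6,8],[4,5,6],[7],[8],[],[8]], At 0, [(2,[0,3,7,2,8,6,4,5,1]),(2,[0,3,8,1,7,6,5,4,2]),(2,[0,1,4,8,2,5,7,6,3]),(2,[0,6,7,5,8,3,1,2,4]),(2,[0,6,8,4,7,3,2,1,5]),(2,[0,4,1,8,5,2,7,3,6]),(2,[0,2,1,3,5,4,6,8,7]),(2,[])]),
     (adj [[],[5,6,7],[4,6,8],[4,5,6],[7],[8]], At 8, [(3,[]),(1,[]),(28,[0,1,2,3,4,8,6,7,5]),(1,[0,4,5,6,1,2,3]),(28,[0,4,5,6,1,8,3,7,2]),(0,[])]),
     (adj [[1,2,3,7],[5,6,7],[4,5,6],[4,5,6],[7],[8]], At 8, []),
     (adj [[1,2,3,7],[5,6,7],[4,5,6],[4,5,6],[7]], Cover 7 [5,6,4,8,7,3,0,2,1], [(0,[]),(0,[0,1,2,3,4,6,5])]),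
     (adj [[1,2,6,7,8],[5,6,7],[4,5,6],[4,5,6],[7]], At 8, []),
     (adj [[1,2,7,8],[5,6,7],[4,5,6],[4,5,6,8],[7]], Cover 3 [7,0,2,5,3,6,8,4,1], [(3,[0,1,3,2])]),
     (adj [[1,2,7,8],[5,6,7],[4,5,6],[4,5,6],[6,7]], At 8, []),
     (adj [[1,2,7,8],[5,6,7],[4,5,6],[4,5,6],[7,8],[],[8]], Cover 3 [3,4,8,0,1,2,5,7,6], []),
     (adj [[1,2,7,8],[5,6,7],[4,5,6],[4,5,6],[7,8]], Cover 0 [0,7,4,6,3,5,8,2,1], [(0,[])]),
     (adj [[1,2,7,8],[5,6,7],[4,5,6],[4,5,6],[7],[],[],[8]], Cover 7 [5,3,8,7,0,6,1,4,2], [(36,[0,7,2,3,6,5,4,1])]),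
     (adj [[1,2,7,8],[5,6,7],[4,5,6],[4,5,6],[7]], Cover 7 [3,4,0,8,1,7,6,2,5], [(6,[]),(4,[]),(1,[]),(3,[]),(5,[]),(0,[])]),
     (adj [[1,2,7],[5,6,7,8],[4,5,6],[4,5,6],[7]], Cover 3 [8,7,4,3,6,2,0,1,5], []),
     (adj [[1,2,7],[5,6,7],[4,5,6],[4,5,6,8],[7]], Cover 3 [1,0,2,3,8,4,7,6,5], [(1,[])]),
     (adj [[1,2,7],[5,6,7],[4,5,6],[4,5,6],[7],[],[],[8]], Cover 0 [3,8,7,1,0,2,4,6,5], [(9,[]),(2,[])]),
     (adj [[1,2,7],[5,6,7],[4,5,6],[4,5,6],[7]], Cover 0 [8,2,0,1,7,3,4,6,5], [(3,[]),(2,[]),(0,[]),(1,[]),(10,[])]),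
     (adj [[1,4,7],[5,6,7],[4,5,6,7],[4,5,6],[7]], Cover 1 [0,8,5,3,6,2,7,4,1], []),
     (adj [[1,4,7],[5,6,7],[4,5,6],[4,5,6,8],[7]], Cover 0 [8,5,1,6,7,4,0,3,2], [(14,[0,1,3,2,4,6,5]),(43,[0,7,5,6,2,3,1,4]),(1,[0,4,6,5,1,2,3])]),
     (adj [[1,4,7],[5,6,7],[4,5,6],[4,5,6],[7]], Cover 5 [3,6,5,8,0,7,4,2,1], [(0,[]),(2,[0,1,3,2]),(1,[0,1,3,2]),(0,[0,4,5,6,1,2,3]),(2,[0,4,6,5,1,2,3]),(1,[0,4,6,5,1,2,3]),(2,[0,4,5,6,1,2,3]),(1,[0,4,5,6,1,2,3]),(1,[])]),
     (adj [[1,5,7,8],[5,6,7],[4,5,6,8],[4,5,6],[7]], Cover 3 [6,3,4,7,0,8,5,1,2], [(16,[0,1,2,3,4,6,5])]),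
     (adj [[1,5,7,8],[5,6,7],[4,5,6],[4,5,6],[7,8]], Cover 7 [1,5,2,8,4,3,7,0,6], [(46,[0,4,5,6,1,3,2])]),
     (adj [[1,5,7,8],[5,6,7],[4,5,6],[4,5,6],[7],[8]], At 8, []),
     (adj [[1,5,7,8],[5,6,7],[4,5,6],[4,5,6],[7]], Cover 1 [8,1,5,3,4,2,0,7,6], [(0,[]),(2,[0,1,3,2]),(1,[]),(2,[]),(6,[0,1,3,2]),(6,[0,4,5,6,1,2,3])]),
     (adj [[1,5,7],[5,6,7],[4,5,6],[4,5,6,8],[7]], Cover 5 [3,8,2,0,1,7,5,6,4], [(0,[]),(49,[0,7,5,6,2,3,1,4])]),
     (adj [[1,5,7],[5,6,7],[4,5,6],[4,5,6],[7,8]], Cover 3 [1,5,3,4,8,2,0,7,6], [(50,[0,4,5,6,1,3,2]),(8,[0,1,3,2])]),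
     (adj [[1,5,7],[5,6,7],[4,5,6],[4,5,6],[7]], Cover 3 [4,3,0,1,8,5,2,6,7], [(9,[0,4,5,6,1,2,3]),(0,[]),(1,[]),(2,[]),(9,[])]),
     (adj [[1,7,8],[5,6,7],[4,5,6],[4,5,6],[5,7]], Cover 3 [0,7,4,2,6,5,1,8,3], [(10,[]),(0,[0,1,2,3,4,6,5])]),
     (adj [[1,7,8],[5,6,7],[4,5,6,7],[4,5,6],[7,8]], At 8, []),
     (adj [[1,7,8],[5,6,7],[4,5,6],[4,5,6],[7,8]], Cover 5 [1,0,7,4,3,2,6,8,5], [(9,[]),(12,[0,1,3,2]),(12,[]),(2,[0,1,2,3,4,6,5]),(0,[0,1,3,2]),(0,[]),(54,[0,4,5,6,1,2,3])]),
     (adj [[1,7,8],[5,6,7],[4,5,6],[4,5,6],[7],[7]], Cover 0 [8,6,1,5,7,4,0,3,2], [(0,[])]),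
     (adj [[1,7,8],[5,6,7],[4,5,6],[4,5,6],[7],[8]], Cover 3 [4,3,5,8,0,1,7,2,6], [(1,[]),(11,[]),(27,[0,1,3,2]),(14,[0,1,3,2]),(4,[]),(56,[0,7,2,3,6,5,4,1])]),
     (adj [[1,7,8],[5,6,7],[4,5,6],[4,5,6],[7]], Cover 0 [5,6,8,0,7,4,2,3,1], [(0,[]),(5,[]),(1,[]),(4,[]),(5,[0,1,2,3,4,6,5]),(1,[0,1,2,3,4,6,5]),(4,[0,1,2,3,4,6,5]),(2,[]),(12,[]),(15,[])]),
     (adj [[1,7],[5,6,7],[4,5,6],[4,5,6],[7]], At 0, [(16,[]),(16,[0,1,3,2]),(13,[]),(6,[]),(6,[0,1,2,3,4,6,5]),(0,[])]),
     (adj [[2,3,6,7],[5,6,7],[4,5,6],[4,5,6],[7],[8]], At 8, []),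
     (adj [[2,3,6,7],[5,6,7],[4,5,6],[4,5,6],[7]], Cover 7 [5,6,0,7,8,3,4,2,1], [(0,[])]),
     (adj [[2,3,7],[5,6,7],[4,5,6,8],[4,5,6],[7]], Cover 2 [5,6,4,7,0,8,3,1,2], []),
     (adj [[2,3,7],[5,6,7],[4,5,6],[4,5,6],[5,7]], Cover 4 [5,1,6,8,0,7,4,3,2], []),
     (adj [[2,3,7],[5,6,7],[4,5,6],[4,5,6],[7],[7]], Cover 0 [6,8,0,4,7,5,1,3,2], []),
     (adj [[2,3,7,8],[5,6,7],[4,5,6],[4,5,6],[7],[8]], Cover 2 [6,5,8,7,4,0,2,1,3], [(209,[]),(210,[])]),
     (adj [[2,3,7],[5,6,7],[4,5,6],[4,5,6],[7],[8],[8]], At 8, [(0,[])]),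
     (adj [[2,3,7],[5,6,7],[4,5,6],[4,5,6],[7],[8]], Cover 7 [4,7,1,6,5,8,2,0,3], [(0,[]),(1,[])]),
     (adj [[2,3,7],[5,6,7],[4,5,6],[4,5,6],[7]], Cover 2 [6,5,0,8,4,7,2,3,1], [(6,[]),(0,[0,1,2,3,4,6,5]),(4,[0,1,2,3,4,6,5]),(3,[0,1,2,3,4,6,5]),(0,[]),(4,[]),(3,[]),(8,[0,4,5,6,1,2,3]),(5,[])]),
     (adj [[2,5,7],[5,6,7],[4,5,6],[4,5,6,8],[7]], Cover 3 [6,4,7,0,5,8,3,2,1], [(0,[0,4,5,6,1,2,3]),(39,[0,1,3,2,4,6,5]),(9,[0,4,5,6,1,2,3])]),
     (adj [[2,5,7],[5,6,7],[4,5,6],[4,5,6],[7],[8]], Cover 3 [8,7,3,6,2,4,0,1,5], []),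
     (adj [[2,5,7],[5,6,7],[4,5,6],[4,5,6],[7],[],[7]], Cover 0 [4,3,6,1,8,0,2,7,5], []),
     (adj [[2,5,7],[5,6,7],[4,5,6],[4,5,6],[7]], Cover 7 [6,5,0,7,8,2,4,3,1], [(3,[0,4,5,6,1,2,3]),(0,[]),(2,[0,4,5,6,1,2,3]),(1,[]),(12,[0,4,5,6,1,2,3]),(2,[])]),
     (adj [[2,7,8],[5,6,7],[4,5,6],[4,5,6,7],[7,8]], At 8, []),
     (adj [[2,7,8],[5,6,7],[4,5,6],[4,5,6,7],[7]], Cover 2 [8,1,7,3,2,4,0,5,6], [(0,[])]),
     (adj [[2,7,8],[5,6,7],[4,5,6],[4,5,6],[5,7]], Cover 2 [5,4,7,8,6,0,2,3,1], [(6,[])]),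
     (adj [[2,7,8],[5,6,7],[4,5,6],[4,5,6],[7],[7]], Cover 7 [7,0,8,3,6,1,5,4,2], [(7,[]),(3,[0,1,2,3,4,6,5])]),
     (adj [[2,7,8],[5,6,7],[4,5,6],[4,5,6],[7,8],[8]], Cover 3 [3,6,2,8,7,0,1,4,5], [(8,[])]),
     (adj [[2,7,8],[5,6,7],[4,5,6],[4,5,6],[7],[8]], Cover 3 [7,0,8,5,3,2,4,1,6], [(77,[0,7,2,3,6,5,4,1]),(3,[]),(5,[]),(9,[]),(48,[0,1,3,2]),(0,[])]),
     (adj [[2,7,8],[5,6,7],[4,5,6],[4,5,6],[7]], Cover 1 [0,7,4,6,5,3,8,2,1], [(19,[0,4,5,6,1,2,3]),(6,[0,1,2,3,4,6,5]),(6,[]),(10,[]),(2,[0,1,2,3,4,6,5]),(2,[]),(4,[]),(3,[]),(0,[0,1,2,3,4,6,5]),(0,[])]),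
     (adj [[2,7],[5,6,7],[4,5,6],[4,5,6],[7]], At 0, [(20,[]),(11,[]),(20,[0,4,5,6,1,2,3]),(7,[]),(7,[0,1,2,3,4,6,5]),(0,[])]),
     (adj [[7,8],[5,6,7],[4,5,6],[4,5,6],[7]], At 0, [(21,[]),(0,[]),(0,[0,1,3,2]),(21,[0,4,5,6,1,2,3]),(0,[0,4,5,6,1,2,3]),(0,[0,4,6,5,1,2,3])]),
     (adj [[7],[5,6,7],[4,5,6],[4,5,6],[7]], At 0, [(22,[]),(1,[]),(1,[0,1,3,2]),(22,[0,4,5,6,1,2,3]),(1,[0,4,5,6,1,2,3]),(1,[0,4,6,5,1,2,3]),(0,[])]),
     (adj [[1,2],[5,6,7],[4,5,6,7],[4,5,6],[7]], Cover 0 [6,4,7,8,0,5,2,3,1], []),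
     (adj [[1,3],[5,6,7],[4,5,6,7],[4,5,6],[7],[8]], Cover 5 [4,2,6,1,0,8,3,7,5], []),
     (adj [[1,3],[5,6,7],[4,5,6,7],[4,5,6],[7]], Cover 4 [8,0,3,5,2,1,7,4,6], [(0,[])]),
     (adj [[1,5],[5,6,7],[4,5,6,7],[4,5,6],[7]], Cover 7 [2,7,8,0,3,4,5,1,6], [(3,[]),(3,[0,3,2,1,7,5,6,4])]),
     (adj [[1,8],[5,6,7],[4,5,6,7],[4,5,6],[7]], At 0, [(3,[]),(1,[]),(4,[0,3,2,1,7,5,6,4]),(0,[]),(0,[0,1,2,3,4,6,5]),(4,[])]),
     (adj [[1],[5,6,7],[4,5,6,7],[4,5,6],[7]], At 0, [(4,[]),(2,[]),(5,[0,3,2,1,7,5,6,4]),(1,[]),(1,[0,1,2,3,4,6,5]),(5,[]),(0,[])]),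
     (adj [[2,8],[5,6,7],[4,5,6,7],[4,5,6],[7,8]], At 8, []),
     (adj [[2,8],[5,6,7],[4,5,6,7],[4,5,6],[7]], Cover 7 [7,4,6,8,0,2,5,3,1], [(0,[0,3,2,1,7,5,6,4]),(7,[]),(0,[]),(7,[0,3,2,1,7,5,6,4]),(1,[0,3,2,1,7,5,6,4])]),
     (adj [[2],[5,6,7],[4,5,6,7],[4,5,6],[7]], Cover 7 [7,1,6,3,0,2,4,8,5], [(8,[]),(2,[]),(0,[])]),
     (adj [[5,6],[5,6,7,8],[4,5,6,7],[4,5,6],[7]], Cover 3 [8,1,7,4,3,5,0,6,2], []),
     (adj [[5,6],[5,6,7],[4,5,6,7],[4,5,6],[7]], Cover 3 [8,4,3,6,1,2,7,0,5], [(0,[0,3,2,1,7,5,6,4]),(0,[])]),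
     (adj [[5,8],[5,6,7],[4,5,6,7],[4,5,6],[7]], At 0, [(5,[]),(2,[]),(5,[0,3,2,1,7,5,6,4]),(11,[0,3,2,1,7,5,6,4]),(0,[]),(11,[])]),
     (adj [[5],[5,6,7],[4,5,6,7],[4,5,6],[7]], At 0, [(6,[]),(3,[]),(6,[0,3,2,1,7,5,6,4]),(12,[0,3,2,1,7,5,6,4]),(1,[]),(12,[]),(0,[])]),
     (adj [[8],[5,6,7],[4,5,6,7],[4,5,6],[7]], At 0, [(7,[]),(4,[]),(7,[0,3,2,1,7,5,6,4]),(13,[0,3,2,1,7,5,6,4]),(0,[]),(0,[0,1,2,3,4,6,5]),(13,[])]),
     (adj [[],[5,6,7],[4,5,6,7],[4,5,6],[7]], At 0, [(8,[]),(5,[]),(8,[0,3,2,1,7,5,6,4]),(14,[0,3,2,1,7,5,6,4]),(1,[]),(1,[0,1,2,3,4,6,5]),(14,[]),(0,[])]),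
     (adj [[8],[5,6,7],[4,5,6],[4,5,6],[7],[],[],[8]], At 8, [(170,[]),(97,[0,7,5,6,3,2,1,4]),(97,[0,7,5,6,2,3,1,4]),(170,[0,4,5,6,1,2,3]),(97,[0,7,2,3,6,5,4,1]),(97,[0,7,2,3,5,6,4,1])]),
     (adj [[],[5,6,7],[4,5,6],[4,5,6],[7],[],[],[8]], At 8, [(0,[]),(171,[]),(98,[0,7,5,6,3,2,1,4]),(98,[0,7,5,6,2,3,1,4]),(171,[0,4,5,6,1,2,3]),(98,[0,7,2,3,6,5,4,1]),(98,[0,7,2,3,5,6,4,1])]),
     (adj [[],[5,6,7],[4,5,6],[4,5,6],[7]], At 7, [(17,[]),(2,[]),(2,[0,1,3,2]),(2,[0,4,5,6,1,2,3]),(2,[0,4,6,5,1,2,3]),(0,[])]),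
     (adj [[1,2,3,6],[4,5,6],[4,5,6],[4,5,6]], Cover 3 [8,7,4,6,0,1,5,2,3], []),
     (adj [[1,2,3],[4,5,6],[4,5,6],[4,5,6],[],[7]], Cover 4 [6,1,4,0,7,8,5,2,3], []),
     (adj [[1,2,3],[4,5,6],[4,5,6],[4,5,6]], Cover 2 [8,7,3,5,1,6,4,0,2], [(0,[0,1,2,3,4,5,6,8,7]),(0,[0,1,2,3,4,6,5,8,7]),(0,[]),(0,[0,1,2,3,4,6,5]),(1,[])]),
     (adj [[1,2,4,6],[4,5,6],[4,5,6],[4,5,6]], Cover 3 [7,0,1,5,3,4,8,6,2], []),
     (adj [[1,2,4,7],[4,5,6],[4,5,6],[4,5,6],[],[],[7]], Cover 5 [0,8,7,6,5,3,4,1,2], []),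
     (adj [[1,2,4,7],[4,5,6],[4,5,6],[4,5,6],[],[],[8]], Cover 4 [8,5,3,4,0,1,7,2,6], []),
     (adj [[1,2,4,7],[4,5,6],[4,5,6],[4,5,6]], Cover 5 [4,6,2,5,7,8,0,1,3], [(1,[]),(0,[])]),
     (adj [[1,2,4],[4,5,6],[4,5,6],[4,5,6]], Cover 5 [4,0,2,6,7,8,3,1,5], [(3,[]),(0,[]),(0,[0,1,2,3,4,5,6,8,7]),(4,[])]),
     (adj [[1,2,7],[4,5,6,7],[4,5,6],[4,5,6]], Cover 2 [8,7,6,3,5,4,1,0,2], []),
     (adj [[1,2,7],[4,5,6],[4,5,6],[4,5,6,7],[],[],[],[8]], Cover 0 [7,8,4,6,1,5,0,3,2], [(182,[0,6,4,5,3,1,2]),(182,[0,5,4,6,3,1,2]),(1,[0,1,2,3,6,5,4])]),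
     (adj [[1,2,7],[4,5,6],[4,5,6],[4,5,6,7]], At 7, [(10,[0,3,2,1]),(10,[0,3,2,1,5,4]),(10,[0,3,2,1,6,5,4]),(0,[])]),
     (adj [[1,2,7],[4,5,6],[4,5,6],[4,5,6],[7],[7]], Cover 5 [7,8,2,6,1,3,4,0,5], []),
     (adj [[1,2,7],[4,5,6],[4,5,6],[4,5,6],[7],[8],[],[8]], Cover 5 [7,8,0,2,3,6,1,4,5], []),
     (adj [[1,2,7],[4,5,6],[4,5,6],[4,5,6],[7],[],[],[8]], Cover 3 [8,0,6,5,4,2,7,1,3], [(0,[0,1,2,3,4,6,5]),(0,[]),(5,[0,1,2,3,5,4])]),
     (adj [[1,2,7],[4,5,6],[4,5,6],[4,5,6],[7]], At 7, [(14,[0,3,2,1]),(2,[]),(2,[0,1,2,3,4,6,5]),(0,[])]),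
     (adj [[1,2,7],[4,5,6],[4,5,6],[4,5,6],[],[],[],[8]], At 7, [(6,[]),(6,[0,2,1]),(4,[]),(0,[]),(0,[0,1,2,3,5,4]),(0,[0,1,2,3,6,5,4])]),
     (adj [[1,2,7],[4,5,6],[4,5,6],[4,5,6]], At 7, [(7,[]),(7,[0,2,1]),(5,[]),(1,[]),(1,[0,1,2,3,5,4]),(1,[0,1,2,3,6,5,4]),(0,[])]),
     (adj [[1,2],[4,5,6],[4,5,6],[4,5,6]], At 0, [(14,[]),(9,[]),(9,[0,1,2,3,5,4]),(9,[0,1,2,3,6,5,4]),(0,[]),(0,[0,1,2,3,4,5,6,8,7])]),
     (adj [[1,4,7],[4,5,6],[4,5,6,7],[4,5,6],[],[],[8]], Cover 2 [5,4,0,8,6,7,1,3,2], []),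
     (adj [[1,4,7],[4,5,6],[4,5,6,7],[4,5,6]], Cover 0 [7,8,5,6,1,4,0,3,2], [(19,[0,2,1,3,5,4]),(19,[0,2,1,3,6,5,4]),(0,[]),(1,[0,4,6,5,1,2,3])]),
     (adj [[1,4,7],[4,5,6],[4,5,6,8],[4,5,6]], Cover 4 [6,2,5,7,0,8,4,1,3], [(0,[0,4,6,5,1,2,3]),(2,[0,4,6,5,1,2,3]),(20,[0,2,1,3,6,5,4,8,7]),(2,[0,4,5,6,1,2,3]),(20,[0,2,1,3,5,4,6,8,7])]),
     (adj [[1,4,7],[4,5,6],[4,5,6],[4,5,6]], Cover 5 [7,8,4,2,6,5,3,0,1], [(1,[]),(1,[0,4,6,5,1,2,3]),(1,[0,4,5,6,1,2,3]),(0,[]),(0,[0,4,6,5,1,2,3]),(0,[0,4,5,6,1,2,3]),(0,[0,1,3,2]),(3,[0,4,5,6,1,2,3])]),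
     (adj [[1,4],[4,5,6],[4,5,6],[4,5,6]], At 0, [(4,[]),(4,[0,1,3,2]),(4,[0,4,5,6,1,2,3]),(4,[0,4,6,5,1,2,3]),(0,[]),(0,[0,1,2,3,4,5,6,8,7])]),
     (adj [[1,7,8],[4,5,6],[4,5,6,7],[4,5,6],[5]], Cover 1 [6,5,4,8,0,7,3,2,1], []),
     (adj [[1,7,8],[4,5,6],[4,5,6,7],[4,5,6],[8],[8]], At 7, []),
     (adj [[1,7,8],[4,5,6],[4,5,6,7],[4,5,6],[8]], At 8, [(25,[0,3,2,1,4,5,6,8,7]),(0,[]),(0,[0,1,2,3,4,6,5]),(198,[0,4,5,6,2,1,3])]),
     (adj [[1,7,8],[4,5,6],[4,5,6,7],[4,5,6]], Cover 3 [0,7,4,6,5,2,8,3,1], [(3,[]),(3,[0,1,2,3,6,5,4]),(3,[0,1,2,3,5,4]),(8,[]),(26,[0,2,1,3,6,5,4]),(26,[0,2,1,3,5,4]),(2,[]),(0,[]),(0,[0,1,2,3,6,5,4])]),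
     (adj [[1,7,8],[4,5,6],[4,5,6],[4,5,6],[5]], Cover 5 [7,8,0,1,4,5,3,6,2], [(0,[0,1,3,2,4,5,6,8,7])]),
     (adj [[1,7,8],[4,5,6],[4,5,6],[4,5,6],[7],[8]], Cover 7 [8,7,4,1,2,3,5,0,6], [(28,[0,2,1,3,5,4,6,8,7]),(28,[0,2,1]),(10,[]),(10,[0,1,3,2])]),
     (adj [[1,7,8],[4,5,6],[4,5,6],[4,5,6],[7]], Cover 5 [8,0,1,5,2,3,4,7,6], [(0,[]),(2,[0,1,2,3,4,5,6,8,7]),(2,[0,1,3,2,4,5,6,8,7]),(6,[0,1,2,3,5,4]),(11,[]),(11,[0,1,3,2]),(6,[]),(29,[0,3,2,1])]),
     (adj [[1,7,8],[4,5,6],[4,5,6],[4,5,6]], Cover 1 [4,3,5,7,8,0,2,6,1], [(2,[]),(0,[]),(0,[0,1,2,3,4,5,6,8,7]),(7,[]),(3,[0,1,3,2]),(3,[0,1,3,2,4,5,6,8,7]),(12,[0,1,3,2]),(0,[0,1,2,3,5,4,6,8,7]),(3,[]),(3,[0,1,2,3,4,5,6,8,7])]),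
     (adj [[1,7],[4,5,6],[4,5,6],[4,5,6]], At 0, [(13,[]),(13,[0,1,3,2]),(8,[]),(8,[0,1,2,3,5,4]),(8,[0,1,2,3,6,5,4]),(0,[])]),
     (adj [[1],[4,5,6],[4,5,6],[4,5,6]], At 0, [(14,[]),(14,[0,1,3,2]),(9,[]),(9,[0,1,2,3,5,4]),(9,[0,1,2,3,6,5,4]),(0,[]),(0,[0,1,2,3,4,5,6,8,7])]),
     (adj [[7,8],[4,5,6],[4,5,6],[4,5,6]], At 0, [(0,[]),(0,[0,2,1]),(0,[0,3,2,1]),(0,[0,4,5,6,1,2,3]),(0,[0,5,4,6,1,2,3]),(0,[0,6,4,5,1,2,3])]),
     (adj [[7],[4,5,6],[4,5,6],[4,5,6]], At 0, [(1,[]),(1,[0,2,1]),(1,[0,3,2,1]),(1,[0,4,5,6,1,2,3]),(1,[0,5,4,6,1,2,3]),(1,[0,6,4,5,1,2,3]),(0,[])]),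
     (adj [[],[4,5,6],[4,5,6],[4,5,6]], At 0, [(2,[]),(2,[0,2,1]),(2,[0,3,2,1]),(2,[0,4,5,6,1,2,3]),(2,[0,5,4,6,1,2,3]),(2,[0,6,4,5,1,2,3]),(0,[]),(0,[0,1,2,3,4,5,6,8,7])])]
    [(0,[]), (0,[]), (36,[]), (209,[]), (136,[]), (107,[]), (0,[]), (0,[]), (0,[]), (0,[])]"
  by code_simp

lemma apex_certificate_10: "apex_certificate 10
    [([(3,4),(2,3),(0,0),(4,1),(5,1),(7,0),(5,3),(3,7),(4,2)], adj [[2,3,4,5,6],[3,4,5,6],[4,6],[6,7],[6,7]]),
     ([(3,4),(0,0),(3,1),(4,1),(10,0),(7,4),(7,5),(5,10),(5,3)], adj [[2,3,4,5,6],[5,6],[4,5,6,7],[5,6,7],[],[],[8]]),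
     ([(1,1),(0,0),(9,1),(4,5),(3,5),(2,6),(0,10),(2,3),(4,3)], adj [[2,3,4,5,6],[3,4,5],[4,5,7],[5,7],[7],[],[8]]),
     ([(3,5),(4,5),(5,2),(4,1),(2,2),(1,0),(7,1),(3,7),(2,3)], adj [[2,3,4,5,6],[3,4,5],[4,5,7],[7],[6,7],[],[8]]),
     ([(1,4),(0,0),(12,0),(5,5),(4,5),(4,3),(2,3),(2,6),(0,11)], adj [[2,3,4,5,6],[3,4],[6,7],[5,6,7],[6,7],[],[8]]),
     ([(1,4),(0,1),(5,1),(5,2),(3,4),(4,4),(10,0),(0,8),(2,2)], adj [[2,3,4,5,6],[3,4,5],[4,5,7],[5,7],[],[8],[8]]),
     ([(1,2),(0,0),(8,0),(3,4),(2,3),(2,5),(0,8),(1,3),(3,2)], adj [[2,3,4,5,6],[3,4,5],[4,5,7],[7],[6],[8],[8]]),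
     ([(1,2),(0,0),(9,1),(6,2),(4,3),(3,5),(2,9),(1,4),(4,1)], adj [[2,3,4,5,6],[3,4,5],[5,7],[5,6,7],[],[8],[8]]),
     ([(3,2),(2,2),(2,1),(0,0),(7,0),(5,3),(3,7),(4,3),(3,1)], adj [[2,3,4,5,6],[4,5],[4,5,6,7],[5,7],[],[8],[8]]),
     ([(0,0),(3,3),(4,1),(11,2),(4,5),(4,7),(6,6),(2,13),(3,5)], adj [[4,5,6],[3,4,5,6,7],[4,5,6,7],[5],[],[8],[8]])]
    [(adj [[7,8,9],[5,6,7],[4,6,8],[4,5,9],[7],[8],[9]], None, 0, [0,7,1,5,8,9,4,6,3,2]),
     (adj [[3,7,8,9],[6,7,8],[4,5,9],[4,5,6],[7],[8],[9]], Some (4,7), 1, [0,8,5,3,4,9,1,2,6])]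
    [(adj [[1,8],[5,6,9],[4,5,6],[4,5,6],[7],[],[],[8],[9]], Cover 4 [4,5,9,8,0,1,6,2,7,3], []),
     (adj [[2,8],[5,6,9],[4,5,6],[4,5,6],[7],[],[],[8],[9]], Cover 3 [1,5,4,7,0,8,3,6,2,9], []),
     (adj [[7,8],[5,6,9],[4,5,6],[4,5,6],[7],[],[],[8],[9]], Cover 0 [5,1,6,0,8,7,4,3,9,2], [(0,[0,4,5,6,1,2,3,9,8,7]),(1,[]),(1,[0,4,5,6,1,2,3,9,8,7]),(0,[0,1,3,2])]),
     (adj [[8],[5,6,9],[4,5,6],[4,5,6],[7],[],[],[8],[9]], At 0, [(2,[]),(1,[]),(1,[0,1,3,2]),(2,[0,4,5,6,1,2,3,9,8,7]),(1,[0,4,5,6,1,2,3,9,8,7]),(1,[0,4,6,5,1,2,3,9,8,7]),(0,[]),(0,[0,4,5,6,1,2,3,9,8,7])]),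
     (adj [[],[5,6,8,9],[4,5,6],[4,5,6],[7],[],[],[8],[9]], Cover 4 [8,9,2,6,5,4,0,7,3,1], []),
     (adj [[],[5,6,9],[4,5,6,8],[4,5,6],[7],[],[],[8],[9]], Cover 2 [1,9,8,2,4,3,7,0,5,6], []),
     (adj [[],[5,6,9],[4,5,6],[4,5,6],[7],[],[],[8],[9]], At 8, [(2,[]),(1,[]),(0,[]),(0,[0,1,3,2]),(1,[0,4,5,6,1,2,3,9,8,7]),(0,[0,4,5,6,1,2,3,9,8,7]),(0,[0,4,6,5,1,2,3,9,8,7])]),
     (adj [[1,7,9],[6,8,9],[4,5,6],[4,5,6],[7],[9],[],[8]], Cover 4 [6,3,8,7,0,9,5,2,1,4], []),
     (adj [[6,7,9],[6,8,9],[4,5,6],[4,5,6],[7],[9],[],[8]], Cover 4 [3,4,1,8,0,9,2,5,7,6], []),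
     (adj [[7,9],[6,8,9],[4,5,6],[4,5,6,8],[7],[9],[],[8]], At 0, []),
     (adj [[7,9],[6,8,9],[4,5,6],[4,5,6],[7],[8,9],[],[8]], At 0, []),
     (adj [[7,9],[6,8,9],[4,5,6],[4,5,6],[7],[9],[],[8]], Cover 7 [5,3,4,7,8,1,6,9,0,2], [(0,[]),(1,[]),(3,[]),(2,[])]),
     (adj [[7],[6,8,9],[4,5,6,9],[4,5,6],[7],[9],[],[8]], Cover 3 [0,8,1,2,5,3,6,7,4,9], []),
     (adj [[7],[6,8,9],[4,5,6],[4,5,6],[7,9],[9],[],[8]], Cover 3 [0,8,9,5,6,2,4,7,1,3], []),
     (adj [[7],[6,8,9],[4,5,6],[4,5,6],[7],[9],[],[8,9]], Cover 3 [0,7,9,1,6,3,5,4,8,2], []),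
     (adj [[5,7],[6,8,9],[4,5,6],[4,5,6],[7],[9],[],[8],[9]], At 0, []),
     (adj [[7],[6,8,9],[4,5,6],[4,5,6],[7],[9],[],[8],[9]], Cover 2 [4,0,6,1,9,5,8,7,3,2], [(4,[0,9,2,3,4,6,5,7,8,1]),(4,[]),(0,[])]),
     (adj [[7],[6,8,9],[4,5,6],[4,5,6],[7],[9],[],[8]], At 9, [(5,[]),(4,[]),(4,[0,1,3,2]),(3,[]),(10,[0,4,5,6,9,2,3,1,8,7]),(2,[]),(0,[])]),
     (adj [[],[6,7,8,9],[4,5,6],[4,5,6],[7],[9],[],[8]], Cover 1 [7,4,6,3,5,9,0,8,2,1], []),
     (adj [[],[6,8,9],[4,5,6,7],[4,5,6],[7],[9],[],[8]], Cover 6 [7,4,5,6,0,1,3,8,2,9], []),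
     (adj [[],[6,8,9],[4,5,6],[4,5,6],[7],[7,9],[],[8]], Cover 2 [0,8,7,5,2,6,4,1,9,3], []),
     (adj [[2],[6,8,9],[4,5,6],[4,5,6],[7],[9],[],[8,9]], Cover 6 [2,4,3,9,1,8,7,0,6,5], []),
     (adj [[5],[6,8,9],[4,5,6],[4,5,6],[7],[9],[],[8,9]], Cover 4 [9,7,4,2,3,0,8,1,6,5], []),
     (adj [[9],[6,8,9],[4,5,6],[4,5,6],[7],[9],[],[8,9]], Cover 1 [6,1,8,0,9,4,5,3,7,2], []),
     (adj [[],[6,8,9],[4,5,6,8],[4,5,6],[7],[9],[],[8,9]], At 0, []),
     (adj [[],[6,8,9],[4,5,6],[4,5,6],[7],[9],[],[8,9]], Cover 3 [0,6,1,9,7,5,2,3,8,4], [(7,[0,7,2,3,6,5,4,1]),(1,[]),(7,[]),(2,[]),(3,[]),(0,[])]),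
     (adj [[],[6,8,9],[4,5,6],[4,5,6],[7],[9],[],[8]], At 7, [(8,[]),(7,[]),(6,[]),(6,[0,1,3,2]),(5,[]),(19,[0,5,4,6,7,2,3,8,1]),(0,[])]),
     (adj [[1,9],[5,6,8],[4,6,9],[4,5,6],[7],[9],[],[8]], Cover 6 [4,9,5,1,6,8,0,7,2,3], []),
     (adj [[2,9],[5,6,8],[4,6,9],[4,5,6],[7],[9],[],[8]], Cover 6 [8,7,2,9,5,3,6,1,0,4], []),
     (adj [[3,9],[5,6,8],[4,6,9],[4,5,6],[7],[9],[],[8]], Cover 6 [5,6,4,7,0,8,2,9,3,1], []),
     (adj [[7,9],[5,6,8],[4,6,9],[4,5,6],[7],[9],[],[8]], Cover 6 [0,7,4,3,1,6,2,9,5,8], [(2,[0,4,5,6,1,2,3,8,7]),(0,[]),(2,[]),(0,[0,4,5,6,1,2,3,8,7]),(1,[])]),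
     (adj [[9],[5,6,8],[4,6,9],[4,5,6],[7],[9],[],[8]], At 0, [(3,[]),(2,[]),(1,[]),(3,[0,4,5,6,1,2,3,8,7]),(2,[0,4,5,6,1,2,3,8,7]),(1,[0,4,5,6,1,2,3,8,7]),(0,[]),(0,[0,4,5,6,1,2,3,8,7])]),
     (adj [[],[5,6,8,9],[4,6,9],[4,5,6],[7],[9],[],[8]], Cover 4 [2,9,0,7,8,1,5,6,4,3], []),
     (adj [[2],[5,6,8],[4,6,9],[4,5,6],[7],[9],[],[8,9]], Cover 1 [9,5,3,6,1,0,8,7,2,4], []),
     (adj [[6],[5,6,8],[4,6,9],[4,5,6],[7],[9],[],[8,9]], Cover 3 [4,2,9,0,8,1,5,3,6,7], []),
     (adj [[7],[5,6,8],[4,6,9],[4,5,6],[7],[9],[],[8,9]], Cover 6 [1,6,4,7,0,9,2,5,8,3], []),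
     (adj [[],[5,6,8],[4,6,9],[4,5,6],[7],[9],[],[8,9]], Cover 3 [0,1,6,2,7,9,3,5,8,4], [(1,[]),(2,[]),(0,[]),(4,[]),(2,[0,7,3,2,6,9,4,1,8,5]),(9,[0,2,1,3,8,5,6,7,4])]),
     (adj [[],[5,6,8],[4,6,9],[4,5,6],[7],[9],[],[8]], At 9, [(5,[]),(4,[]),(10,[0,1,2,3,4,9,6,7,8,5]),(4,[0,4,5,6,1,2,3,8,7]),(10,[0,4,5,6,1,9,3,8,7,2]),(0,[]),(0,[0,4,5,6,1,2,3,8,7])]),
     (adj [[2,7,8],[7,8,9],[4,5,6],[4,5,6],[7],[8],[9]], Cover 6 [7,8,5,2,9,6,3,1,0,4], []),
     (adj [[5,7,8],[7,8,9],[4,5,6],[4,5,6],[7],[8],[9]], Cover 4 [8,1,3,4,2,6,9,0,5,7], []),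
     (adj [[6,7,8],[7,8,9],[4,5,6],[4,5,6],[7],[8],[9]], Cover 6 [8,1,9,6,2,4,3,7,0,5], []),
     (adj [[7,8],[7,8,9],[4,5,6],[4,5,6],[7],[8],[9]], Cover 6 [6,3,5,1,7,0,8,4,2,9], [(0,[]),(2,[0,1,3,2]),(1,[]),(2,[])]),
     (adj [[8],[7,8,9],[4,5,6,7],[4,5,6],[7],[8],[9]], Cover 2 [7,4,3,6,0,8,5,1,9,2], []),
     (adj [[8],[7,8,9],[4,5,6],[4,5,6],[7],[7,8],[9]], Cover 2 [3,6,9,0,8,7,1,4,2,5], []),
     (adj [[8],[7,8,9],[4,5,6],[4,5,6],[7],[8],[7,9]], Cover 6 [3,7,9,0,2,8,1,4,6,5], []),
     (adj [[8],[7,8,9],[4,5,6],[4,5,6],[7],[8],[9]], At 7, [(3,[]),(2,[]),(2,[0,1,3,2]),(1,[]),(0,[]),(18,[0,7,2,3,6,5,4,9,1,8]),(18,[0,7,2,3,5,6,4,8,1])]),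
     (adj [[],[7,8,9],[4,5,6,8],[4,5,6],[7],[8],[9]], Cover 6 [5,2,4,7,1,9,0,8,3,6], []),
     (adj [[],[7,8,9],[4,5,6],[4,5,6],[7,8],[8],[9]], Cover 6 [0,7,1,6,3,2,8,5,9,4], []),
     (adj [[],[7,8,9],[4,5,6],[4,5,6],[7],[8],[9]], At 8, [(2,[]),(1,[]),(1,[0,1,3,2]),(0,[]),(0,[0,1,2,3,6,5,4,9,8,7]),(21,[0,7,2,3,6,5,4,9,1,8]),(21,[0,8,2,3,4,6,5,7,1])]),
     (adj [[1,7],[6,7,8],[5,6,9],[4,5,6],[7,9],[8]], Cover 8 [5,2,6,1,0,4,7,9,8,3], []),
     (adj [[2,7],[6,7,8],[5,6,9],[4,5,6],[7,9],[8]], Cover 5 [1,7,3,5,2,9,4,0,6,8], []),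
     (adj [[3,7],[6,7,8],[5,6,9],[4,5,6],[7,9],[8]], Cover 5 [4,7,0,8,5,2,1,6,3,9], []),
     (adj [[7],[6,7,8],[5,6,9],[4,5,6],[7,9],[8],[9]], Cover 3 [7,0,3,6,9,2,5,8,1,4], []),
     (adj [[7],[6,7,8],[5,6,9],[4,5,6],[7,9],[8]], Cover 6 [0,4,5,2,1,6,3,7,9,8], [(2,[0,4,5,6,1,2,3,7,9,8]),(2,[]),(3,[]),(1,[0,4,5,6,1,2,3,7,9,8]),(1,[]),(0,[]),(26,[0,1,2,3,9,5,6,4,7,8])]),
     (adj [[],[6,7,8],[5,6,7,9],[4,5,6],[7,9],[8]], Cover 3 [3,5,0,9,7,1,8,6,4,2], []),
     (adj [[1],[6,7,8],[5,6,9],[4,5,6],[7,9],[8],[],[8]], Cover 5 [1,7,3,5,2,9,4,0,8,6], []),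
     (adj [[4],[6,7,8],[5,6,9],[4,5,6],[7,9],[8],[],[8]], Cover 5 [0,4,7,8,6,2,5,9,1,3], []),
     (adj [[],[6,7,8],[5,6,9],[4,5,6],[7,9],[8],[],[8]], Cover 9 [6,2,0,3,8,7,4,1,5,9], [(1,[0,8,2,3,4,6,5,7,1]),(3,[]),(0,[]),(1,[])]),
     (adj [[],[6,7,8],[5,6,9],[4,5,6],[7,9],[8]], At 7, [(4,[]),(3,[]),(20,[0,2,1,3,7,5,6,4,9,8]),(3,[0,4,5,6,1,2,3,7,9,8]),(20,[0,5,4,6,7,2,3,1]),(0,[]),(0,[0,4,5,6,1,2,3,7,9,8])]),
     (adj [[3,7,9],[6,7,8],[4,5,9],[4,5,6],[7],[8],[9]], At 8, [(60,[])]),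
     (adj [[5,7,9],[6,7,8],[4,5,9],[4,5,6],[7],[8],[9]], Cover 6 [8,1,7,4,2,3,6,5,0,9], []),
     (adj [[7,9],[6,7,8],[4,5,9],[4,5,6],[7],[8],[9]], Cover 5 [7,1,6,9,2,5,3,4,0,8], [(0,[]),(1,[])]),
     (adj [[9],[6,7,8],[4,5,7,9],[4,5,6],[7],[8],[9]], Cover 6 [5,3,6,1,0,7,4,2,9,8], []),
     (adj [[9],[6,7,8],[4,5,9],[4,5,6,7],[7],[8],[9]], Cover 4 [1,6,9,0,2,4,3,7,8,5], []),
     (adj [[9],[6,7,8],[4,5,9],[4,5,6],[7],[7,8],[9]], Cover 6 [1,7,5,2,0,9,4,6,8,3], []),
     (adj [[9],[6,7,8],[4,5,9],[4,5,6],[7],[8],[9]], At 7, [(3,[]),(2,[]),(1,[]),(0,[]),(27,[0,5,6,4,7,2,3,1]),(6,[0,7,2,3,6,5,4,1]),(27,[0,1,4,9,2,6,7,5,8,3])]),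
     (adj [[],[6,7,8,9],[4,5,9],[4,5,6],[7],[8],[9]], Cover 9 [2,9,6,3,8,7,0,4,5,1], []),
     (adj [[],[6,7,8],[4,5,9],[4,5,6],[7],[8],[9]], At 9, [(1,[]),(0,[]),(18,[0,1,2,3,4,5,9,7,8,6]),(8,[0,1,9,3,5,4,6,8,7,2]),(8,[0,1,9,3,4,5,6,7,8,2]),(29,[0,1,4,9,2,6,7,5,8,3]),(29,[0,1,5,9,2,6,8,4,7,3])]),
     (adj [[7,8],[5,6,7],[4,6,8],[4,5,9],[7],[8],[9]], At 9, [(68,[]),(0,[0,2,1,3,5,9,4,8,6,7]),(0,[0,1,2,3,4,9,5,7,6,8]),(0,[0,5,4,6,2,9,1,8,3,7]),(0,[0,4,5,6,1,9,2,7,3,8]),(9,[0,2,7,3,5,9,4,8,6,1]),(9,[0,1,8,3,4,9,5,7,6,2])]),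
     (adj [[8],[5,6,7],[4,6,8],[4,5,9],[7],[8],[9]], At 7, [(0,[]),(1,[0,3,2,1,6,7,5,9,4,8]),(1,[0,2,3,1,7,5,6,4]),(1,[0,6,5,4,3,7,2,9,1,8]),(1,[0,5,6,4,7,2,3,1]),(10,[0,3,7,2,6,8,4,9,5,1]),(10,[0,2,7,3,5,9,4,8,6,1])]),
     (adj [[],[5,6,7],[4,6,8],[4,5,9],[7],[8],[9]], At 8, [(0,[]),(2,[0,3,1,2,6,8,4,9,5,7]),(2,[0,1,3,2,4,8,6,7,5]),(2,[0,6,4,5,3,8,1,9,2,7]),(2,[0,4,6,5,1,8,3,7,2]),(11,[0,3,7,2,6,8,4,9,5,1]),(11,[0,1,8,3,4,9,5,7,6,2])]),
     (adj [[1,9],[5,6,8],[4,5,6],[4,5,6],[7],[],[],[8]], Cover 9 [3,6,2,4,0,9,7,8,5,1], []),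
     (adj [[2,9],[5,6,8],[4,5,6],[4,5,6],[7],[],[],[8]], Cover 9 [9,0,8,1,6,3,5,4,7,2], []),
     (adj [[7,8,9],[5,6,8],[4,5,6,9],[4,5,6],[7],[],[],[8]], At 9, []),
     (adj [[7,8,9],[5,6,8],[4,5,6],[4,5,6],[7],[],[],[8]], Cover 4 [6,2,7,8,9,4,5,3,0,1], [(0,[0,4,6,5,1,2,3,8,7]),(0,[]),(0,[0,4,5,6,1,2,3,8,7]),(0,[0,1,3,2]),(1,[0,4,5,6,1,2,3,8,7])]),
     (adj [[7,9],[5,6,8],[4,5,6],[4,5,6],[7],[],[],[8]], At 0, [(3,[]),(2,[]),(2,[0,1,3,2]),(3,[0,4,5,6,1,2,3,8,7]),(2,[0,4,5,6,1,2,3,8,7]),(2,[0,4,6,5,1,2,3,8,7]),(0,[])]),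
     (adj [[9],[5,6,8],[4,5,6],[4,5,6],[7],[],[],[8]], At 0, [(4,[]),(3,[]),(3,[0,1,3,2]),(4,[0,4,5,6,1,2,3,8,7]),(3,[0,4,5,6,1,2,3,8,7]),(3,[0,4,6,5,1,2,3,8,7]),(0,[]),(0,[0,4,5,6,1,2,3,8,7])]),
     (adj [[],[5,6,8,9],[4,5,6],[4,5,6],[7],[],[],[8]], Cover 6 [9,8,0,2,6,3,5,1,7,4], [(0,[])]),
     (adj [[],[5,6,8],[4,5,6,9],[4,5,6],[7],[],[],[8]], Cover 1 [4,3,6,1,5,9,0,7,2,8], []),
     (adj [[],[5,6,8],[4,5,6],[4,5,6],[7],[],[],[8,9]], At 9, [(2,[]),(1,[]),(30,[0,7,5,6,3,1,2,4]),(30,[0,7,5,6,2,1,3,4]),(72,[0,4,5,6,1,2,3,8,7]),(52,[0,7,2,3,6,5,4,1]),(52,[0,7,2,3,5,6,4,1]),(72,[0,1,2,3,4,5,6,7,9,8])]),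
     (adj [[],[5,6,8],[4,5,6],[4,5,6],[7],[],[],[8]], At 9, [(3,[]),(2,[]),(1,[]),(1,[0,1,3,2]),(2,[0,4,5,6,1,2,3,8,7]),(1,[0,4,5,6,1,2,3,8,7]),(1,[0,4,6,5,1,2,3,8,7]),(0,[]),(0,[0,4,5,6,1,2,3,8,7])]),
     (adj [[3,7,8],[6,7,8],[4,5,6],[4,5,6],[7],[8]], Cover 8 [5,8,9,0,7,6,1,2,4,3], []),
     (adj [[6,7,8],[6,7,8],[4,5,6],[4,5,6],[7],[8]], Cover 6 [9,7,4,3,8,5,2,0,1,6], []),
     (adj [[7,8],[6,7,8],[4,5,6,9],[4,5,6],[7],[8]], Cover 6 [3,6,1,7,0,9,2,5,8,4], []),
     (adj [[7,8],[6,7,8],[4,5,6],[4,5,6],[7],[8],[9]], Cover 8 [9,4,3,2,1,8,7,0,6,5], []),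
     (adj [[7,8],[6,7,8],[4,5,6],[4,5,6],[7],[8],[],[],[9]], Cover 5 [5,2,4,0,9,1,7,6,3,8], []),
     (adj [[7,8],[6,7,8],[4,5,6],[4,5,6],[7],[8]], Cover 5 [8,2,6,3,9,7,4,0,5,1], [(0,[]),(2,[]),(1,[]),(3,[]),(4,[])]),
     (adj [[8],[6,7,8],[4,5,6,7],[4,5,6],[7],[8]], Cover 3 [5,3,4,9,0,1,7,6,8,2], []),
     (adj [[8],[6,7,8],[4,5,6],[4,5,6],[7],[7,8]], Cover 6 [9,0,2,6,3,1,8,7,4,5], []),
     (adj [[8],[6,7,8],[4,5,6],[4,5,6],[7],[8],[],[8]], Cover 9 [8,0,9,1,2,3,6,5,7,4], []),
     (adj [[3,8,9],[6,7,8],[4,5,6],[4,5,6],[7],[8],[],[9]], At 9, []),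
     (adj [[8,9],[6,7,8],[4,5,6],[4,5,6],[7],[8],[],[9]], Cover 6 [2,6,3,7,9,8,1,0,4,5], [(23,[0,7,5,6,2,3,1,9,4,8]),(64,[0,7,2,3,5,6,4,8,1]),(23,[0,7,5,6,2,3,1,4,9,8]),(0,[]),(4,[]),(64,[0,1,2,3,4,5,6,7,9,8])]),
     (adj [[8],[6,7,8],[4,5,6],[4,5,6],[7],[8,9],[],[9]], Cover 8 [1,0,9,5,3,4,2,6,8,7], []),
     (adj [[8],[6,7,8],[4,5,6],[4,5,6],[7],[8],[],[9]], At 9, [(1,[]),(66,[0,1,2,3,4,5,6,7,9,8]),(25,[0,7,5,6,2,3,1,9,4,8]),(25,[0,7,5,6,2,3,1,4,9,8]),(66,[0,1,2,3,4,5,6,9,7,8]),(0,[]),(66,[0,7,2,3,5,6,4,8,1]),(66,[0,7,2,3,5,6,4,8,9,1])]),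
     (adj [[8],[6,7,8],[4,5,6],[4,5,6],[7],[8]], At 7, [(7,[]),(6,[]),(6,[0,1,3,2]),(5,[]),(13,[0,5,4,6,7,2,3,1]),(4,[]),(0,[])]),
     (adj [[],[6,7,8],[4,5,6,8],[4,5,6],[7],[8]], Cover 2 [0,3,4,2,8,1,5,9,6,7], []),
     (adj [[],[6,7,8],[4,5,6],[4,5,6],[7,8],[8]], Cover 8 [8,6,2,3,7,0,9,1,4,5], []),
     (adj [[2],[6,7,8],[4,5,6],[4,5,6],[7],[8],[],[8]], Cover 4 [9,7,4,3,6,1,8,0,2,5], []),
     (adj [[4],[6,7,8],[4,5,6],[4,5,6],[7],[8],[],[8]], Cover 6 [9,0,7,8,3,6,1,2,5,4], []),
     (adj [[9],[6,7,8],[4,5,6],[4,5,6],[7],[8],[],[8]], At 0, [(4,[0,7,2,3,5,6,4,8,1]),(1,[]),(1,[0,1,3,2]),(0,[]),(0,[0,1,2,3,5,4,6,8,7]),(0,[0,7,2,3,6,5,4,1]),(4,[0,1,2,3,5,4,6,8,7]),(4,[])]),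
     (adj [[],[6,7,8],[4,5,6],[4,5,6],[7],[8],[],[8]], At 0, [(5,[0,7,2,3,5,6,4,8,1]),(2,[]),(2,[0,1,3,2]),(1,[]),(1,[0,1,2,3,5,4,6,8,7]),(1,[0,7,2,3,6,5,4,1]),(5,[0,1,2,3,5,4,6,8,7]),(5,[]),(0,[])]),
     (adj [[],[6,7,8],[4,5,6],[4,5,6],[7],[8],[],[],[9]], At 7, [(6,[0,1,2,3,5,4,6,8,7]),(5,[0,1,2,3,5,4,6,8,7]),(5,[0,1,3,2,5,4,6,8,7]),(4,[0,1,2,3,5,4,6,8,7]),(20,[0,5,4,6,7,2,3,1]),(0,[]),(74,[0,7,2,3,5,6,4,8,9,1])]),
     (adj [[],[6,7,8],[4,5,6],[4,5,6],[7],[8]], At 8, [(7,[]),(6,[]),(6,[0,1,3,2]),(5,[]),(21,[0,4,5,6,8,2,3,1,7]),(1,[]),(0,[])]),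
     (adj [[1,7,8],[5,6,7],[4,6,8],[4,5,6],[7],[8]], Cover 8 [9,4,7,5,8,6,3,2,0,1], []),
     (adj [[3,7,8],[5,6,7],[4,6,8],[4,5,6],[7],[8]], Cover 3 [6,4,9,0,8,5,7,1,2,3], []),
     (adj [[7,8,9],[5,6,7],[4,6,8,9],[4,5,6],[7],[8]], At 9, []),
     (adj [[7,8,9],[5,6,7],[4,6,8],[4,5,6,9],[7],[8]], At 9, []),
     (adj [[7,8,9],[5,6,7],[4,6,8],[4,5,6],[7],[8]], Cover 6 [3,1,7,0,2,8,9,5,6,4], [(2,[]),(0,[]),(3,[]),(3,[0,5,4,6,2,1,3,8,7]),(1,[]),(0,[0,4,5,6,1,2,3])]),
     (adj [[7,8],[5,6,7],[4,6,8],[4,5,6],[7],[8]], At 0, [(4,[]),(4,[0,2,1,3,5,4,6,8,7]),(3,[]),(4,[0,4,5,6,1,2,3]),(4,[0,5,4,6,2,1,3,8,7]),(3,[0,4,5,6,1,2,3]),(0,[])]),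
     (adj [[8],[5,6,7],[4,6,7,8],[4,5,6],[7],[8]], Cover 2 [4,7,1,5,0,9,8,2,6,3], []),
     (adj [[8],[5,6,7],[4,6,8],[4,5,6],[7],[8],[],[8]], Cover 2 [7,4,5,9,0,6,3,2,1,8], []),
     (adj [[8,9],[5,6,7],[4,6,8],[4,5,6],[7],[8],[],[9]], At 9, [(73,[0,1,2,3,4,5,6,7,9,8]),(52,[0,2,3,1,7,5,6,9,8,4]),(52,[0,2,3,1,7,5,6,4]),(73,[0,1,2,3,4,5,6,9,7,8]),(52,[0,5,6,4,7,2,3,9,8,1]),(52,[0,5,6,4,7,2,3,1]),(52,[0,7,3,2,8,6,4,9,1,5])]),
     (adj [[8],[5,6,7],[4,6,8],[4,5,6],[7],[8],[],[9]], At 9, [(0,[]),(74,[0,1,2,3,4,5,6,7,9,8]),(53,[0,2,3,1,7,5,6,9,8,4]),(53,[0,2,3,1,7,5,6,4]),(74,[0,1,2,3,4,5,6,9,7,8]),(53,[0,5,6,4,7,2,3,9,8,1]),(53,[0,5,6,4,7,2,3,1]),(53,[0,7,3,2,8,6,4,9,1,5])]),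
     (adj [[8],[5,6,7],[4,6,8],[4,5,6],[7],[8]], At 7, [(4,[]),(3,[]),(10,[0,2,1,3,7,5,6,4]),(3,[0,4,5,6,1,2,3]),(10,[0,5,4,6,7,2,3,1]),(2,[]),(0,[])]),
     (adj [[],[5,6,7,8],[4,6,8],[4,5,6],[7],[8]], Cover 8 [8,6,3,4,7,0,9,1,2,5], []),
     (adj [[],[5,6,7],[4,6,8],[4,5,6,9],[7],[8],[],[8]], Cover 1 [4,6,0,9,1,5,8,2,3,7], []),
     (adj [[],[5,6,7],[4,6,8],[4,5,6],[7],[8],[],[8]], Cover 6 [0,9,8,7,3,4,2,6,5,1], [(2,[]),(2,[0,2,1,3,5,4,6,8,7]),(2,[0,1,4,8,2,5,7,6,3]),(2,[0,6,7,5,8,3,1,2,4]),(2,[0,3,8,1,7,6,5,4,2]),(0,[0,2,5,7,1,4,8,6,3]),(0,[]),(0,[0,6,8,4,7,3,2,1,5])]),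
     (adj [[],[5,6,7],[4,6,8],[4,5,6],[7],[8],[],[],[9]], At 7, [(3,[0,2,1,3,5,4,6,8,7]),(2,[0,2,1,3,5,4,6,8,7]),(14,[0,2,1,3,7,5,6,4]),(2,[0,5,4,6,2,1,3,8,7]),(14,[0,5,4,6,7,2,3,1]),(0,[]),(58,[0,7,3,2,8,6,4,9,1,5])]),
     (adj [[],[5,6,7],[4,6,8],[4,5,6],[7],[8]], At 8, [(4,[]),(3,[]),(15,[0,1,2,3,4,8,6,7,5]),(3,[0,4,5,6,1,2,3]),(15,[0,4,5,6,1,8,3,7,2]),(1,[]),(0,[])]),
     (adj [[1,7],[5,6,7],[4,5,6],[4,5,6],[7]], Cover 6 [3,5,1,0,8,9,7,2,6,4], []),
     (adj [[2,7],[5,6,7],[4,5,6],[4,5,6],[7]], Cover 6 [6,5,8,0,4,7,9,3,2,1], []),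
     (adj [[7,8,9],[5,6,7],[4,5,6,9],[4,5,6],[7]], Cover 5 [8,0,7,1,5,3,6,2,9,4], []),
     (adj [[7,8,9],[5,6,7],[4,5,6],[4,5,6],[7,8]], Cover 1 [1,6,2,3,8,9,0,7,4,5], []),
     (adj [[7,8,9],[5,6,7],[4,5,6],[4,5,6],[7]], Cover 8 [5,2,6,4,7,9,0,8,3,1], [(1,[0,4,5,6,1,2,3]),(2,[0,4,5,6,1,2,3]),(1,[]),(1,[0,4,6,5,1,2,3]),(2,[0,4,6,5,1,2,3]),(1,[0,4,6,5,1,2,3,7,9,8]),(0,[0,1,2,3,4,5,6,7,9,8]),(0,[]),(1,[0,1,3,2]),(2,[0,1,3,2])]),
     (adj [[7,8],[5,6,7],[4,5,6],[4,5,6],[7]], At 0, [(4,[]),(3,[]),(3,[0,1,3,2]),(4,[0,4,5,6,1,2,3]),(3,[0,4,5,6,1,2,3]),(3,[0,4,6,5,1,2,3]),(0,[])]),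
     (adj [[7],[5,6,7],[4,5,6],[4,5,6],[7]], At 0, [(5,[]),(4,[]),(4,[0,1,3,2]),(5,[0,4,5,6,1,2,3]),(4,[0,4,5,6,1,2,3]),(4,[0,4,6,5,1,2,3]),(0,[]),(0,[0,1,2,3,4,5,6,7,9,8])]),
     (adj [[],[5,6,7],[4,5,6,7],[4,5,6],[7]], Cover 6 [4,3,5,8,9,0,1,7,2,6], []),
     (adj [[3,8],[5,6,7],[4,5,6],[4,5,6],[7],[],[],[8],[9]], Cover 4 [4,5,9,8,0,1,6,2,7,3], []),
     (adj [[8],[5,6,7],[4,5,6],[4,5,6],[7],[],[],[8],[9]], Cover 9 [9,8,7,4,2,5,3,6,0,1], [(101,[0,7,5,6,2,3,1,9,8,4]),(101,[0,7,2,3,5,6,4,9,8,1]),(101,[0,7,5,6,3,2,1,9,8,4]),(0,[0,4,6,5,1,2,3]),(0,[])]),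
     (adj [[8],[5,6,7],[4,5,6],[4,5,6],[7],[],[],[8]], At 8, [(48,[]),(26,[0,7,5,6,3,2,1,4]),(26,[0,7,5,6,2,3,1,4]),(48,[0,4,5,6,1,2,3]),(26,[0,7,2,3,6,5,4,1]),(26,[0,7,2,3,5,6,4,1]),(0,[])]),
     (adj [[],[5,6,7],[4,5,6],[4,5,6],[7],[],[],[8],[9]], At 8, [(0,[]),(49,[]),(27,[0,7,5,6,3,2,1,4]),(27,[0,7,5,6,2,3,1,4]),(49,[0,4,5,6,1,2,3]),(27,[0,7,2,3,6,5,4,1]),(27,[0,7,2,3,5,6,4,1])]),
     (adj [[],[5,6,7],[4,5,6],[4,5,6],[7],[],[],[8]], At 8, [(1,[]),(50,[]),(28,[0,7,5,6,3,2,1,4]),(28,[0,7,5,6,2,3,1,4]),(50,[0,4,5,6,1,2,3]),(28,[0,7,2,3,6,5,4,1]),(28,[0,7,2,3,5,6,4,1]),(0,[])]),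
     (adj [[],[5,6,7],[4,5,6],[4,5,6],[7]], At 7, [(6,[]),(5,[]),(5,[0,1,3,2]),(5,[0,4,5,6,1,2,3]),(5,[0,4,6,5,1,2,3]),(0,[]),(0,[0,1,2,3,4,5,6,7,9,8])]),
     (adj [[1],[4,5,6],[4,5,6],[4,5,6]], Cover 9 [7,8,9,5,1,6,4,2,0,3], []),
     (adj [[7,8,9],[4,5,6],[4,5,6,8],[4,5,6]], Cover 9 [2,4,1,5,7,0,9,8,3,6], []),
     (adj [[7,8,9],[4,5,6],[4,5,6],[4,5,6]], Cover 4 [6,2,7,9,8,5,4,3,0,1], [(0,[0,4,6,5,1,2,3,8,7]),(0,[0,4,6,5,1,2,3,7,9,8]),(0,[0,4,6,5,1,2,3]),(0,[0,1,2,3,4,5,6,7,9,8]),(0,[]),(0,[0,5,4,6,1,2,3,8,7]),(0,[0,1,3,2,4,5,6,8,7]),(0,[0,4,5,6,1,2,3,7,9,8]),(0,[0,5,4,6,1,2,3,7,9,8]),(0,[0,1,3,2,4,5,6,7,9,8]),(0,[0,5,4,6,1,2,3]),(0,[0,1,3,2]),(1,[0,4,5,6,1,2,3])]),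
     (adj [[7,8],[4,5,6],[4,5,6],[4,5,6]], At 0, [(2,[]),(2,[0,2,1]),(2,[0,3,2,1]),(2,[0,4,5,6,1,2,3]),(2,[0,5,4,6,1,2,3]),(2,[0,6,4,5,1,2,3]),(0,[])]),
     (adj [[7],[4,5,6],[4,5,6],[4,5,6]], At 0, [(3,[]),(3,[0,2,1]),(3,[0,3,2,1]),(3,[0,4,5,6,1,2,3]),(3,[0,5,4,6,1,2,3]),(3,[0,6,4,5,1,2,3]),(0,[]),(0,[0,1,2,3,4,5,6,7,9,8])]),
     (adj [[],[4,5,6],[4,5,6],[4,5,6]], At 0, [(4,[]),(4,[0,2,1]),(4,[0,3,2,1]),(4,[0,4,5,6,1,2,3]),(4,[0,5,4,6,1,2,3]),(4,[0,6,4,5,1,2,3]),(0,[]),(0,[0,1,2,3,4,5,6,8,7]),(0,[0,1,2,3,4,5,6,9,8,7])])]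
    [(0,[]), (0,[]), (6,[]), (58,[]), (132,[]), (112,[]), (101,[]), (36,[]), (90,[]), (80,[]), (71,[]), (20,[]), (68,[]), (0,[]), (0,[]), (0,[]), (0,[])]"
  by code_simp

section \<open>Proof of the classification\<close>

theorem contains_kuratowski_if_not_line_planar:
  assumes "simple_graph H" "\<not> line_planar H" "card (edges H) \<le> 12"
  shows "contains_kuratowski H"
  using assms
proof (induction H rule: low_degree_induct)
  case (del_vertex H x a)
  have "\<not> line_planar (del_vertex H x)"
    using line_planar_if_line_planar_del_vertex[OF del_vertex.hyps] del_vertex.prems(1) by blast
  moreover have "card (edges (del_vertex H x)) \<le> 12"
    using card_edges_del_vertex[OF del_vertex.hyps(1), of x] del_vertex.prems(2) by simp
  ultimately show ?case by (intro contains_kuratowski_del_vertex[of H x] del_vertex.IH)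
next
  case (suppress H x a b)
  have "\<not> line_planar (suppress H x a b)"
    using line_planar_if_line_planar_suppress[OF suppress.hyps] suppress.prems(1) by blast
  moreover have "card (edges (suppress H x a b)) \<le> 12"
    using card_edges_suppress[OF suppress.hyps(1,3,4)] suppress.prems(2) by simp
  ultimately show ?case
    by (intro contains_kuratowski_suppress[OF suppress.hyps suppress.prems(2)] suppress.IH)
next
  case (min_degree_3 H)
  have nonempty: "verts H \<noteq> {}"
    using line_planar_singleton[OF min_degree_3.hyps(1)] min_degree_3.prems(1) by blast
  then obtain x where "x \<in> verts H" by blast
  then have "4 \<le> card (verts H)"
    using min_degree_3.hyps(2) card_nbrs_less_card_verts[OF min_degree_3.hyps(1)] by fastforce
  moreover have "card (verts H) \<le> 8"
    using min_degree_3_card_verts[OF min_degree_3.hyps] min_degree_3.prems(2) by linarith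
  ultimately have "card (verts H) \<in> {4, 5, 6, 7, 8}" by auto
  moreover note certified =
    contains_kuratowski_if_certificate[OF min_degree_3.hyps(1) nonempty min_degree_3.prems
      min_degree_3.hyps(2)]
  ultimately show ?case
    using certified[OF _ kuratowski_certificate_4] certified[OF _ kuratowski_certificate_5]
      certified[OF _ kuratowski_certificate_6] certified[OF _ kuratowski_certificate_7]
      certified[OF _ kuratowski_certificate_8] by blast
qed

lemma kuratowski_pats_card: "list_all (\<lambda>(m, B). 5 \<le> m) kuratowski_pats"
  by code_simp

lemma contains_kuratowski_card_verts:
  assumes "simple_graph G" "contains_kuratowski G"
  shows "5 \<le> card (verts G)"
proof -
  obtain m B f where "(m, B) \<in> set kuratowski_pats" and f: "graph_embedding f (pat_graph m B) G"
    using assms(2) unfolding contains_kuratowski_def by blast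
  then have "5 \<le> m" using kuratowski_pats_card by (auto simp: list_all_iff)
  also have "m \<le> card (verts G)"
    using f card_inj_on_le[OF _ _ finite_verts[OF assms(1)], of f "{..<m}"]
    by (simp add: graph_embedding_def)
  finally show ?thesis .
qed

text \<open>A cubic graph has an even number of vertices, hence at most 15 edges if it has at most 16.\<close>

lemma card_edges_del_max_degree_vertex:
  assumes G: "simple_graph G" and v: "max_degree_vertex G v"
    and min: "\<forall>x\<in>verts G. 3 \<le> card (nbrs G x)" and few: "card (edges G) \<le> 16"
  shows "card (edges (del_vertex G v)) \<le> 12"
proof (cases "card (nbrs G v) = 3")
  case True
  then have "card (nbrs G x) = 3" if "x \<in> verts G" for x
    using max_degree_vertexD(2)[OF v that] min that by fastforce
  then have "3 * card (verts G) = 2 * card (edges G)" using sum_card_nbrs[OF G] by simp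
  then have "card (edges G) \<le> 15" using few by presburger
  then show ?thesis using card_edges_del_vertex[OF G, of v] True by simp
next
  case False
  then show ?thesis
    using card_edges_del_vertex[OF G, of v] bspec[OF min max_degree_vertexD(1)[OF v]] few
    by simp
qed

lemma contains_kuratowski_del_max_degree_vertex:
  assumes G: "simple_graph G" and na: "\<not> line_apex G" and few: "card (edges G) \<le> 16"
    and min: "\<forall>x\<in>verts G. 3 \<le> card (nbrs G x)" and v: "max_degree_vertex G v"
  shows "contains_kuratowski (del_vertex G v)" "6 \<le> card (verts G)"
proof -
  have mem: "v \<in> verts G" by (rule max_degree_vertexD(1)[OF v])
  note simple = simple_graph_del_vertex[OF G]
  have "\<not> line_planar (del_vertex G v)" using na mem unfolding line_apex_def by blast
  then show K: "contains_kuratowski (del_vertex G v)"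
    using contains_kuratowski_if_not_line_planar[OF simple]
      card_edges_del_max_degree_vertex[OF G v min few] by blast
  have "5 \<le> card (verts G - {v})"
    using contains_kuratowski_card_verts[OF simple K] by (simp add: del_vertex_def)
  then show "6 \<le> card (verts G)" using mem finite_verts[OF G] by simp
qed

theorem petersen_minor_if_not_line_apex:
  assumes "simple_graph G" "\<not> line_apex G" "card (edges G) \<le> 16"
  shows "petersen_minor G"
  using assms
proof (induction G rule: low_degree_induct)
  case (del_vertex G x a)
  have "\<not> line_apex (del_vertex G x)"
    using line_apex_if_line_apex_del_vertex[OF del_vertex.hyps] del_vertex.prems(1) by blast
  moreover have "card (edges (del_vertex G x)) \<le> 16"
    using card_edges_del_vertex[OF del_vertex.hyps(1), of x] del_vertex.prems(2) by simp
  ultimately have "petersen_minor (del_vertex G x)" by (rule del_vertex.IH)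
  then show ?case using is_minor_del_vertex[of _ G x] unfolding petersen_minor_def by blast
next
  case (suppress G x a b)
  have "\<not> line_apex (suppress G x a b)"
    using line_apex_if_line_apex_suppress[OF suppress.hyps] suppress.prems(1) by blast
  moreover have "card (edges (suppress G x a b)) \<le> 16"
    using card_edges_suppress[OF suppress.hyps(1,3,4)] suppress.prems(2) by simp
  ultimately have "petersen_minor (suppress G x a b)" by (rule suppress.IH)
  then show ?case
    using is_minor_suppress[OF suppress.hyps(1,3,4)] unfolding petersen_minor_def by blast
next
  case (min_degree_3 G)
  note G = min_degree_3.hyps(1) and min = min_degree_3.hyps(2)
    and na = min_degree_3.prems(1) and few = min_degree_3.prems(2)
  have "verts G \<noteq> {}" using line_planar_singleton[OF G] na unfolding line_apex_def by blast
  then obtain v where v: "max_degree_vertex G v" using exists_max_degree_vertex[OF G] by blast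
  note K = contains_kuratowski_del_max_degree_vertex[OF G na few min v]
  have "card (verts G) \<le> 10" using min_degree_3_card_verts[OF G min] few by linarith
  with K(2) have "card (verts G) \<in> {6, 7, 8, 9, 10}" by auto
  moreover note certified = petersen_minor_if_certificate[OF G na few min v K(1)]
  ultimately show ?case
    using certified[OF _ apex_certificate_6] certified[OF _ apex_certificate_7]
      certified[OF _ apex_certificate_8] certified[OF _ apex_certificate_9]
      certified[OF _ apex_certificate_10] by blast
qed

lemma apex_if_few_edges:
  assumes "simple_graph H" "card (edges H) < 15"
  shows "apex H"
proof (rule ccontr)
  assume "\<not> apex H"
  then have "\<not> line_apex H" using line_apex_imp_apex[OF assms(1)] by blast
  then obtain J where "is_minor J H" "petersen_type J"
    using petersen_minor_if_not_line_apex[OF assms(1)] assms(2) unfolding petersen_minor_def by auto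
  then show False
    using is_minor_simple_graph(2)[OF assms(1)] petersen_type_edges(1) assms(2) by fastforce
qed

lemma MMNA_if_petersen_type:
  assumes G: "simple_graph G" and "petersen_type G"
  shows "MMNA G"
  unfolding MMNA_def
proof (intro conjI allI impI)
  show "\<not> apex G" by (rule petersen_type_not_apex[OF assms(2)])
  show "apex H" if "proper_minor H G" for H
  proof (rule apex_if_few_edges)
    show "simple_graph H"
      using that is_minor_simple_graph(1)[OF G] unfolding proper_minor_def by blast
    show "card (edges H) < 15"
      using proper_minor_card_edges[OF G petersen_type_edges(2)[OF assms(2)] that]
        petersen_type_edges(1)[OF assms(2)]
      by simp
  qed
qed

lemma petersen_type_if_MMNA:
  assumes G: "simple_graph G" "card (edges G) \<le> 16" and MMNA: "MMNA G"
  shows "petersen_type G"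
proof -
  have "\<not> line_apex G" using MMNA line_apex_imp_apex[OF G(1)] by (auto simp: MMNA_def)
  then obtain H where H: "is_minor H G" "petersen_type H"
    using petersen_minor_if_not_line_apex[OF G(1) _ G(2)] unfolding petersen_minor_def by blast
  then have "H = G"
    using MMNA petersen_type_not_apex[OF H(2)] unfolding MMNA_def proper_minor_def by blast
  then show ?thesis using H(2) by simp
qed

theorem theorem1p4:
  fixes G :: "'a ugraph"
  assumes "simple_graph G" and "card (edges G) \<le> 16"
  shows "MMNA G \<longleftrightarrow> (\<exists>P\<in>petersen_family. graph_iso G P)"
proof -
  have "MMNA G \<longleftrightarrow> petersen_type G"
    using MMNA_if_petersen_type petersen_type_if_MMNA assms by blast
  also have "\<dots> \<longleftrightarrow> (\<exists>P\<in>petersen_family. graph_iso G P)"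
    by (rule petersen_type_iff_petersen_family[OF assms(1)])
  finally show ?thesis .
qed

end
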